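(* Fix $x>0$ and suppose the Integrability Assumption holds at $x$, the Complementarity Assumption holds, $u(z,0)<\infty$ for some $z>0$, and $y=u_x(x,0)$. Then, in $\mathbb P$-probability, $$\lim_{|\Delta x|+|\delta|\to0}\frac{1}{|\Delta x|+|\delta|}\Big|\xi(x+\Delta x,\delta)-\frac{\xi(x,0)}{x}\big(x+\Delta x(1+\alpha(x,0))+\delta\alpha_d(x,0)\big)\frac1{L^\delta}\Big|=0,$$ $$\lim_{|\Delta y|+|\delta|\to0}\frac{1}{|\Delta y|+|\delta|}\Big|\eta(y+\Delta y,\delta)-\frac{\eta(y,0)}{y}\big(y+\Delta y(1+\beta(y,0))+\delta\beta_d(y,0)\big)L^\delta\Big|=0.$$
   Context: Let $(\Omega,\mathcal F,\mathbb P)$ be a probability space and $\mathbf L^0_+$ the nonnegative random variables. $U:(0,\infty)\to\mathbb R$ is strictly increasing, strictly concave, twice differentiable with $c_1\le A(x):=-U''(x)x/U'(x)\le c_2$ for constants $0<c_1\le c_2$; $V(y)=\sup_{x>0}(U(x)-xy)$, $B(y):=-V''(y)y/V'(y)$. Sets $\mathcal C,\mathcal D\subseteq\mathbf L^0_+$ both contain a strictly positive element and satisfy: $\xi\in\mathcal C$ iff $\mathbb E[\xi\eta]\le1$ for all $\eta\in\mathcal D$, and $\eta\in\mathcal D$ iff $\mathbb E[\xi\eta]\le1$ for all $\xi\in\mathcal C$. Put $\mathcal C(x,0)=x\mathcal C$, $\mathcal D(y,0)=y\mathcal D$. Given random variables $F$ and $G\ge0$, set $L^\delta=\exp(-(\delta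 F+\tfrac12\delta^2G))$, $\mathcal C(x,\delta)=\{\xi/L^\delta:\xi\in\mathcal C(x,0)\}$, $\mathcal D(y,\delta)=\{\eta L^\delta:\eta\in\mathcal D(y,0)\}$, $u(x,\delta)=\sup_{\xi\in\mathcal C(x,\delta)}\mathbb E[U(\xi)]$, $v(y,\delta)=\inf_{\eta\in\mathcal D(y,\delta)}\mathbb E[V(\eta)]$ (with $\mathbb E[U(\xi)]=-\infty$ if $\mathbb E[U^-(\xi)]=\infty$, $\mathbb E[V(\eta)]=+\infty$ if $\mathbb E[V^+(\eta)]=\infty$). If $u(z,0)<\infty$ for some $z$, then $u(\cdot,0)$ is finite and differentiable, optimizers $\xi(x,0)$, $\eta(y,0)$ exist uniquely, and for $y=u_x(x,0)$: $\eta(y,0)=U'(\xi(x,0))$, $\mathbb E[\xi(x,0)\eta(y,0)]=xy$. $\xi(x,\delta),\eta(y,\delta)$ denote optimizers when they exist; $\mathbb R(x,\delta)$ is the probability with $d\mathbb R(x,\delta)/d\mathbb P=\xi(x,\delta)\eta(y,\delta)/(xy)$, $y=u_x(x,\delta)$. $\mathcal A^\infty(x,\delta)$ is the set of $\alpha\in\mathbf L^\infty$ such that $\xi(x,\delta)(1\pm c\alpha)\in\mathcal C(x,\delta)$ for some $c>0$; $\mathcal B^\infty(y,\delta)$ the set of $\beta\in\mathbf L^\infty$ with $\eta(y,\delta)(1\pm c\beta)\in\mathcal D(y,\delta)$ for some $c>0$; $\mathcal A^2(x,\delta)$, $\mathcal B^2(y,\delta)$ are their closures in $\mathbf L^2_0(\mathbb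 R(x,\delta))$ (square-integrable, mean zero), $y=u_x(x,\delta)$. Integrability Assumption (at $x$): there is $c>0$ with $\mathbb E^{\mathbb R(x,0)}[\exp(c(|F|+G))]<\infty$. Complementarity Assumption: for every $\delta$ and $x>0$ with $y=u_x(x,\delta)$, $\alpha\in\mathcal A^2(x,\delta)$ iff $\alpha\in\mathbf L^2_0(\mathbb R(x,\delta))$ and $\mathbb E^{\mathbb R(x,\delta)}[\alpha\beta]=0$ for all $\beta\in\mathcal B^2(y,\delta)$, and $\beta\in\mathcal B^2(y,\delta)$ iff $\beta\in\mathbf L^2_0(\mathbb R(x,\delta))$ and $\mathbb E^{\mathbb R(x,\delta)}[\alpha\beta]=0$ for all $\alpha\in\mathcal A^2(x,\delta)$. Abstract quadratic problems (with $\xi=\xi(x,0)$, $\eta=\eta(y,0)$, $y=u_x(x,0)$, $\mathbb E^{\mathbb R}=\mathbb E^{\mathbb R(x,0)}$): $a(x,x)=\inf_{\alpha\in\mathcal A^2(x,0)}\mathbb E^{\mathbb R}[A(\xi)(1+\alpha)^2]$; $b(y,y)=\inf_{\beta\in\mathcal B^2(y,0)}\mathbb E^{\mathbb R}[B(\eta)(1+\beta)^2]$; $a(d,d)=\inf_{\alpha\in\mathcal A^2(x,0)}\mathbb E^{\mathbb R}[A(\xi)(\alpha+xF)^2-2xF\alpha-x^2(F^2+G)]$; $b(d,d)=\inf_{\beta\in\mathcal B^2(y,0)}\mathbb E^{\mathbb R}[B(\eta)(\beta-yF)^2+2yF\beta-y^2(F^2-G)]$, with unique minimizers $\alpha(x,0),\beta(y,0),\alpha_d(x,0),\beta_d(y,0)$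 respectively; $a(x,d)=\mathbb E^{\mathbb R}[A(\xi)(1+\alpha(x,0))(xF+\alpha_d(x,0))-xF(1+\alpha(x,0))]$; $b(y,d)=\mathbb E^{\mathbb R}[B(\eta)(1+\beta(y,0))(\beta_d(y,0)-yF)+yF(1+\beta(y,0))]$. *)

theory Defs
  imports "HOL-Probability.Probability"
begin

definition strictly_concave_pos :: "(real \<Rightarrow> real) \<Rightarrow> bool" where
  "strictly_concave_pos U \<longleftrightarrow>
     (\<forall>a>0. \<forall>b>0. \<forall>t. a \<noteq> b \<and> 0 < t \<and> t < 1 \<longrightarrow>
        (1 - t) * U a + t * U b < U ((1 - t) * a + t * b))"

definition utility_ok :: "(real \<Rightarrow> real) \<Rightarrow> real \<Rightarrow> real \<Rightarrow> bool" where
  "utility_ok U c1 c2 \<longleftrightarrow>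
     strict_mono_on {0<..} U \<and> strictly_concave_pos U \<and>
     (\<forall>t>0. U differentiable (at t) \<and> deriv U differentiable (at t)) \<and>
     0 < c1 \<and> c1 \<le> c2 \<and>
     (\<forall>t>0. c1 \<le> - deriv (deriv U) t * t / deriv U t \<and>
            - deriv (deriv U) t * t / deriv U t \<le> c2)"

definition RRA :: "(real \<Rightarrow> real) \<Rightarrow> real \<Rightarrow> real" where
  "RRA U t = - deriv (deriv U) t * t / deriv U t"

text \<open>U extended to [0,\<infinity>): U(0) := lim_{t \<rightarrow> 0+} U(t) = inf_{t>0} U(t) (possibly -\<infinity>).\<close>
definition Uext :: "(real \<Rightarrow> real) \<Rightarrow> real \<Rightarrow> ereal" where
  "Uext U t = (if t > 0 then ereal (U t) else (INF s\<in>{0<..}. ereal (U s)))"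

text \<open>Convex conjugate V(y) = sup_{x>0} (U(x) - x y), for y \<ge> 0 (V(0) may be +\<infinity>).\<close>
definition Vext :: "(real \<Rightarrow> real) \<Rightarrow> real \<Rightarrow> ereal" where
  "Vext U s = (SUP t\<in>{0<..}. ereal (U t - t * s))"

definition Vfun :: "(real \<Rightarrow> real) \<Rightarrow> real \<Rightarrow> real" where
  "Vfun U s = real_of_ereal (Vext U s)"

definition Bcoef :: "(real \<Rightarrow> real) \<Rightarrow> real \<Rightarrow> real" where
  "Bcoef U s = - deriv (deriv (Vfun U)) s * s / deriv (Vfun U) s"

definition Epos :: "'a measure \<Rightarrow> ('a \<Rightarrow> ereal) \<Rightarrow> ennreal" where
  "Epos M f = (\<integral>\<^sup>+ \<omega>. e2ennreal (max 0 (f \<omega>)) \<partial>M)"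

definition Eneg :: "'a measure \<Rightarrow> ('a \<Rightarrow> ereal) \<Rightarrow> ennreal" where
  "Eneg M f = (\<integral>\<^sup>+ \<omega>. e2ennreal (max 0 (- f \<omega>)) \<partial>M)"

definition EU :: "'a measure \<Rightarrow> ('a \<Rightarrow> ereal) \<Rightarrow> ereal" where
  "EU M f = (if Eneg M f = \<infinity> then - \<infinity> else enn2ereal (Epos M f) - enn2ereal (Eneg M f))"

definition EV :: "'a measure \<Rightarrow> ('a \<Rightarrow> ereal) \<Rightarrow> ereal" where
  "EV M f = (if Epos M f = \<infinity> then \<infinity> else enn2ereal (Epos M f) - enn2ereal (Eneg M f))"

definition L0plus :: "'a measure \<Rightarrow> ('a \<Rightarrow> real) set" where
  "L0plus M = {f. f \<in> borel_measurable M \<and> (\<forall>\<omega>\<in>space M. 0 \<le> f \<omega>)}"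

definition polar_pair :: "'a measure \<Rightarrow> ('a \<Rightarrow> real) set \<Rightarrow> ('a \<Rightarrow> real) set \<Rightarrow> bool" where
  "polar_pair M Cs Ds \<longleftrightarrow>
     Cs \<subseteq> L0plus M \<and> Ds \<subseteq> L0plus M \<and>
     (\<exists>\<xi>\<in>Cs. \<forall>\<omega>\<in>space M. 0 < \<xi> \<omega>) \<and> (\<exists>\<eta>\<in>Ds. \<forall>\<omega>\<in>space M. 0 < \<eta> \<omega>) \<and>
     (\<forall>\<xi>\<in>L0plus M. \<xi> \<in> Cs \<longleftrightarrow> (\<forall>\<eta>\<in>Ds. (\<integral>\<^sup>+ \<omega>. ennreal (\<xi> \<omega> * \<eta> \<omega>) \<partial>M) \<le> 1)) \<and>
     (\<forall>\<eta>\<in>L0plus M. \<eta> \<in> Ds \<longleftrightarrow> (\<forall>\<xi>\<in>Cs. (\<integral>\<^sup>+ \<omega>. ennreal (\<xi> \<omega> * \<eta> \<omega>) \<partial>M) \<le> 1))"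

definition Ldelta :: "('a \<Rightarrow> real) \<Rightarrow> ('a \<Rightarrow> real) \<Rightarrow> real \<Rightarrow> 'a \<Rightarrow> real" where
  "Ldelta F G d \<omega> = exp (- (d * F \<omega> + d\<^sup>2 / 2 * G \<omega>))"

definition Cset :: "('a \<Rightarrow> real) set \<Rightarrow> ('a \<Rightarrow> real) \<Rightarrow> ('a \<Rightarrow> real) \<Rightarrow> real \<Rightarrow> real \<Rightarrow> ('a \<Rightarrow> real) set" where
  "Cset Cs F G x d = {(\<lambda>\<omega>. x * \<xi> \<omega> / Ldelta F G d \<omega>) | \<xi>. \<xi> \<in> Cs}"

definition Dset :: "('a \<Rightarrow> real) set \<Rightarrow> ('a \<Rightarrow> real) \<Rightarrow> ('a \<Rightarrow> real) \<Rightarrow> real \<Rightarrow> real \<Rightarrow> ('a \<Rightarrow> real) set" where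
  "Dset Ds F G y d = {(\<lambda>\<omega>. y * \<eta> \<omega> * Ldelta F G d \<omega>) | \<eta>. \<eta> \<in> Ds}"

definition uval :: "'a measure \<Rightarrow> (real \<Rightarrow> real) \<Rightarrow> ('a \<Rightarrow> real) set \<Rightarrow> ('a \<Rightarrow> real) \<Rightarrow> ('a \<Rightarrow> real) \<Rightarrow> real \<Rightarrow> real \<Rightarrow> ereal" where
  "uval M U Cs F G x d = (SUP \<xi>\<in>Cset Cs F G x d. EU M (\<lambda>\<omega>. Uext U (\<xi> \<omega>)))"

definition vval :: "'a measure \<Rightarrow> (real \<Rightarrow> real) \<Rightarrow> ('a \<Rightarrow> real) set \<Rightarrow> ('a \<Rightarrow> real) \<Rightarrow> ('a \<Rightarrow> real) \<Rightarrow> real \<Rightarrow> real \<Rightarrow> ereal" where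
  "vval M U Ds F G y d = (INF \<eta>\<in>Dset Ds F G y d. EV M (\<lambda>\<omega>. Vext U (\<eta> \<omega>)))"

definition primal_opt where
  "primal_opt M U Cs F G x d \<xi> \<longleftrightarrow>
     \<xi> \<in> Cset Cs F G x d \<and> uval M U Cs F G x d < \<infinity> \<and>
     EU M (\<lambda>\<omega>. Uext U (\<xi> \<omega>)) = uval M U Cs F G x d"

definition dual_opt where
  "dual_opt M U Ds F G y d \<eta> \<longleftrightarrow>
     \<eta> \<in> Dset Ds F G y d \<and> - \<infinity> < vval M U Ds F G y d \<and>
     EV M (\<lambda>\<omega>. Vext U (\<eta> \<omega>)) = vval M U Ds F G y d"

definition u_deriv where
  "u_deriv M U Cs F G x d y \<longleftrightarrow>
     eventually (\<lambda>t. \<bar>uval M U Cs F G t d\<bar> \<noteq> \<infinity>) (nhds x) \<and>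
     ((\<lambda>t. real_of_ereal (uval M U Cs F G t d)) has_real_derivative y) (at x)"

definition Rmeas :: "'a measure \<Rightarrow> ('a \<Rightarrow> real) \<Rightarrow> ('a \<Rightarrow> real) \<Rightarrow> real \<Rightarrow> real \<Rightarrow> 'a measure" where
  "Rmeas M \<xi> \<eta> x y = density M (\<lambda>\<omega>. ennreal (\<xi> \<omega> * \<eta> \<omega> / (x * y)))"

definition L2_0 :: "'a measure \<Rightarrow> ('a \<Rightarrow> real) set" where
  "L2_0 R = {\<alpha>. \<alpha> \<in> borel_measurable R \<and> integrable R \<alpha> \<and>
                 integrable R (\<lambda>\<omega>. (\<alpha> \<omega>)\<^sup>2) \<and> integral\<^sup>L R \<alpha> = 0}"

definition Linf :: "'a measure \<Rightarrow> ('a \<Rightarrow> real) set" where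
  "Linf M = {\<alpha>. \<alpha> \<in> borel_measurable M \<and> (\<exists>K. AE \<omega> in M. \<bar>\<alpha> \<omega>\<bar> \<le> K)}"

text \<open>Bounded directions: alpha with zeta(1 +- c alpha) in S for some c > 0
  (this is A^infty(x,delta) for zeta = xi(x,delta), S = C(x,delta), and
   B^infty(y,delta) for zeta = eta(y,delta), S = D(y,delta)).\<close>
definition Dirinf :: "'a measure \<Rightarrow> ('a \<Rightarrow> real) set \<Rightarrow> ('a \<Rightarrow> real) \<Rightarrow> ('a \<Rightarrow> real) set" where
  "Dirinf M S \<zeta> = {\<alpha>. \<alpha> \<in> Linf M \<and> (\<exists>c>0. (\<lambda>\<omega>. \<zeta> \<omega> * (1 + c * \<alpha> \<omega>)) \<in> S \<and>
                                          (\<lambda>\<omega>. \<zeta> \<omega> * (1 - c * \<alpha> \<omega>)) \<in> S)}"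

definition L2closure :: "'a measure \<Rightarrow> ('a \<Rightarrow> real) set \<Rightarrow> ('a \<Rightarrow> real) set" where
  "L2closure R S = {\<alpha>. \<alpha> \<in> L2_0 R \<and>
      (\<forall>e>0. \<exists>\<alpha>'\<in>S. integral\<^sup>L R (\<lambda>\<omega>. (\<alpha> \<omega> - \<alpha>' \<omega>)\<^sup>2) < e)}"

definition A2 where
  "A2 M Cs F G x d \<xi> \<eta> y = L2closure (Rmeas M \<xi> \<eta> x y) (Dirinf M (Cset Cs F G x d) \<xi>)"

definition B2 where
  "B2 M Ds F G y d \<xi> \<eta> x = L2closure (Rmeas M \<xi> \<eta> x y) (Dirinf M (Dset Ds F G y d) \<eta>)"

definition integrability_assm where
  "integrability_assm M F G \<xi> \<eta> x y \<longleftrightarrow>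
     (\<exists>c>0. integrable (Rmeas M \<xi> \<eta> x y) (\<lambda>\<omega>. exp (c * (\<bar>F \<omega>\<bar> + G \<omega>))))"

definition complementarity_assm where
  "complementarity_assm M U Cs Ds F G \<longleftrightarrow>
    (\<forall>d x y \<xi> \<eta>. 0 < x \<and> u_deriv M U Cs F G x d y \<and>
        primal_opt M U Cs F G x d \<xi> \<and> dual_opt M U Ds F G y d \<eta> \<longrightarrow>
      (let R = Rmeas M \<xi> \<eta> x y;
           AA = A2 M Cs F G x d \<xi> \<eta> y;
           BB = B2 M Ds F G y d \<xi> \<eta> x
       in (\<forall>\<alpha>. \<alpha> \<in> AA \<longleftrightarrow> \<alpha> \<in> L2_0 R \<and> (\<forall>\<beta>\<in>BB. integral\<^sup>L R (\<lambda>\<omega>. \<alpha> \<omega> * \<beta> \<omega>) = 0)) \<and>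
          (\<forall>\<beta>. \<beta> \<in> BB \<longleftrightarrow> \<beta> \<in> L2_0 R \<and> (\<forall>\<alpha>\<in>AA. integral\<^sup>L R (\<lambda>\<omega>. \<alpha> \<omega> * \<beta> \<omega>) = 0))))"

definition conv_in_prob_00 :: "'a measure \<Rightarrow> (real \<times> real \<Rightarrow> 'a \<Rightarrow> real) \<Rightarrow> bool" where
  "conv_in_prob_00 M Z \<longleftrightarrow>
     (\<forall>e>0. ((\<lambda>p. measure M {\<omega>\<in>space M. e < \<bar>Z p \<omega>\<bar>}) \<longlongrightarrow> 0) (at (0, 0)))"

end

theory Submission
  imports Defs
begin

text \<open>
  No second-order expansion of the value functions is needed. Write \<open>W = - V\<close> and consider the Fenchel gap
  \<open>t s - U t - W s \<ge> 0\<close>, which, relative to \<open>t s\<close>, is comparable to \<open>(ln s - ln (U' t))\<^sup>2\<close> because the relative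
  risk aversion is bounded above and below. Complementarity and the first-order conditions of the four
  quadratic problems say exactly that, for a suitable linear choice of \<open>\<Delta>y\<close> in terms of \<open>(\<Delta>x, \<delta>)\<close>, the
  linear approximations of the primal and of the dual optimizer satisfy \<open>\<eta> = U' \<xi>\<close> up to \<open>o(\<bar>\<Delta>x\<bar> + \<bar>\<delta>\<bar>)\<close>.
  Replacing the minimizers by bounded admissible directions makes these approximations feasible, and
  orthogonality makes the expectation of their product equal to the product of the initial values, so their
  duality gap is \<open>o((\<bar>\<Delta>x\<bar> + \<bar>\<delta>\<bar>)\<^sup>2)\<close>. The expected Fenchel gap between the true optimizer and the dual approximation
  is no larger, and the quadratic lower bound of the gap turns this into the claimed convergence.

  Since \<open>W\<close> is again a utility function, the dual problem is the primal problem for \<open>W\<close> with the two polar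
  sets exchanged and \<open>(F, G)\<close> replaced by \<open>(- F, - G)\<close>, so it suffices to treat the primal half.
\<close>

section \<open>Utility functions and the Fenchel gap\<close>

text \<open>The linear choice of \<Delta>y comes out of complementarity: a square integrable
  function orthogonal to all primal directions is, up to its mean, a dual direction. The first-order
  conditions of the two primal quadratic problems thereby produce two means, and \<Delta>y = - (a y
  / x) \<Delta>x + w \<delta> with a = a(x,x) and w = - (y / x) a(x,d). The obstacle is that the
  minimizers lie only in L2 closures, so candidates built from them need be neither nonnegative nor
  admissible. Bounded directions are therefore fixed before the limit is taken; the gap is then at
  most \<kappa> times the squared perturbation, with \<kappa> as small as desired but not tending to
  0 with the perturbation. The second derivative of U carries no modulus of continuity, so the
  linearization is pointwise and is integrated by dominated convergence, for which the exponential
  moments supply the majorant. The lower bound of the gap is quadratic only for bounded relative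
  deviations, and the weight \<xi> \<eta> may be small; hence convergence in probability, from
  Markov's inequality on a set of large probability.\<close>

lemma one_minus_exp_le: "\<bar>1 - exp (- z)\<bar> \<le> \<bar>z\<bar> * exp \<bar>z\<bar>" for z :: real
proof (cases "z \<ge> 0")
  case True
  have "1 - exp (- z) \<le> z" using exp_ge_add_one_self[of "-z"] by simp
  also have "z \<le> z * exp z" using True by (simp add: mult_le_cancel_left1)
  finally show ?thesis using True by simp
next
  case False
  have "exp (-z) * (1 + z) \<le> exp (-z) * exp z" by (intro mult_left_mono) (use exp_ge_add_one_self[of z] in auto)
  then have "exp (-z) - 1 \<le> -z * exp (-z)" by (simp add: algebra_simps flip: exp_add)
  then show ?thesis using False by simp
qed

text \<open>U, its derivative and the risk aversion are controlled on positive arguments only, so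
  measurability is stated for the function cut off at 0.\<close>

lemma borel_measurable_on_positive:
  fixes f :: "real \<Rightarrow> real"
  assumes "\<And>t. 0 < t \<Longrightarrow> isCont f t"
  shows "(\<lambda>t. if 0 < t then f t else 0) \<in> borel_measurable borel"
proof -
  have "(\<lambda>t. if t \<in> {0<..} then f t else 0) \<in> borel_measurable borel"
    by (rule borel_measurable_continuous_on_if) (auto intro!: continuous_at_imp_continuous_on assms)
  then show ?thesis by simp
qed

text \<open>On negative arguments \<open>\<phi>\<close> may be arbitrary; a nonnegative
  \<open>f\<close> meets besides the positive axis only the single value \<open>\<phi> 0\<close>, a
  constant on a measurable set.\<close>

lemma borel_measurable_comp_nonneg:
  fixes f :: "'a \<Rightarrow> real" and \<phi> :: "real \<Rightarrow> real"
  assumes [measurable]: "f \<in> borel_measurable M" and nn: "\<And>\<omega>. \<omega> \<in> space M \<Longrightarrow> 0 \<le> f \<omega>"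
    and m: "(\<lambda>t. if 0 < t then \<phi> t else 0) \<in> borel_measurable borel"
  shows "(\<lambda>\<omega>. \<phi> (f \<omega>)) \<in> borel_measurable M"
proof -
  note measurable_compose[OF assms(1) m, measurable]
  have "(\<lambda>\<omega>. if 0 < f \<omega> then (if 0 < f \<omega> then \<phi> (f \<omega>) else 0) else \<phi> 0) \<in> borel_measurable M"
    by (intro measurable_If measurable_compose[OF assms(1) m]) measurable
  then show ?thesis
  proof (rule measurable_cong[THEN iffD1, rotated])
    fix \<omega> assume "\<omega> \<in> space M"
    then have "f \<omega> = 0" if "\<not> 0 < f \<omega>" using nn[of \<omega>] that by simp
    then show "(if 0 < f \<omega> then (if 0 < f \<omega> then \<phi> (f \<omega>) else 0) else \<phi> 0) = \<phi> (f \<omega>)" by auto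
  qed
qed

text \<open>
  \<open>p\<close> and \<open>q\<close> are the derivatives of \<open>U\<close> and of \<open>W = - V\<close>, and \<open>A\<close> is the relative risk aversion of \<open>U\<close>. Stating
  the conjugacy in terms of \<open>W\<close> makes the axioms symmetric under exchanging \<open>U\<close> and \<open>W\<close>.
\<close>

locale utility_pair =
  fixes U W p q A :: "real \<Rightarrow> real" and c1 c2 :: real
  assumes c1_pos: "0 < c1" and c1_le: "c1 \<le> c2"
    and dU: "\<And>t. 0 < t \<Longrightarrow> (U has_real_derivative p t) (at t)"
    and dW: "\<And>s. 0 < s \<Longrightarrow> (W has_real_derivative q s) (at s)"
    and p_pos: "\<And>t. 0 < t \<Longrightarrow> 0 < p t"
    and q_pos: "\<And>s. 0 < s \<Longrightarrow> 0 < q s"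
    and qp: "\<And>t. 0 < t \<Longrightarrow> q (p t) = t"
    and pq: "\<And>s. 0 < s \<Longrightarrow> p (q s) = s"
    and dp: "\<And>t. 0 < t \<Longrightarrow> (p has_real_derivative - (A t * p t / t)) (at t)"
    and dq: "\<And>s. 0 < s \<Longrightarrow> (q has_real_derivative - (1 / A (q s) * q s / s)) (at s)"
    and A_ge: "\<And>t. 0 < t \<Longrightarrow> c1 \<le> A t"
    and A_le: "\<And>t. 0 < t \<Longrightarrow> A t \<le> c2"
    and fenchel_eq: "\<And>t. 0 < t \<Longrightarrow> U t + W (p t) = t * p t"
begin

lemma c2_pos: "0 < c2" using c1_pos c1_le by simp

lemma A_pos: "0 < t \<Longrightarrow> 0 < A t" using A_ge[of t] c1_pos by simp

text \<open>In logarithmic coordinates \<open>p\<close> and \<open>q\<close> are inverse to each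
  other with slopes - A and - 1 / A, so the bounds \<open>c1\<close>, \<open>c2\<close> turn into
  \<open>1 / c2\<close>, \<open>1 / c1\<close>. Through this every lemma of the locale has a dual
  twin.\<close>

lemma swap: "utility_pair W U q p (\<lambda>s. 1 / A (q s)) (1 / c2) (1 / c1)"
proof
  show "0 < 1 / c2" using c2_pos by simp
  show "1 / c2 \<le> 1 / c1" using c1_pos c1_le by (simp add: frac_le)
next
  fix t :: real assume t: "0 < t"
  show "1 / c2 \<le> 1 / A (q t)" "1 / A (q t) \<le> 1 / c1"
    using A_ge[OF q_pos[OF t]] A_le[OF q_pos[OF t]] c1_pos c2_pos by (auto intro!: divide_left_mono)
  show "W t + U (q t) = t * q t" using fenchel_eq[OF q_pos[OF t]] pq[OF t] by (simp add: mult.commute)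
  show "(p has_real_derivative - (1 / (1 / A (q (p t))) * p t / t)) (at t)"
    using dp[OF t] qp[OF t] by simp
  show "(q has_real_derivative - (1 / A (q t) * q t / t)) (at t)" using dq[OF t] .
qed (use dU dW p_pos q_pos qp pq in auto)

text \<open>As a function of ln t, ln p has slope - A, so bounds on the risk aversion are bounds on
  difference quotients; \<open>k\<close> is the value of A at an intermediate point.\<close>

lemma ln_p_mean_value:
  assumes "0 < a" "a < b"
  shows "\<exists>k. c1 \<le> k \<and> k \<le> c2 \<and> ln (p b) - ln (p a) = - k * (ln b - ln a)"
proof -
  have d: "((\<lambda>s. ln (p (exp s))) has_real_derivative - A (exp s)) (at s)" for s
  proof -
    have "((\<lambda>s. p (exp s)) has_real_derivative - (A (exp s) * p (exp s) / exp s) * exp s) (at s)"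
      by (rule DERIV_chain2[OF dp]) auto
    then have "((\<lambda>s. ln (p (exp s))) has_real_derivative
        1 / p (exp s) * (- (A (exp s) * p (exp s) / exp s) * exp s)) (at s)"
      by (intro DERIV_chain2[where f=ln and g="\<lambda>s. p (exp s)"])
         (auto intro!: derivative_eq_intros p_pos)
    moreover have "p (exp s) \<noteq> 0" using p_pos[of "exp s"] by simp
    ultimately show ?thesis by (simp add: field_simps)
  qed
  have "ln a < ln b" using assms by simp
  from MVT2[OF this, of "\<lambda>s. ln (p (exp s))" "\<lambda>s. - A (exp s)"] d
  obtain s where "ln (p (exp (ln b))) - ln (p (exp (ln a))) = (ln b - ln a) * (- A (exp s))" by auto
  then have "ln (p b) - ln (p a) = - A (exp s) * (ln b - ln a)" using assms by (simp add: mult.commute)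
  then show ?thesis using A_ge A_le by (intro exI[of _ "A (exp s)"]) auto
qed

text \<open>Between any two points \<open>p\<close> behaves like a power with an exponent in
  [c1, c2]. The exponent depends on the two points; its range alone carries the growth estimates
  below.\<close>

lemma p_exp:
  assumes "0 < a" "0 < b"
  shows "\<exists>k. c1 \<le> k \<and> k \<le> c2 \<and> p b = p a * exp (- k * ln (b / a))"
proof -
  have "\<exists>k. c1 \<le> k \<and> k \<le> c2 \<and> ln (p b) - ln (p a) = - k * (ln b - ln a)"
  proof (cases a b rule: linorder_cases)
    case less then show ?thesis using ln_p_mean_value assms by blast
  next
    case equal then show ?thesis using c1_le by (intro exI[of _ c1]) auto
  next
    case greater
    from ln_p_mean_value[OF assms(2) greater] obtain k where "c1 \<le> k" "k \<le> c2"
      "ln (p a) - ln (p b) = - k * (ln a - ln b)" by blast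
    then show ?thesis by (intro exI[of _ k]) (auto simp: algebra_simps)
  qed
  then obtain k where k: "c1 \<le> k" "k \<le> c2" "ln (p b) - ln (p a) = - k * (ln b - ln a)" by blast
  have "p b = exp (ln (p a) + (ln (p b) - ln (p a)))" using p_pos assms by simp
  also have "\<dots> = p a * exp (- k * ln (b / a))"
    using p_pos assms by (simp only: k(3) exp_add) (simp add: ln_div)
  finally show ?thesis using k by blast
qed

lemma p_antimono: assumes "0 < a" "a \<le> b" shows "p b \<le> p a"
proof -
  obtain k where "c1 \<le> k" "k \<le> c2" "p b = p a * exp (- k * ln (b / a))"
    using p_exp[of a b] assms by auto
  moreover have "ln (b / a) \<ge> 0" using assms by simp
  ultimately show ?thesis using p_pos[OF assms(1)] c1_pos by (simp add: mult_le_cancel_left1)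
qed

lemma tangent: assumes "0 < a" "0 < b" shows "U b \<le> U a + p a * (b - a)"
proof (cases a b rule: linorder_cases)
  case less
  with MVT2[OF less, of U p] assms dU obtain \<sigma> where "a < \<sigma>" "U b - U a = (b - a) * p \<sigma>" by force
  with p_antimono[of a \<sigma>] assms less show ?thesis
    by (smt (verit, best) mult.commute mult_left_mono)
next
  case greater
  with MVT2[OF greater, of U p] assms dU obtain \<sigma> where s: "b < \<sigma>" "\<sigma> < a" "U a - U b = (a - b) * p \<sigma>" by force
  have "(a - b) * p a \<le> (a - b) * p \<sigma>" using p_antimono[of \<sigma> a] assms s by (intro mult_left_mono) auto
  then show ?thesis using s by (simp add: algebra_simps)
qed simp

lemma U_mono: assumes "0 < a" "a \<le> b" shows "U a \<le> U b"
  using tangent[of b a] p_pos[of b] assms mult_nonneg_nonpos[of "p b" "a - b"] by auto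

lemma U_continuous: "0 < t \<Longrightarrow> isCont U t" by (rule DERIV_isCont[OF dU])
lemma p_continuous: "0 < t \<Longrightarrow> isCont p t" by (rule DERIV_isCont[OF dp])

text \<open>Since \<open>p (q s) = s\<close>, the gap is the error at \<open>t\<close> of the
  tangent to U at \<open>q s\<close>.\<close>

lemma gap_tangent: "0 < s \<Longrightarrow> t * s - U t - W s = U (q s) + s * (t - q s) - U t"
  using fenchel_eq[of "q s"] q_pos[of s] pq[of s] by (simp add: algebra_simps)

lemma gap_nonneg: assumes "0 < t" "0 < s" shows "U t + W s \<le> t * s"
  using gap_tangent[OF assms(2), of t] tangent[OF q_pos[OF assms(2)] assms(1)] pq[OF assms(2)] by simp

text \<open>Concavity is used at \<open>t\<close> and not at \<open>q s\<close>: both factors of the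
  resulting product vanish when \<open>s = p t\<close>, so the bound is quadratic in the
  mismatch.\<close>

lemma gap_upper: assumes "0 < t" "0 < s" shows "t * s - U t - W s \<le> (t - q s) * (s - p t)"
  using gap_tangent[OF assms(2), of t] tangent[OF assms(1) q_pos[OF assms(2)]]
  by (simp add: algebra_simps)

text \<open>With \<open>p t = s * exp (- r)\<close> and \<open>q s = t * exp (- k * r)\<close>,
  where \<open>k\<close> is at most \<open>1 / c1\<close>, both factors of \<open>gap_upper\<close>
  become relative changes of size |r| up to an exponential. Relative to \<open>t * s\<close> the
  bound then depends on the logarithmic mismatch \<open>r\<close> alone.\<close>

lemma gap_upper_exp:
  assumes t: "0 < t" and s: "0 < s" and r: "r = ln s - ln (p t)"
  shows "t * s - U t - W s \<le> t * s * (1 / c1 * r\<^sup>2 * exp ((1 / c1 + 1) * \<bar>r\<bar>))"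
proof -
  interpret S: utility_pair W U q p "\<lambda>s. 1 / A (q s)" "1 / c2" "1 / c1" by (rule swap)
  note pt = p_pos[OF t]
  obtain k where k: "1 / c2 \<le> k" "k \<le> 1 / c1" "q s = t * exp (- k * r)"
    using S.p_exp[OF pt s] qp[OF t] pt s r by (auto simp: ln_div)
  have k0: "k > 0" using k c2_pos by (smt (verit) divide_pos_pos)
  have "p t = s * exp (- r)" unfolding r using pt s by (simp add: exp_diff)
  then have "t * s - U t - W s \<le> (t - t * exp (- (k * r))) * (s - s * exp (- r))"
    using gap_upper[OF t s] k(3) by simp
  also have "\<dots> = t * s * ((1 - exp (- (k * r))) * (1 - exp (- r)))" by (simp add: algebra_simps)
  also have "\<dots> \<le> t * s * \<bar>(1 - exp (- (k * r))) * (1 - exp (- r))\<bar>"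
    using t s by (intro mult_left_mono) auto
  also have "\<dots> = t * s * (\<bar>1 - exp (- (k * r))\<bar> * \<bar>1 - exp (- r)\<bar>)" by (simp add: abs_mult)
  also have "\<dots> \<le> t * s * ((\<bar>k * r\<bar> * exp \<bar>k * r\<bar>) * (\<bar>r\<bar> * exp \<bar>r\<bar>))"
    using t s by (intro mult_left_mono mult_mono one_minus_exp_le) auto
  also have "\<dots> = t * s * (k * r\<^sup>2 * exp ((k + 1) * \<bar>r\<bar>))"
    using k0 by (simp add: abs_mult power2_eq_square exp_add algebra_simps)
  also have "\<dots> \<le> t * s * (1 / c1 * r\<^sup>2 * exp ((1 / c1 + 1) * \<bar>r\<bar>))"
    using t s k k0 c1_pos by (intro mult_left_mono mult_mono) (auto intro!: mult_right_mono)
  finally show ?thesis .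
qed

lemma Uext_pos: "0 < t \<Longrightarrow> Uext U t = ereal (U t)" by (simp add: Uext_def)

lemma Uext_tangent:
  assumes "0 < a" "0 \<le> b" shows "Uext U b \<le> ereal (U a + p a * (b - a))"
proof (cases "b > 0")
  case True then show ?thesis using tangent assms by (simp add: Uext_def)
next
  case False
  then have b: "b = 0" using assms by simp
  have "Uext U b \<le> ereal (U a + p a * (b - a)) + ereal e" if e: "e > 0" for e
  proof -
    \<comment> \<open>From 0 to this point the tangent line at \<open>a\<close> rises by exactly
      \<open>e\<close>, so bounding the infimum by the value here costs no more than
      \<open>e\<close>.\<close>
    let ?s = "e / p a"
    have s: "?s > 0" using e p_pos assms by simp
    have "Uext U b \<le> ereal (U ?s)" using s b by (auto simp: Uext_def intro!: INF_lower)
    also have "U ?s \<le> U a + p a * (?s - a)" using tangent[OF assms(1) s] .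
    also have "\<dots> = U a + p a * (b - a) + e" using p_pos[OF assms(1)] b by (simp add: field_simps)
    finally show ?thesis by simp
  qed
  then show ?thesis by (metis ereal_le_epsilon2)
qed

text \<open>Here \<open>w\<close> is the relative deviation of \<open>t\<close> from
  \<open>q s\<close>, \<open>1 + w / 2\<close> the ratio of their midpoint to \<open>q s\<close>,
  and the exponential the factor by which \<open>p\<close> changes on the way to the midpoint. For
  large \<open>w\<close> the product grows only linearly, whence the truncation at 1.\<close>

lemma relative_gap_lower:
  fixes w k :: real
  assumes "w \<ge> -1" "c1 \<le> k"
  shows "c1 / (8 * (1 + c1)) * min 1 (w\<^sup>2) \<le> (1 - exp (- k * ln (1 + w / 2))) * (w / 2)"
proof (cases "w \<ge> 0")
  case True
  \<comment> \<open>Capping at 1/2 gives \<open>v\<^sup>2 = min 1 (w\<^sup>2) / 4\<close>, so the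
    truncation is already contained in \<open>v\<close>.\<close>
  define v where "v = min (w / 2) (1 / 2)"
  have v: "0 \<le> v" "v \<le> 1/2" "v \<le> w / 2" using True by (auto simp: v_def)
  have vv: "v\<^sup>2 = min 1 (w\<^sup>2) / 4"
  proof (cases "w \<le> 1")
    case T: True
    then have "w\<^sup>2 \<le> 1" using True by (simp add: power_le_one)
    with T show ?thesis by (simp add: v_def power_divide)
  next
    case F: False
    then have "w\<^sup>2 \<ge> 1" by (simp add: one_le_power)
    with F show ?thesis by (simp add: v_def power_divide)
  qed
  have "v / 2 \<le> v / (1 + v)" using v by (intro divide_left_mono) auto
  also have "\<dots> \<le> ln (1 + v)"
  proof -
    have "ln (1 / (1 + v)) \<le> 1 / (1 + v) - 1" using v by (intro ln_le_minus_one) auto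
    then show ?thesis using v by (simp add: ln_div field_simps)
  qed
  also have "\<dots> \<le> ln (1 + w / 2)" using v by simp
  finally have l: "v / 2 \<le> ln (1 + w / 2)" .
  \<comment> \<open>\<open>1 - exp (- z)\<close> is at least \<open>z / (1 + z)\<close>, and
    \<open>z \<le> c1\<close> gives the denominator \<open>1 + c1\<close>. The 8 of the constant is
    the 2 from here times the 4 from \<open>v\<^sup>2\<close>.\<close>
  define z where "z = c1 * v / 2"
  have z: "0 \<le> z" "z \<le> c1" using v c1_pos by (auto simp: z_def mult_le_cancel_left1)
  have "z \<le> k * ln (1 + w/2)" unfolding z_def
    using mult_mono[OF assms(2) l] v c1_pos assms by simp
  then have "exp (- k * ln (1 + w/2)) \<le> exp (- z)" by simp
  also have "\<dots> \<le> 1 / (1 + z)" using exp_ge_add_one_self[of z] z by (simp add: exp_minus field_simps)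
  finally have "1 - exp (- k * ln (1 + w/2)) \<ge> z / (1 + z)" using z by (simp add: field_simps)
  moreover have "z / (1 + z) \<ge> z / (1 + c1)" using z by (intro divide_left_mono) auto
  ultimately have zz: "1 - exp (- k * ln (1 + w/2)) \<ge> z / (1 + c1)" by linarith
  have nn: "0 \<le> z / (1 + c1)" using z c1_pos by simp
  have "(1 - exp (- k * ln (1 + w / 2))) * (w / 2) \<ge> z / (1 + c1) * v"
    using v zz nn order_trans[OF nn zz] by (intro mult_mono) auto
  moreover have "z / (1 + c1) * v = c1 / (8 * (1 + c1)) * min 1 (w\<^sup>2)"
  proof -
    have "z / (1 + c1) * v = c1 / (2 * (1 + c1)) * v\<^sup>2"
      by (simp add: z_def power2_eq_square divide_simps)
    then show ?thesis unfolding vv by simp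
  qed
  ultimately show ?thesis by linarith
next
  case False
  define v where "v = - w / 2"
  have v: "0 < v" "v \<le> 1/2" "w = - 2 * v" using False assms by (auto simp: v_def)
  have "ln (1 - v) \<le> - v" using ln_le_minus_one[of "1 - v"] v by simp
  then have "c1 * v \<le> k * (- ln (1 - v))" using v assms c1_pos by (intro mult_mono) auto
  also have "\<dots> \<le> exp (- k * ln (1 - v)) - 1" using exp_ge_add_one_self[of "- k * ln (1 - v)"] by simp
  finally have "c1 * v * v \<le> (exp (- k * ln (1 - v)) - 1) * v" using v by (intro mult_right_mono) auto
  moreover have "c1 / (8 * (1 + c1)) * min 1 (w\<^sup>2) \<le> c1 / 4 * w\<^sup>2"
    using c1_pos by (intro mult_mono) (auto simp: field_simps)
  moreover have "c1 / 4 * w\<^sup>2 = c1 * v * v" by (simp add: v(3) power2_eq_square)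
  moreover have "(exp (- k * ln (1 - v)) - 1) * v = (1 - exp (- k * ln (1 + w / 2))) * (w / 2)"
    by (simp add: v(3) algebra_simps)
  ultimately show ?thesis by linarith
qed

definition c0 :: real where "c0 = c1 / (8 * (1 + c1))"

lemma c0_pos: "0 < c0" using c1_pos by (simp add: c0_def)

text \<open>The way from \<open>q s\<close> to \<open>t\<close> is cut at the midpoint: tangent at
  \<open>q s\<close> up to there, tangent at the midpoint for the rest. The change of slope times
  the remaining length is the quadratic gain. The midpoint is positive even for
  \<open>t = 0\<close>, so the possibly infinite value of U at 0 occurs only on the left.\<close>

lemma gap_lower:
  assumes "0 \<le> t" "0 < s"
  shows "Uext U t \<le> ereal (t * s - W s - c0 * (s * q s) * min 1 (((t - q s) / q s)\<^sup>2))"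
proof -
  define \<tau> where "\<tau> = q s"
  have \<tau>: "\<tau> > 0" "p \<tau> = s" using q_pos pq assms by (auto simp: \<tau>_def)
  define m where "m = (t + \<tau>) / 2"
  have m: "m > 0" using \<tau> assms by (simp add: m_def)
  define w where "w = (t - \<tau>) / \<tau>"
  have w: "w \<ge> -1" "m / \<tau> = 1 + w / 2" "t - m = \<tau> * (w / 2)"
    using \<tau> assms by (auto simp: w_def m_def field_simps)
  obtain k where k: "c1 \<le> k" "p m = s * exp (- k * ln (1 + w / 2))"
    using p_exp[OF \<tau>(1) m] \<tau> w by auto
  have "Uext U t \<le> ereal (U m + p m * (t - m))" using Uext_tangent m assms by simp
  also have "U m + p m * (t - m) \<le> U \<tau> + s * (m - \<tau>) + p m * (t - m)"
    using tangent[OF \<tau>(1) m] \<tau> by simp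
  also have "\<dots> = U \<tau> + s * (t - \<tau>) - (s - p m) * (t - m)" by (simp add: algebra_simps)
  also have "(s - p m) * (t - m) = s * \<tau> * ((1 - exp (- k * ln (1 + w / 2))) * (w / 2))"
    by (simp add: k w algebra_simps)
  also have "U \<tau> + s * (t - \<tau>) - s * \<tau> * ((1 - exp (- k * ln (1 + w / 2))) * (w / 2))
      \<le> U \<tau> + s * (t - \<tau>) - s * \<tau> * (c0 * min 1 (w\<^sup>2))"
    unfolding c0_def using relative_gap_lower[OF w(1) k(1)] \<tau> assms
    by (intro diff_left_mono mult_left_mono) auto
  also have "U \<tau> + s * (t - \<tau>) = t * s - W s"
    using fenchel_eq[of \<tau>] \<tau> by (simp add: algebra_simps)
  finally show ?thesis by (simp add: w_def \<tau>_def algebra_simps)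
qed

text \<open>The tangent at the smaller of the two points bounds the increment; for l < 1 its slope
  exceeds \<open>p t\<close> by at most the factor \<open>exp (c2 * \<bar>ln l\<bar>)\<close>. At
  \<open>t = \<xi>\<close> the weight \<open>t * p t\<close> is \<xi> \<eta>, so exponential moments
  under that weight make U of a perturbed optimizer integrable.\<close>

lemma U_increment:
  assumes "0 < t" "0 < l"
  shows "\<bar>U (t * l) - U t\<bar> \<le> t * p t * exp ((c2 + 1) * \<bar>ln l\<bar>)"
proof (cases "l \<ge> 1")
  case True
  have "U t \<le> U (t * l)" using U_mono[of t "t * l"] assms True by (simp add: mult_le_cancel_left1)
  moreover have "U (t * l) \<le> U t + p t * (t * l - t)" using tangent[of t "t*l"] assms by simp
  moreover have "p t * (t * l - t) \<le> t * p t * l" using p_pos[of t] assms by (simp add: algebra_simps)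
  moreover have "t * p t * l \<le> t * p t * exp ((c2 + 1) * \<bar>ln l\<bar>)"
  proof -
    have "l = exp (1 * \<bar>ln l\<bar>)" using True by simp
    also have "\<dots> \<le> exp ((c2 + 1) * \<bar>ln l\<bar>)" using c2_pos by (intro iffD2[OF exp_le_cancel_iff] mult_right_mono) auto
    finally show ?thesis using p_pos[of t] assms by (intro mult_left_mono) auto
  qed
  ultimately show ?thesis by linarith
next
  case False
  have "U (t * l) \<le> U t" using U_mono[of "t * l" t] assms False by (simp add: mult_le_cancel_left1)
  moreover have "U t \<le> U (t * l) + p (t * l) * (t - t * l)" using tangent[of "t*l" t] assms by simp
  moreover obtain k where k: "c1 \<le> k" "k \<le> c2" "p (t * l) = p t * exp (- k * ln l)"
    using p_exp[of t "t * l"] assms by auto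
  have "p (t * l) * (t - t * l) \<le> p (t * l) * t"
    using p_pos[of "t*l"] assms by (intro mult_left_mono) auto
  moreover have "p (t * l) * t \<le> t * p t * exp ((c2 + 1) * \<bar>ln l\<bar>)"
  proof -
    have "- k * ln l = k * \<bar>ln l\<bar>" using False assms by simp
    also have "\<dots> \<le> (c2 + 1) * \<bar>ln l\<bar>" using k by (intro mult_right_mono) auto
    finally show ?thesis using k p_pos[of t] assms by simp
  qed
  ultimately show ?thesis by linarith
qed

text \<open>Differentiability of ln p in logarithmic coordinates, with slope \<open>- A t\<close>.
  As A need not be continuous, \<open>d\<close> depends on \<open>t\<close>; this is why the
  linearization below is pointwise in the random parameter.\<close>

lemma ln_p_expansion:
  assumes t: "0 < t" and e: "0 < e"
  shows "\<exists>d>0. \<forall>z. \<bar>z\<bar> < d \<longrightarrow> \<bar>ln (p (t * exp z)) - ln (p t) + A t * z\<bar> \<le> e * \<bar>z\<bar>"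
proof -
  have "((\<lambda>z. t * exp z) has_real_derivative t) (at 0)" by (auto intro!: derivative_eq_intros)
  then have "((\<lambda>z. p (t * exp z)) has_real_derivative - (A t * p t / t) * t) (at 0)"
    by (intro DERIV_chain2[where f=p and g="\<lambda>z. t * exp z"]) (use dp[OF t] in auto)
  then have "((\<lambda>z. ln (p (t * exp z))) has_real_derivative 1 / p t * (- (A t * p t / t) * t)) (at 0)"
    by (intro DERIV_chain2[where f=ln and g="\<lambda>z. p (t * exp z)"])
       (auto intro!: derivative_eq_intros p_pos t)
  moreover have "1 / p t * (- (A t * p t / t) * t) = - A t" using p_pos[OF t] t by simp
  ultimately have "((\<lambda>z. ln (p (t * exp z))) has_derivative (*) (- A t)) (at 0)"
    by (simp add: has_field_derivative_def)
  from this[unfolded has_derivative_at_alt] e obtain d where "d > 0" and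
    "\<forall>z. norm (z - 0) < d \<longrightarrow> norm (ln (p (t * exp z)) - ln (p (t * exp 0)) - (- A t) * (z - 0)) \<le> e * norm (z - 0)"
    by blast
  then show ?thesis by (intro exI[of _ d]) auto
qed

section \<open>Behaviour at zero and measurability\<close>

lemma mono_Uext: "mono (Uext U)"
proof (rule monoI)
  fix a b :: real assume ab: "a \<le> b"
  show "Uext U a \<le> Uext U b"
    using ab U_mono by (auto simp: Uext_def intro!: INF_lower)
qed

text \<open>At 0 monotonicity makes the limit the infimum, also when that is - \<infinity>.
  Convergence in the extended reals is the form in which Fatou's lemma uses it.\<close>

lemma Uext_tendsto:
  assumes "X \<longlonglongrightarrow> l" "\<And>n. 0 \<le> X n"
  shows "(\<lambda>n. Uext U (X n)) \<longlonglongrightarrow> Uext U l"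
proof (cases "l > 0")
  case True
  have ev: "eventually (\<lambda>n. X n > 0) sequentially" using order_tendstoD(1)[OF assms(1) True] .
  have "(\<lambda>n. U (X n)) \<longlonglongrightarrow> U l" using isCont_tendsto_compose[OF U_continuous[OF True] assms(1)] .
  then have "(\<lambda>n. ereal (U (X n))) \<longlonglongrightarrow> ereal (U l)" by simp
  then show ?thesis unfolding Uext_pos[OF True]
    by (rule Lim_transform_eventually) (use ev in \<open>eventually_elim, simp add: Uext_pos\<close>)
next
  case False
  moreover have "l \<ge> 0" using LIMSEQ_le_const[OF assms(1)] assms(2) by auto
  ultimately have l: "l = 0" by simp
  show ?thesis
  proof (rule order_tendstoI)
    fix a assume "a < Uext U l"
    then show "eventually (\<lambda>n. a < Uext U (X n)) sequentially"
      using monoD[OF mono_Uext, of l] assms(2) l by (intro always_eventually allI) (meson less_le_trans)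
  next
    fix a assume "Uext U l < a"
    then obtain s where s: "s > 0" "ereal (U s) < a" using l by (auto simp: Uext_def INF_less_iff)
    have "eventually (\<lambda>n. X n < s) sequentially" using order_tendstoD(2)[OF assms(1)] s l by simp
    then show "eventually (\<lambda>n. Uext U (X n) < a) sequentially"
    proof eventually_elim
      case (elim n)
      have "Uext U (X n) \<le> Uext U s" using monoD[OF mono_Uext] elim by simp
      also have "\<dots> < a" using s by (simp add: Uext_pos)
      finally show ?case .
    qed
  qed
qed

lemma p_measurable [measurable]: "(\<lambda>t. if 0 < t then p t else 0) \<in> borel_measurable borel"
  by (rule borel_measurable_on_positive[OF p_continuous])

lemma U_measurable [measurable]: "(\<lambda>t. if 0 < t then U t else 0) \<in> borel_measurable borel"
  by (rule borel_measurable_on_positive[OF U_continuous])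

lemma Uext_measurable [measurable]: "Uext U \<in> borel_measurable borel"
proof -
  have "(\<lambda>t. if 0 < t then ereal (if 0 < t then U t else 0) else (INF s\<in>{0<..}. ereal (U s)))
      \<in> borel_measurable borel" by measurable
  also have "(\<lambda>t. if 0 < t then ereal (if 0 < t then U t else 0) else (INF s\<in>{0<..}. ereal (U s))) = Uext U"
    by (auto simp: Uext_def fun_eq_iff)
  finally show ?thesis .
qed

text \<open>A comes from a second derivative and need not be continuous; it is the pointwise limit
  of difference quotients of \<open>p\<close> multiplied by \<open>- t / p t\<close>, which are
  measurable.\<close>

lemma A_measurable [measurable]: "(\<lambda>t. if 0 < t then A t else 0) \<in> borel_measurable borel"
proof -
  define g where "g t = (if 0 < t then p t else 0)" for t
  have [measurable]: "g \<in> borel_measurable borel" unfolding g_def by measurable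
  define f where "f n t = (if 0 < t then - t / g t *
     ((g (t + inverse (real (Suc n))) - g t) / inverse (real (Suc n))) else 0)" for n and t :: real
  have [measurable]: "f n \<in> borel_measurable borel" for n
    unfolding f_def by measurable
  have "(\<lambda>n. f n t) \<longlonglongrightarrow> (if 0 < t then A t else 0)" for t
  proof (cases "0 < t")
    case True
    have "(\<lambda>n. inverse (real (Suc n))) \<longlonglongrightarrow> 0" by (rule LIMSEQ_inverse_real_of_nat)
    then have fl: "filterlim (\<lambda>n. inverse (real (Suc n))) (at 0) sequentially" by (auto simp: filterlim_at)
    have "((\<lambda>h. (p (t + h) - p t) / h) \<longlongrightarrow> - (A t * p t / t)) (at 0)"
      using dp[OF True] by (simp add: DERIV_def)
    from filterlim_compose[OF this fl]
    have "(\<lambda>n. - t / p t * ((p (t + inverse (real (Suc n))) - p t) / inverse (real (Suc n))))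
        \<longlonglongrightarrow> - t / p t * (- (A t * p t / t))" by (intro tendsto_mult tendsto_const)
    moreover have "- t / p t * (- (A t * p t / t)) = A t" using p_pos[OF True] True by (simp add: field_simps)
    moreover have "0 < t + inverse (real (Suc n))" for n using True by (simp add: add_pos_pos)
    ultimately show ?thesis using True by (simp add: f_def g_def)
  next
    case False then show ?thesis by (simp add: f_def)
  qed
  then show ?thesis by (rule borel_measurable_LIMSEQ_real[of _ f]) measurable
qed

end

section \<open>Expected utility and polar sets\<close>

text \<open>Finite positive and negative parts leave the integrand finite almost everywhere, which
  turns the extended expectation into a Bochner integral; comparisons of expected utilities are made
  in that form.\<close>

lemma EU_eq_integral:
  assumes [measurable]: "f \<in> borel_measurable M" and fin: "Epos M f < \<infinity>" "Eneg M f < \<infinity>"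
  shows "integrable M (\<lambda>\<omega>. real_of_ereal (f \<omega>))" "AE \<omega> in M. f \<omega> = ereal (real_of_ereal (f \<omega>))"
    "EU M f = ereal (\<integral>\<omega>. real_of_ereal (f \<omega>) \<partial>M)"
proof -
  define g where "g \<omega> = real_of_ereal (f \<omega>)" for \<omega>
  have [measurable]: "g \<in> borel_measurable M" unfolding g_def by measurable
  have "AE \<omega> in M. e2ennreal (max 0 (f \<omega>)) \<noteq> \<infinity>"
    by (rule nn_integral_PInf_AE) (use fin in \<open>auto simp: Epos_def\<close>)
  moreover have "AE \<omega> in M. e2ennreal (max 0 (- f \<omega>)) \<noteq> \<infinity>"
    by (rule nn_integral_PInf_AE) (use fin in \<open>auto simp: Eneg_def\<close>)
  ultimately have ae: "AE \<omega> in M. f \<omega> = ereal (g \<omega>)"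
  proof eventually_elim
    case (elim \<omega>) then show ?case by (cases "f \<omega>") (auto simp: g_def)
  qed
  then show "AE \<omega> in M. f \<omega> = ereal (real_of_ereal (f \<omega>))" by (simp add: g_def)
  have P: "Epos M f = (\<integral>\<^sup>+\<omega>. ennreal (g \<omega>) \<partial>M)"
    unfolding Epos_def using ae
    by (intro nn_integral_cong_AE, elim AE_mp, intro AE_I2) (auto simp: max_def ennreal_neg zero_ereal_def)
  have N: "Eneg M f = (\<integral>\<^sup>+\<omega>. ennreal (- g \<omega>) \<partial>M)"
    unfolding Eneg_def using ae
    by (intro nn_integral_cong_AE, elim AE_mp, intro AE_I2) (auto simp: max_def ennreal_neg zero_ereal_def)
  show "integrable M (\<lambda>\<omega>. real_of_ereal (f \<omega>))"
    unfolding real_integrable_def using fin P N by (simp add: g_def[symmetric] less_top[symmetric])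
  then have "(\<integral>\<omega>. g \<omega> \<partial>M) = enn2real (Epos M f) - enn2real (Eneg M f)"
    unfolding P N by (intro real_lebesgue_integral_def) (simp add: g_def[symmetric])
  moreover have "ereal (enn2real a) = enn2ereal a" if "a < \<infinity>" for a
    using that by (cases a) (auto simp: enn2ereal_ennreal)
  ultimately show "EU M f = ereal (\<integral>\<omega>. real_of_ereal (f \<omega>) \<partial>M)"
    using fin by (auto simp: EU_def g_def[symmetric] simp flip: ereal_minus(1))
qed

lemma Epos_less_top:
  assumes "integrable M k" "AE \<omega> in M. f \<omega> \<le> ereal (k \<omega>)"
  shows "Epos M f < \<infinity>"
proof -
  have "Epos M f \<le> (\<integral>\<^sup>+\<omega>. ennreal (norm (k \<omega>)) \<partial>M)"
    unfolding Epos_def using assms(2)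
    by (intro nn_integral_mono_AE, elim AE_mp, intro AE_I2 impI)
       (auto simp: max_def simp flip: e2ennreal_ereal intro!: e2ennreal_mono,
        metis (no_types, opaque_lifting) abs_ge_self ereal_less_eq(3) order_trans)
  also have "\<dots> < \<infinity>" using assms(1) by (simp add: integrable_iff_bounded)
  finally show ?thesis .
qed

lemma Eneg_less_top:
  assumes "integrable M l" "AE \<omega> in M. ereal (l \<omega>) \<le> f \<omega>"
  shows "Eneg M f < \<infinity>"
proof -
  have "Eneg M f = Epos M (\<lambda>\<omega>. - f \<omega>)" by (simp add: Eneg_def Epos_def)
  also have "\<dots> < \<infinity>"
    using assms by (intro Epos_less_top[of M "\<lambda>\<omega>. - l \<omega>"]) (auto simp: ereal_uminus_le_reorder simp flip: uminus_ereal.simps(1))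
  finally show ?thesis .
qed

lemma EU_sandwich:
  assumes "f \<in> borel_measurable M" "integrable M k" "AE \<omega> in M. f \<omega> \<le> ereal (k \<omega>)"
    "integrable M l" "AE \<omega> in M. ereal (l \<omega>) \<le> f \<omega>"
  shows "ereal (\<integral>\<omega>. l \<omega> \<partial>M) \<le> EU M f" "EU M f \<le> ereal (\<integral>\<omega>. k \<omega> \<partial>M)"
proof -
  note E = EU_eq_integral[OF assms(1) Epos_less_top[OF assms(2,3)] Eneg_less_top[OF assms(4,5)]]
  have "(\<integral>\<omega>. l \<omega> \<partial>M) \<le> (\<integral>\<omega>. real_of_ereal (f \<omega>) \<partial>M)"
  proof (rule integral_mono_AE[OF assms(4) E(1)])
    show "AE \<omega> in M. l \<omega> \<le> real_of_ereal (f \<omega>)"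
      using E(2) assms(5) by eventually_elim (metis ereal_less_eq(3))
  qed
  then show "ereal (\<integral>\<omega>. l \<omega> \<partial>M) \<le> EU M f" unfolding E(3) by simp
  have "(\<integral>\<omega>. real_of_ereal (f \<omega>) \<partial>M) \<le> (\<integral>\<omega>. k \<omega> \<partial>M)"
  proof (rule integral_mono_AE[OF E(1) assms(2)])
    show "AE \<omega> in M. real_of_ereal (f \<omega>) \<le> k \<omega>"
      using E(2) assms(3) by eventually_elim (metis ereal_less_eq(3))
  qed
  then show "EU M f \<le> ereal (\<integral>\<omega>. k \<omega> \<partial>M)" unfolding E(3) by simp
qed

text \<open>An integrable bound from above is enough, because an infinite negative part makes the
  expectation - \<infinity> by convention.\<close>

lemma EU_upper:
  assumes "f \<in> borel_measurable M" "integrable M k" "AE \<omega> in M. f \<omega> \<le> ereal (k \<omega>)"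
  shows "EU M f \<le> ereal (\<integral>\<omega>. k \<omega> \<partial>M)"
proof (cases "Eneg M f = \<infinity>")
  case True then show ?thesis by (simp add: EU_def)
next
  case False
  then have N: "Eneg M f < \<infinity>" by (simp add: less_top)
  note E = EU_eq_integral[OF assms(1) Epos_less_top[OF assms(2,3)] N]
  have "(\<integral>\<omega>. real_of_ereal (f \<omega>) \<partial>M) \<le> (\<integral>\<omega>. k \<omega> \<partial>M)"
  proof (rule integral_mono_AE[OF E(1) assms(2)])
    show "AE \<omega> in M. real_of_ereal (f \<omega>) \<le> k \<omega>"
      using E(2) assms(3) by eventually_elim (metis ereal_less_eq(3))
  qed
  then show "EU M f \<le> ereal (\<integral>\<omega>. k \<omega> \<partial>M)" unfolding E(3) by simp
qed

lemma EU_finite: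
  assumes "f \<in> borel_measurable M" "integrable M k" "AE \<omega> in M. f \<omega> \<le> ereal (k \<omega>)" "EU M f \<noteq> - \<infinity>"
  shows "integrable M (\<lambda>\<omega>. real_of_ereal (f \<omega>))" "AE \<omega> in M. f \<omega> = ereal (real_of_ereal (f \<omega>))"
    "EU M f = ereal (\<integral>\<omega>. real_of_ereal (f \<omega>) \<partial>M)"
proof -
  have N: "Eneg M f < \<infinity>" using assms(4) by (auto simp: EU_def less_top split: if_splits)
  note E = EU_eq_integral[OF assms(1) Epos_less_top[OF assms(2,3)] N]
  show "integrable M (\<lambda>\<omega>. real_of_ereal (f \<omega>))" "AE \<omega> in M. f \<omega> = ereal (real_of_ereal (f \<omega>))"
    "EU M f = ereal (\<integral>\<omega>. real_of_ereal (f \<omega>) \<partial>M)" by fact+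
qed

text \<open>For a polar pair and x > 0 this is C(x,0) when taken of \<open>Ds\<close> and D(x,0)
  when taken of \<open>Cs\<close>. Carrying the budget as a parameter lets budgets add up in sums,
  the form in which perturbations are built.\<close>

definition pol :: "'a measure \<Rightarrow> ('a \<Rightarrow> real) set \<Rightarrow> real \<Rightarrow> ('a \<Rightarrow> real) set" where
  "pol M D x = {f \<in> L0plus M. \<forall>h\<in>D. (\<integral>\<^sup>+ \<omega>. ennreal (f \<omega> * h \<omega>) \<partial>M) \<le> ennreal x}"

lemma polI: "f \<in> L0plus M \<Longrightarrow> (\<And>h. h \<in> D \<Longrightarrow> (\<integral>\<^sup>+ \<omega>. ennreal (f \<omega> * h \<omega>) \<partial>M) \<le> ennreal x) \<Longrightarrow> f \<in> pol M D x"
  by (simp add: pol_def)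

lemma polD: "f \<in> pol M D x \<Longrightarrow> h \<in> D \<Longrightarrow> (\<integral>\<^sup>+ \<omega>. ennreal (f \<omega> * h \<omega>) \<partial>M) \<le> ennreal x"
  by (simp add: pol_def)

lemma pol_L0plus: "f \<in> pol M D x \<Longrightarrow> f \<in> L0plus M" by (simp add: pol_def)

lemma L0plus_measurable: "f \<in> L0plus M \<Longrightarrow> f \<in> borel_measurable M" by (simp add: L0plus_def)
lemma L0plus_nonneg: "f \<in> L0plus M \<Longrightarrow> \<omega> \<in> space M \<Longrightarrow> 0 \<le> f \<omega>" by (simp add: L0plus_def)
lemmas pol_measurable = L0plus_measurable[OF pol_L0plus]
lemmas pol_nonneg = L0plus_nonneg[OF pol_L0plus]

lemma pol_add:
  assumes D: "D \<subseteq> L0plus M" and f: "f \<in> pol M D x" and g: "g \<in> pol M D y" and "0 \<le> x" "0 \<le> y"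
  shows "(\<lambda>\<omega>. f \<omega> + g \<omega>) \<in> pol M D (x + y)"
proof (rule polI)
  show "(\<lambda>\<omega>. f \<omega> + g \<omega>) \<in> L0plus M" using f g by (auto simp: pol_def L0plus_def)
  fix h assume h: "h \<in> D"
  have [measurable]: "f \<in> borel_measurable M" "g \<in> borel_measurable M" "h \<in> borel_measurable M"
    using pol_measurable[OF f] pol_measurable[OF g] D h by (auto simp: L0plus_def)
  have "(\<integral>\<^sup>+ \<omega>. ennreal ((f \<omega> + g \<omega>) * h \<omega>) \<partial>M)
      = (\<integral>\<^sup>+ \<omega>. ennreal (f \<omega> * h \<omega>) + ennreal (g \<omega> * h \<omega>) \<partial>M)"
    using pol_nonneg[OF f] pol_nonneg[OF g] D h
    by (intro nn_integral_cong) (auto simp: L0plus_def distrib_right subset_eq intro!: ennreal_plus)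
  also have "\<dots> = (\<integral>\<^sup>+ \<omega>. ennreal (f \<omega> * h \<omega>) \<partial>M) + (\<integral>\<^sup>+ \<omega>. ennreal (g \<omega> * h \<omega>) \<partial>M)"
    by (rule nn_integral_add) auto
  also have "\<dots> \<le> ennreal (x + y)"
    using polD[OF f h] polD[OF g h] assms(4,5) by (simp add: ennreal_plus add_mono)
  finally show "(\<integral>\<^sup>+ \<omega>. ennreal ((f \<omega> + g \<omega>) * h \<omega>) \<partial>M) \<le> ennreal (x + y)" .
qed

lemma pol_scale:
  assumes D: "D \<subseteq> L0plus M" and f: "f \<in> pol M D x" and r: "0 \<le> r"
  shows "(\<lambda>\<omega>. r * f \<omega>) \<in> pol M D (r * x)"
proof (rule polI)
  show "(\<lambda>\<omega>. r * f \<omega>) \<in> L0plus M" using f r by (auto simp: pol_def L0plus_def)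
  fix h assume h: "h \<in> D"
  have [measurable]: "f \<in> borel_measurable M" "h \<in> borel_measurable M"
    using pol_measurable[OF f] D h by (auto simp: L0plus_def)
  have "(\<integral>\<^sup>+ \<omega>. ennreal (r * f \<omega> * h \<omega>) \<partial>M) = ennreal r * (\<integral>\<^sup>+ \<omega>. ennreal (f \<omega> * h \<omega>) \<partial>M)"
    using r by (subst nn_integral_cmult[symmetric]) (auto simp: ennreal_mult' mult.assoc)
  also have "\<dots> \<le> ennreal (r * x)"
    using polD[OF f h] r by (simp add: ennreal_mult' mult_left_mono)
  finally show "(\<integral>\<^sup>+ \<omega>. ennreal (r * f \<omega> * h \<omega>) \<partial>M) \<le> ennreal (r * x)" .
qed

text \<open>Closedness under almost sure convergence is Fatou's lemma against each test
  function.\<close>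

lemma pol_lim:
  assumes D: "D \<subseteq> L0plus M" and Z: "\<And>n. Z n \<in> pol M D x" and z: "z \<in> L0plus M"
    and lim: "AE \<omega> in M. (\<lambda>n. Z n \<omega>) \<longlonglongrightarrow> z \<omega>"
  shows "z \<in> pol M D x"
proof (rule polI[OF z])
  fix h assume h: "h \<in> D"
  have [measurable]: "h \<in> borel_measurable M" "\<And>n. Z n \<in> borel_measurable M"
    using pol_measurable[OF Z] D h by (auto simp: L0plus_def)
  have "(\<integral>\<^sup>+ \<omega>. ennreal (z \<omega> * h \<omega>) \<partial>M) = (\<integral>\<^sup>+ \<omega>. liminf (\<lambda>n. ennreal (Z n \<omega> * h \<omega>)) \<partial>M)"
  proof (rule nn_integral_cong_AE)
    show "AE \<omega> in M. ennreal (z \<omega> * h \<omega>) = liminf (\<lambda>n. ennreal (Z n \<omega> * h \<omega>))"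
      using lim
    proof eventually_elim
      case (elim \<omega>)
      then have "(\<lambda>n. ennreal (Z n \<omega> * h \<omega>)) \<longlonglongrightarrow> ennreal (z \<omega> * h \<omega>)"
        by (intro tendsto_ennrealI tendsto_intros)
      from lim_imp_Liminf[OF _ this] show ?case by simp
    qed
  qed
  also have "\<dots> \<le> liminf (\<lambda>n. \<integral>\<^sup>+ \<omega>. ennreal (Z n \<omega> * h \<omega>) \<partial>M)"
    by (rule nn_integral_liminf) simp
  also have "\<dots> \<le> ennreal x"
    by (intro Liminf_le always_eventually allI polD[OF Z h]) auto
  finally show "(\<integral>\<^sup>+ \<omega>. ennreal (z \<omega> * h \<omega>) \<partial>M) \<le> ennreal x" .
qed

lemma Ldelta_pos: "0 < Ldelta F G d \<omega>" by (simp add: Ldelta_def)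

lemma Ldelta_measurable [measurable (raw)]:
  assumes [measurable]: "F \<in> borel_measurable M" "G \<in> borel_measurable M"
  shows "(\<lambda>\<omega>. Ldelta F G d \<omega>) \<in> borel_measurable M"
  unfolding Ldelta_def by measurable

text \<open>Multiplication by \<open>Ldelta\<close> undoes the perturbation, so every C(x,\<delta>)
  is described by one and the same polar set.\<close>

lemma Cset_iff:
  assumes C: "Cs = pol M D 1" and D: "D \<subseteq> L0plus M" and x: "0 < x"
  shows "\<zeta> \<in> Cset Cs F G x d \<longleftrightarrow> (\<lambda>\<omega>. \<zeta> \<omega> * Ldelta F G d \<omega>) \<in> pol M D x"
proof
  assume "\<zeta> \<in> Cset Cs F G x d"
  then obtain f where f: "f \<in> pol M D 1" "\<zeta> = (\<lambda>\<omega>. x * f \<omega> / Ldelta F G d \<omega>)"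
    by (auto simp: Cset_def C)
  have "(\<lambda>\<omega>. \<zeta> \<omega> * Ldelta F G d \<omega>) = (\<lambda>\<omega>. x * f \<omega>)"
    using Ldelta_pos[of F G d] by (auto simp: f(2) fun_eq_iff less_imp_neq[symmetric])
  then show "(\<lambda>\<omega>. \<zeta> \<omega> * Ldelta F G d \<omega>) \<in> pol M D x" using pol_scale[OF D f(1), of x] x by simp
next
  assume *: "(\<lambda>\<omega>. \<zeta> \<omega> * Ldelta F G d \<omega>) \<in> pol M D x"
  let ?f = "\<lambda>\<omega>. 1 / x * (\<zeta> \<omega> * Ldelta F G d \<omega>)"
  have "?f \<in> Cs" using pol_scale[OF D *, of "1 / x"] x by (simp add: C)
  moreover have "\<zeta> = (\<lambda>\<omega>. x * ?f \<omega> / Ldelta F G d \<omega>)"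
    using x Ldelta_pos[of F G d] by (auto simp: fun_eq_iff less_imp_neq[symmetric])
  ultimately show "\<zeta> \<in> Cset Cs F G x d" unfolding Cset_def mem_Collect_eq by (intro exI conjI)
qed

lemma pol_pairing:
  assumes D: "D = pol M Cs 1" and Cs: "Cs \<subseteq> L0plus M" and f: "f \<in> pol M D x" and h: "h \<in> pol M Cs y" and y: "0 < y"
    and x: "0 \<le> x"
  shows "(\<integral>\<^sup>+ \<omega>. ennreal (f \<omega> * h \<omega>) \<partial>M) \<le> ennreal (x * y)"
proof -
  have [measurable]: "f \<in> borel_measurable M" "h \<in> borel_measurable M"
    using pol_measurable[OF f] pol_measurable[OF h] by auto
  have "(\<lambda>\<omega>. 1 / y * h \<omega>) \<in> D" using pol_scale[OF Cs h, of "1 / y"] y by (simp add: D)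
  from polD[OF f this] have 1: "(\<integral>\<^sup>+ \<omega>. ennreal (f \<omega> * (1 / y * h \<omega>)) \<partial>M) \<le> ennreal x" .
  have "(\<integral>\<^sup>+ \<omega>. ennreal (f \<omega> * h \<omega>) \<partial>M) = (\<integral>\<^sup>+ \<omega>. ennreal y * ennreal (f \<omega> * (1 / y * h \<omega>)) \<partial>M)"
    using y by (intro nn_integral_cong) (simp add: ennreal_mult'[symmetric])
  also have "\<dots> = ennreal y * (\<integral>\<^sup>+ \<omega>. ennreal (f \<omega> * (1 / y * h \<omega>)) \<partial>M)"
    by (rule nn_integral_cmult) simp
  also have "\<dots> \<le> ennreal (x * y)"
    using mult_left_mono[OF 1, of "ennreal y"] y x by (simp add: ennreal_mult' mult.commute[of x])
  finally show ?thesis .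
qed


section \<open>Strict concavity at midpoints with an explicit modulus\<close>

context utility_pair
begin

text \<open>\<open>gap_lower\<close> at the price \<open>p m\<close> is applied to \<open>a\<close>,
  the plain tangent at \<open>m\<close> to \<open>b\<close>; the linear terms cancel because
  \<open>m\<close> is the midpoint.\<close>

lemma midpoint_gap:
  assumes "0 \<le> a" "0 \<le> b" "0 < m" "m = (a + b) / 2"
  shows "Uext U a + Uext U b \<le> ereal (2 * U m - c0 * (m * p m) * min 1 (((a - m) / m)\<^sup>2))"
proof -
  let ?d = "c0 * (m * p m) * min 1 (((a - m) / m)\<^sup>2)"
  have "Uext U a \<le> ereal (a * p m - W (p m) - c0 * (p m * q (p m)) * min 1 (((a - q (p m)) / q (p m))\<^sup>2))"
    by (rule gap_lower) (use assms p_pos in auto)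
  also have "a * p m - W (p m) - c0 * (p m * q (p m)) * min 1 (((a - q (p m)) / q (p m))\<^sup>2) = U m + p m * (a - m) - ?d"
    using fenchel_eq[OF assms(3)] qp[OF assms(3)] by (simp add: algebra_simps)
  finally have 1: "Uext U a \<le> ereal (U m + p m * (a - m) - ?d)" .
  have 2: "Uext U b \<le> ereal (U m + p m * (b - m))" using Uext_tangent assms by simp
  have "p m * (a - m) + p m * (b - m) = 0" using assms(4) by (simp flip: distrib_left)
  then have "(U m + p m * (a - m) - ?d) + (U m + p m * (b - m)) = 2 * U m - ?d" by linarith
  with add_mono[OF 1 2] show ?thesis by simp
qed

text \<open>For two points of [0, K] more than \<theta> apart, the midpoint m lies in
  [\<theta> / 2, K] and is at least \<theta> / 2 away from either of them. So \<open>m * p m\<close>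
  is at least \<open>\<theta> / 2 * p K\<close> and the relative deviation from m at least
  \<open>\<theta> / (2 * K)\<close>; inserting both into \<open>midpoint_gap\<close> gives this
  expression.\<close>

definition midpoint_modulus :: "real \<Rightarrow> real \<Rightarrow> real" where
  "midpoint_modulus \<theta> K = c0 * (\<theta> / 2 * p K) * min 1 ((\<theta> / (2 * K))\<^sup>2)"

lemma midpoint_modulus_pos: "0 < \<theta> \<Longrightarrow> 0 < K \<Longrightarrow> 0 < midpoint_modulus \<theta> K"
  using c0_pos p_pos by (simp add: midpoint_modulus_def)

lemma midpoint_gap_uniform:
  assumes a: "0 \<le> a" "a \<le> K" and b: "0 \<le> b" "b \<le> K" and t: "0 < \<theta>" "\<theta> < \<bar>a - b\<bar>"
  shows "Uext U a + Uext U b \<le> ereal (2 * U ((a + b) / 2) - midpoint_modulus \<theta> K)"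
proof -
  define m where "m = (a + b) / 2"
  have m: "\<theta> / 2 \<le> m" "m \<le> K" "\<theta> / 2 \<le> \<bar>a - m\<bar>" using a b t by (auto simp: m_def abs_if field_simps split: if_splits)
  then have m0: "0 < m" using t by simp
  have K: "0 < K" using m m0 by simp
  have "\<theta> / (2 * K) = \<theta> / 2 / K" by simp
  also have "\<dots> \<le> \<bar>a - m\<bar> / m" using m t m0 by (intro frac_le) auto
  also have "\<dots> = \<bar>(a - m) / m\<bar>" using m0 by simp
  finally have "(\<theta> / (2 * K))\<^sup>2 \<le> ((a - m) / m)\<^sup>2"
    using t K abs_le_square_iff[of "\<theta> / (2 * K)" "(a - m) / m"] by simp
  moreover have "\<theta> / 2 * p K \<le> m * p m"
    using m m0 t p_antimono[OF m0 m(2)] p_pos[OF K] by (intro mult_mono) auto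
  ultimately have "midpoint_modulus \<theta> K \<le> c0 * (m * p m) * min 1 (((a - m) / m)\<^sup>2)"
    unfolding midpoint_modulus_def using c0_pos t p_pos[OF K] p_pos[OF m0] m0 K
    by (intro mult_mono[OF mult_left_mono]) auto
  then show ?thesis
    using midpoint_gap[OF a(1) b(1) m0 m_def] by (auto simp flip: m_def intro: order_trans)
qed

lemma Uext_midpoint:
  assumes "0 \<le> a" "0 \<le> b"
  shows "Uext U a + Uext U b \<le> 2 * Uext U ((a + b) / 2)"
proof (cases "a + b > 0")
  case True
  then have "Uext U a + Uext U b \<le> ereal (2 * U ((a + b) / 2) - c0 * ((a+b)/2 * p ((a+b)/2)) * min 1 (((a - (a+b)/2) / ((a+b)/2))\<^sup>2))"
    by (intro midpoint_gap assms) auto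
  also have "\<dots> \<le> ereal (2 * U ((a + b) / 2))"
    using True c0_pos p_pos[of "(a+b)/2"] by (auto intro!: mult_nonneg_nonneg)
  finally show ?thesis using True by (simp add: Uext_pos)
next
  case False
  then have "a = 0" "b = 0" using assms by auto
  then show ?thesis by (cases "Uext U 0") auto
qed

lemma Uext_le:
  assumes "0 \<le> t" "0 < s" shows "Uext U t \<le> ereal (t * s - W s)"
proof -
  have "Uext U t \<le> ereal (U (q s) + p (q s) * (t - q s))"
    by (rule Uext_tangent) (use assms q_pos in auto)
  also have "U (q s) + p (q s) * (t - q s) = t * s - W s"
    using gap_tangent[of s 0] pq[of s] assms by (simp add: algebra_simps)
  finally show ?thesis .
qed

end

section \<open>Existence of optimizers\<close>

lemma nn_bound_integrable:
  fixes f :: "'a \<Rightarrow> real"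
  assumes [measurable]: "f \<in> borel_measurable M" and nn: "AE \<omega> in M. 0 \<le> f \<omega>"
    and b: "(\<integral>\<^sup>+ \<omega>. ennreal (f \<omega>) \<partial>M) \<le> ennreal K" and K: "0 \<le> K"
  shows "integrable M f" "(\<integral>\<omega>. f \<omega> \<partial>M) \<le> K"
proof -
  show i: "integrable M f"
    by (rule integrableI_nonneg) (use nn le_less_trans[OF b] in auto)
  show "(\<integral>\<omega>. f \<omega> \<partial>M) \<le> K"
    using b K unfolding nn_integral_eq_integral[OF i nn] by simp
qed

lemma convergent_of_geometric_steps:
  fixes Z :: "nat \<Rightarrow> real"
  assumes "eventually (\<lambda>n. \<bar>Z (Suc n) - Z n\<bar> \<le> (1/2)^n) sequentially"
  shows "convergent Z"
proof -
  have "summable (\<lambda>n. Z (Suc n) - Z n)"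
    by (rule summable_comparison_test_ev[where g="\<lambda>n. (1/2)^n"]) (use assms in auto)
  then have "convergent (\<lambda>n. \<Sum>i<n. Z (Suc i) - Z i)" by (simp add: summable_iff_convergent)
  then have "convergent (\<lambda>n. Z n - Z 0)" by (simp add: sum_lessThan_telescope)
  then have "convergent (\<lambda>n. (Z n - Z 0) + Z 0)" by (intro convergent_add convergent_const)
  then show ?thesis by simp
qed

context utility_pair
begin

text \<open>
  Strict concavity at midpoints makes a fast maximizing sequence converge almost everywhere, so no compactness
  theorem is needed. Upper semicontinuity follows from Fatou's lemma for the gap against \<open>s h\<close> in the limit \<open>s \<rightarrow> 0\<close>, which
  replaces uniform integrability of the positive parts.
\<close>

theorem exists_maximizer:
  fixes M :: "'a measure" and h f0 :: "'a \<Rightarrow> real"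
  assumes prob: "prob_space M"
    and S: "S \<subseteq> L0plus M"
    and conv: "\<And>f g. f \<in> S \<Longrightarrow> g \<in> S \<Longrightarrow> (\<lambda>\<omega>. (f \<omega> + g \<omega>) / 2) \<in> S"
    and closed: "\<And>Z z. (\<And>n::nat. Z n \<in> S) \<Longrightarrow> z \<in> L0plus M \<Longrightarrow> AE \<omega> in M. (\<lambda>n. Z n \<omega>) \<longlonglongrightarrow> z \<omega> \<Longrightarrow> z \<in> S"
    and h [measurable]: "h \<in> borel_measurable M" and hpos: "AE \<omega> in M. 0 < h \<omega>"
    and bd: "\<And>f. f \<in> S \<Longrightarrow> (\<integral>\<^sup>+ \<omega>. ennreal (f \<omega> * h \<omega>) \<partial>M) \<le> ennreal K" and K: "0 \<le> K"
    and W: "\<And>s. 0 < s \<Longrightarrow> integrable M (\<lambda>\<omega>. W (s * h \<omega>))"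
    and f0: "f0 \<in> S" "EU M (\<lambda>\<omega>. Uext U (f0 \<omega>)) \<noteq> - \<infinity>"
  shows "\<exists>f\<in>S. \<forall>g\<in>S. EU M (\<lambda>\<omega>. Uext U (g \<omega>)) \<le> EU M (\<lambda>\<omega>. Uext U (f \<omega>))"
proof -
  interpret prob_space M by fact
  define e where "e f = EU M (\<lambda>\<omega>. Uext U (f \<omega>))" for f
  define k where "k s f \<omega> = s * (f \<omega> * h \<omega>) - W (s * h \<omega>)" for s f \<omega>
  define EW where "EW s = (\<integral>\<omega>. W (s * h \<omega>) \<partial>M)" for s
  define g where "g f \<omega> = real_of_ereal (Uext U (f \<omega>))" for f :: "'a \<Rightarrow> real" and \<omega>
  have Sm [measurable]: "f \<in> S \<Longrightarrow> f \<in> borel_measurable M" for f using S by (auto simp: L0plus_def)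
  have Snn: "f \<in> S \<Longrightarrow> \<omega> \<in> space M \<Longrightarrow> 0 \<le> f \<omega>" for f \<omega> using S by (auto simp: L0plus_def)
  have fm: "(\<lambda>\<omega>. Uext U (f \<omega>)) \<in> borel_measurable M" if "f \<in> S" for f
    using Sm[OF that] by measurable
  have fh: "integrable M (\<lambda>\<omega>. f \<omega> * h \<omega>)" "(\<integral>\<omega>. f \<omega> * h \<omega> \<partial>M) \<le> K" "AE \<omega> in M. 0 \<le> f \<omega> * h \<omega>"
    if f: "f \<in> S" for f
  proof -
    show nn: "AE \<omega> in M. 0 \<le> f \<omega> * h \<omega>" using hpos AE_space by eventually_elim (use Snn[OF f] in auto)
    have "(\<lambda>\<omega>. f \<omega> * h \<omega>) \<in> borel_measurable M" using Sm[OF f] by measurable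
    from nn_bound_integrable[OF this nn bd[OF f] K]
    show "integrable M (\<lambda>\<omega>. f \<omega> * h \<omega>)" "(\<integral>\<omega>. f \<omega> * h \<omega> \<partial>M) \<le> K" by auto
  qed
  have ki: "integrable M (k s f)" "(\<integral>\<omega>. k s f \<omega> \<partial>M) = s * (\<integral>\<omega>. f \<omega> * h \<omega> \<partial>M) - EW s"
    if "f \<in> S" "0 < s" for s f
    using fh(1)[OF that(1)] W[OF that(2)] by (auto simp: k_def[abs_def] EW_def)
  \<comment> \<open>Fenchel's inequality at the price \<open>s * h\<close>: an integrable majorant
    of the utility for every s > 0, with the free parameter \<open>s\<close> to be sent to
    0.\<close>
  have kb: "AE \<omega> in M. Uext U (f \<omega>) \<le> ereal (k s f \<omega>)" if "f \<in> S" "0 < s" for s f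
    using hpos AE_space
  proof eventually_elim
    case (elim \<omega>)
    then show ?case using Uext_le[of "f \<omega>" "s * h \<omega>"] Snn[OF that(1)] that(2) by (simp add: k_def mult.left_commute)
  qed
  have ub: "e f \<le> ereal (K - EW 1)" if f: "f \<in> S" for f
  proof -
    have "e f \<le> ereal (\<integral>\<omega>. k 1 f \<omega> \<partial>M)" unfolding e_def by (intro EU_upper fm ki kb f) auto
    also have "\<dots> \<le> ereal (K - EW 1)" using ki(2)[OF f, of 1] fh(2)[OF f] by simp
    finally show ?thesis .
  qed
  define u where "u = (SUP f\<in>S. e f)"
  have "u \<le> ereal (K - EW 1)" unfolding u_def by (intro SUP_least ub)
  moreover have "u \<noteq> - \<infinity>" using SUP_upper[OF f0(1), of e] f0(2) by (auto simp: u_def e_def)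
  ultimately obtain ur where ur: "u = ereal ur" by (cases u) auto
  have eu: "e f \<le> ereal ur" if "f \<in> S" for f using SUP_upper[OF that, of e] ur by (simp add: u_def)
  have gi: "integrable M (g f)" "AE \<omega> in M. Uext U (f \<omega>) = ereal (g f \<omega>)" "e f = ereal (\<integral>\<omega>. g f \<omega> \<partial>M)"
    if f: "f \<in> S" "ereal r \<le> e f" for f r
  proof -
    have "e f \<noteq> - \<infinity>" using f(2) by auto
    from EU_finite[OF fm[OF f(1)] ki(1)[OF f(1), of 1] kb[OF f(1), of 1] this[unfolded e_def]]
    show "integrable M (g f)" "AE \<omega> in M. Uext U (f \<omega>) = ereal (g f \<omega>)" "e f = ereal (\<integral>\<omega>. g f \<omega> \<partial>M)"
      by (auto simp: g_def[abs_def] e_def)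
  qed
  \<comment> \<open>The average of two nearly maximal elements is again in \<open>S\<close> and
    cannot beat the supremum. Strict concavity therefore leaves little probability for both to be
    below \<open>B\<close> and yet more than \<theta> apart.\<close>
  have mid: "midpoint_modulus \<theta> B * measure M {\<omega>\<in>space M. f1 \<omega> \<le> B \<and> f2 \<omega> \<le> B \<and> \<theta> < \<bar>f1 \<omega> - f2 \<omega>\<bar>} \<le> 2 * d"
    if f1: "f1 \<in> S" "ereal (ur - d) \<le> e f1" and f2: "f2 \<in> S" "ereal (ur - d) \<le> e f2" and \<theta>: "0 < \<theta>"
    for f1 f2 \<theta> B d
  proof -
    define A where "A = {\<omega>\<in>space M. f1 \<omega> \<le> B \<and> f2 \<omega> \<le> B \<and> \<theta> < \<bar>f1 \<omega> - f2 \<omega>\<bar>}"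
    have [measurable]: "f1 \<in> borel_measurable M" "f2 \<in> borel_measurable M" using Sm f1 f2 by auto
    have A[measurable]: "A \<in> sets M" unfolding A_def by measurable
    define m where "m \<omega> = (f1 \<omega> + f2 \<omega>) / 2" for \<omega>
    have m: "m \<in> S" unfolding m_def[abs_def] by (rule conv[OF f1(1) f2(1)])
    define l where "l \<omega> = (g f1 \<omega> + g f2 \<omega> + midpoint_modulus \<theta> B * indicator A \<omega>) / 2" for \<omega>
    have li: "integrable M l" "(\<integral>\<omega>. l \<omega> \<partial>M) = ((\<integral>\<omega>. g f1 \<omega> \<partial>M) + (\<integral>\<omega>. g f2 \<omega> \<partial>M) + midpoint_modulus \<theta> B * measure M A) / 2"
    proof -
      have i: "integrable M (\<lambda>\<omega>. midpoint_modulus \<theta> B * indicator A \<omega>)" "(\<integral>\<omega>. midpoint_modulus \<theta> B * indicator A \<omega> \<partial>M) = midpoint_modulus \<theta> B * measure M A"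
        using A by (auto simp: integrable_indicator_iff emeasure_eq_measure)
      show "integrable M l" "(\<integral>\<omega>. l \<omega> \<partial>M) = ((\<integral>\<omega>. g f1 \<omega> \<partial>M) + (\<integral>\<omega>. g f2 \<omega> \<partial>M) + midpoint_modulus \<theta> B * measure M A) / 2"
        unfolding l_def[abs_def] using gi(1)[OF f1] gi(1)[OF f2] i by simp_all
    qed
    have "AE \<omega> in M. ereal (l \<omega>) \<le> Uext U (m \<omega>)"
      using gi(2)[OF f1] gi(2)[OF f2] AE_space
    proof eventually_elim
      case (elim \<omega>)
      note nn = Snn[OF f1(1) elim(3)] Snn[OF f2(1) elim(3)]
      show ?case
      proof (cases "\<omega> \<in> A")
        case True
        then have a: "f1 \<omega> \<le> B" "f2 \<omega> \<le> B" "\<theta> < \<bar>f1 \<omega> - f2 \<omega>\<bar>" by (auto simp: A_def)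
        from midpoint_gap_uniform[OF nn(1) a(1) nn(2) a(2) \<theta> a(3)] elim
        have "g f1 \<omega> + g f2 \<omega> \<le> 2 * U (m \<omega>) - midpoint_modulus \<theta> B" by (simp add: m_def)
        moreover have "m \<omega> > 0" using nn a(3) \<theta> by (auto simp: m_def)
        ultimately show ?thesis using True by (simp add: l_def Uext_pos)
      next
        case False
        have "ereal (g f1 \<omega> + g f2 \<omega>) \<le> 2 * Uext U (m \<omega>)"
          using Uext_midpoint[OF nn] elim by (simp add: m_def)
        then show ?thesis using False by (cases "Uext U (m \<omega>)") (auto simp: l_def)
      qed
    qed
    from EU_sandwich(1)[OF fm[OF m] ki(1)[OF m, of 1] kb[OF m, of 1] li(1) this]
    have "ereal (\<integral>\<omega>. l \<omega> \<partial>M) \<le> e m" by (simp add: e_def)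
    also have "e m \<le> ereal ur" by (rule eu[OF m])
    finally have "(\<integral>\<omega>. l \<omega> \<partial>M) \<le> ur" by simp
    with li(2) gi(3)[OF f1] gi(3)[OF f2] f1(2) f2(2) show ?thesis by (simp add: A_def field_simps)
  qed
  \<comment> \<open>Steps larger than \<open>(1/2)^n\<close> between points below \<open>4^n\<close>
    are to be rare: \<open>\<gamma> n\<close> is the modulus for this pair of thresholds, and the
    accuracy \<open>\<delta> n\<close> makes the exceptional probabilities summable.\<close>
  define \<gamma> where "\<gamma> n = midpoint_modulus ((1/2)^n) (4^n)" for n :: nat
  have \<gamma>: "0 < \<gamma> n" for n unfolding \<gamma>_def by (intro midpoint_modulus_pos) auto
  define \<delta> where "\<delta> n = \<gamma> n * (1/2)^n" for n :: nat
  have \<delta>: "0 < \<delta> n" for n using \<gamma> by (simp add: \<delta>_def)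
  \<comment> \<open>The minimum over all earlier values makes \<open>Z n\<close> and
    \<open>Z (Suc n)\<close> both accurate to \<open>\<delta> n\<close>, without monotonicity of
    \<open>\<delta>\<close>.\<close>
  define tiny where "tiny n = min (Min (\<delta> ` {..n})) ((1/2)^n)" for n :: nat
  have tiny: "0 < tiny n" "tiny n \<le> (1/2)^n" "tiny n \<le> \<delta> n" "tiny (Suc n) \<le> \<delta> n" for n
    unfolding tiny_def using \<delta> by (auto simp: min_le_iff_disj)
  have "\<exists>f\<in>S. ereal (ur - tiny n) \<le> e f" for n
  proof -
    have "ereal (ur - tiny n) < u" using tiny(1)[of n] by (simp add: ur)
    then show ?thesis unfolding u_def less_SUP_iff by (meson less_imp_le)
  qed
  then obtain Z where Z: "\<And>n. Z n \<in> S" "\<And>n. ereal (ur - tiny n) \<le> e (Z n)" by metis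
  note [measurable] = Sm[OF Z(1)]
  define B where "B n = {\<omega>\<in>space M. Z n \<omega> \<le> 4^n \<and> Z (Suc n) \<omega> \<le> 4^n \<and> (1/2)^n < \<bar>Z n \<omega> - Z (Suc n) \<omega>\<bar>}" for n
  \<comment> \<open>Rare by Markov's inequality for the budget. Outside, \<open>Z n\<close> is below
    \<open>2^n / h\<close>, hence eventually below \<open>4^n\<close>, so that large values do not
    escape the set \<open>B n\<close>.\<close>
  define C where "C n = {\<omega>\<in>space M. 2^n \<le> Z n \<omega> * h \<omega>}" for n
  have BC [measurable]: "B n \<in> sets M" "C n \<in> sets M" for n unfolding B_def C_def by measurable
  have Bm: "measure M (B n) \<le> 2 * (1/2)^n" for n
  proof -
    have "ereal (ur - \<delta> n) \<le> e (Z n)" "ereal (ur - \<delta> n) \<le> e (Z (Suc n))"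
      using Z(2)[of n] Z(2)[of "Suc n"] tiny(3,4)[of n]
      by (auto intro: order_trans[rotated])
    from mid[OF Z(1) this(1) Z(1) this(2), of "(1/2)^n" "4^n"]
    have "\<gamma> n * measure M (B n) \<le> 2 * (\<gamma> n * (1/2)^n)" by (simp add: \<gamma>_def B_def \<delta>_def)
    then have "\<gamma> n * measure M (B n) \<le> \<gamma> n * (2 * (1/2)^n)" by simp
    then show ?thesis using \<gamma>[of n] by (simp only: mult_le_cancel_left_pos)
  qed
  have Cm: "measure M (C n) \<le> K * (1/2)^n" for n
  proof -
    have "measure M (C n) \<le> (\<integral>\<omega>. Z n \<omega> * h \<omega> \<partial>M) / 2^n" unfolding C_def
      by (intro integral_Markov_inequality_measure[OF fh(1)[OF Z(1)], of "{}"] fh(3) Z(1)) auto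
    also have "\<dots> \<le> K / 2^n" using fh(2)[OF Z(1)[of n]] by (intro divide_right_mono) auto
    finally show ?thesis by (simp add: power_divide)
  qed
  have BCm: "measure M (B n \<union> C n) \<le> (2 + K) * (1/2)^n" for n
    using measure_Un_le[OF BC, of n n] Bm[of n] Cm[of n] by (simp add: distrib_right)
  have "summable (\<lambda>n. measure M (B n \<union> C n))"
    by (rule summable_comparison_test'[where g="\<lambda>n. (2 + K) * (1/2)^n" and N=0])
       (use BCm in \<open>auto intro!: summable_mult\<close>)
  then have "AE \<omega> in M. eventually (\<lambda>n. \<omega> \<in> space M - (B n \<union> C n)) sequentially"
    by (intro borel_cantelli_AE1) (auto simp: emeasure_eq_measure)
  then have Zc: "AE \<omega> in M. convergent (\<lambda>n. Z n \<omega>)"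
    using hpos AE_space
  proof eventually_elim
    case (elim \<omega>)
    \<comment> \<open>The 2 in the numerator accommodates \<open>Z (Suc n)\<close>, for which only
      the bound \<open>2 ^ Suc n / h \<omega>\<close> is known.\<close>
    obtain N where N: "2 / h \<omega> < 2 ^ N" using real_arch_pow[of 2 "2 / h \<omega>"] by auto
    have "eventually (\<lambda>n. \<bar>Z (Suc n) \<omega> - Z n \<omega>\<bar> \<le> (1/2)^n) sequentially"
      using elim(1) eventually_sequentially_Suc[THEN iffD2, OF elim(1)] eventually_ge_at_top[of N]
    proof eventually_elim
      case (elim n)
      have "2 ^ N \<le> (2::real) ^ n" using elim by (intro power_increasing) auto
      with N have "2 / h \<omega> < 2 ^ n" by linarith
      then have n: "2 < 2 ^ n * h \<omega>" using \<open>0 < h \<omega>\<close> by (simp add: pos_divide_less_eq)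
      have aux: "t \<le> 4 ^ n" if "t * h \<omega> \<le> 2 * 2 ^ n" for t
      proof -
        have "t * h \<omega> \<le> 2 * 2 ^ n" by (rule that)
        also have "\<dots> \<le> 2 ^ n * h \<omega> * 2 ^ n" using n by (intro mult_right_mono) auto
        also have "\<dots> = 4 ^ n * h \<omega>" using power_mult_distrib[of "2::real" 2 n] by simp
        finally show ?thesis using \<open>0 < h \<omega>\<close> by (rule mult_right_le_imp_le)
      qed
      have "Z n \<omega> * h \<omega> < 2 ^ n" using elim(1) by (simp add: C_def not_le)
      moreover have "(0::real) \<le> 2 ^ n" by simp
      ultimately have "Z n \<omega> * h \<omega> \<le> 2 * 2 ^ n" by linarith
      then have 1: "Z n \<omega> \<le> 4 ^ n" by (rule aux)
      have "Z (Suc n) \<omega> * h \<omega> < 2 ^ Suc n" using elim(2) unfolding C_def by (simp add: not_le)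
      then have "Z (Suc n) \<omega> * h \<omega> \<le> 2 * 2 ^ n" by simp
      then have 2: "Z (Suc n) \<omega> \<le> 4 ^ n" by (rule aux)
      have "\<not> (1/2)^n < \<bar>Z n \<omega> - Z (Suc n) \<omega>\<bar>" using elim(1) 1 2 unfolding B_def by blast
      then show ?case by (simp only: abs_minus_commute not_less)
    qed
    then show ?case by (rule convergent_of_geometric_steps)
  qed
  \<comment> \<open>The maximum with 0 keeps \<open>z\<close> nonnegative at the points where the
    sequence diverges and \<open>lim\<close> is unspecified.\<close>
  define z where "z \<omega> = max 0 (lim (\<lambda>n. Z n \<omega>))" for \<omega>
  have zL: "z \<in> L0plus M" unfolding L0plus_def z_def[abs_def] by simp
  have Zz: "AE \<omega> in M. (\<lambda>n. Z n \<omega>) \<longlonglongrightarrow> z \<omega>"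
    using Zc AE_space
  proof eventually_elim
    case (elim \<omega>)
    then have l: "(\<lambda>n. Z n \<omega>) \<longlonglongrightarrow> lim (\<lambda>n. Z n \<omega>)" by (simp add: convergent_LIMSEQ_iff)
    have "0 \<le> lim (\<lambda>n. Z n \<omega>)" using LIMSEQ_le_const[OF l] Snn[OF Z(1) elim(2)] by auto
    with l show ?case by (simp add: z_def)
  qed
  have zS: "z \<in> S" by (rule closed[OF Z(1) zL Zz])
  \<comment> \<open>Fatou's lemma is applied to the nonnegative difference between
    \<open>k s (Z n)\<close> and the utility of \<open>Z n\<close>. The expectation of
    \<open>Z n * h\<close> may drop in the limit; the resulting loss is at most
    \<open>s * K\<close>, which vanishes with \<open>s\<close>.\<close>
  have main: "ereal (ur - s * K) \<le> e z" if s: "0 < s" for s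
  proof -
    define c where "c = s * K - EW s - ur"
    have kg: "AE \<omega> in M. 0 \<le> k s (Z n) \<omega> - g (Z n) \<omega>" for n
      using kb[OF Z(1) s, of n] gi(2)[OF Z(1,2), of n] by eventually_elim (metis diff_ge_0_iff_ge ereal_less_eq(3))
    have kgi: "integrable M (\<lambda>\<omega>. k s (Z n) \<omega> - g (Z n) \<omega>)" for n
      using ki(1)[OF Z(1) s, of n] gi(1)[OF Z(1,2), of n] by auto
    have le: "(\<integral>\<omega>. k s (Z n) \<omega> - g (Z n) \<omega> \<partial>M) \<le> c + tiny n" for n
    proof -
      have "(\<integral>\<omega>. k s (Z n) \<omega> - g (Z n) \<omega> \<partial>M) = s * (\<integral>\<omega>. Z n \<omega> * h \<omega> \<partial>M) - EW s - (\<integral>\<omega>. g (Z n) \<omega> \<partial>M)"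
        using ki[OF Z(1) s, of n] gi(1)[OF Z(1,2), of n] by simp
      moreover have "s * (\<integral>\<omega>. Z n \<omega> * h \<omega> \<partial>M) \<le> s * K" using fh(2)[OF Z(1)[of n]] s by simp
      moreover have "ur - tiny n \<le> (\<integral>\<omega>. g (Z n) \<omega> \<partial>M)" using gi(3)[OF Z(1,2), of n] Z(2)[of n] by simp
      ultimately show ?thesis by (simp add: c_def)
    qed
    have half: "(\<lambda>n. (1/2::real)^n) \<longlonglongrightarrow> 0" by (rule LIMSEQ_power_zero) simp
    have tl: "tiny \<longlonglongrightarrow> 0"
      by (rule tendsto_sandwich[OF _ _ tendsto_const half]) (use tiny in \<open>auto intro!: always_eventually less_imp_le\<close>)
    have "(\<lambda>n. c + tiny n) \<longlonglongrightarrow> c + 0" by (intro tendsto_intros tl)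
    then have cl: "(\<lambda>n. c + tiny n) \<longlonglongrightarrow> c" by simp
    have c0: "0 \<le> c"
    proof (rule LIMSEQ_le_const[OF cl], intro exI allI impI)
      fix n show "0 \<le> c + tiny n" using le[of n] integral_nonneg_AE[OF kg[of n]] by linarith
    qed
    \<comment> \<open>Extended values are kept because the utility of \<open>z\<close> could still
      be - \<infinity>; its finiteness almost everywhere results from the bound \<open>c\<close> on
      this integral.\<close>
    define \<phi> where "\<phi> \<omega> = e2ennreal (ereal (k s z \<omega>) - Uext U (z \<omega>))" for \<omega>
    have [measurable]: "k s z \<in> borel_measurable M" using ki(1)[OF zS s] by auto
    have [measurable]: "z \<in> borel_measurable M" using Sm[OF zS] .
    have \<phi>m [measurable]: "\<phi> \<in> borel_measurable M" unfolding \<phi>_def[abs_def] by measurable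
    have "(\<integral>\<^sup>+ \<omega>. \<phi> \<omega> \<partial>M) = (\<integral>\<^sup>+ \<omega>. liminf (\<lambda>n. ennreal (k s (Z n) \<omega> - g (Z n) \<omega>)) \<partial>M)"
    proof (rule nn_integral_cong_AE)
      have "AE \<omega> in M. \<forall>n. Uext U (Z n \<omega>) = ereal (g (Z n) \<omega>)"
        using gi(2)[OF Z(1,2)] by (simp add: AE_all_countable)
      then show "AE \<omega> in M. \<phi> \<omega> = liminf (\<lambda>n. ennreal (k s (Z n) \<omega> - g (Z n) \<omega>))"
        using Zz AE_space
      proof eventually_elim
        case (elim \<omega>)
        have "(\<lambda>n. k s (Z n) \<omega>) \<longlonglongrightarrow> k s z \<omega>" unfolding k_def by (intro tendsto_intros elim(2))
        then have a: "(\<lambda>n. ereal (k s (Z n) \<omega>)) \<longlonglongrightarrow> ereal (k s z \<omega>)" by simp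
        have b: "(\<lambda>n. - Uext U (Z n \<omega>)) \<longlonglongrightarrow> - Uext U (z \<omega>)"
          by (intro tendsto_uminus_ereal Uext_tendsto elim(2) Snn[OF Z(1) elim(3)])
        have "(\<lambda>n. ereal (k s (Z n) \<omega>) + - Uext U (Z n \<omega>)) \<longlonglongrightarrow> ereal (k s z \<omega>) + - Uext U (z \<omega>)"
          by (rule tendsto_add_ereal_general2[OF _ a b]) simp
        from tendsto_e2ennrealI[OF this]
        have "(\<lambda>n. ennreal (k s (Z n) \<omega> - g (Z n) \<omega>)) \<longlonglongrightarrow> \<phi> \<omega>"
          by (simp add: \<phi>_def elim(1) minus_ereal_def)
        from lim_imp_Liminf[OF _ this] show ?case by simp
      qed
    qed
    also have "\<dots> \<le> liminf (\<lambda>n. \<integral>\<^sup>+ \<omega>. ennreal (k s (Z n) \<omega> - g (Z n) \<omega>) \<partial>M)"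
      by (rule nn_integral_liminf) (use kgi in auto)
    also have "\<dots> \<le> liminf (\<lambda>n. ennreal (c + tiny n))"
      using le by (intro Liminf_mono always_eventually allI) (auto simp: nn_integral_eq_integral[OF kgi kg] intro!: ennreal_leI)
    also have "\<dots> = ennreal c"
      using lim_imp_Liminf[OF _ tendsto_ennrealI[OF cl]] by simp
    finally have \<phi>b: "(\<integral>\<^sup>+ \<omega>. \<phi> \<omega> \<partial>M) \<le> ennreal c" .
    have \<phi>f: "AE \<omega> in M. \<phi> \<omega> \<noteq> \<infinity>"
      by (rule nn_integral_PInf_AE) (use \<phi>b in \<open>auto simp: top_unique\<close>)
    define r where "r \<omega> = enn2real (\<phi> \<omega>)" for \<omega>
    have "(\<integral>\<^sup>+ \<omega>. ennreal (r \<omega>) \<partial>M) = (\<integral>\<^sup>+ \<omega>. \<phi> \<omega> \<partial>M)"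
      by (intro nn_integral_cong_AE) (use \<phi>f in eventually_elim, auto simp: r_def less_top)
    with \<phi>b have "(\<integral>\<^sup>+ \<omega>. ennreal (r \<omega>) \<partial>M) \<le> ennreal c" by simp
    from nn_bound_integrable[OF _ _ this c0] have ri: "integrable M r" "(\<integral>\<omega>. r \<omega> \<partial>M) \<le> c"
      by (auto simp: r_def[abs_def])
    have "AE \<omega> in M. ereal (k s z \<omega> - r \<omega>) \<le> Uext U (z \<omega>)"
      using \<phi>f kb[OF zS s]
    proof eventually_elim
      case (elim \<omega>)
      then show ?case by (cases "Uext U (z \<omega>)") (auto simp: \<phi>_def r_def)
    qed
    from EU_sandwich(1)[OF fm[OF zS] ki(1)[OF zS s] kb[OF zS s] _ this] ki(1)[OF zS s] ri(1)
    have "ereal (\<integral>\<omega>. k s z \<omega> - r \<omega> \<partial>M) \<le> e z" by (simp add: e_def)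
    moreover have "(\<integral>\<omega>. k s z \<omega> - r \<omega> \<partial>M) = s * (\<integral>\<omega>. z \<omega> * h \<omega> \<partial>M) - EW s - (\<integral>\<omega>. r \<omega> \<partial>M)"
      using ki[OF zS s] ri(1) by simp
    moreover have "0 \<le> s * (\<integral>\<omega>. z \<omega> * h \<omega> \<partial>M)" using integral_nonneg_AE[OF fh(3)[OF zS]] s by simp
    ultimately show ?thesis using ri(2)
      by (intro order_trans[OF _ \<open>ereal (\<integral>\<omega>. k s z \<omega> - r \<omega> \<partial>M) \<le> e z\<close>]) (simp add: c_def)
  qed
  have "ereal ur \<le> e z + ereal \<epsilon>" if "\<epsilon> > 0" for \<epsilon>
  proof -
    have "ereal (ur - \<epsilon> / (K + 1) * K) \<le> e z" using main[of "\<epsilon> / (K + 1)"] that K by simp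
    moreover have "\<epsilon> / (K + 1) * K \<le> \<epsilon>" using that K by (simp add: field_simps)
    ultimately show ?thesis by (cases "e z") auto
  qed
  then have "ereal ur \<le> e z" using ereal_le_epsilon2 by blast
  then show ?thesis using zS eu unfolding e_def by (meson order_trans)
qed

end

section \<open>Admissible directions\<close>

lemma integrable_bounded_mult:
  fixes f g :: "'a \<Rightarrow> real"
  assumes [measurable]: "f \<in> borel_measurable R" and g: "integrable R g" and b: "AE \<omega> in R. \<bar>f \<omega>\<bar> \<le> K"
  shows "integrable R (\<lambda>\<omega>. f \<omega> * g \<omega>)"
proof (rule Bochner_Integration.integrable_bound)
  show "integrable R (\<lambda>\<omega>. K * g \<omega>)" using g by simp
  show "(\<lambda>\<omega>. f \<omega> * g \<omega>) \<in> borel_measurable R" using g by measurable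
  show "AE \<omega> in R. norm (f \<omega> * g \<omega>) \<le> norm (K * g \<omega>)"
    using b by eventually_elim (auto simp: abs_mult intro!: mult_right_mono)
qed

lemma abs_ln_one_plus_le: "\<bar>x\<bar> \<le> 1/2 \<Longrightarrow> \<bar>ln (1 + x)\<bar> \<le> 2 * \<bar>x\<bar>" for x :: real
proof -
  assume x: "\<bar>x\<bar> \<le> 1/2"
  have "\<bar>ln (1 + x) - x\<bar> \<le> 2 * x\<^sup>2" by (rule abs_ln_one_plus_x_minus_x_bound[OF x])
  also have "\<dots> = 2 * \<bar>x\<bar> * \<bar>x\<bar>" by (simp add: power2_eq_square abs_mult[symmetric])
  also have "\<dots> \<le> 1 * \<bar>x\<bar>" using x by (intro mult_right_mono) auto
  finally show ?thesis by linarith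
qed

lemma square_le_exp:
  fixes c s :: real assumes "0 < c" "0 \<le> s"
  shows "s\<^sup>2 \<le> 2 / c\<^sup>2 * exp (c * s)"
proof -
  have "(c * s)\<^sup>2 / 2 \<le> exp (c * s)"
    using exp_lower_Taylor_quadratic[of "c * s"] assms by (smt (verit) mult_nonneg_nonneg)
  then show ?thesis using assms by (simp add: field_simps power_mult_distrib)
qed

definition nrm :: "real \<times> real \<Rightarrow> real" where "nrm \<pi> = \<bar>fst \<pi>\<bar> + \<bar>snd \<pi>\<bar>"

lemma nrm_nonneg [simp]: "0 \<le> nrm \<pi>"
  and abs_fst_le_nrm [simp]: "\<bar>fst \<pi>\<bar> \<le> nrm \<pi>"
  and abs_snd_le_nrm [simp]: "\<bar>snd \<pi>\<bar> \<le> nrm \<pi>"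
  by (auto simp: nrm_def)

lemma nrm_tendsto_00: "(nrm \<longlongrightarrow> 0) (at (0,0))"
proof -
  have "(nrm \<longlongrightarrow> \<bar>fst (0::real,0::real)\<bar> + \<bar>snd (0::real,0::real)\<bar>) (at (0,0))"
    unfolding nrm_def[abs_def] by (intro tendsto_intros)
  then show ?thesis by simp
qed

lemma nrm_small_00: "0 < e \<Longrightarrow> eventually (\<lambda>\<pi>. nrm \<pi> < e) (at (0,0))"
  using order_tendstoD(2)[OF nrm_tendsto_00] .

lemma nrm_pos_00: "eventually (\<lambda>\<pi>. 0 < nrm \<pi>) (at (0,0))"
  unfolding eventually_at_filter
proof (rule always_eventually, intro allI impI)
  fix \<pi> :: "real \<times> real" assume "\<pi> \<noteq> (0,0)"
  then have "fst \<pi> \<noteq> 0 \<or> snd \<pi> \<noteq> 0" by (cases \<pi>) auto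
  then show "0 < nrm \<pi>" by (auto simp: nrm_def)
qed

section \<open>The logarithmic mismatch of a perturbed pair\<close>

context utility_pair
begin

text \<open>The mismatch \<open>r\<close> of \<open>gap_upper_exp\<close> for the pair obtained from
  \<open>t\<close> and \<open>p t\<close> by relative changes \<open>X\<close> and \<open>Y\<close>
  and by the factor \<open>L\<close>, which divides the primal entry and multiplies the dual
  one.\<close>

definition lograte :: "real \<Rightarrow> real \<Rightarrow> real \<Rightarrow> real \<Rightarrow> real" where
  "lograte t X Y L = ln (p t * (1 + Y) * L) - ln (p (t * (1 + X) / L))"

text \<open>Rests on the power law, so its constants are free of \<open>t\<close>; this is the
  majorant for the passage to the limit under the integral.\<close>

lemma lograte_bound:
  assumes t: "0 < t" and X: "\<bar>X\<bar> \<le> 1/2" and Y: "\<bar>Y\<bar> \<le> 1/2" and L: "0 < L"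
  shows "\<bar>lograte t X Y L\<bar> \<le> 2 * \<bar>Y\<bar> + 2 * c2 * \<bar>X\<bar> + (1 + c2) * \<bar>ln L\<bar>"
proof -
  have X1: "0 < 1 + X" and Y1: "0 < 1 + Y" using X Y by auto
  obtain k where k: "c1 \<le> k" "k \<le> c2" "p (t * (1 + X) / L) = p t * exp (- k * ln (t * (1 + X) / L / t))"
    using p_exp[of t "t * (1 + X) / L"] t X1 L by auto
  have l: "ln (t * (1 + X) / L / t) = ln (1 + X) - ln L" using t X1 L by (simp add: ln_div)
  have "lograte t X Y L = ln (1 + Y) + ln L + k * (ln (1 + X) - ln L)"
    unfolding lograte_def k(3) l using p_pos[OF t] Y1 L by (simp add: ln_mult)
  also have "\<dots> = ln (1 + Y) + k * ln (1 + X) + (1 - k) * ln L" by (simp add: algebra_simps)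
  also have "\<bar>\<dots>\<bar> \<le> \<bar>ln (1 + Y)\<bar> + \<bar>k * ln (1 + X)\<bar> + \<bar>(1 - k) * ln L\<bar>" by linarith
  also have "\<dots> \<le> 2 * \<bar>Y\<bar> + c2 * (2 * \<bar>X\<bar>) + (1 + c2) * \<bar>ln L\<bar>"
  proof (intro add_mono)
    show "\<bar>k * ln (1 + X)\<bar> \<le> c2 * (2 * \<bar>X\<bar>)" unfolding abs_mult
      using k c1_pos abs_ln_one_plus_le[OF X] by (intro mult_mono) auto
    show "\<bar>(1 - k) * ln L\<bar> \<le> (1 + c2) * \<bar>ln L\<bar>" unfolding abs_mult
      using k c1_pos by (intro mult_right_mono) auto
  qed (rule abs_ln_one_plus_le[OF Y])
  finally show ?thesis by simp
qed

text \<open>The pointwise counterpart with the exact slope \<open>A t\<close>. The error is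
  quadratic in \<open>X\<close> and \<open>Y\<close> apart from the last term, which comes from
  differentiating ln p at the fixed point \<open>t\<close>.\<close>

lemma lograte_linear:
  assumes t: "0 < t" and X: "\<bar>X\<bar> \<le> 1/2" and Y: "\<bar>Y\<bar> \<le> 1/2" and L: "0 < L"
    and d: "\<forall>z. \<bar>z\<bar> < d \<longrightarrow> \<bar>ln (p (t * exp z)) - ln (p t) + A t * z\<bar> \<le> e * \<bar>z\<bar>"
    and small: "2 * \<bar>X\<bar> + \<bar>ln L\<bar> < d" and e: "0 \<le> e"
  shows "\<bar>lograte t X Y L - (Y + ln L + A t * (X - ln L))\<bar>
    \<le> 2 * Y\<^sup>2 + 2 * c2 * X\<^sup>2 + e * (2 * \<bar>X\<bar> + \<bar>ln L\<bar>)"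
proof -
  have X1: "0 < 1 + X" and Y1: "0 < 1 + Y" using X Y by auto
  define z where "z = ln (1 + X) - ln L"
  have z: "\<bar>z\<bar> \<le> 2 * \<bar>X\<bar> + \<bar>ln L\<bar>" unfolding z_def using abs_ln_one_plus_le[OF X] by linarith
  have tz: "t * (1 + X) / L = t * exp z" using X1 L by (simp add: z_def exp_diff)
  have "lograte t X Y L - (Y + ln L + A t * (X - ln L))
     = (ln (1 + Y) - Y) + A t * (ln (1 + X) - X) - (ln (p (t * exp z)) - ln (p t) + A t * z)"
  proof -
    have "ln (p t * (1 + Y) * L) = ln (p t) + ln (1 + Y) + ln L" using p_pos[OF t] Y1 L by (simp add: ln_mult)
    then show ?thesis unfolding lograte_def tz by (simp add: z_def algebra_simps)
  qed
  also have "\<bar>\<dots>\<bar> \<le> \<bar>ln (1 + Y) - Y\<bar> + \<bar>A t * (ln (1 + X) - X)\<bar> + \<bar>ln (p (t * exp z)) - ln (p t) + A t * z\<bar>"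
    by linarith
  also have "\<dots> \<le> 2 * Y\<^sup>2 + c2 * (2 * X\<^sup>2) + e * (2 * \<bar>X\<bar> + \<bar>ln L\<bar>)"
  proof (intro add_mono)
    show "\<bar>ln (1 + Y) - Y\<bar> \<le> 2 * Y\<^sup>2" by (rule abs_ln_one_plus_x_minus_x_bound[OF Y])
    show "\<bar>A t * (ln (1 + X) - X)\<bar> \<le> c2 * (2 * X\<^sup>2)" unfolding abs_mult
      using A_le[OF t] A_pos[OF t] abs_ln_one_plus_x_minus_x_bound[OF X] by (intro mult_mono) auto
    have "\<bar>ln (p (t * exp z)) - ln (p t) + A t * z\<bar> \<le> e * \<bar>z\<bar>" using d z small by auto
    also have "\<dots> \<le> e * (2 * \<bar>X\<bar> + \<bar>ln L\<bar>)" using z e by (intro mult_left_mono)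
    finally show "\<bar>ln (p (t * exp z)) - ln (p t) + A t * z\<bar> \<le> e * (2 * \<bar>X\<bar> + \<bar>ln L\<bar>)" .
  qed
  finally show ?thesis by simp
qed

end

definition Dirs :: "'a measure \<Rightarrow> ('a \<Rightarrow> real) set \<Rightarrow> ('a \<Rightarrow> real) \<Rightarrow> ('a \<Rightarrow> real) set" where
  "Dirs M S \<zeta> = {\<alpha>. \<alpha> \<in> borel_measurable M \<and> (\<exists>c>0. (\<lambda>\<omega>. \<zeta> \<omega> * (1 + c * \<alpha> \<omega>)) \<in> S \<and>
                                          (\<lambda>\<omega>. \<zeta> \<omega> * (1 - c * \<alpha> \<omega>)) \<in> S)}"

text \<open>Both \<zeta> (1 + c \<alpha>) and \<zeta> (1 - c \<alpha>) are nonnegative, which forces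
  |\<alpha>| \<le> 1 / c wherever \<zeta> is positive.\<close>

lemma Dirs_AE_bounded:
  assumes "\<alpha> \<in> Dirs M S \<zeta>" "S \<subseteq> L0plus M" "AE \<omega> in M. 0 < \<zeta> \<omega>"
  shows "\<exists>K>0. AE \<omega> in M. \<bar>\<alpha> \<omega>\<bar> \<le> K"
proof -
  from assms(1) obtain c where c: "c > 0" "(\<lambda>\<omega>. \<zeta> \<omega> * (1 + c * \<alpha> \<omega>)) \<in> S" "(\<lambda>\<omega>. \<zeta> \<omega> * (1 - c * \<alpha> \<omega>)) \<in> S"
    by (auto simp: Dirs_def)
  have "AE \<omega> in M. \<bar>\<alpha> \<omega>\<bar> \<le> 1 / c"
    using assms(3) AE_space
  proof eventually_elim
    case (elim \<omega>)
    have "0 \<le> \<zeta> \<omega> * (1 + c * \<alpha> \<omega>)" "0 \<le> \<zeta> \<omega> * (1 - c * \<alpha> \<omega>)" using c assms(2) elim(2) by (auto simp: L0plus_def)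
    then have "\<bar>c * \<alpha> \<omega>\<bar> \<le> 1" using elim(1) by (auto simp: zero_le_mult_iff abs_le_iff)
    then show ?case using c(1) by (simp add: abs_mult field_simps)
  qed
  then show ?thesis using c(1) by (intro exI[of _ "1/c"]) auto
qed

text \<open>A count of budgets. A constant multiple of \<zeta> / x costs that constant, and the
  multiple \<open>s\<close> of a direction is affordable at the cost |s| / c once |s| / c copies of
  \<zeta> / x are added to it. What remains of the budget pays for a nonnegative multiple of
  \<zeta>.\<close>

lemma Dirs_perturb:
  assumes D: "D \<subseteq> L0plus M" and \<zeta>: "\<zeta> \<in> pol M D x" and x: "0 < x"
    and a: "a \<in> Dirs M (pol M D x) \<zeta>" and b: "b \<in> Dirs M (pol M D x) \<zeta>"
  shows "\<exists>e>0. \<forall>s t x'. \<bar>s\<bar> + \<bar>t\<bar> \<le> e * x' \<longrightarrow> (\<lambda>\<omega>. \<zeta> \<omega> * (x' + s * a \<omega> + t * b \<omega>) / x) \<in> pol M D x'"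
proof -
  \<comment> \<open>The sign of \<open>s\<close> decides which of the two elements \<zeta> (1 + c f)
    and \<zeta> (1 - c f) is scaled; the cost is |s| in either case.\<close>
  have sign: "\<exists>c>0. \<forall>s. (\<lambda>\<omega>. \<zeta> \<omega> * (\<bar>s\<bar> + s * c * f \<omega>) / x) \<in> pol M D \<bar>s\<bar>" if f: "f \<in> Dirs M (pol M D x) \<zeta>" for f
  proof -
    from f obtain c where c: "c > 0" "(\<lambda>\<omega>. \<zeta> \<omega> * (1 + c * f \<omega>)) \<in> pol M D x" "(\<lambda>\<omega>. \<zeta> \<omega> * (1 - c * f \<omega>)) \<in> pol M D x"
      by (auto simp: Dirs_def)
    have "(\<lambda>\<omega>. \<zeta> \<omega> * (\<bar>s\<bar> + s * c * f \<omega>) / x) \<in> pol M D \<bar>s\<bar>" for s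
    proof (cases "s \<ge> 0")
      case True
      have e: "(\<lambda>\<omega>. s / x * (\<zeta> \<omega> * (1 + c * f \<omega>))) = (\<lambda>\<omega>. \<zeta> \<omega> * (\<bar>s\<bar> + s * c * f \<omega>) / x)"
        using True by (auto simp: field_simps)
      show ?thesis using pol_scale[OF D c(2), of "s / x"] True x unfolding e by simp
    next
      case False
      have e: "(\<lambda>\<omega>. - s / x * (\<zeta> \<omega> * (1 - c * f \<omega>))) = (\<lambda>\<omega>. \<zeta> \<omega> * (\<bar>s\<bar> + s * c * f \<omega>) / x)"
        using False x by (auto simp: fun_eq_iff divide_simps) (auto simp: algebra_simps)
      have "0 \<le> - s / x" using False x by (intro divide_nonneg_pos) auto
      from pol_scale[OF D c(3) this] show ?thesis using False x unfolding e by simp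
    qed
    then show ?thesis using c(1) by blast
  qed
  obtain c where c: "c > 0" "\<And>s. (\<lambda>\<omega>. \<zeta> \<omega> * (\<bar>s\<bar> + s * c * a \<omega>) / x) \<in> pol M D \<bar>s\<bar>" using sign[OF a] by blast
  obtain c' where c': "c' > 0" "\<And>s. (\<lambda>\<omega>. \<zeta> \<omega> * (\<bar>s\<bar> + s * c' * b \<omega>) / x) \<in> pol M D \<bar>s\<bar>" using sign[OF b] by blast
  define e where "e = min c c'"
  have e0: "0 < e" using c c' by (simp add: e_def)
  have "(\<lambda>\<omega>. \<zeta> \<omega> * (x' + s * a \<omega> + t * b \<omega>) / x) \<in> pol M D x'" if st: "\<bar>s\<bar> + \<bar>t\<bar> \<le> e * x'" for s t x'
  proof -
    \<comment> \<open>The budget left after paying for both directions; smallness of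
      \<open>s\<close> and \<open>t\<close> relative to \<open>x'\<close> keeps it
      nonnegative.\<close>
    define r where "r = x' - \<bar>s / c\<bar> - \<bar>t / c'\<bar>"
    have "\<bar>s / c\<bar> \<le> \<bar>s\<bar> / e" using c e0 unfolding abs_divide by (intro frac_le) (auto simp: e_def)
    moreover have "\<bar>t / c'\<bar> \<le> \<bar>t\<bar> / e" using c' e0 unfolding abs_divide by (intro frac_le) (auto simp: e_def)
    moreover have "\<bar>s\<bar> / e + \<bar>t\<bar> / e \<le> x'" using st e0 by (simp add: field_simps)
    ultimately have r: "0 \<le> r" unfolding r_def by linarith
    have 1: "(\<lambda>\<omega>. r / x * \<zeta> \<omega>) \<in> pol M D r" using pol_scale[OF D \<zeta>, of "r / x"] r x by simp
    have 2: "(\<lambda>\<omega>. \<zeta> \<omega> * (\<bar>s / c\<bar> + s / c * c * a \<omega>) / x) \<in> pol M D \<bar>s / c\<bar>" by (rule c(2))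
    have 3: "(\<lambda>\<omega>. \<zeta> \<omega> * (\<bar>t / c'\<bar> + t / c' * c' * b \<omega>) / x) \<in> pol M D \<bar>t / c'\<bar>" by (rule c'(2))
    have eq: "(\<lambda>\<omega>. r / x * \<zeta> \<omega> + \<zeta> \<omega> * (\<bar>s / c\<bar> + s / c * c * a \<omega>) / x + \<zeta> \<omega> * (\<bar>t / c'\<bar> + t / c' * c' * b \<omega>) / x)
        = (\<lambda>\<omega>. \<zeta> \<omega> * (x' + s * a \<omega> + t * b \<omega>) / x)"
    proof
      fix \<omega>
      have "s / c * c = s" "t / c' * c' = t" using c(1) c'(1) by auto
      then show "r / x * \<zeta> \<omega> + \<zeta> \<omega> * (\<bar>s / c\<bar> + s / c * c * a \<omega>) / x + \<zeta> \<omega> * (\<bar>t / c'\<bar> + t / c' * c' * b \<omega>) / x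
        = \<zeta> \<omega> * (x' + s * a \<omega> + t * b \<omega>) / x"
        by (simp only: r_def) (simp add: add_divide_distrib diff_divide_distrib algebra_simps)
    qed
    have sum: "r + \<bar>s / c\<bar> + \<bar>t / c'\<bar> = x'" by (simp add: r_def)
    show ?thesis using pol_add[OF D pol_add[OF D 1 2 r] 3] r unfolding eq sum by simp
  qed
  then show ?thesis using e0 by blast
qed


section \<open>Pairs that saturate the budget inequality\<close>

lemma pol_pairing_integral:
  assumes D: "D = pol M C 1" and C: "C \<subseteq> L0plus M" and f: "f \<in> pol M D x" and h: "h \<in> pol M C y"
    and y: "0 < y" and x: "0 < x"
  shows "integrable M (\<lambda>\<omega>. f \<omega> * h \<omega>)" "(\<integral>\<omega>. f \<omega> * h \<omega> \<partial>M) \<le> x * y"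
proof -
  have m: "(\<lambda>\<omega>. f \<omega> * h \<omega>) \<in> borel_measurable M"
    using pol_measurable[OF f] pol_measurable[OF h] by measurable
  have nn: "AE \<omega> in M. 0 \<le> f \<omega> * h \<omega>"
    using pol_nonneg[OF f] pol_nonneg[OF h] by auto
  show "integrable M (\<lambda>\<omega>. f \<omega> * h \<omega>)" "(\<integral>\<omega>. f \<omega> * h \<omega> \<partial>M) \<le> x * y"
    using nn_bound_integrable[OF m nn pol_pairing[OF D C f h y less_imp_le[OF x]]] x y by auto
qed

text \<open>Equality in E[\<xi> \<eta>] \<le> x y is the source of the identities below: a factor
  that can be moved within its set in two opposite directions cannot raise the product in either,
  hence leaves it unchanged. The hypotheses are symmetric in the two sides.\<close>

locale polar_pairing =
  fixes M :: "'a measure" and Cs Ds :: "('a \<Rightarrow> real) set" and x y :: real and \<xi> \<eta> :: "'a \<Rightarrow> real"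
  assumes C_pol: "Cs = pol M Ds 1" and D_pol: "Ds = pol M Cs 1"
    and xy_pos: "0 < x" "0 < y"
    and \<xi>: "\<xi> \<in> pol M Ds x" and \<eta>: "\<eta> \<in> pol M Cs y"
    and pos: "AE \<omega> in M. 0 < \<xi> \<omega>" "AE \<omega> in M. 0 < \<eta> \<omega>"
    and pair_eq: "(\<integral>\<omega>. \<xi> \<omega> * \<eta> \<omega> \<partial>M) = x * y"
begin

lemma polar_pairing_swap: "polar_pairing M Ds Cs y x \<eta> \<xi>"
  using C_pol D_pol xy_pos \<xi> \<eta> pos pair_eq by unfold_locales (auto simp: mult.commute)

lemma Cs_L0: "Cs \<subseteq> L0plus M" using C_pol pol_L0plus by auto
lemma Ds_L0: "Ds \<subseteq> L0plus M" using D_pol pol_L0plus by auto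
lemma pol_L0: "pol M D z \<subseteq> L0plus M" using pol_L0plus by auto

lemma \<xi>m [measurable]: "\<xi> \<in> borel_measurable M" and \<eta>m [measurable]: "\<eta> \<in> borel_measurable M"
  using pol_measurable \<xi> \<eta> by auto

lemma \<xi>_nn: "\<omega> \<in> space M \<Longrightarrow> 0 \<le> \<xi> \<omega>" and \<eta>_nn: "\<omega> \<in> space M \<Longrightarrow> 0 \<le> \<eta> \<omega>"
  using pol_nonneg[OF \<xi>] pol_nonneg[OF \<eta>] by auto

lemma wt_integrable: "integrable M (\<lambda>\<omega>. \<xi> \<omega> * \<eta> \<omega>)"
  using pol_pairing_integral[OF D_pol Cs_L0 \<xi> \<eta>] xy_pos by auto

lemma Dirs_integrable:
  assumes "\<alpha> \<in> Dirs M (pol M Ds x) \<xi>"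
  shows "integrable M (\<lambda>\<omega>. \<xi> \<omega> * \<eta> \<omega> * \<alpha> \<omega>)"
  using Dirs_AE_bounded[OF assms pol_L0 pos(1)] assms
  by (auto intro!: integrable_bounded_mult[OF _ wt_integrable] simp: Dirs_def mult.commute[of _ "\<alpha> _"])

text \<open>Both \<xi> (1 + c \<alpha>) and \<xi> (1 - c \<alpha>) respect the budget against
  \<eta>, which \<xi> already exhausts.\<close>

lemma Dirs_mean_zero:
  assumes \<alpha>: "\<alpha> \<in> Dirs M (pol M Ds x) \<xi>"
  shows "(\<integral>\<omega>. \<xi> \<omega> * \<eta> \<omega> * \<alpha> \<omega> \<partial>M) = 0"
proof -
  from \<alpha> obtain c where c: "c > 0" "(\<lambda>\<omega>. \<xi> \<omega> * (1 + c * \<alpha> \<omega>)) \<in> pol M Ds x" "(\<lambda>\<omega>. \<xi> \<omega> * (1 - c * \<alpha> \<omega>)) \<in> pol M Ds x"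
    by (auto simp: Dirs_def)
  note i = Dirs_integrable[OF \<alpha>] wt_integrable
  have "(\<lambda>\<omega>. \<xi> \<omega> * (1 + c * \<alpha> \<omega>) * \<eta> \<omega>) = (\<lambda>\<omega>. \<xi> \<omega> * \<eta> \<omega> + c * (\<xi> \<omega> * \<eta> \<omega> * \<alpha> \<omega>))"
    by (auto simp: algebra_simps)
  then have 1: "x * y + c * (\<integral>\<omega>. \<xi> \<omega> * \<eta> \<omega> * \<alpha> \<omega> \<partial>M) \<le> x * y"
    using pol_pairing_integral(2)[OF D_pol Cs_L0 c(2) \<eta>] xy_pos i pair_eq by simp
  have "(\<lambda>\<omega>. \<xi> \<omega> * (1 - c * \<alpha> \<omega>) * \<eta> \<omega>) = (\<lambda>\<omega>. \<xi> \<omega> * \<eta> \<omega> - c * (\<xi> \<omega> * \<eta> \<omega> * \<alpha> \<omega>))"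
    by (auto simp: algebra_simps)
  then have 2: "x * y - c * (\<integral>\<omega>. \<xi> \<omega> * \<eta> \<omega> * \<alpha> \<omega> \<partial>M) \<le> x * y"
    using pol_pairing_integral(2)[OF D_pol Cs_L0 c(3) \<eta>] xy_pos i pair_eq by simp
  from 1 2 have "c * (\<integral>\<omega>. \<xi> \<omega> * \<eta> \<omega> * \<alpha> \<omega> \<partial>M) = 0" by linarith
  then show ?thesis using c(1) by simp
qed

text \<open>Testing \<xi> (1 + c \<alpha>) against \<eta> (1 + d \<beta>) and against \<eta> (1 - d
  \<beta>) bounds the mixed term from both sides, as the linear terms have mean zero.\<close>

lemma Dirs_orthogonal:
  assumes \<alpha>: "\<alpha> \<in> Dirs M (pol M Ds x) \<xi>" and \<beta>: "\<beta> \<in> Dirs M (pol M Cs y) \<eta>"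
  shows "integrable M (\<lambda>\<omega>. \<xi> \<omega> * \<eta> \<omega> * (\<alpha> \<omega> * \<beta> \<omega>))" "(\<integral>\<omega>. \<xi> \<omega> * \<eta> \<omega> * (\<alpha> \<omega> * \<beta> \<omega>) \<partial>M) = 0"
proof -
  interpret S: polar_pairing M Ds Cs y x \<eta> \<xi> by (rule polar_pairing_swap)
  from \<alpha> obtain c where c: "c > 0" "(\<lambda>\<omega>. \<xi> \<omega> * (1 + c * \<alpha> \<omega>)) \<in> pol M Ds x" "(\<lambda>\<omega>. \<xi> \<omega> * (1 - c * \<alpha> \<omega>)) \<in> pol M Ds x"
    by (auto simp: Dirs_def)
  from \<beta> obtain d where d: "d > 0" "(\<lambda>\<omega>. \<eta> \<omega> * (1 + d * \<beta> \<omega>)) \<in> pol M Cs y" "(\<lambda>\<omega>. \<eta> \<omega> * (1 - d * \<beta> \<omega>)) \<in> pol M Cs y"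
    by (auto simp: Dirs_def)
  have [measurable]: "\<alpha> \<in> borel_measurable M" "\<beta> \<in> borel_measurable M" using \<alpha> \<beta> by (auto simp: Dirs_def)
  obtain K where K: "AE \<omega> in M. \<bar>\<beta> \<omega>\<bar> \<le> K" using Dirs_AE_bounded[OF \<beta> pol_L0 pos(2)] by blast
  show i: "integrable M (\<lambda>\<omega>. \<xi> \<omega> * \<eta> \<omega> * (\<alpha> \<omega> * \<beta> \<omega>))"
    using integrable_bounded_mult[OF _ Dirs_integrable[OF \<alpha>] K] by (simp add: mult_ac)
  have ib: "integrable M (\<lambda>\<omega>. \<xi> \<omega> * \<eta> \<omega> * \<beta> \<omega>)" "(\<integral>\<omega>. \<xi> \<omega> * \<eta> \<omega> * \<beta> \<omega> \<partial>M) = 0"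
    using S.Dirs_integrable[OF \<beta>] S.Dirs_mean_zero[OF \<beta>] by (simp_all add: mult.commute[of "\<eta> _"])
  note iis = i ib(1) wt_integrable Dirs_integrable[OF \<alpha>]
  have "(\<lambda>\<omega>. (\<xi> \<omega> * (1 + c * \<alpha> \<omega>)) * (\<eta> \<omega> * (1 + d * \<beta> \<omega>))) =
     (\<lambda>\<omega>. \<xi> \<omega> * \<eta> \<omega> + c * (\<xi> \<omega> * \<eta> \<omega> * \<alpha> \<omega>) + d * (\<xi> \<omega> * \<eta> \<omega> * \<beta> \<omega>) + c * d * (\<xi> \<omega> * \<eta> \<omega> * (\<alpha> \<omega> * \<beta> \<omega>)))"
    by (auto simp: algebra_simps)
  then have 1: "x * y + c * d * (\<integral>\<omega>. \<xi> \<omega> * \<eta> \<omega> * (\<alpha> \<omega> * \<beta> \<omega>) \<partial>M) \<le> x * y"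
    using pol_pairing_integral(2)[OF D_pol Cs_L0 c(2) d(2)] xy_pos iis pair_eq Dirs_mean_zero[OF \<alpha>] ib(2) by simp
  have "(\<lambda>\<omega>. (\<xi> \<omega> * (1 + c * \<alpha> \<omega>)) * (\<eta> \<omega> * (1 - d * \<beta> \<omega>))) =
     (\<lambda>\<omega>. \<xi> \<omega> * \<eta> \<omega> + c * (\<xi> \<omega> * \<eta> \<omega> * \<alpha> \<omega>) - d * (\<xi> \<omega> * \<eta> \<omega> * \<beta> \<omega>) - c * d * (\<xi> \<omega> * \<eta> \<omega> * (\<alpha> \<omega> * \<beta> \<omega>)))"
    by (auto simp: algebra_simps)
  then have 2: "x * y - c * d * (\<integral>\<omega>. \<xi> \<omega> * \<eta> \<omega> * (\<alpha> \<omega> * \<beta> \<omega>) \<partial>M) \<le> x * y"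
    using pol_pairing_integral(2)[OF D_pol Cs_L0 c(2) d(3)] xy_pos iis pair_eq Dirs_mean_zero[OF \<alpha>] ib(2) by simp
  from 1 2 have "c * d * (\<integral>\<omega>. \<xi> \<omega> * \<eta> \<omega> * (\<alpha> \<omega> * \<beta> \<omega>) \<partial>M) = 0" by linarith
  then show "(\<integral>\<omega>. \<xi> \<omega> * \<eta> \<omega> * (\<alpha> \<omega> * \<beta> \<omega>) \<partial>M) = 0" using c(1) d(1) by simp
qed

end

section \<open>Perturbed primal-dual pairs\<close>

text \<open>The filter at (0,0) is first countable, so the limit is checked along sequences, where
  dominated convergence applies.\<close>

lemma dominated_convergence_00:
  fixes s :: "real \<times> real \<Rightarrow> 'a \<Rightarrow> real"
  assumes "\<And>\<pi>. s \<pi> \<in> borel_measurable M" "integrable M w"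
    and "\<And>\<pi>. AE \<omega> in M. \<bar>s \<pi> \<omega>\<bar> \<le> w \<omega>"
    and "AE \<omega> in M. ((\<lambda>\<pi>. s \<pi> \<omega>) \<longlongrightarrow> 0) (at (0,0))"
  shows "((\<lambda>\<pi>. \<integral>\<omega>. s \<pi> \<omega> \<partial>M) \<longlongrightarrow> 0) (at (0,0))"
  unfolding tendsto_at_iff_sequentially
proof (intro allI impI)
  fix X :: "nat \<Rightarrow> real \<times> real" assume X: "\<forall>i. X i \<in> UNIV - {(0, 0)}" "X \<longlonglongrightarrow> (0, 0)"
  have "(\<lambda>i. \<integral>\<omega>. s (X i) \<omega> \<partial>M) \<longlonglongrightarrow> (\<integral>\<omega>. 0 \<partial>M)"
  proof (rule integral_dominated_convergence[where w=w])
    show "AE \<omega> in M. (\<lambda>i. s (X i) \<omega>) \<longlonglongrightarrow> 0"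
      using assms(4)
    proof eventually_elim
      case (elim \<omega>)
      from this[unfolded tendsto_at_iff_sequentially] X show ?case by (auto simp: o_def)
    qed
  qed (use assms in auto)
  then show "((\<lambda>\<pi>. \<integral>\<omega>. s \<pi> \<omega> \<partial>M) \<circ> X) \<longlonglongrightarrow> 0" by (simp add: o_def)
qed

lemma abs_ln_Ldelta_le:
  assumes "\<bar>d\<bar> \<le> e" "e \<le> 1"
  shows "\<bar>ln (Ldelta F G d \<omega>)\<bar> \<le> e * (\<bar>F \<omega>\<bar> + \<bar>G \<omega>\<bar>)"
proof -
  have "\<bar>ln (Ldelta F G d \<omega>)\<bar> = \<bar>d * F \<omega> + d\<^sup>2 / 2 * G \<omega>\<bar>" by (simp add: Ldelta_def)
  also have "\<dots> \<le> \<bar>d\<bar> * \<bar>F \<omega>\<bar> + d\<^sup>2 / 2 * \<bar>G \<omega>\<bar>"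
    by (rule order_trans[OF abs_triangle_ineq]) (simp add: abs_mult)
  also have "d\<^sup>2 / 2 \<le> e"
  proof -
    have "d\<^sup>2 = \<bar>d\<bar> * \<bar>d\<bar>" by (simp add: power2_eq_square)
    also have "\<dots> \<le> \<bar>d\<bar> * 1" using assms by (intro mult_left_mono) auto
    finally show ?thesis using assms by simp
  qed
  also have "\<bar>d\<bar> * \<bar>F \<omega>\<bar> + e * \<bar>G \<omega>\<bar> \<le> e * \<bar>F \<omega>\<bar> + e * \<bar>G \<omega>\<bar>"
    using assms by (intro add_right_mono mult_right_mono) auto
  finally show ?thesis by (simp add: distrib_left mult_right_mono)
qed

text \<open>\<open>rel1\<close> and \<open>rel2\<close> match the coefficients of \<Delta>x and of
  \<delta> in the linearization of \<eta> = U'(\<xi>) along \<Delta>y = - (a y / x) \<Delta>x + w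
  \<delta>. The minimizers enter through these relations and through their approximability by
  admissible directions. The moment condition is written with the absolute value of G so that it
  survives the passage to (- F, - G).\<close>

locale perturbed_pairing =
  utility_pair U W p q A c1 c2 + prob_space M + polar_pairing M Cs Ds x y \<xi> \<eta>
  for U W p q A :: "real \<Rightarrow> real" and c1 c2 and M :: "'a measure" and Cs Ds x y \<xi> \<eta> +
  fixes F G \<alpha>0 \<alpha>d \<beta>0 \<beta>d :: "'a \<Rightarrow> real" and a w c :: real
  assumes FG [measurable]: "F \<in> borel_measurable M" "G \<in> borel_measurable M"
    and dual: "AE \<omega> in M. \<eta> \<omega> = p (\<xi> \<omega>)"
    and Ui: "integrable M (\<lambda>\<omega>. U (\<xi> \<omega>))" and Wi: "integrable M (\<lambda>\<omega>. W (\<eta> \<omega>))"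
    and c_pos: "0 < c" and expi: "integrable M (\<lambda>\<omega>. \<xi> \<omega> * \<eta> \<omega> * exp (c * (\<bar>F \<omega>\<bar> + \<bar>G \<omega>\<bar>)))"
    and a_nz: "a \<noteq> 0"
    and dirm [measurable]: "\<alpha>0 \<in> borel_measurable M" "\<alpha>d \<in> borel_measurable M"
      "\<beta>0 \<in> borel_measurable M" "\<beta>d \<in> borel_measurable M"
    and app\<alpha>: "\<And>\<alpha> e. \<alpha> \<in> {\<alpha>0, \<alpha>d} \<Longrightarrow> 0 < e \<Longrightarrow> \<exists>f\<in>Dirs M (pol M Ds x) \<xi>.
        integrable M (\<lambda>\<omega>. \<xi> \<omega> * \<eta> \<omega> * (\<alpha> \<omega> - f \<omega>)\<^sup>2) \<and> (\<integral>\<omega>. \<xi> \<omega> * \<eta> \<omega> * (\<alpha> \<omega> - f \<omega>)\<^sup>2 \<partial>M) < e"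
    and app\<beta>: "\<And>\<beta> e. \<beta> \<in> {\<beta>0, \<beta>d} \<Longrightarrow> 0 < e \<Longrightarrow> \<exists>f\<in>Dirs M (pol M Cs y) \<eta>.
        integrable M (\<lambda>\<omega>. \<xi> \<omega> * \<eta> \<omega> * (\<beta> \<omega> - f \<omega>)\<^sup>2) \<and> (\<integral>\<omega>. \<xi> \<omega> * \<eta> \<omega> * (\<beta> \<omega> - f \<omega>)\<^sup>2 \<partial>M) < e"
    and rel1: "AE \<omega> in M. A (\<xi> \<omega>) * (1 + \<alpha>0 \<omega>) = a * (1 + \<beta>0 \<omega>)"
    and rel2: "AE \<omega> in M. y * F \<omega> - A (\<xi> \<omega>) * (\<alpha>d \<omega> + x * F \<omega>) * (y / x) = w * (1 + \<beta>0 \<omega>) + \<beta>d \<omega>"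
begin

lemma q_eta: "AE \<omega> in M. q (\<eta> \<omega>) = \<xi> \<omega>"
  using dual pos(1) by eventually_elim (simp add: qp)

text \<open>The new slopes \<open>1 / a\<close> and \<open>x * w / (y * a)\<close> arise from
  solving \<Delta>y = - (a y / x) \<Delta>x + w \<delta> for \<Delta>x; the two relations are solved
  for the primal side accordingly.\<close>

lemma swap_pairing:
  "perturbed_pairing W U q p (\<lambda>s. 1 / A (q s)) (1 / c2) (1 / c1) M Ds Cs y x \<eta> \<xi>
     (\<lambda>\<omega>. - F \<omega>) (\<lambda>\<omega>. - G \<omega>) \<beta>0 \<beta>d \<alpha>0 \<alpha>d (1 / a) (x * w / (y * a)) c"
proof (intro perturbed_pairing.intro swap polar_pairing_swap perturbed_pairing_axioms.intro prob_space_axioms)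
  show "AE \<omega> in M. \<xi> \<omega> = q (\<eta> \<omega>)" using q_eta by eventually_elim simp
  show "integrable M (\<lambda>\<omega>. \<eta> \<omega> * \<xi> \<omega> * exp (c * (\<bar>- F \<omega>\<bar> + \<bar>- G \<omega>\<bar>)))"
    using expi by (simp add: mult.commute[of "\<eta> _"])
  show "AE \<omega> in M. 1 / A (q (\<eta> \<omega>)) * (1 + \<beta>0 \<omega>) = 1 / a * (1 + \<alpha>0 \<omega>)"
    using rel1 q_eta pos(1)
  proof eventually_elim
    case (elim \<omega>)
    then show ?case using A_pos[OF elim(3)] a_nz by (simp add: field_simps)
  qed
  show "AE \<omega> in M. x * - F \<omega> - 1 / A (q (\<eta> \<omega>)) * (\<beta>d \<omega> + y * - F \<omega>) * (x / y)
      = x * w / (y * a) * (1 + \<alpha>0 \<omega>) + \<alpha>d \<omega>"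
    using rel1 rel2 q_eta pos(1)
  proof eventually_elim
    case (elim \<omega>)
    define B where "B = A (\<xi> \<omega>)"
    have B: "B > 0" using A_pos[OF elim(4)] by (simp add: B_def)
    have 1: "(1 + \<beta>0 \<omega>) = B * (1 + \<alpha>0 \<omega>) / a" using elim(1) a_nz by (simp add: B_def)
    have 2: "\<beta>d \<omega> = y * F \<omega> - B * (\<alpha>d \<omega> + x * F \<omega>) * (y / x) - w * (B * (1 + \<alpha>0 \<omega>) / a)"
      using elim(2) by (simp add: B_def[symmetric] 1)
    show ?case unfolding elim(3) B_def[symmetric] 2
      using B a_nz xy_pos by (simp add: field_simps)
  qed
qed (use FG dirm Ui Wi c_pos expi a_nz app\<alpha> app\<beta> in \<open>auto simp: mult.commute[of "\<eta> _"]\<close>)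

end

text \<open>Four admissible directions standing in for the minimizers, fixed while (\<Delta>x,
  \<delta>) tends to 0. Their distance to the minimizers enters the estimates through the single
  function \<open>N\<close>.\<close>

locale approximants = perturbed_pairing +
  fixes a1 a2 b1 b2 :: "'a \<Rightarrow> real"
  assumes a12: "a1 \<in> Dirs M (pol M Ds x) \<xi>" "a2 \<in> Dirs M (pol M Ds x) \<xi>"
    and b12: "b1 \<in> Dirs M (pol M Cs y) \<eta>" "b2 \<in> Dirs M (pol M Cs y) \<eta>"
    and ab_close: "integrable M (\<lambda>\<omega>. \<xi> \<omega> * \<eta> \<omega> * (\<alpha>0 \<omega> - a1 \<omega>)\<^sup>2)" "integrable M (\<lambda>\<omega>. \<xi> \<omega> * \<eta> \<omega> * (\<alpha>d \<omega> - a2 \<omega>)\<^sup>2)"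
      "integrable M (\<lambda>\<omega>. \<xi> \<omega> * \<eta> \<omega> * (\<beta>0 \<omega> - b1 \<omega>)\<^sup>2)" "integrable M (\<lambda>\<omega>. \<xi> \<omega> * \<eta> \<omega> * (\<beta>d \<omega> - b2 \<omega>)\<^sup>2)"
begin

interpretation SP: polar_pairing M Ds Cs y x \<eta> \<xi> by (rule polar_pairing_swap)

lemma abm [measurable]: "a1 \<in> borel_measurable M" "a2 \<in> borel_measurable M"
    "b1 \<in> borel_measurable M" "b2 \<in> borel_measurable M"
  using a12 b12 by (auto simp: Dirs_def)

text \<open>The slopes are those of \<open>rel1\<close> and \<open>rel2\<close>, which is what
  cancels the first-order mismatch in \<open>linear_part\<close>.\<close>

definition dy :: "real \<times> real \<Rightarrow> real" where "dy \<pi> = - (a * y / x) * fst \<pi> + w * snd \<pi>"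
definition X :: "real \<times> real \<Rightarrow> 'a \<Rightarrow> real" where "X \<pi> \<omega> = (fst \<pi> * (1 + a1 \<omega>) + snd \<pi> * a2 \<omega>) / x"
definition Y :: "real \<times> real \<Rightarrow> 'a \<Rightarrow> real" where "Y \<pi> \<omega> = (dy \<pi> * (1 + b1 \<omega>) + snd \<pi> * b2 \<omega>) / y"
definition L :: "real \<times> real \<Rightarrow> 'a \<Rightarrow> real" where "L \<pi> = Ldelta F G (snd \<pi>)"
definition xt :: "real \<times> real \<Rightarrow> 'a \<Rightarrow> real" where "xt \<pi> \<omega> = \<xi> \<omega> * (1 + X \<pi> \<omega>) / L \<pi> \<omega>"
definition et :: "real \<times> real \<Rightarrow> 'a \<Rightarrow> real" where "et \<pi> \<omega> = \<eta> \<omega> * (1 + Y \<pi> \<omega>) * L \<pi> \<omega>"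
definition r :: "real \<times> real \<Rightarrow> 'a \<Rightarrow> real" where "r \<pi> \<omega> = lograte (\<xi> \<omega>) (X \<pi> \<omega>) (Y \<pi> \<omega>) (L \<pi> \<omega>)"
definition N :: "'a \<Rightarrow> real" where "N \<omega> = \<bar>a1 \<omega> - \<alpha>0 \<omega>\<bar> + \<bar>a2 \<omega> - \<alpha>d \<omega>\<bar> + \<bar>b1 \<omega> - \<beta>0 \<omega>\<bar> + \<bar>b2 \<omega> - \<beta>d \<omega>\<bar>"

lemma L_pos: "0 < L \<pi> \<omega>" by (simp add: L_def Ldelta_pos)

lemma L_measurable [measurable]: "L \<pi> \<in> borel_measurable M" unfolding L_def by measurable
lemma X_measurable [measurable]: "X \<pi> \<in> borel_measurable M" unfolding X_def[abs_def] by measurable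
lemma Y_measurable [measurable]: "Y \<pi> \<in> borel_measurable M" unfolding Y_def[abs_def] by measurable
lemma xt_measurable [measurable]: "xt \<pi> \<in> borel_measurable M" unfolding xt_def[abs_def] by measurable
lemma et_measurable [measurable]: "et \<pi> \<in> borel_measurable M" unfolding et_def[abs_def] by measurable
lemma N_measurable [measurable]: "N \<in> borel_measurable M" unfolding N_def[abs_def] by measurable

lemma abs_dy_le: "\<bar>dy \<pi>\<bar> \<le> (\<bar>a * y / x\<bar> + \<bar>w\<bar>) * nrm \<pi>"
proof -
  have "\<bar>dy \<pi>\<bar> \<le> \<bar>a * y / x\<bar> * \<bar>fst \<pi>\<bar> + \<bar>w\<bar> * \<bar>snd \<pi>\<bar>"
    unfolding dy_def by (rule order_trans[OF abs_triangle_ineq]) (simp add: abs_mult)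
  also have "\<dots> \<le> \<bar>a * y / x\<bar> * nrm \<pi> + \<bar>w\<bar> * nrm \<pi>" by (intro add_mono mult_left_mono) auto
  finally show ?thesis by (simp add: distrib_right)
qed

text \<open>The quantifier over \<pi> stands inside \<open>AE\<close>: limits along an uncountable
  filter are taken at fixed \<omega>, so one null set has to serve all perturbations.\<close>

lemma XY_bound: "\<exists>K\<ge>1. AE \<omega> in M. \<forall>\<pi>. \<bar>X \<pi> \<omega>\<bar> \<le> K * nrm \<pi> \<and> \<bar>Y \<pi> \<omega>\<bar> \<le> K * nrm \<pi>"
proof -
  define D where "D = \<bar>a * y / x\<bar> + \<bar>w\<bar>"
  have D: "0 \<le> D" by (simp add: D_def)
  obtain k1 k2 k3 k4 where k: "AE \<omega> in M. \<bar>a1 \<omega>\<bar> \<le> k1" "AE \<omega> in M. \<bar>a2 \<omega>\<bar> \<le> k2"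
      "AE \<omega> in M. \<bar>b1 \<omega>\<bar> \<le> k3" "AE \<omega> in M. \<bar>b2 \<omega>\<bar> \<le> k4" "0 < k1" "0 < k2" "0 < k3" "0 < k4"
    using Dirs_AE_bounded[OF a12(1) pol_L0 pos(1)] Dirs_AE_bounded[OF a12(2) pol_L0 pos(1)]
      Dirs_AE_bounded[OF b12(1) pol_L0 pos(2)] Dirs_AE_bounded[OF b12(2) pol_L0 pos(2)] by blast
  define K where "K = 1 + (1 + k1 + k2) / x + (D * (1 + k3) + k4) / y"
  have K: "(1 + k1 + k2) / x \<le> K" "(D * (1 + k3) + k4) / y \<le> K" "1 \<le> K"
    using k(5-8) xy_pos D by (auto simp: K_def)
  have "AE \<omega> in M. \<forall>\<pi>. \<bar>X \<pi> \<omega>\<bar> \<le> K * nrm \<pi> \<and> \<bar>Y \<pi> \<omega>\<bar> \<le> K * nrm \<pi>"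
    using k(1-4)
  proof eventually_elim
    case (elim \<omega>)
    show ?case
    proof
      fix \<pi> :: "real \<times> real"
      have e1: "\<bar>1 + a1 \<omega>\<bar> \<le> 1 + k1" and e3: "\<bar>1 + b1 \<omega>\<bar> \<le> 1 + k3" using elim(1,3) by linarith+
      have n: "0 \<le> nrm \<pi>" "\<bar>fst \<pi>\<bar> \<le> nrm \<pi>" "\<bar>snd \<pi>\<bar> \<le> nrm \<pi>" by simp_all
      have Dn: "0 \<le> D * nrm \<pi>" using D n(1) by (rule mult_nonneg_nonneg)
      have dyD: "\<bar>dy \<pi>\<bar> \<le> D * nrm \<pi>" using abs_dy_le[of \<pi>] by (simp only: D_def)
      have "\<bar>fst \<pi> * (1 + a1 \<omega>) + snd \<pi> * a2 \<omega>\<bar> \<le> \<bar>fst \<pi>\<bar> * \<bar>1 + a1 \<omega>\<bar> + \<bar>snd \<pi>\<bar> * \<bar>a2 \<omega>\<bar>"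
        by (rule order_trans[OF abs_triangle_ineq]) (simp add: abs_mult)
      also have "\<dots> \<le> nrm \<pi> * (1 + k1) + nrm \<pi> * k2" by (intro add_mono mult_mono e1 elim(2) n abs_ge_zero)
      finally have "\<bar>X \<pi> \<omega>\<bar> \<le> (nrm \<pi> * (1 + k1) + nrm \<pi> * k2) / x"
        unfolding X_def abs_divide using xy_pos by (simp add: divide_right_mono)
      also have "\<dots> = (1 + k1 + k2) / x * nrm \<pi>" by (simp add: algebra_simps)
      also have "\<dots> \<le> K * nrm \<pi>" using K by (intro mult_right_mono) auto
      finally have 1: "\<bar>X \<pi> \<omega>\<bar> \<le> K * nrm \<pi>" .
      have "\<bar>dy \<pi> * (1 + b1 \<omega>) + snd \<pi> * b2 \<omega>\<bar> \<le> \<bar>dy \<pi>\<bar> * \<bar>1 + b1 \<omega>\<bar> + \<bar>snd \<pi>\<bar> * \<bar>b2 \<omega>\<bar>"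
        by (rule order_trans[OF abs_triangle_ineq]) (simp add: abs_mult)
      also have "\<dots> \<le> (D * nrm \<pi>) * (1 + k3) + nrm \<pi> * k4"
        by (intro add_mono mult_mono e3 elim(4) n abs_ge_zero dyD Dn)
      finally have "\<bar>Y \<pi> \<omega>\<bar> \<le> ((D * nrm \<pi>) * (1 + k3) + nrm \<pi> * k4) / y"
        unfolding Y_def abs_divide using xy_pos by (simp add: divide_right_mono)
      also have "\<dots> = (D * (1 + k3) + k4) / y * nrm \<pi>" by (simp add: algebra_simps)
      also have "\<dots> \<le> K * nrm \<pi>" using K by (intro mult_right_mono) auto
      finally show "\<bar>X \<pi> \<omega>\<bar> \<le> K * nrm \<pi> \<and> \<bar>Y \<pi> \<omega>\<bar> \<le> K * nrm \<pi>" using 1 by simp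
    qed
  qed
  then show ?thesis using K by blast
qed

lemma dy_tendsto: "(dy \<longlongrightarrow> 0) (at (0,0))"
proof -
  have "(dy \<longlongrightarrow> - (a * y / x) * fst (0::real,0::real) + w * snd (0::real,0::real)) (at (0,0))"
    unfolding dy_def[abs_def] by (intro tendsto_intros)
  then show ?thesis by simp
qed

text \<open>Near (0,0) the condition |s| + |t| \<le> e x' of \<open>Dirs_perturb\<close> holds, its
  left side being \<open>nrm \<pi>\<close> and x' staying above x / 2.\<close>

lemma xt_member: "eventually (\<lambda>\<pi>. 0 < x + fst \<pi> \<and> (\<lambda>\<omega>. xt \<pi> \<omega> * L \<pi> \<omega>) \<in> pol M Ds (x + fst \<pi>)) (at (0,0))"
proof -
  from Dirs_perturb[OF Ds_L0 \<xi> xy_pos(1) a12] obtain e where e: "0 < e"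
    "\<And>s t x'. \<bar>s\<bar> + \<bar>t\<bar> \<le> e * x' \<Longrightarrow> (\<lambda>\<omega>. \<xi> \<omega> * (x' + s * a1 \<omega> + t * a2 \<omega>) / x) \<in> pol M Ds x'" by blast
  have "eventually (\<lambda>\<pi>. nrm \<pi> < min (e * (x / 2)) (x / 2)) (at (0,0))"
    by (rule nrm_small_00) (use e xy_pos in auto)
  then show ?thesis
  proof eventually_elim
    case (elim \<pi>)
    have "- fst \<pi> \<le> nrm \<pi>" using abs_fst_le_nrm[of \<pi>] by linarith
    then have h: "x / 2 \<le> x + fst \<pi>" using elim by auto
    then have "e * (x / 2) \<le> e * (x + fst \<pi>)" using e by (intro mult_left_mono) auto
    then have "(\<lambda>\<omega>. \<xi> \<omega> * ((x + fst \<pi>) + fst \<pi> * a1 \<omega> + snd \<pi> * a2 \<omega>) / x) \<in> pol M Ds (x + fst \<pi>)"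
      using elim by (intro e(2)) (auto simp: nrm_def)
    moreover have "(\<lambda>\<omega>. xt \<pi> \<omega> * L \<pi> \<omega>) = (\<lambda>\<omega>. \<xi> \<omega> * ((x + fst \<pi>) + fst \<pi> * a1 \<omega> + snd \<pi> * a2 \<omega>) / x)"
    proof
      fix \<omega> show "xt \<pi> \<omega> * L \<pi> \<omega> = \<xi> \<omega> * ((x + fst \<pi>) + fst \<pi> * a1 \<omega> + snd \<pi> * a2 \<omega>) / x"
        using L_pos[of \<pi> \<omega>] xy_pos by (simp add: xt_def X_def field_simps)
    qed
    ultimately show ?case using h xy_pos by simp
  qed
qed

lemma et_member: "eventually (\<lambda>\<pi>. 0 < y + dy \<pi> \<and> (\<lambda>\<omega>. et \<pi> \<omega> / L \<pi> \<omega>) \<in> pol M Cs (y + dy \<pi>)) (at (0,0))"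
proof -
  from Dirs_perturb[OF Cs_L0 \<eta> xy_pos(2) b12] obtain e where e: "0 < e"
    "\<And>s t x'. \<bar>s\<bar> + \<bar>t\<bar> \<le> e * x' \<Longrightarrow> (\<lambda>\<omega>. \<eta> \<omega> * (x' + s * b1 \<omega> + t * b2 \<omega>) / y) \<in> pol M Cs x'" by blast
  define m where "m = min (e * (y / 2)) (y / 2) / 2"
  have m: "0 < m" using e xy_pos by (simp add: m_def)
  have "eventually (\<lambda>\<pi>. nrm \<pi> < m) (at (0,0))"
    by (rule nrm_small_00) (use m in auto)
  moreover have "eventually (\<lambda>\<pi>. \<bar>dy \<pi>\<bar> < m) (at (0,0))"
    using tendsto_rabs_zero[OF dy_tendsto] m by (intro order_tendstoD(2)) auto
  ultimately show ?thesis
  proof eventually_elim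
    case (elim \<pi>)
    have mm: "m \<le> y / 4" "m \<le> e * (y / 2) / 2" by (auto simp: m_def)
    then have h: "y / 2 \<le> y + dy \<pi>" using elim xy_pos by linarith
    then have "e * (y / 2) \<le> e * (y + dy \<pi>)" using e by (intro mult_left_mono) auto
    moreover have "\<bar>dy \<pi>\<bar> + \<bar>snd \<pi>\<bar> \<le> e * (y / 2)" using elim mm abs_snd_le_nrm[of \<pi>] by linarith
    ultimately have "(\<lambda>\<omega>. \<eta> \<omega> * ((y + dy \<pi>) + dy \<pi> * b1 \<omega> + snd \<pi> * b2 \<omega>) / y) \<in> pol M Cs (y + dy \<pi>)"
      by (intro e(2)) auto
    moreover have "(\<lambda>\<omega>. et \<pi> \<omega> / L \<pi> \<omega>) = (\<lambda>\<omega>. \<eta> \<omega> * ((y + dy \<pi>) + dy \<pi> * b1 \<omega> + snd \<pi> * b2 \<omega>) / y)"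
    proof
      fix \<omega> show "et \<pi> \<omega> / L \<pi> \<omega> = \<eta> \<omega> * ((y + dy \<pi>) + dy \<pi> * b1 \<omega> + snd \<pi> * b2 \<omega>) / y"
        using L_pos[of \<pi> \<omega>] xy_pos by (simp add: et_def Y_def field_simps)
    qed
    ultimately show ?case using h xy_pos by simp
  qed
qed

lemma xt_et_eq: "xt \<pi> \<omega> * et \<pi> \<omega> = \<xi> \<omega> * \<eta> \<omega> * ((1 + X \<pi> \<omega>) * (1 + Y \<pi> \<omega>))"
  using L_pos[of \<pi> \<omega>] by (simp add: xt_def et_def)

text \<open>Of the nine terms of the product only the one free of directions survives: single
  directions have mean zero, and a primal direction is orthogonal to a dual one. The approximating
  pair thus saturates its own budget inequality exactly, not just up to second order.\<close>

lemma xt_et_integral: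
  "integrable M (\<lambda>\<omega>. xt \<pi> \<omega> * et \<pi> \<omega>)" "(\<integral>\<omega>. xt \<pi> \<omega> * et \<pi> \<omega> \<partial>M) = (x + fst \<pi>) * (y + dy \<pi>)"
proof -
  let ?w = "\<lambda>\<omega>. \<xi> \<omega> * \<eta> \<omega>"
  define s t u v where "s = fst \<pi>" and "t = snd \<pi>" and "u = dy \<pi>" and "v = snd \<pi>"
  have eq: "(\<lambda>\<omega>. xt \<pi> \<omega> * et \<pi> \<omega>) = (\<lambda>\<omega>. 1 / (x * y) * ((x + s) * (y + u) * ?w \<omega>
     + (y + u) * s * (?w \<omega> * a1 \<omega>) + (y + u) * t * (?w \<omega> * a2 \<omega>)
     + (x + s) * u * (?w \<omega> * b1 \<omega>) + (x + s) * v * (?w \<omega> * b2 \<omega>)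
     + s * u * (?w \<omega> * (a1 \<omega> * b1 \<omega>)) + s * v * (?w \<omega> * (a1 \<omega> * b2 \<omega>))
     + t * u * (?w \<omega> * (a2 \<omega> * b1 \<omega>)) + t * v * (?w \<omega> * (a2 \<omega> * b2 \<omega>))))"
  proof
    fix \<omega>
    have "(1 + X \<pi> \<omega>) = ((x + s) + s * a1 \<omega> + t * a2 \<omega>) / x" "(1 + Y \<pi> \<omega>) = ((y + u) + u * b1 \<omega> + v * b2 \<omega>) / y"
      using xy_pos by (auto simp: X_def Y_def s_def t_def u_def v_def field_simps)
    then have "xt \<pi> \<omega> * et \<pi> \<omega> = 1 / (x * y) * (?w \<omega> * (((x + s) + s * a1 \<omega> + t * a2 \<omega>) * ((y + u) + u * b1 \<omega> + v * b2 \<omega>)))"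
      unfolding xt_et_eq by simp
    then show "xt \<pi> \<omega> * et \<pi> \<omega> = 1 / (x * y) * ((x + s) * (y + u) * ?w \<omega>
     + (y + u) * s * (?w \<omega> * a1 \<omega>) + (y + u) * t * (?w \<omega> * a2 \<omega>)
     + (x + s) * u * (?w \<omega> * b1 \<omega>) + (x + s) * v * (?w \<omega> * b2 \<omega>)
     + s * u * (?w \<omega> * (a1 \<omega> * b1 \<omega>)) + s * v * (?w \<omega> * (a1 \<omega> * b2 \<omega>))
     + t * u * (?w \<omega> * (a2 \<omega> * b1 \<omega>)) + t * v * (?w \<omega> * (a2 \<omega> * b2 \<omega>)))"
      by (simp only: ring_distribs mult.assoc mult.left_commute mult.commute)
  qed
  have b: "integrable M (\<lambda>\<omega>. ?w \<omega> * f \<omega>)" "(\<integral>\<omega>. ?w \<omega> * f \<omega> \<partial>M) = 0" if "f \<in> {b1, b2}" for f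
    using that SP.Dirs_integrable[of f] SP.Dirs_mean_zero[of f] b12 by (auto simp: mult.commute[of "\<eta> _"])
  note i = wt_integrable Dirs_integrable[OF a12(1)] Dirs_integrable[OF a12(2)] b(1)[of b1] b(1)[of b2]
     Dirs_orthogonal(1)[OF a12(1) b12(1)] Dirs_orthogonal(1)[OF a12(1) b12(2)]
     Dirs_orthogonal(1)[OF a12(2) b12(1)] Dirs_orthogonal(1)[OF a12(2) b12(2)]
  note z = pair_eq Dirs_mean_zero[OF a12(1)] Dirs_mean_zero[OF a12(2)] b(2)[of b1] b(2)[of b2]
     Dirs_orthogonal(2)[OF a12(1) b12(1)] Dirs_orthogonal(2)[OF a12(1) b12(2)]
     Dirs_orthogonal(2)[OF a12(2) b12(1)] Dirs_orthogonal(2)[OF a12(2) b12(2)]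
  show "integrable M (\<lambda>\<omega>. xt \<pi> \<omega> * et \<pi> \<omega>)" unfolding eq using i by simp
  show "(\<integral>\<omega>. xt \<pi> \<omega> * et \<pi> \<omega> \<partial>M) = (x + fst \<pi>) * (y + dy \<pi>)"
    unfolding eq using i z xy_pos by (simp add: s_def u_def)
qed

end

section \<open>Uniform estimates and the integrated gap\<close>

context approximants
begin

definition K :: real where
  "K = (SOME K. K \<ge> 1 \<and> (AE \<omega> in M. \<forall>\<pi>. \<bar>X \<pi> \<omega>\<bar> \<le> K * nrm \<pi> \<and> \<bar>Y \<pi> \<omega>\<bar> \<le> K * nrm \<pi>))"

lemma K: "1 \<le> K" "AE \<omega> in M. \<forall>\<pi>. \<bar>X \<pi> \<omega>\<bar> \<le> K * nrm \<pi> \<and> \<bar>Y \<pi> \<omega>\<bar> \<le> K * nrm \<pi>"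
  using someI_ex[of "\<lambda>K. K \<ge> 1 \<and> (AE \<omega> in M. \<forall>\<pi>. \<bar>X \<pi> \<omega>\<bar> \<le> K * nrm \<pi> \<and> \<bar>Y \<pi> \<omega>\<bar> \<le> K * nrm \<pi>)"] XY_bound
  unfolding K_def by auto

definition S :: "'a \<Rightarrow> real" where "S \<omega> = \<bar>F \<omega>\<bar> + \<bar>G \<omega>\<bar>"

lemma S_nonneg: "0 \<le> S \<omega>" by (simp add: S_def)
lemma S_measurable [measurable]: "S \<in> borel_measurable M" unfolding S_def[abs_def] by measurable

text \<open>The sum of the coefficients in \<open>lograte_bound\<close> after inserting
  \<open>K * nrm \<pi>\<close> for the relative changes and \<open>nrm \<pi> * S \<omega>\<close>
  for the logarithm of \<open>L\<close>.\<close>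

definition R0 :: real where "R0 = 2 * K + 2 * c2 * K + 1 + c2"

lemma R0_pos: "0 < R0" using K(1) c2_pos by (simp add: R0_def add_pos_pos)

text \<open>One entry per smallness requirement: relative changes of at most 1/2; the exponents of
  \<open>U_increment\<close> for U and for W at most c (1 + S); and the exponent in the upper gap
  bound at most half of that, the other half being reserved for the squared mismatch.\<close>

definition e0 :: real where
  "e0 = min (1 / (2 * K)) (min (c / ((c2 + 1) * R0)) (min (c / ((1 / c1 + 1) * R0)) (c / (2 * (1 / c1 + 1) * R0))))"

lemma e0_pos: "0 < e0" using K(1) c2_pos c1_pos c_pos R0_pos by (simp add: e0_def add_pos_pos)

lemma e0_props:
  assumes "nrm \<pi> \<le> e0"
  shows "K * nrm \<pi> \<le> 1/2" "nrm \<pi> \<le> 1" "(c2 + 1) * (R0 * nrm \<pi>) \<le> c" "(1 / c1 + 1) * (R0 * nrm \<pi>) \<le> c"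
    "(1 / c1 + 1) * (R0 * nrm \<pi>) \<le> c / 2"
proof -
  have k: "0 < K" "0 < (c2 + 1) * R0" "0 < (1 / c1 + 1) * R0"
    using K(1) c2_pos c1_pos R0_pos by (auto simp: add_pos_pos)
  have e: "e0 \<le> 1 / (2 * K)" "e0 \<le> c / ((c2 + 1) * R0)" "e0 \<le> c / ((1 / c1 + 1) * R0)"
    "e0 \<le> c / (2 * (1 / c1 + 1) * R0)"
    unfolding e0_def by (simp_all only: min_le_iff_disj order_refl simp_thms)
  have "nrm \<pi> \<le> 1 / (2 * K)" by (rule order_trans[OF assms e(1)])
  then show 1: "K * nrm \<pi> \<le> 1/2" using k by (simp add: field_simps)
  have "1 * nrm \<pi> \<le> K * nrm \<pi>" using K(1) by (intro mult_right_mono) auto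
  then show "nrm \<pi> \<le> 1" using 1 by linarith
  have "nrm \<pi> \<le> c / ((c2 + 1) * R0)" by (rule order_trans[OF assms e(2)])
  then show "(c2 + 1) * (R0 * nrm \<pi>) \<le> c" using k(2) by (simp only: pos_le_divide_eq mult_ac)
  have "nrm \<pi> \<le> c / ((1 / c1 + 1) * R0)" by (rule order_trans[OF assms e(3)])
  then show "(1 / c1 + 1) * (R0 * nrm \<pi>) \<le> c" using k(3) by (simp only: pos_le_divide_eq mult_ac)
  have "nrm \<pi> \<le> c / (2 * (1 / c1 + 1) * R0)" by (rule order_trans[OF assms e(4)])
  also have "\<dots> = (c / 2) / ((1 / c1 + 1) * R0)" by simp
  finally show "(1 / c1 + 1) * (R0 * nrm \<pi>) \<le> c / 2" using k(3) by (simp only: pos_le_divide_eq mult_ac)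
qed

text \<open>All logarithmic changes are linear in 1 + |F| + |G| with a factor proportional to the
  perturbation, so their exponentials are integrable against \<xi> \<eta> once the perturbation is
  small. Again one null set serves all \<pi>.\<close>

lemma ratio_bounds:
  "AE \<omega> in M. \<forall>\<pi>. nrm \<pi> \<le> e0 \<longrightarrow> \<bar>X \<pi> \<omega>\<bar> \<le> 1/2 \<and> \<bar>Y \<pi> \<omega>\<bar> \<le> 1/2 \<and> 0 < xt \<pi> \<omega> \<and> 0 < et \<pi> \<omega> \<and>
     \<bar>r \<pi> \<omega>\<bar> \<le> R0 * nrm \<pi> * (1 + S \<omega>) \<and>
     \<bar>ln ((1 + X \<pi> \<omega>) / L \<pi> \<omega>)\<bar> \<le> R0 * nrm \<pi> * (1 + S \<omega>) \<and>
     \<bar>ln ((1 + Y \<pi> \<omega>) * L \<pi> \<omega>)\<bar> \<le> R0 * nrm \<pi> * (1 + S \<omega>)"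
  using K(2) pos
proof eventually_elim
  case (elim \<omega>)
  show ?case
  proof (intro allI impI)
    fix \<pi> :: "real \<times> real" assume e: "nrm \<pi> \<le> e0"
    note p = e0_props[OF e]
    have XY: "\<bar>X \<pi> \<omega>\<bar> \<le> K * nrm \<pi>" "\<bar>Y \<pi> \<omega>\<bar> \<le> K * nrm \<pi>" using spec[OF elim(1), of \<pi>] by auto
    then have h: "\<bar>X \<pi> \<omega>\<bar> \<le> 1/2" "\<bar>Y \<pi> \<omega>\<bar> \<le> 1/2" using p(1) by auto
    have l: "\<bar>ln (L \<pi> \<omega>)\<bar> \<le> nrm \<pi> * S \<omega>"
      unfolding L_def S_def by (rule abs_ln_Ldelta_le) (use p(2) in auto)
    have n0: "0 \<le> nrm \<pi>" "0 \<le> nrm \<pi> * S \<omega>" using S_nonneg[of \<omega>] by auto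
    have one: "0 < 1 + X \<pi> \<omega>" "0 < 1 + Y \<pi> \<omega>" using h by auto
    have "\<bar>r \<pi> \<omega>\<bar> \<le> 2 * \<bar>Y \<pi> \<omega>\<bar> + 2 * c2 * \<bar>X \<pi> \<omega>\<bar> + (1 + c2) * \<bar>ln (L \<pi> \<omega>)\<bar>"
      unfolding r_def by (rule lograte_bound[OF elim(2) h L_pos])
    also have "\<dots> \<le> 2 * (K * nrm \<pi>) + 2 * c2 * (K * nrm \<pi>) + (1 + c2) * (nrm \<pi> * S \<omega>)"
      using XY l c2_pos by (intro add_mono mult_left_mono) auto
    also have "\<dots> = (2 * K + 2 * c2 * K) * nrm \<pi> + (1 + c2) * (nrm \<pi> * S \<omega>)" by (simp add: algebra_simps)
    also have "\<dots> \<le> R0 * nrm \<pi> + R0 * (nrm \<pi> * S \<omega>)"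
      using n0 K(1) c2_pos by (intro add_mono mult_right_mono) (auto simp: R0_def)
    also have "\<dots> = R0 * nrm \<pi> * (1 + S \<omega>)" by (simp add: algebra_simps)
    finally have 1: "\<bar>r \<pi> \<omega>\<bar> \<le> R0 * nrm \<pi> * (1 + S \<omega>)" .
    have "2 * (K * nrm \<pi>) + nrm \<pi> * S \<omega> = (2 * K) * nrm \<pi> + 1 * (nrm \<pi> * S \<omega>)" by simp
    also have "\<dots> \<le> R0 * nrm \<pi> + R0 * (nrm \<pi> * S \<omega>)"
      using n0 K(1) c2_pos by (intro add_mono mult_right_mono) (auto simp: R0_def)
    also have "\<dots> = R0 * nrm \<pi> * (1 + S \<omega>)" by (simp add: algebra_simps)
    finally have 2: "2 * (K * nrm \<pi>) + nrm \<pi> * S \<omega> \<le> R0 * nrm \<pi> * (1 + S \<omega>)" .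
    have "ln ((1 + X \<pi> \<omega>) / L \<pi> \<omega>) = ln (1 + X \<pi> \<omega>) - ln (L \<pi> \<omega>)"
      using one L_pos[of \<pi> \<omega>] by (simp add: ln_div)
    then have 3: "\<bar>ln ((1 + X \<pi> \<omega>) / L \<pi> \<omega>)\<bar> \<le> R0 * nrm \<pi> * (1 + S \<omega>)"
      using abs_ln_one_plus_le[OF h(1)] XY l 2 by linarith
    have "ln ((1 + Y \<pi> \<omega>) * L \<pi> \<omega>) = ln (1 + Y \<pi> \<omega>) + ln (L \<pi> \<omega>)"
      using one L_pos[of \<pi> \<omega>] by (simp add: ln_mult)
    then have 4: "\<bar>ln ((1 + Y \<pi> \<omega>) * L \<pi> \<omega>)\<bar> \<le> R0 * nrm \<pi> * (1 + S \<omega>)"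
      using abs_ln_one_plus_le[OF h(2)] XY l 2 by linarith
    show "\<bar>X \<pi> \<omega>\<bar> \<le> 1/2 \<and> \<bar>Y \<pi> \<omega>\<bar> \<le> 1/2 \<and> 0 < xt \<pi> \<omega> \<and> 0 < et \<pi> \<omega> \<and>
     \<bar>r \<pi> \<omega>\<bar> \<le> R0 * nrm \<pi> * (1 + S \<omega>) \<and>
     \<bar>ln ((1 + X \<pi> \<omega>) / L \<pi> \<omega>)\<bar> \<le> R0 * nrm \<pi> * (1 + S \<omega>) \<and>
     \<bar>ln ((1 + Y \<pi> \<omega>) * L \<pi> \<omega>)\<bar> \<le> R0 * nrm \<pi> * (1 + S \<omega>)"
      using h 1 3 4 elim(2,3) one L_pos[of \<pi> \<omega>] by (simp add: xt_def et_def)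
  qed
qed

text \<open>Assembled from the bound |a y / x| + |w| on the slope of \<open>dy\<close>, the slope 1
  of \<delta>, and A \<le> c2. The chosen directions do not occur in it, which later allows choosing
  them in dependence on this constant.\<close>

definition K1 :: real where "K1 = (\<bar>a * y / x\<bar> + \<bar>w\<bar> + 1) / y + c2 / x"

lemma N_nonneg: "0 \<le> N \<omega>" by (simp add: N_def)

text \<open>With the exact minimizers in place of the chosen directions the expression vanishes
  identically by \<open>r1\<close> and \<open>r2\<close>. Subtracting this zero leaves differences
  between directions and minimizers only.\<close>

lemma linear_part:
  assumes A: "0 < A (\<xi> \<omega>)" "A (\<xi> \<omega>) \<le> c2"
    and r1: "A (\<xi> \<omega>) * (1 + \<alpha>0 \<omega>) = a * (1 + \<beta>0 \<omega>)"
    and r2: "y * F \<omega> - A (\<xi> \<omega>) * (\<alpha>d \<omega> + x * F \<omega>) * (y / x) = w * (1 + \<beta>0 \<omega>) + \<beta>d \<omega>"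
  shows "\<bar>Y \<pi> \<omega> - snd \<pi> * F \<omega> + A (\<xi> \<omega>) * (X \<pi> \<omega> + snd \<pi> * F \<omega>)\<bar> \<le> K1 * N \<omega> * nrm \<pi>"
proof -
  define s t B where "s = fst \<pi>" and "t = snd \<pi>" and "B = A (\<xi> \<omega>)"
  have u: "dy \<pi> * (1 + \<beta>0 \<omega>) + t * \<beta>d \<omega> = - (y / x) * s * (B * (1 + \<alpha>0 \<omega>)) + t * (y * F \<omega> - B * (\<alpha>d \<omega> + x * F \<omega>) * (y / x))"
    unfolding r1[folded B_def] r2[folded B_def] dy_def s_def[symmetric] t_def[symmetric]
    by (simp add: algebra_simps add_divide_distrib)
  have z: "(dy \<pi> * (1 + \<beta>0 \<omega>) + t * \<beta>d \<omega>) / y - t * F \<omega> + B * ((s * (1 + \<alpha>0 \<omega>) + t * \<alpha>d \<omega>) / x + t * F \<omega>) = 0"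
    unfolding u using xy_pos by (simp add: field_simps)
  have "Y \<pi> \<omega> - t * F \<omega> + B * (X \<pi> \<omega> + t * F \<omega>) =
     Y \<pi> \<omega> - t * F \<omega> + B * (X \<pi> \<omega> + t * F \<omega>) - ((dy \<pi> * (1 + \<beta>0 \<omega>) + t * \<beta>d \<omega>) / y - t * F \<omega> + B * ((s * (1 + \<alpha>0 \<omega>) + t * \<alpha>d \<omega>) / x + t * F \<omega>))"
    unfolding z by simp
  also have "\<dots> = (dy \<pi> * (b1 \<omega> - \<beta>0 \<omega>) + t * (b2 \<omega> - \<beta>d \<omega>)) / y + B * ((s * (a1 \<omega> - \<alpha>0 \<omega>) + t * (a2 \<omega> - \<alpha>d \<omega>)) / x)"
    unfolding X_def Y_def s_def[symmetric] t_def[symmetric] by (simp add: diff_divide_distrib add_divide_distrib algebra_simps)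
  finally have eq: "Y \<pi> \<omega> - t * F \<omega> + B * (X \<pi> \<omega> + t * F \<omega>)
    = (dy \<pi> * (b1 \<omega> - \<beta>0 \<omega>) + t * (b2 \<omega> - \<beta>d \<omega>)) / y + B * ((s * (a1 \<omega> - \<alpha>0 \<omega>) + t * (a2 \<omega> - \<alpha>d \<omega>)) / x)" .
  define D where "D = \<bar>a * y / x\<bar> + \<bar>w\<bar>"
  have K1e: "K1 = (D + 1) / y + c2 / x" by (simp add: K1_def D_def)
  have D: "0 \<le> D" "\<bar>dy \<pi>\<bar> \<le> D * nrm \<pi>" using abs_dy_le by (auto simp: D_def)
  have n: "0 \<le> nrm \<pi>" "\<bar>s\<bar> \<le> nrm \<pi>" "\<bar>t\<bar> \<le> nrm \<pi>" by (auto simp: s_def t_def)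
  have Nb: "\<bar>b1 \<omega> - \<beta>0 \<omega>\<bar> + \<bar>b2 \<omega> - \<beta>d \<omega>\<bar> \<le> N \<omega>" "\<bar>a1 \<omega> - \<alpha>0 \<omega>\<bar> + \<bar>a2 \<omega> - \<alpha>d \<omega>\<bar> \<le> N \<omega>"
    by (auto simp: N_def)
  have Dn: "0 \<le> (D + 1) * nrm \<pi>" using D n by auto
  have "\<bar>dy \<pi> * (b1 \<omega> - \<beta>0 \<omega>) + t * (b2 \<omega> - \<beta>d \<omega>)\<bar> \<le> \<bar>dy \<pi>\<bar> * \<bar>b1 \<omega> - \<beta>0 \<omega>\<bar> + \<bar>t\<bar> * \<bar>b2 \<omega> - \<beta>d \<omega>\<bar>"
    by (rule order_trans[OF abs_triangle_ineq]) (simp add: abs_mult)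
  also have "\<dots> \<le> (D + 1) * nrm \<pi> * \<bar>b1 \<omega> - \<beta>0 \<omega>\<bar> + (D + 1) * nrm \<pi> * \<bar>b2 \<omega> - \<beta>d \<omega>\<bar>"
  proof (intro add_mono mult_right_mono abs_ge_zero)
    show "\<bar>dy \<pi>\<bar> \<le> (D + 1) * nrm \<pi>" using D(2) n(1) by (simp only: distrib_right)
    have "0 \<le> D * nrm \<pi>" using D(1) n(1) by (rule mult_nonneg_nonneg)
    then show "\<bar>t\<bar> \<le> (D + 1) * nrm \<pi>" using n(3) by (simp only: distrib_right)
  qed
  also have "\<dots> = (D + 1) * nrm \<pi> * (\<bar>b1 \<omega> - \<beta>0 \<omega>\<bar> + \<bar>b2 \<omega> - \<beta>d \<omega>\<bar>)" by (simp only: distrib_left)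
  also have "\<dots> \<le> (D + 1) * nrm \<pi> * N \<omega>" by (rule mult_left_mono[OF Nb(1) Dn])
  finally have 1: "\<bar>(dy \<pi> * (b1 \<omega> - \<beta>0 \<omega>) + t * (b2 \<omega> - \<beta>d \<omega>)) / y\<bar> \<le> (D + 1) * nrm \<pi> * N \<omega> / y"
    unfolding abs_divide using xy_pos by (simp add: divide_right_mono)
  have "\<bar>s * (a1 \<omega> - \<alpha>0 \<omega>) + t * (a2 \<omega> - \<alpha>d \<omega>)\<bar> \<le> \<bar>s\<bar> * \<bar>a1 \<omega> - \<alpha>0 \<omega>\<bar> + \<bar>t\<bar> * \<bar>a2 \<omega> - \<alpha>d \<omega>\<bar>"
    by (rule order_trans[OF abs_triangle_ineq]) (simp add: abs_mult)
  also have "\<dots> \<le> nrm \<pi> * \<bar>a1 \<omega> - \<alpha>0 \<omega>\<bar> + nrm \<pi> * \<bar>a2 \<omega> - \<alpha>d \<omega>\<bar>"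
    by (intro add_mono mult_right_mono n abs_ge_zero)
  also have "\<dots> = nrm \<pi> * (\<bar>a1 \<omega> - \<alpha>0 \<omega>\<bar> + \<bar>a2 \<omega> - \<alpha>d \<omega>\<bar>)" by (simp only: distrib_left)
  also have "\<dots> \<le> nrm \<pi> * N \<omega>" by (rule mult_left_mono[OF Nb(2) n(1)])
  finally have "\<bar>(s * (a1 \<omega> - \<alpha>0 \<omega>) + t * (a2 \<omega> - \<alpha>d \<omega>)) / x\<bar> \<le> nrm \<pi> * N \<omega> / x"
    unfolding abs_divide using xy_pos by (simp add: divide_right_mono)
  then have 2: "\<bar>B * ((s * (a1 \<omega> - \<alpha>0 \<omega>) + t * (a2 \<omega> - \<alpha>d \<omega>)) / x)\<bar> \<le> c2 * (nrm \<pi> * N \<omega> / x)"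
    unfolding abs_mult using A xy_pos N_nonneg[of \<omega>] n(1) by (intro mult_mono) (auto simp: B_def)
  have "\<bar>Y \<pi> \<omega> - t * F \<omega> + B * (X \<pi> \<omega> + t * F \<omega>)\<bar> \<le> (D + 1) * nrm \<pi> * N \<omega> / y + c2 * (nrm \<pi> * N \<omega> / x)"
    unfolding eq using 1 2 by linarith
  also have "\<dots> = K1 * N \<omega> * nrm \<pi>" by (simp add: K1e algebra_simps add_divide_distrib)
  finally show ?thesis by (simp add: t_def B_def)
qed

text \<open>The linear part is at most \<open>K1 * N\<close> times the perturbation, the quadratic
  terms and the term with G are of second order, and the remainder of ln p is of lower order at each
  fixed \<omega>. The maximum with 0 records that only an upper limit is controlled.\<close>

lemma rate_asymptotics:
  "AE \<omega> in M. ((\<lambda>\<pi>. max 0 (\<bar>r \<pi> \<omega>\<bar> / nrm \<pi> - K1 * N \<omega>)) \<longlongrightarrow> 0) (at (0,0))"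
  using K(2) pos(1) rel1 rel2
proof eventually_elim
  case (elim \<omega>)
  note XYb = elim(1) and rels = elim(3,4)
  define t where "t = \<xi> \<omega>"
  have t: "0 < t" using elim(2) by (simp add: t_def)
  note A = A_pos[OF t] A_le[OF t]
  show ?case
  proof (rule tendstoI)
    fix e :: real assume e: "0 < e"
    \<comment> \<open>Larger than \<open>2 * K + S \<omega>\<close>, so a remainder of accuracy
      \<open>e / (3 * Q)\<close> contributes at most a third of \<open>e\<close>. Another third goes
      to the second-order terms, whose coefficients are collected in \<open>C\<close>; the last
      third makes the final inequality strict.\<close>
    define Q where "Q = 2 * K + S \<omega> + 1"
    define e' where "e' = e / (3 * Q)"
    have D: "0 < Q" unfolding Q_def using K(1) S_nonneg[of \<omega>] by linarith
    have e': "0 < e'" "e' * (2 * K + S \<omega>) \<le> e / 3"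
    proof -
      show "0 < e'" using e D by (simp add: e'_def)
      then have "e' * (2 * K + S \<omega>) \<le> e' * Q" by (intro mult_left_mono) (auto simp: Q_def)
      also have "\<dots> = e / 3" using D by (simp add: e'_def)
      finally show "e' * (2 * K + S \<omega>) \<le> e / 3" .
    qed
    from ln_p_expansion[OF t e'(1)] obtain d where d: "0 < d"
      "\<forall>z. \<bar>z\<bar> < d \<longrightarrow> \<bar>ln (p (t * exp z)) - ln (p t) + A t * z\<bar> \<le> e' * \<bar>z\<bar>" by blast
    define C where "C = (2 + 2 * c2) * K\<^sup>2 + (1 + c2) * S \<omega> + 1"
    have C: "0 < C" using c2_pos S_nonneg[of \<omega>] by (simp add: C_def add_nonneg_pos)
    have "eventually (\<lambda>\<pi>. nrm \<pi> < min e0 (min (d / Q) (e / (3 * C)))) (at (0,0))"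
      by (rule nrm_small_00) (use e0_pos d D e C in auto)
    then show "eventually (\<lambda>\<pi>. dist (max 0 (\<bar>r \<pi> \<omega>\<bar> / nrm \<pi> - K1 * N \<omega>)) 0 < e) (at (0,0))"
      using nrm_pos_00
    proof eventually_elim
      case (elim \<pi>)
      define n where "n = nrm \<pi>"
      have n: "0 < n" "n \<le> e0" "n < d / Q" "n < e / (3 * C)" using elim by (auto simp: n_def)
      have nK: "K * n \<le> 1/2" "n \<le> 1" using e0_props[of \<pi>] n by (auto simp: n_def)
      have XY: "\<bar>X \<pi> \<omega>\<bar> \<le> K * n" "\<bar>Y \<pi> \<omega>\<bar> \<le> K * n" using spec[OF XYb, of \<pi>] by (auto simp: n_def)
      then have h: "\<bar>X \<pi> \<omega>\<bar> \<le> 1/2" "\<bar>Y \<pi> \<omega>\<bar> \<le> 1/2" using nK by auto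
      have l: "\<bar>ln (L \<pi> \<omega>)\<bar> \<le> n * S \<omega>"
        unfolding L_def S_def n_def by (rule abs_ln_Ldelta_le) (use nK in \<open>auto simp: n_def\<close>)
      have xl: "2 * \<bar>X \<pi> \<omega>\<bar> + \<bar>ln (L \<pi> \<omega>)\<bar> \<le> n * (2 * K + S \<omega>)" using XY l by (simp add: algebra_simps)
      also have "\<dots> < n * Q" using n by (intro mult_strict_left_mono) (auto simp: Q_def)
      also have "\<dots> < d" using n(3) D by (simp add: pos_less_divide_eq)
      finally have small: "2 * \<bar>X \<pi> \<omega>\<bar> + \<bar>ln (L \<pi> \<omega>)\<bar> < d" .
      have 1: "\<bar>r \<pi> \<omega> - (Y \<pi> \<omega> + ln (L \<pi> \<omega>) + A t * (X \<pi> \<omega> - ln (L \<pi> \<omega>)))\<bar>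
        \<le> 2 * (Y \<pi> \<omega>)\<^sup>2 + 2 * c2 * (X \<pi> \<omega>)\<^sup>2 + e' * (2 * \<bar>X \<pi> \<omega>\<bar> + \<bar>ln (L \<pi> \<omega>)\<bar>)"
        unfolding r_def t_def[symmetric] using e' by (intro lograte_linear[OF t h L_pos d(2) small]) auto
      have sq: "(Y \<pi> \<omega>)\<^sup>2 \<le> (K * n)\<^sup>2" "(X \<pi> \<omega>)\<^sup>2 \<le> (K * n)\<^sup>2"
        using XY power_mono[of "\<bar>Y \<pi> \<omega>\<bar>" "K * n" 2] power_mono[of "\<bar>X \<pi> \<omega>\<bar>" "K * n" 2] by auto
      have "2 * (Y \<pi> \<omega>)\<^sup>2 + 2 * c2 * (X \<pi> \<omega>)\<^sup>2 + e' * (2 * \<bar>X \<pi> \<omega>\<bar> + \<bar>ln (L \<pi> \<omega>)\<bar>)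
        \<le> 2 * (K * n)\<^sup>2 + 2 * c2 * (K * n)\<^sup>2 + e' * (n * (2 * K + S \<omega>))"
        using sq xl c2_pos e' by (intro add_mono mult_left_mono) auto
      also have "\<dots> = (2 + 2 * c2) * K\<^sup>2 * n * n + e' * (2 * K + S \<omega>) * n" by (simp add: power2_eq_square algebra_simps)
      also have "\<dots> \<le> (2 + 2 * c2) * K\<^sup>2 * n * n + e / 3 * n"
        using e' n by (intro add_mono mult_right_mono order_refl) auto
      finally have 2: "\<bar>r \<pi> \<omega> - (Y \<pi> \<omega> + ln (L \<pi> \<omega>) + A t * (X \<pi> \<omega> - ln (L \<pi> \<omega>)))\<bar> \<le> (2 + 2 * c2) * K\<^sup>2 * n * n + e / 3 * n"
        using 1 by linarith
      have lnL: "ln (L \<pi> \<omega>) = - (snd \<pi> * F \<omega> + (snd \<pi>)\<^sup>2 / 2 * G \<omega>)" by (simp add: L_def Ldelta_def)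
      have 3: "Y \<pi> \<omega> + ln (L \<pi> \<omega>) + A t * (X \<pi> \<omega> - ln (L \<pi> \<omega>))
         = (Y \<pi> \<omega> - snd \<pi> * F \<omega> + A t * (X \<pi> \<omega> + snd \<pi> * F \<omega>)) + (A t - 1) * ((snd \<pi>)\<^sup>2 / 2 * G \<omega>)"
      proof -
        have "v + - (f + g) + B * (u - - (f + g)) = (v - f + B * (u + f)) + (B - 1) * g" for u v f g B :: real
          by (simp add: algebra_simps)
        then show ?thesis unfolding lnL .
      qed
      have 4: "\<bar>Y \<pi> \<omega> - snd \<pi> * F \<omega> + A t * (X \<pi> \<omega> + snd \<pi> * F \<omega>)\<bar> \<le> K1 * N \<omega> * n"
        unfolding n_def t_def using A by (intro linear_part rels) (auto simp: t_def)
      have 5: "\<bar>(A t - 1) * ((snd \<pi>)\<^sup>2 / 2 * G \<omega>)\<bar> \<le> (1 + c2) * (n * n * S \<omega>)"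
        unfolding abs_mult
      proof (rule mult_mono)
        show "\<bar>A t - 1\<bar> \<le> 1 + c2" using A by auto
        have "(snd \<pi>)\<^sup>2 = \<bar>snd \<pi>\<bar> * \<bar>snd \<pi>\<bar>" by (simp add: power2_eq_square)
        also have "\<dots> \<le> n * n" using n by (intro mult_mono) (auto simp: n_def)
        finally have "(snd \<pi>)\<^sup>2 / 2 \<le> n * n" using zero_le_power2[of "snd \<pi>"] by linarith
        then show "\<bar>(snd \<pi>)\<^sup>2 / 2\<bar> * \<bar>G \<omega>\<bar> \<le> n * n * S \<omega>" using n by (intro mult_mono) (auto simp: S_def)
      qed (use c2_pos in auto)
      have "\<bar>r \<pi> \<omega>\<bar> \<le> K1 * N \<omega> * n + (1 + c2) * (n * n * S \<omega>) + ((2 + 2 * c2) * K\<^sup>2 * n * n + e / 3 * n)"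
        using 2 4 5 unfolding 3 by linarith
      also have "\<dots> = (K1 * N \<omega> + e / 3 + ((2 + 2 * c2) * K\<^sup>2 + (1 + c2) * S \<omega>) * n) * n" by (simp add: algebra_simps)
      also have "\<dots> \<le> (K1 * N \<omega> + e / 3 + C * n) * n"
        using n by (intro mult_right_mono add_left_mono) (auto simp: C_def)
      also have "\<dots> \<le> (K1 * N \<omega> + e / 3 + e / 3) * n"
        using n C by (intro mult_right_mono add_left_mono) (auto simp: field_simps)
      finally have "\<bar>r \<pi> \<omega>\<bar> / n \<le> K1 * N \<omega> + e / 3 + e / 3" by (simp only: pos_divide_le_eq[OF n(1)])
      then show ?case using e by (simp add: n_def dist_real_def)
    qed
  qed
qed


lemma gap_bound:
  "AE \<omega> in M. \<forall>\<pi>. nrm \<pi> \<le> e0 \<longrightarrow>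
     xt \<pi> \<omega> * et \<pi> \<omega> - U (xt \<pi> \<omega>) - W (et \<pi> \<omega>)
       \<le> 4 / c1 * (\<xi> \<omega> * \<eta> \<omega> * ((r \<pi> \<omega>)\<^sup>2 * exp ((1 / c1 + 1) * \<bar>r \<pi> \<omega>\<bar>)))"
  using ratio_bounds pos dual
proof eventually_elim
  case (elim \<omega>)
  show ?case
  proof (intro allI impI)
    fix \<pi> assume e: "nrm \<pi> \<le> e0"
    note b = spec[OF elim(1), of \<pi>, THEN mp, OF e]
    have r: "r \<pi> \<omega> = ln (et \<pi> \<omega>) - ln (p (xt \<pi> \<omega>))"
      using elim(4) by (simp add: r_def lograte_def xt_def et_def)
    let ?T = "1 / c1 * (r \<pi> \<omega>)\<^sup>2 * exp ((1 / c1 + 1) * \<bar>r \<pi> \<omega>\<bar>)"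
    have T: "0 \<le> ?T" using c1_pos by simp
    have "(1 + X \<pi> \<omega>) * (1 + Y \<pi> \<omega>) \<le> 2 * 2" using b by (intro mult_mono) auto
    then have "\<xi> \<omega> * \<eta> \<omega> * ((1 + X \<pi> \<omega>) * (1 + Y \<pi> \<omega>)) \<le> \<xi> \<omega> * \<eta> \<omega> * 4"
      using elim(2,3) by (intro mult_left_mono) auto
    then have "xt \<pi> \<omega> * et \<pi> \<omega> * ?T \<le> \<xi> \<omega> * \<eta> \<omega> * 4 * ?T"
      unfolding xt_et_eq using T by (rule mult_right_mono)
    moreover have "xt \<pi> \<omega> * et \<pi> \<omega> - U (xt \<pi> \<omega>) - W (et \<pi> \<omega>) \<le> xt \<pi> \<omega> * et \<pi> \<omega> * ?T"
      using b by (intro gap_upper_exp r) auto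
    ultimately show "xt \<pi> \<omega> * et \<pi> \<omega> - U (xt \<pi> \<omega>) - W (et \<pi> \<omega>)
       \<le> 4 / c1 * (\<xi> \<omega> * \<eta> \<omega> * ((r \<pi> \<omega>)\<^sup>2 * exp ((1 / c1 + 1) * \<bar>r \<pi> \<omega>\<bar>)))"
      by (simp add: mult_ac)
  qed
qed

lemma exp_S_integrable: "integrable M (\<lambda>\<omega>. \<xi> \<omega> * \<eta> \<omega> * exp (c * (1 + S \<omega>)))"
proof -
  have "(\<lambda>\<omega>. \<xi> \<omega> * \<eta> \<omega> * exp (c * (1 + S \<omega>))) = (\<lambda>\<omega>. exp c * (\<xi> \<omega> * \<eta> \<omega> * exp (c * (\<bar>F \<omega>\<bar> + \<bar>G \<omega>\<bar>))))"
    by (simp add: S_def distrib_left exp_add mult_ac)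
  then show ?thesis using expi by simp
qed

text \<open>Since \<eta> = p(\<xi>), the increment bound carries the weight \<xi> \<eta>, and its
  exponent stays below c (1 + S) by the choice of \<open>e0\<close>.\<close>

lemma U_xt_integrable:
  assumes e: "nrm \<pi> \<le> e0" and nn: "\<And>\<omega>. \<omega> \<in> space M \<Longrightarrow> 0 \<le> xt \<pi> \<omega>"
  shows "integrable M (\<lambda>\<omega>. U (xt \<pi> \<omega>))"
proof (rule Bochner_Integration.integrable_bound)
  show "integrable M (\<lambda>\<omega>. \<bar>U (\<xi> \<omega>)\<bar> + \<xi> \<omega> * \<eta> \<omega> * exp (c * (1 + S \<omega>)))"
    using Ui exp_S_integrable by auto
  show "(\<lambda>\<omega>. U (xt \<pi> \<omega>)) \<in> borel_measurable M"
    by (rule borel_measurable_comp_nonneg[OF xt_measurable nn U_measurable])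
  show "AE \<omega> in M. norm (U (xt \<pi> \<omega>)) \<le> norm (\<bar>U (\<xi> \<omega>)\<bar> + \<xi> \<omega> * \<eta> \<omega> * exp (c * (1 + S \<omega>)))"
    using ratio_bounds pos dual
  proof eventually_elim
    case (elim \<omega>)
    note b = spec[OF elim(1), of \<pi>, THEN mp, OF e]
    let ?l = "(1 + X \<pi> \<omega>) / L \<pi> \<omega>"
    have "0 < ?l" using b L_pos[of \<pi> \<omega>] by auto
    from U_increment[OF elim(2) this] have
      1: "\<bar>U (xt \<pi> \<omega>) - U (\<xi> \<omega>)\<bar> \<le> \<xi> \<omega> * \<eta> \<omega> * exp ((c2 + 1) * \<bar>ln ?l\<bar>)" using elim(4) by (simp add: xt_def)
    have "(c2 + 1) * \<bar>ln ?l\<bar> \<le> (c2 + 1) * (R0 * nrm \<pi> * (1 + S \<omega>))" using b c2_pos by (intro mult_left_mono) auto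
    also have "\<dots> = (c2 + 1) * (R0 * nrm \<pi>) * (1 + S \<omega>)" by simp
    also have "\<dots> \<le> c * (1 + S \<omega>)" using e0_props(3)[OF e] S_nonneg[of \<omega>] by (intro mult_right_mono) auto
    finally have "exp ((c2 + 1) * \<bar>ln ?l\<bar>) \<le> exp (c * (1 + S \<omega>))" by simp
    then have "\<xi> \<omega> * \<eta> \<omega> * exp ((c2 + 1) * \<bar>ln ?l\<bar>) \<le> \<xi> \<omega> * \<eta> \<omega> * exp (c * (1 + S \<omega>))"
      using elim(2,3) by (intro mult_left_mono) auto
    then show ?case using 1 by simp
  qed
qed

lemma W_et_integrable:
  assumes e: "nrm \<pi> \<le> e0" and nn: "\<And>\<omega>. \<omega> \<in> space M \<Longrightarrow> 0 \<le> et \<pi> \<omega>"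
  shows "integrable M (\<lambda>\<omega>. W (et \<pi> \<omega>))"
proof (rule Bochner_Integration.integrable_bound)
  interpret Sw: utility_pair W U q p "\<lambda>s. 1 / A (q s)" "1 / c2" "1 / c1" by (rule swap)
  show "integrable M (\<lambda>\<omega>. \<bar>W (\<eta> \<omega>)\<bar> + \<xi> \<omega> * \<eta> \<omega> * exp (c * (1 + S \<omega>)))"
    using Wi exp_S_integrable by auto
  show "(\<lambda>\<omega>. W (et \<pi> \<omega>)) \<in> borel_measurable M"
    by (rule borel_measurable_comp_nonneg[OF et_measurable nn Sw.U_measurable])
  show "AE \<omega> in M. norm (W (et \<pi> \<omega>)) \<le> norm (\<bar>W (\<eta> \<omega>)\<bar> + \<xi> \<omega> * \<eta> \<omega> * exp (c * (1 + S \<omega>)))"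
    using ratio_bounds pos q_eta
  proof eventually_elim
    case (elim \<omega>)
    note b = spec[OF elim(1), of \<pi>, THEN mp, OF e]
    let ?l = "(1 + Y \<pi> \<omega>) * L \<pi> \<omega>"
    have "0 < ?l" using b L_pos[of \<pi> \<omega>] by auto
    from Sw.U_increment[OF elim(3) this] have
      1: "\<bar>W (et \<pi> \<omega>) - W (\<eta> \<omega>)\<bar> \<le> \<xi> \<omega> * \<eta> \<omega> * exp ((1 / c1 + 1) * \<bar>ln ?l\<bar>)" using elim(4) by (simp add: et_def mult_ac)
    have "(1 / c1 + 1) * \<bar>ln ?l\<bar> \<le> (1 / c1 + 1) * (R0 * nrm \<pi> * (1 + S \<omega>))" using b c1_pos by (intro mult_left_mono) auto
    also have "\<dots> = (1 / c1 + 1) * (R0 * nrm \<pi>) * (1 + S \<omega>)" by simp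
    also have "\<dots> \<le> c * (1 + S \<omega>)" using e0_props(4)[OF e] S_nonneg[of \<omega>] by (intro mult_right_mono) auto
    finally have "exp ((1 / c1 + 1) * \<bar>ln ?l\<bar>) \<le> exp (c * (1 + S \<omega>))" by simp
    then have "\<xi> \<omega> * \<eta> \<omega> * exp ((1 / c1 + 1) * \<bar>ln ?l\<bar>) \<le> \<xi> \<omega> * \<eta> \<omega> * exp (c * (1 + S \<omega>))"
      using elim(2,3) by (intro mult_left_mono) auto
    then show ?case using 1 by simp
  qed
qed

text \<open>The 4 is the number of summands of \<open>N\<close>: the square of a sum of four terms
  is at most four times the sum of squares.\<close>

lemma wtN_integrable:
  "integrable M (\<lambda>\<omega>. \<xi> \<omega> * \<eta> \<omega> * (N \<omega>)\<^sup>2)"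
  "(\<integral>\<omega>. \<xi> \<omega> * \<eta> \<omega> * (N \<omega>)\<^sup>2 \<partial>M) \<le> 4 * ((\<integral>\<omega>. \<xi> \<omega> * \<eta> \<omega> * (\<alpha>0 \<omega> - a1 \<omega>)\<^sup>2 \<partial>M) + (\<integral>\<omega>. \<xi> \<omega> * \<eta> \<omega> * (\<alpha>d \<omega> - a2 \<omega>)\<^sup>2 \<partial>M)
     + (\<integral>\<omega>. \<xi> \<omega> * \<eta> \<omega> * (\<beta>0 \<omega> - b1 \<omega>)\<^sup>2 \<partial>M) + (\<integral>\<omega>. \<xi> \<omega> * \<eta> \<omega> * (\<beta>d \<omega> - b2 \<omega>)\<^sup>2 \<partial>M))"
proof -
  define B where "B \<omega> = 4 * (\<xi> \<omega> * \<eta> \<omega> * (\<alpha>0 \<omega> - a1 \<omega>)\<^sup>2 + \<xi> \<omega> * \<eta> \<omega> * (\<alpha>d \<omega> - a2 \<omega>)\<^sup>2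
     + \<xi> \<omega> * \<eta> \<omega> * (\<beta>0 \<omega> - b1 \<omega>)\<^sup>2 + \<xi> \<omega> * \<eta> \<omega> * (\<beta>d \<omega> - b2 \<omega>)\<^sup>2)" for \<omega>
  have Bi: "integrable M B" unfolding B_def[abs_def] using ab_close by auto
  have sq: "(\<bar>a\<bar> + \<bar>b\<bar> + \<bar>c\<bar> + \<bar>d\<bar>)\<^sup>2 \<le> 4 * (a\<^sup>2 + b\<^sup>2 + c\<^sup>2 + d\<^sup>2)" for a b c d :: real
  proof -
    have "0 \<le> (\<bar>a\<bar> - \<bar>b\<bar>)\<^sup>2 + (\<bar>a\<bar> - \<bar>c\<bar>)\<^sup>2 + (\<bar>a\<bar> - \<bar>d\<bar>)\<^sup>2 + (\<bar>b\<bar> - \<bar>c\<bar>)\<^sup>2 + (\<bar>b\<bar> - \<bar>d\<bar>)\<^sup>2 + (\<bar>c\<bar> - \<bar>d\<bar>)\<^sup>2"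
      by simp
    also have "\<dots> = 4 * (\<bar>a\<bar>\<^sup>2 + \<bar>b\<bar>\<^sup>2 + \<bar>c\<bar>\<^sup>2 + \<bar>d\<bar>\<^sup>2) - (\<bar>a\<bar> + \<bar>b\<bar> + \<bar>c\<bar> + \<bar>d\<bar>)\<^sup>2"
      by (simp only: power2_eq_square ring_distribs mult_ac)
    finally show ?thesis by simp
  qed
  have le: "\<xi> \<omega> * \<eta> \<omega> * (N \<omega>)\<^sup>2 \<le> B \<omega>" "0 \<le> \<xi> \<omega> * \<eta> \<omega> * (N \<omega>)\<^sup>2" if "\<omega> \<in> space M" for \<omega>
  proof -
    have nn: "0 \<le> \<xi> \<omega> * \<eta> \<omega>" using \<xi>_nn[OF that] \<eta>_nn[OF that] by simp
    then show "0 \<le> \<xi> \<omega> * \<eta> \<omega> * (N \<omega>)\<^sup>2" by simp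
    have "(N \<omega>)\<^sup>2 \<le> 4 * ((\<alpha>0 \<omega> - a1 \<omega>)\<^sup>2 + (\<alpha>d \<omega> - a2 \<omega>)\<^sup>2 + (\<beta>0 \<omega> - b1 \<omega>)\<^sup>2 + (\<beta>d \<omega> - b2 \<omega>)\<^sup>2)"
      using sq[of "a1 \<omega> - \<alpha>0 \<omega>" "a2 \<omega> - \<alpha>d \<omega>" "b1 \<omega> - \<beta>0 \<omega>" "b2 \<omega> - \<beta>d \<omega>"] by (simp add: N_def power2_commute)
    from mult_left_mono[OF this nn] show "\<xi> \<omega> * \<eta> \<omega> * (N \<omega>)\<^sup>2 \<le> B \<omega>"
      by (simp add: B_def distrib_left mult_ac)
  qed
  show i: "integrable M (\<lambda>\<omega>. \<xi> \<omega> * \<eta> \<omega> * (N \<omega>)\<^sup>2)"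
  proof (rule Bochner_Integration.integrable_bound[OF Bi])
    show "AE \<omega> in M. norm (\<xi> \<omega> * \<eta> \<omega> * (N \<omega>)\<^sup>2) \<le> norm (B \<omega>)"
    proof (rule AE_I2)
      fix \<omega> assume "\<omega> \<in> space M"
      from le[OF this] show "norm (\<xi> \<omega> * \<eta> \<omega> * (N \<omega>)\<^sup>2) \<le> norm (B \<omega>)"
        unfolding real_norm_def by linarith
    qed
  qed measurable
  have "(\<integral>\<omega>. \<xi> \<omega> * \<eta> \<omega> * (N \<omega>)\<^sup>2 \<partial>M) \<le> (\<integral>\<omega>. B \<omega> \<partial>M)"
    by (rule integral_mono[OF i Bi]) (use le in auto)
  also have "\<dots> = 4 * ((\<integral>\<omega>. \<xi> \<omega> * \<eta> \<omega> * (\<alpha>0 \<omega> - a1 \<omega>)\<^sup>2 \<partial>M) + (\<integral>\<omega>. \<xi> \<omega> * \<eta> \<omega> * (\<alpha>d \<omega> - a2 \<omega>)\<^sup>2 \<partial>M)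
     + (\<integral>\<omega>. \<xi> \<omega> * \<eta> \<omega> * (\<beta>0 \<omega> - b1 \<omega>)\<^sup>2 \<partial>M) + (\<integral>\<omega>. \<xi> \<omega> * \<eta> \<omega> * (\<beta>d \<omega> - b2 \<omega>)\<^sup>2 \<partial>M))"
    unfolding B_def using ab_close by simp
  finally show "(\<integral>\<omega>. \<xi> \<omega> * \<eta> \<omega> * (N \<omega>)\<^sup>2 \<partial>M) \<le> 4 * ((\<integral>\<omega>. \<xi> \<omega> * \<eta> \<omega> * (\<alpha>0 \<omega> - a1 \<omega>)\<^sup>2 \<partial>M) + (\<integral>\<omega>. \<xi> \<omega> * \<eta> \<omega> * (\<alpha>d \<omega> - a2 \<omega>)\<^sup>2 \<partial>M)
     + (\<integral>\<omega>. \<xi> \<omega> * \<eta> \<omega> * (\<beta>0 \<omega> - b1 \<omega>)\<^sup>2 \<partial>M) + (\<integral>\<omega>. \<xi> \<omega> * \<eta> \<omega> * (\<beta>d \<omega> - b2 \<omega>)\<^sup>2 \<partial>M))" .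
qed


text \<open>Divided by the squared perturbation, the integrand of \<open>gap_bound\<close> has the
  pointwise upper limit \<open>K1\<^sup>2 * (N \<omega>)\<^sup>2\<close>, up to weight and constant.
  Only its excess over this value tends to 0, so dominated convergence is applied to the positive
  part of the excess, and \<kappa> absorbs the resulting integral.\<close>

lemma gap_integral_bound:
  assumes \<kappa>: "0 < \<kappa>"
  shows "eventually (\<lambda>\<pi>. (\<integral>\<omega>. xt \<pi> \<omega> * et \<pi> \<omega> - U (xt \<pi> \<omega>) - W (et \<pi> \<omega>) \<partial>M)
     \<le> 4 / c1 * (K1\<^sup>2 * (\<integral>\<omega>. \<xi> \<omega> * \<eta> \<omega> * (N \<omega>)\<^sup>2 \<partial>M) + \<kappa>) * (nrm \<pi>)\<^sup>2) (at (0,0))"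
proof -
  define k where "k = 1 / c1 + 1"
  have k: "0 < k" using c1_pos by (simp add: k_def add_pos_pos)
  define T where "T \<pi> \<omega> = (\<bar>r \<pi> \<omega>\<bar> / nrm \<pi>)\<^sup>2 * exp (k * \<bar>r \<pi> \<omega>\<bar>)" for \<pi> \<omega>
  \<comment> \<open>Dominated convergence is invoked with measurability and a majorant for every
    \<pi>. Where the candidates may be negative or the perturbation large, the integrand is
    therefore replaced by 0.\<close>
  define ok where "ok \<pi> \<longleftrightarrow> 0 < nrm \<pi> \<and> nrm \<pi> \<le> e0 \<and> (\<forall>\<omega>\<in>space M. 0 \<le> xt \<pi> \<omega>) \<and> (\<forall>\<omega>\<in>space M. 0 \<le> et \<pi> \<omega>)" for \<pi>
  define s where "s \<pi> \<omega> = (if ok \<pi> then \<xi> \<omega> * \<eta> \<omega> * max 0 (T \<pi> \<omega> - K1\<^sup>2 * (N \<omega>)\<^sup>2) else 0)" for \<pi> \<omega>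
  have evok: "eventually ok (at (0,0))"
    using nrm_pos_00 nrm_small_00[OF e0_pos] xt_member et_member
  proof eventually_elim
    case (elim \<pi>)
    have "0 \<le> xt \<pi> \<omega>" if "\<omega> \<in> space M" for \<omega>
      using pol_nonneg[of "\<lambda>\<omega>. xt \<pi> \<omega> * L \<pi> \<omega>", OF _ that] elim(3) L_pos[of \<pi> \<omega>] by (auto simp: zero_le_mult_iff)
    moreover have "0 \<le> et \<pi> \<omega>" if "\<omega> \<in> space M" for \<omega>
      using pol_nonneg[of "\<lambda>\<omega>. et \<pi> \<omega> / L \<pi> \<omega>", OF _ that] elim(4) L_pos[of \<pi> \<omega>] by (auto simp: zero_le_divide_iff)
    ultimately show ?case using elim(1,2) by (auto simp: ok_def)
  qed
  have rm: "r \<pi> \<in> borel_measurable M" if "ok \<pi>" for \<pi>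
  proof -
    have [measurable]: "(\<lambda>\<omega>. p (\<xi> \<omega>)) \<in> borel_measurable M"
      by (rule borel_measurable_comp_nonneg[OF \<xi>m \<xi>_nn p_measurable])
    have [measurable]: "(\<lambda>\<omega>. p (xt \<pi> \<omega>)) \<in> borel_measurable M"
      by (rule borel_measurable_comp_nonneg[OF xt_measurable _ p_measurable]) (use that in \<open>auto simp: ok_def\<close>)
    have "r \<pi> = (\<lambda>\<omega>. ln (p (\<xi> \<omega>) * (1 + Y \<pi> \<omega>) * L \<pi> \<omega>) - ln (p (xt \<pi> \<omega>)))"
      by (simp add: r_def lograte_def xt_def fun_eq_iff)
    also have "\<dots> \<in> borel_measurable M" by measurable
    finally show ?thesis .
  qed
  have sm: "s \<pi> \<in> borel_measurable M" for \<pi>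
  proof (cases "ok \<pi>")
    case True
    note [measurable] = rm[OF True]
    show ?thesis unfolding s_def[abs_def] T_def using True by simp
  qed (simp add: s_def[abs_def])
  \<comment> \<open>The value \<open>8 / c\<^sup>2\<close> is \<open>square_le_exp\<close> at the
    rate c / 2, applied to 1 + S; the remaining c / 2 pays for the factor
    \<open>exp (k * \<bar>r\<bar>)\<close>.\<close>
  define C where "C = R0\<^sup>2 * (8 / c\<^sup>2)"
  have dom: "AE \<omega> in M. \<forall>\<pi>. ok \<pi> \<longrightarrow> T \<pi> \<omega> \<le> C * exp (c * (1 + S \<omega>))"
    using ratio_bounds
  proof eventually_elim
    case (elim \<omega>)
    show ?case
    proof (intro allI impI)
      fix \<pi> assume ok: "ok \<pi>"
      then have e: "nrm \<pi> \<le> e0" "0 < nrm \<pi>" by (auto simp: ok_def)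
      note b = spec[OF elim, of \<pi>, THEN mp, OF e(1)]
      let ?S = "1 + S \<omega>"
      have S: "0 \<le> ?S" using S_nonneg[of \<omega>] by simp
      have rb: "\<bar>r \<pi> \<omega>\<bar> \<le> R0 * nrm \<pi> * ?S" using b by simp
      then have "\<bar>r \<pi> \<omega>\<bar> / nrm \<pi> \<le> R0 * ?S" using e(2) by (simp add: pos_divide_le_eq mult_ac)
      then have "(\<bar>r \<pi> \<omega>\<bar> / nrm \<pi>)\<^sup>2 \<le> (R0 * ?S)\<^sup>2" using e by (intro power_mono) auto
      also have "\<dots> = R0\<^sup>2 * ?S\<^sup>2" by (rule power_mult_distrib)
      also have "\<dots> \<le> R0\<^sup>2 * (2 / (c / 2)\<^sup>2 * exp (c / 2 * ?S))"
        using c_pos S by (intro mult_left_mono square_le_exp) auto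
      also have "\<dots> = C * exp (c / 2 * ?S)" by (simp add: C_def power_divide)
      finally have 1: "(\<bar>r \<pi> \<omega>\<bar> / nrm \<pi>)\<^sup>2 \<le> C * exp (c / 2 * ?S)" .
      have "k * \<bar>r \<pi> \<omega>\<bar> \<le> k * (R0 * nrm \<pi> * ?S)" using rb k by (intro mult_left_mono) auto
      also have "\<dots> = k * (R0 * nrm \<pi>) * ?S" by simp
      also have "\<dots> \<le> c / 2 * ?S" using e0_props(5)[OF e(1)] S unfolding k_def by (rule mult_right_mono)
      finally have 2: "exp (k * \<bar>r \<pi> \<omega>\<bar>) \<le> exp (c / 2 * ?S)" by simp
      have "T \<pi> \<omega> \<le> C * exp (c / 2 * ?S) * exp (c / 2 * ?S)"
        unfolding T_def by (rule mult_mono[OF 1 2]) (auto simp: C_def)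
      also have "\<dots> = C * exp (c * ?S)" by (simp add: exp_add[symmetric])
      finally show "T \<pi> \<omega> \<le> C * exp (c * ?S)" .
    qed
  qed
  have lim: "((\<lambda>\<pi>. \<integral>\<omega>. s \<pi> \<omega> \<partial>M) \<longlongrightarrow> 0) (at (0,0))"
  proof (rule dominated_convergence_00[OF sm, where w="\<lambda>\<omega>. C * (\<xi> \<omega> * \<eta> \<omega> * exp (c * (1 + S \<omega>)))"])
    show "integrable M (\<lambda>\<omega>. C * (\<xi> \<omega> * \<eta> \<omega> * exp (c * (1 + S \<omega>))))" using exp_S_integrable by auto
    show "AE \<omega> in M. \<bar>s \<pi> \<omega>\<bar> \<le> C * (\<xi> \<omega> * \<eta> \<omega> * exp (c * (1 + S \<omega>)))" for \<pi>
      using dom pos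
    proof eventually_elim
      case (elim \<omega>)
      have w: "0 \<le> \<xi> \<omega> * \<eta> \<omega>" using elim by simp
      have C: "0 \<le> C * exp (c * (1 + S \<omega>))" by (simp add: C_def)
      show ?case
      proof (cases "ok \<pi>")
        case True
        then have "T \<pi> \<omega> \<le> C * exp (c * (1 + S \<omega>))" using elim(1) by blast
        moreover have "0 \<le> K1\<^sup>2 * (N \<omega>)\<^sup>2" by simp
        ultimately have "max 0 (T \<pi> \<omega> - K1\<^sup>2 * (N \<omega>)\<^sup>2) \<le> C * exp (c * (1 + S \<omega>))" using C by linarith
        from mult_left_mono[OF this w] have "s \<pi> \<omega> \<le> \<xi> \<omega> * \<eta> \<omega> * (C * exp (c * (1 + S \<omega>)))"
          using True by (simp add: s_def)
        moreover have "0 \<le> s \<pi> \<omega>" using w by (simp add: s_def)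
        ultimately show ?thesis by (simp add: mult_ac)
      next
        case False
        then show ?thesis using mult_nonneg_nonneg[OF w C] by (simp add: s_def mult_ac)
      qed
    qed
    show "AE \<omega> in M. ((\<lambda>\<pi>. s \<pi> \<omega>) \<longlongrightarrow> 0) (at (0,0))"
      using rate_asymptotics ratio_bounds pos
    proof eventually_elim
      case (elim \<omega>)
      define m where "m \<pi> = max 0 (\<bar>r \<pi> \<omega>\<bar> / nrm \<pi> - K1 * N \<omega>)" for \<pi>
      have m: "(m \<longlongrightarrow> 0) (at (0,0))" using elim(1) by (simp add: m_def[abs_def])
      \<comment> \<open>A majorant of the excess that no longer involves \<open>r\<close>; it tends
        to 0 because \<open>m\<close> does and the exponential tends to 1.\<close>
      define B where "B \<pi> = (K1 * N \<omega> + m \<pi>)\<^sup>2 * exp (k * (R0 * nrm \<pi> * (1 + S \<omega>))) - K1\<^sup>2 * (N \<omega>)\<^sup>2" for \<pi>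
      have "(B \<longlongrightarrow> (K1 * N \<omega> + 0)\<^sup>2 * exp (k * (R0 * 0 * (1 + S \<omega>))) - K1\<^sup>2 * (N \<omega>)\<^sup>2) (at (0,0))"
        unfolding B_def[abs_def] by (intro tendsto_intros m nrm_tendsto_00)
      then have B: "(B \<longlongrightarrow> 0) (at (0,0))" by (simp add: power_mult_distrib)
      have "((\<lambda>\<pi>. \<xi> \<omega> * \<eta> \<omega> * \<bar>B \<pi>\<bar>) \<longlongrightarrow> \<xi> \<omega> * \<eta> \<omega> * \<bar>0\<bar>) (at (0,0))"
        by (intro tendsto_intros B)
      then have up: "((\<lambda>\<pi>. \<xi> \<omega> * \<eta> \<omega> * \<bar>B \<pi>\<bar>) \<longlongrightarrow> 0) (at (0,0))" by simp
      have w: "0 \<le> \<xi> \<omega> * \<eta> \<omega>" using elim by simp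
      show ?case
      proof (rule tendsto_sandwich[OF _ _ tendsto_const up])
        show "eventually (\<lambda>\<pi>. 0 \<le> s \<pi> \<omega>) (at (0,0))"
          using w by (intro always_eventually allI) (simp add: s_def)
        show "eventually (\<lambda>\<pi>. s \<pi> \<omega> \<le> \<xi> \<omega> * \<eta> \<omega> * \<bar>B \<pi>\<bar>) (at (0,0))"
          using evok
        proof eventually_elim
          fix \<pi> assume ok: "ok \<pi>"
          then have e: "nrm \<pi> \<le> e0" "0 < nrm \<pi>" by (auto simp: ok_def)
          note b = spec[OF elim(2), of \<pi>, THEN mp, OF e(1)]
          have q: "\<bar>r \<pi> \<omega>\<bar> / nrm \<pi> \<le> K1 * N \<omega> + m \<pi>" unfolding m_def by linarith
          have "0 \<le> \<bar>r \<pi> \<omega>\<bar> / nrm \<pi>" using e by simp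
          with q have sq: "(\<bar>r \<pi> \<omega>\<bar> / nrm \<pi>)\<^sup>2 \<le> (K1 * N \<omega> + m \<pi>)\<^sup>2" by (intro power_mono)
          have "k * \<bar>r \<pi> \<omega>\<bar> \<le> k * (R0 * nrm \<pi> * (1 + S \<omega>))" using b k by (intro mult_left_mono) auto
          then have "T \<pi> \<omega> \<le> (K1 * N \<omega> + m \<pi>)\<^sup>2 * exp (k * (R0 * nrm \<pi> * (1 + S \<omega>)))"
            unfolding T_def using sq by (intro mult_mono) auto
          then have "T \<pi> \<omega> - K1\<^sup>2 * (N \<omega>)\<^sup>2 \<le> B \<pi>" unfolding B_def by simp
          then have "max 0 (T \<pi> \<omega> - K1\<^sup>2 * (N \<omega>)\<^sup>2) \<le> \<bar>B \<pi>\<bar>" by linarith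
          from mult_left_mono[OF this w] show "s \<pi> \<omega> \<le> \<xi> \<omega> * \<eta> \<omega> * \<bar>B \<pi>\<bar>" using ok by (simp add: s_def)
        qed
      qed
    qed
  qed
  show ?thesis
    using evok order_tendstoD(2)[OF lim \<kappa>]
  proof eventually_elim
    case (elim \<pi>)
    then have e: "nrm \<pi> \<le> e0" "0 < nrm \<pi>" and nn: "\<And>\<omega>. \<omega>\<in>space M \<Longrightarrow> 0 \<le> xt \<pi> \<omega>" "\<And>\<omega>. \<omega>\<in>space M \<Longrightarrow> 0 \<le> et \<pi> \<omega>" by (auto simp: ok_def)
    note [measurable] = rm[OF elim(1)]
    have si: "integrable M (s \<pi>)"
    proof (rule Bochner_Integration.integrable_bound[OF _ sm])
      show "integrable M (\<lambda>\<omega>. C * (\<xi> \<omega> * \<eta> \<omega> * exp (c * (1 + S \<omega>))))" using exp_S_integrable by auto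
      show "AE \<omega> in M. norm (s \<pi> \<omega>) \<le> norm (C * (\<xi> \<omega> * \<eta> \<omega> * exp (c * (1 + S \<omega>))))"
        using dom pos
      proof eventually_elim
        fix \<omega> assume d: "\<forall>\<pi>. ok \<pi> \<longrightarrow> T \<pi> \<omega> \<le> C * exp (c * (1 + S \<omega>))" "0 < \<xi> \<omega>" "0 < \<eta> \<omega>"
        have w: "0 \<le> \<xi> \<omega> * \<eta> \<omega>" using d by simp
        have C: "0 \<le> C * exp (c * (1 + S \<omega>))" by (simp add: C_def)
        have "T \<pi> \<omega> \<le> C * exp (c * (1 + S \<omega>))" using d(1) elim(1) by blast
        moreover have "0 \<le> K1\<^sup>2 * (N \<omega>)\<^sup>2" by simp
        ultimately have "max 0 (T \<pi> \<omega> - K1\<^sup>2 * (N \<omega>)\<^sup>2) \<le> C * exp (c * (1 + S \<omega>))" using C by linarith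
        from mult_left_mono[OF this w] have "s \<pi> \<omega> \<le> \<xi> \<omega> * \<eta> \<omega> * (C * exp (c * (1 + S \<omega>)))"
          using elim(1) by (simp add: s_def)
        moreover have "0 \<le> s \<pi> \<omega>" using w by (simp add: s_def)
        ultimately have "\<bar>s \<pi> \<omega>\<bar> \<le> C * (\<xi> \<omega> * \<eta> \<omega> * exp (c * (1 + S \<omega>)))" by (simp add: mult_ac)
        then show "norm (s \<pi> \<omega>) \<le> norm (C * (\<xi> \<omega> * \<eta> \<omega> * exp (c * (1 + S \<omega>))))" by simp
      qed
    qed
    let ?g = "\<lambda>\<omega>. xt \<pi> \<omega> * et \<pi> \<omega> - U (xt \<pi> \<omega>) - W (et \<pi> \<omega>)"
    have gi: "integrable M ?g" using xt_et_integral(1) U_xt_integrable[OF e(1) nn(1)] W_et_integrable[OF e(1) nn(2)] by auto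
    let ?h = "\<lambda>\<omega>. 4 / c1 * (nrm \<pi>)\<^sup>2 * (K1\<^sup>2 * (\<xi> \<omega> * \<eta> \<omega> * (N \<omega>)\<^sup>2) + s \<pi> \<omega>)"
    have hi: "integrable M ?h" using wtN_integrable(1) si by auto
    have "(\<integral>\<omega>. ?g \<omega> \<partial>M) \<le> (\<integral>\<omega>. ?h \<omega> \<partial>M)"
    proof (rule integral_mono_AE[OF gi hi])
      show "AE \<omega> in M. ?g \<omega> \<le> ?h \<omega>" using gap_bound pos
      proof eventually_elim
        fix \<omega> assume g: "\<forall>\<pi>. nrm \<pi> \<le> e0 \<longrightarrow> xt \<pi> \<omega> * et \<pi> \<omega> - U (xt \<pi> \<omega>) - W (et \<pi> \<omega>)
             \<le> 4 / c1 * (\<xi> \<omega> * \<eta> \<omega> * ((r \<pi> \<omega>)\<^sup>2 * exp ((1 / c1 + 1) * \<bar>r \<pi> \<omega>\<bar>)))"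
          and w0: "0 < \<xi> \<omega>" "0 < \<eta> \<omega>"
        have "?g \<omega> \<le> 4 / c1 * (\<xi> \<omega> * \<eta> \<omega> * ((r \<pi> \<omega>)\<^sup>2 * exp (k * \<bar>r \<pi> \<omega>\<bar>)))" using g e(1) unfolding k_def by blast
        also have "(r \<pi> \<omega>)\<^sup>2 * exp (k * \<bar>r \<pi> \<omega>\<bar>) = (nrm \<pi>)\<^sup>2 * T \<pi> \<omega>" using e(2) by (simp add: T_def power_divide)
        also have "4 / c1 * (\<xi> \<omega> * \<eta> \<omega> * ((nrm \<pi>)\<^sup>2 * T \<pi> \<omega>)) = 4 / c1 * (nrm \<pi>)\<^sup>2 * (\<xi> \<omega> * \<eta> \<omega> * T \<pi> \<omega>)" by simp
        also have "\<dots> \<le> ?h \<omega>"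
        proof (rule mult_left_mono)
          have "T \<pi> \<omega> \<le> K1\<^sup>2 * (N \<omega>)\<^sup>2 + max 0 (T \<pi> \<omega> - K1\<^sup>2 * (N \<omega>)\<^sup>2)" by linarith
          then have "\<xi> \<omega> * \<eta> \<omega> * T \<pi> \<omega> \<le> \<xi> \<omega> * \<eta> \<omega> * (K1\<^sup>2 * (N \<omega>)\<^sup>2 + max 0 (T \<pi> \<omega> - K1\<^sup>2 * (N \<omega>)\<^sup>2))"
            using w0 by (intro mult_left_mono) auto
          then show "\<xi> \<omega> * \<eta> \<omega> * T \<pi> \<omega> \<le> K1\<^sup>2 * (\<xi> \<omega> * \<eta> \<omega> * (N \<omega>)\<^sup>2) + s \<pi> \<omega>"
            using elim(1) by (simp add: s_def distrib_left mult_ac)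
        qed (use c1_pos in auto)
        finally show "?g \<omega> \<le> ?h \<omega>" .
      qed
    qed
    also have "(\<integral>\<omega>. ?h \<omega> \<partial>M) = 4 / c1 * (nrm \<pi>)\<^sup>2 * (K1\<^sup>2 * (\<integral>\<omega>. \<xi> \<omega> * \<eta> \<omega> * (N \<omega>)\<^sup>2 \<partial>M) + (\<integral>\<omega>. s \<pi> \<omega> \<partial>M))"
      using wtN_integrable(1) si by simp
    also have "\<dots> \<le> 4 / c1 * (nrm \<pi>)\<^sup>2 * (K1\<^sup>2 * (\<integral>\<omega>. \<xi> \<omega> * \<eta> \<omega> * (N \<omega>)\<^sup>2 \<partial>M) + \<kappa>)"
      using elim(2) c1_pos by (intro mult_left_mono) auto
    finally show ?case by (simp only: mult_ac)
  qed
qed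

end

text \<open>As m grows, the sets on which one of the three bounds fails shrink to a null set,
  \<open>f\<close> being positive almost surely and \<open>g\<close>, \<open>h\<close> real
  valued.\<close>

lemma (in prob_space) prob_large_set:
  assumes [measurable]: "f \<in> borel_measurable M" "g \<in> borel_measurable M" "h \<in> borel_measurable M"
    and pos: "AE \<omega> in M. 0 < f \<omega>" and \<rho>: "0 < (\<rho>::real)"
  shows "\<exists>m\<ge>1. prob {\<omega>\<in>space M. \<not> (1 / m \<le> f \<omega> \<and> g \<omega> \<le> m \<and> h \<omega> \<le> (m::real))} < \<rho>"
proof -
  define B where "B n = {\<omega>\<in>space M. \<not> (1 / real (Suc n) \<le> f \<omega> \<and> g \<omega> \<le> real (Suc n) \<and> h \<omega> \<le> real (Suc n))}" for n
  have [measurable]: "B n \<in> sets M" for n unfolding B_def by measurable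
  have "(\<lambda>n. \<integral>\<omega>. indicator (B n) \<omega> \<partial>M) \<longlonglongrightarrow> (\<integral>\<omega>. (0::real) \<partial>M)"
  proof (rule integral_dominated_convergence[where w="\<lambda>_. 1"])
    show "AE \<omega> in M. (\<lambda>n. indicator (B n) \<omega>) \<longlonglongrightarrow> (0::real)"
      using pos
    proof eventually_elim
      case (elim \<omega>)
      obtain k :: nat where k: "1 / f \<omega> + \<bar>g \<omega>\<bar> + \<bar>h \<omega>\<bar> < real k" using reals_Archimedean2 by blast
      have "indicator (B n) \<omega> = (0::real)" if "k \<le> n" for n
      proof -
        have n: "1 / f \<omega> + \<bar>g \<omega>\<bar> + \<bar>h \<omega>\<bar> < real (Suc n)" using k that by simp
        have "0 < 1 / f \<omega>" using elim by simp
        then have "1 / f \<omega> \<le> real (Suc n)" "g \<omega> \<le> real (Suc n)" "h \<omega> \<le> real (Suc n)" using n by linarith+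
        moreover from this(1) have "1 / real (Suc n) \<le> f \<omega>" using elim by (simp add: field_simps)
        ultimately show ?thesis by (simp add: B_def)
      qed
      then show ?case by (intro tendsto_eventually) (auto simp: eventually_sequentially)
    qed
  qed (auto simp: indicator_def)
  then have "(\<lambda>n. prob (B n)) \<longlonglongrightarrow> 0" by simp
  then have "eventually (\<lambda>n. prob (B n) < \<rho>) sequentially" using \<rho> by (rule order_tendstoD(2))
  then obtain n where "prob (B n) < \<rho>" by (auto simp: eventually_sequentially)
  then show ?thesis unfolding B_def by (intro exI[of _ "real (Suc n)"]) auto
qed

text \<open>Changing the sign of F and G inverts the factor, so the dual sets are primal sets of the
  exchanged problem.\<close>

lemma Ldelta_uminus: "Ldelta (\<lambda>\<omega>. - F \<omega>) (\<lambda>\<omega>. - G \<omega>) d \<omega> = 1 / Ldelta F G d \<omega>"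
proof -
  have "- (d * - F \<omega> + d\<^sup>2 / 2 * - G \<omega>) = - (- (d * F \<omega> + d\<^sup>2 / 2 * G \<omega>))" by (simp add: algebra_simps)
  then show ?thesis unfolding Ldelta_def by (simp only: exp_minus inverse_eq_divide)
qed

section \<open>Perturbed optimizers and almost optimal pairs\<close>

context perturbed_pairing
begin

lemma U_scaled_integrable:
  assumes d: "\<bar>d\<bar> \<le> 1" "(c2 + 1) * \<bar>d\<bar> \<le> c" and b: "0 < b"
  shows "integrable M (\<lambda>\<omega>. U (b * (\<xi> \<omega> / Ldelta F G d \<omega>)))"
proof (rule Bochner_Integration.integrable_bound)
  define k where "k = exp ((c2 + 1) * \<bar>ln b\<bar>)"
  show "integrable M (\<lambda>\<omega>. \<bar>U (\<xi> \<omega>)\<bar> + k * (\<xi> \<omega> * \<eta> \<omega> * exp (c * (\<bar>F \<omega>\<bar> + \<bar>G \<omega>\<bar>))))"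
    using Ui expi by auto
  show "(\<lambda>\<omega>. U (b * (\<xi> \<omega> / Ldelta F G d \<omega>))) \<in> borel_measurable M"
    by (rule borel_measurable_comp_nonneg[OF _ _ U_measurable]) (use \<xi>_nn Ldelta_pos[of F G d] b in \<open>auto simp: less_imp_le\<close>)
  show "AE \<omega> in M. norm (U (b * (\<xi> \<omega> / Ldelta F G d \<omega>)))
     \<le> norm (\<bar>U (\<xi> \<omega>)\<bar> + k * (\<xi> \<omega> * \<eta> \<omega> * exp (c * (\<bar>F \<omega>\<bar> + \<bar>G \<omega>\<bar>))))"
    using pos dual
  proof eventually_elim
    case (elim \<omega>)
    let ?L = "Ldelta F G d \<omega>" and ?S = "\<bar>F \<omega>\<bar> + \<bar>G \<omega>\<bar>"
    have L: "0 < ?L" by (rule Ldelta_pos)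
    have "0 < b / ?L" using b L by simp
    from U_increment[OF elim(1) this] elim(3)
    have 1: "\<bar>U (b * (\<xi> \<omega> / ?L)) - U (\<xi> \<omega>)\<bar> \<le> \<xi> \<omega> * \<eta> \<omega> * exp ((c2 + 1) * \<bar>ln (b / ?L)\<bar>)"
      by (simp add: mult.commute)
    have "ln (b / ?L) = ln b - ln ?L" using b L by (simp add: ln_div)
    then have "\<bar>ln (b / ?L)\<bar> \<le> \<bar>ln b\<bar> + \<bar>d\<bar> * ?S" using abs_ln_Ldelta_le[OF order_refl d(1), of F G \<omega>] by linarith
    then have "(c2 + 1) * \<bar>ln (b / ?L)\<bar> \<le> (c2 + 1) * (\<bar>ln b\<bar> + \<bar>d\<bar> * ?S)"
      using c2_pos by (intro mult_left_mono) auto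
    also have "\<dots> = (c2 + 1) * \<bar>ln b\<bar> + (c2 + 1) * \<bar>d\<bar> * ?S" by (simp add: distrib_left)
    also have "\<dots> \<le> (c2 + 1) * \<bar>ln b\<bar> + c * ?S" using d(2) by (intro add_left_mono mult_right_mono) auto
    finally have "exp ((c2 + 1) * \<bar>ln (b / ?L)\<bar>) \<le> k * exp (c * ?S)" by (simp add: k_def flip: exp_add)
    then have "\<xi> \<omega> * \<eta> \<omega> * exp ((c2 + 1) * \<bar>ln (b / ?L)\<bar>) \<le> \<xi> \<omega> * \<eta> \<omega> * (k * exp (c * ?S))"
      using elim(1,2) by (intro mult_left_mono) auto
    then show ?case using 1 by (simp add: mult_ac)
  qed
qed

lemma W_scaled_integrable:
  assumes d: "\<bar>d\<bar> \<le> 1" "(1 / c1 + 1) * \<bar>d\<bar> \<le> c" and b: "0 < b"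
  shows "integrable M (\<lambda>\<omega>. W (b * (\<eta> \<omega> * Ldelta F G d \<omega>)))"
proof -
  interpret Sw: perturbed_pairing W U q p "\<lambda>s. 1 / A (q s)" "1 / c2" "1 / c1" M Ds Cs y x \<eta> \<xi>
    "\<lambda>\<omega>. - F \<omega>" "\<lambda>\<omega>. - G \<omega>" \<beta>0 \<beta>d \<alpha>0 \<alpha>d "1 / a" "x * w / (y * a)" c by (rule swap_pairing)
  show ?thesis using Sw.U_scaled_integrable[OF d(1) d(2) b] by (simp add: Ldelta_uminus)
qed

text \<open>C(x + \<Delta>x, \<delta>) in polar form; the two descriptions agree once x + \<Delta>x
  is positive.\<close>

definition feasible :: "real \<times> real \<Rightarrow> ('a \<Rightarrow> real) set" where
  "feasible \<pi> = {f. (\<lambda>\<omega>. f \<omega> * Ldelta F G (snd \<pi>) \<omega>) \<in> pol M Ds (x + fst \<pi>)}"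

text \<open>Leaves out the finiteness of the value contained in \<open>primal_opt\<close>, which
  weak duality supplies for small perturbations.\<close>

definition optimal :: "real \<times> real \<Rightarrow> ('a \<Rightarrow> real) \<Rightarrow> bool" where
  "optimal \<pi> f \<longleftrightarrow> f \<in> feasible \<pi> \<and> (\<forall>g\<in>feasible \<pi>. EU M (\<lambda>\<omega>. Uext U (g \<omega>)) \<le> EU M (\<lambda>\<omega>. Uext U (f \<omega>)))"

lemma feasible_L0plus: "f \<in> feasible \<pi> \<Longrightarrow> f \<in> L0plus M"
proof -
  assume "f \<in> feasible \<pi>"
  then have l: "(\<lambda>\<omega>. f \<omega> * Ldelta F G (snd \<pi>) \<omega>) \<in> L0plus M" by (auto simp: feasible_def pol_def)
  note L0plus_measurable[OF l, measurable]
  have "f = (\<lambda>\<omega>. (f \<omega> * Ldelta F G (snd \<pi>) \<omega>) / Ldelta F G (snd \<pi>) \<omega>)"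
    using Ldelta_pos[of F G "snd \<pi>"] by (simp add: fun_eq_iff less_imp_neq[symmetric])
  also have "\<dots> \<in> borel_measurable M" by measurable
  finally have "f \<in> borel_measurable M" .
  moreover have "0 \<le> f \<omega>" if "\<omega> \<in> space M" for \<omega>
    using L0plus_nonneg[OF l that] Ldelta_pos[of F G "snd \<pi>" \<omega>] by (simp add: zero_le_mult_iff)
  ultimately show ?thesis by (simp add: L0plus_def)
qed

lemma feasible_pairing:
  assumes "f \<in> feasible \<pi>" "0 < x + fst \<pi>" and h: "(\<lambda>\<omega>. h \<omega> / Ldelta F G (snd \<pi>) \<omega>) \<in> pol M Cs y'" "0 < y'"
  shows "integrable M (\<lambda>\<omega>. f \<omega> * h \<omega>)" "(\<integral>\<omega>. f \<omega> * h \<omega> \<partial>M) \<le> (x + fst \<pi>) * y'"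
proof -
  have eq: "(\<lambda>\<omega>. (f \<omega> * Ldelta F G (snd \<pi>) \<omega>) * (h \<omega> / Ldelta F G (snd \<pi>) \<omega>)) = (\<lambda>\<omega>. f \<omega> * h \<omega>)"
    using Ldelta_pos[of F G "snd \<pi>"] by (simp add: fun_eq_iff less_imp_neq[symmetric])
  have fp: "(\<lambda>\<omega>. f \<omega> * Ldelta F G (snd \<pi>) \<omega>) \<in> pol M Ds (x + fst \<pi>)" using assms(1) by (simp add: feasible_def)
  show "integrable M (\<lambda>\<omega>. f \<omega> * h \<omega>)" "(\<integral>\<omega>. f \<omega> * h \<omega> \<partial>M) \<le> (x + fst \<pi>) * y'"
    by (fact pol_pairing_integral[OF D_pol Cs_L0 fp h(1) h(2) assms(2), unfolded eq])+
qed

lemma small_perturbation: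
  "eventually (\<lambda>\<pi>. 0 < x + fst \<pi> \<and> \<bar>snd \<pi>\<bar> \<le> 1 \<and> (c2 + 1) * \<bar>snd \<pi>\<bar> \<le> c \<and> (1 / c1 + 1) * \<bar>snd \<pi>\<bar> \<le> c) (at (0,0))"
proof -
  have k: "0 < c2 + 1" "0 < 1 / c1 + 1" using c2_pos c1_pos by (auto simp: add_pos_pos)
  have "eventually (\<lambda>\<pi>. nrm \<pi> < x) (at (0,0))" "eventually (\<lambda>\<pi>. nrm \<pi> < 1) (at (0,0))"
    "eventually (\<lambda>\<pi>. nrm \<pi> < c / (c2 + 1)) (at (0,0))" "eventually (\<lambda>\<pi>. nrm \<pi> < c / (1 / c1 + 1)) (at (0,0))"
    by (intro nrm_small_00; use xy_pos c_pos k in simp)+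
  then show ?thesis
  proof eventually_elim
    case (elim \<pi>)
    note n = abs_fst_le_nrm[of \<pi>] abs_snd_le_nrm[of \<pi>]
    have "\<bar>snd \<pi>\<bar> \<le> c / (c2 + 1)" "\<bar>snd \<pi>\<bar> \<le> c / (1 / c1 + 1)" "\<bar>snd \<pi>\<bar> \<le> 1" "\<bar>fst \<pi>\<bar> < x" using n elim by linarith+
    then show ?case using k by (auto simp: pos_le_divide_eq mult.commute)
  qed
qed

text \<open>The price required by \<open>exists_maximizer\<close> is \<eta> L, whose pairing with
  feasible elements is bounded by (x + \<Delta>x) y. The unperturbed optimizer, rescaled to the new
  capital and divided by L, has finite expected utility, so the supremum is not -
  \<infinity>.\<close>

theorem optimal_exists: "eventually (\<lambda>\<pi>. \<exists>f. optimal \<pi> f) (at (0,0))"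
  using small_perturbation
proof eventually_elim
  case (elim \<pi>)
  define L where "L = Ldelta F G (snd \<pi>)"
  have L: "0 < L \<omega>" for \<omega> by (simp add: L_def Ldelta_pos)
  have [measurable]: "L \<in> borel_measurable M" unfolding L_def by measurable
  define x' where "x' = x + fst \<pi>"
  have x': "0 < x'" using elim by (simp add: x'_def)
  define f0 where "f0 \<omega> = x' / x * (\<xi> \<omega> / L \<omega>)" for \<omega>
  have "\<exists>f\<in>feasible \<pi>. \<forall>g\<in>feasible \<pi>. EU M (\<lambda>\<omega>. Uext U (g \<omega>)) \<le> EU M (\<lambda>\<omega>. Uext U (f \<omega>))"
  proof (rule exists_maximizer[where h="\<lambda>\<omega>. \<eta> \<omega> * L \<omega>" and K="x' * y" and ?f0.0=f0])
    show "prob_space M" by (rule prob_space_axioms)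
    show "feasible \<pi> \<subseteq> L0plus M" using feasible_L0plus by blast
    show "(\<lambda>\<omega>. (f \<omega> + g \<omega>) / 2) \<in> feasible \<pi>" if f: "f \<in> feasible \<pi>" and g: "g \<in> feasible \<pi>" for f g
    proof -
      have e: "(\<lambda>\<omega>. (f \<omega> + g \<omega>) / 2 * L \<omega>) = (\<lambda>\<omega>. 1 / 2 * (f \<omega> * L \<omega> + g \<omega> * L \<omega>))" by (auto simp: field_simps)
      have "(\<lambda>\<omega>. f \<omega> * L \<omega> + g \<omega> * L \<omega>) \<in> pol M Ds (x' + x')"
        by (rule pol_add[OF Ds_L0]) (use f g x' in \<open>auto simp: feasible_def L_def x'_def\<close>)
      from pol_scale[OF Ds_L0 this, of "1 / 2"] show ?thesis
        unfolding feasible_def mem_Collect_eq L_def[symmetric] x'_def[symmetric] e by simp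
    qed
    show "z \<in> feasible \<pi>" if Z: "\<And>n::nat. Z n \<in> feasible \<pi>" and z: "z \<in> L0plus M"
      and lim: "AE \<omega> in M. (\<lambda>n. Z n \<omega>) \<longlonglongrightarrow> z \<omega>" for Z z
    proof -
      have "(\<lambda>\<omega>. z \<omega> * L \<omega>) \<in> pol M Ds x'"
      proof (rule pol_lim[OF Ds_L0, where Z="\<lambda>n \<omega>. Z n \<omega> * L \<omega>"])
        show "(\<lambda>\<omega>. Z n \<omega> * L \<omega>) \<in> pol M Ds x'" for n using Z by (simp add: feasible_def L_def x'_def)
        show "(\<lambda>\<omega>. z \<omega> * L \<omega>) \<in> L0plus M" using z by (auto simp: L0plus_def intro!: mult_nonneg_nonneg less_imp_le[OF L])
        show "AE \<omega> in M. (\<lambda>n. Z n \<omega> * L \<omega>) \<longlonglongrightarrow> z \<omega> * L \<omega>"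
          using lim by eventually_elim (intro tendsto_intros)
      qed
      then show ?thesis by (simp add: feasible_def L_def x'_def)
    qed
    show "(\<lambda>\<omega>. \<eta> \<omega> * L \<omega>) \<in> borel_measurable M" by measurable
    show "AE \<omega> in M. 0 < \<eta> \<omega> * L \<omega>" using pos(2) by eventually_elim (simp add: L)
    show "(\<integral>\<^sup>+ \<omega>. ennreal (f \<omega> * (\<eta> \<omega> * L \<omega>)) \<partial>M) \<le> ennreal (x' * y)" if f: "f \<in> feasible \<pi>" for f
    proof -
      have "(\<lambda>\<omega>. f \<omega> * L \<omega>) \<in> pol M Ds x'" using f by (simp add: feasible_def L_def x'_def)
      from pol_pairing[OF D_pol Cs_L0 this \<eta> xy_pos(2) less_imp_le[OF x']] show ?thesis by (simp add: mult_ac)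
    qed
    show "0 \<le> x' * y" using x' xy_pos by simp
    show "integrable M (\<lambda>\<omega>. W (s * (\<eta> \<omega> * L \<omega>)))" if "0 < s" for s
      unfolding L_def by (rule W_scaled_integrable) (use elim that in auto)
    have "(\<lambda>\<omega>. f0 \<omega> * L \<omega>) = (\<lambda>\<omega>. x' / x * \<xi> \<omega>)" using L by (auto simp: f0_def fun_eq_iff less_imp_neq[symmetric])
    then show "f0 \<in> feasible \<pi>"
      using pol_scale[OF Ds_L0 \<xi>, of "x' / x"] x' xy_pos by (simp add: feasible_def L_def x'_def)
    have Ui: "integrable M (\<lambda>\<omega>. U (f0 \<omega>))" unfolding f0_def L_def
      by (rule U_scaled_integrable) (use elim x' xy_pos in auto)
    have AEf: "AE \<omega> in M. Uext U (f0 \<omega>) = ereal (U (f0 \<omega>))"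
      using pos(1) by eventually_elim (use L x' xy_pos in \<open>simp add: f0_def Uext_pos\<close>)
    have "f0 \<in> borel_measurable M" unfolding f0_def[abs_def] by measurable
    then have m: "(\<lambda>\<omega>. Uext U (f0 \<omega>)) \<in> borel_measurable M" by measurable
    have "ereal (\<integral>\<omega>. U (f0 \<omega>) \<partial>M) \<le> EU M (\<lambda>\<omega>. Uext U (f0 \<omega>))"
      by (rule EU_sandwich(1)[OF m Ui _ Ui]) (use AEf in \<open>eventually_elim, simp\<close>)+
    then show "EU M (\<lambda>\<omega>. Uext U (f0 \<omega>)) \<noteq> - \<infinity>" by auto
  qed
  then show ?case by (auto simp: optimal_def)
qed


text \<open>The claimed first-order expansion, multiplied by L and divided by \<xi>.\<close>

definition tangent_ratio :: "real \<times> real \<Rightarrow> 'a \<Rightarrow> real" where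
  "tangent_ratio \<pi> \<omega> = (x + fst \<pi> * (1 + \<alpha>0 \<omega>) + snd \<pi> * \<alpha>d \<omega>) / x"

text \<open>What is retained of an approximating pair once its directions are forgotten: feasibility
  with a saturated budget, a small gap, relative changes below 1/2, and closeness of the primal part
  to the tangent in the weighted L2 sense. The dual value \<open>y'\<close> stays unspecified, as
  only the primal part is compared with the expansion.\<close>

definition almost_optimal_pair where
  "almost_optimal_pair \<kappa> \<pi> f h y' \<longleftrightarrow> f \<in> feasible \<pi> \<and> 0 < x + fst \<pi> \<and> 0 < y' \<and>
     (\<lambda>\<omega>. h \<omega> / Ldelta F G (snd \<pi>) \<omega>) \<in> pol M Cs y' \<and>
     integrable M (\<lambda>\<omega>. U (f \<omega>)) \<and> integrable M (\<lambda>\<omega>. W (h \<omega>)) \<and>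
     (\<integral>\<omega>. f \<omega> * h \<omega> \<partial>M) = (x + fst \<pi>) * y' \<and>
     (\<integral>\<omega>. f \<omega> * h \<omega> - U (f \<omega>) - W (h \<omega>) \<partial>M) \<le> \<kappa> * (nrm \<pi>)\<^sup>2 \<and>
     (AE \<omega> in M. \<exists>X Y. \<bar>X\<bar> \<le> 1/2 \<and> \<bar>Y\<bar> \<le> 1/2 \<and> f \<omega> = \<xi> \<omega> * (1 + X) / Ldelta F G (snd \<pi>) \<omega> \<and>
        h \<omega> = \<eta> \<omega> * (1 + Y) * Ldelta F G (snd \<pi>) \<omega>) \<and>
     integrable M (\<lambda>\<omega>. \<xi> \<omega> * \<eta> \<omega> * (f \<omega> * Ldelta F G (snd \<pi>) \<omega> / \<xi> \<omega> - tangent_ratio \<pi> \<omega>)\<^sup>2) \<and>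
     (\<integral>\<omega>. \<xi> \<omega> * \<eta> \<omega> * (f \<omega> * Ldelta F G (snd \<pi>) \<omega> / \<xi> \<omega> - tangent_ratio \<pi> \<omega>)\<^sup>2 \<partial>M) \<le> \<kappa> * (nrm \<pi>)\<^sup>2"

lemma almost_optimal_pair_exists:
  assumes \<kappa>: "0 < \<kappa>"
  shows "eventually (\<lambda>\<pi>. \<exists>f h y'. almost_optimal_pair \<kappa> \<pi> f h y') (at (0,0))"
proof -
  \<comment> \<open>This is the constant \<open>K1\<close>, written out here because the accuracy
    \<open>e\<close> of the directions is chosen in terms of it before there are any
    directions.\<close>
  define k1 where "k1 = (\<bar>a * y / x\<bar> + \<bar>w\<bar> + 1) / y + c2 / x"
  \<comment> \<open>Four errors below \<open>e\<close> and the factor 4 of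
    \<open>wtN_integrable\<close> bound the weighted integral of \<open>N\<^sup>2\<close> by 16 e.
    One entry brings its share of the gap below \<kappa> / 2, with the other half left for dominated
    convergence; the other entry brings the squared distance to the tangent below \<kappa>.\<close>
  define e where "e = min (\<kappa> * c1 / (128 * (k1\<^sup>2 + 1))) (\<kappa> * x\<^sup>2 / 16)"
  have k1: "0 < k1\<^sup>2 + 1" by (simp add: add_nonneg_pos)
  have e: "0 < e" "k1\<^sup>2 * (16 * e) \<le> \<kappa> * c1 / 8" "16 * e \<le> \<kappa> * x\<^sup>2"
  proof -
    show "0 < e" unfolding e_def using \<kappa> c1_pos k1 xy_pos by simp
    have "e \<le> \<kappa> * c1 / (128 * (k1\<^sup>2 + 1))" unfolding e_def by (rule min.cobounded1)
    then have "(k1\<^sup>2 + 1) * (16 * e) \<le> \<kappa> * c1 / 8" using k1 by (simp add: pos_le_divide_eq algebra_simps)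
    moreover have "k1\<^sup>2 * (16 * e) \<le> (k1\<^sup>2 + 1) * (16 * e)" using \<open>0 < e\<close> by (intro mult_right_mono) auto
    ultimately show "k1\<^sup>2 * (16 * e) \<le> \<kappa> * c1 / 8" by linarith
    have "e \<le> \<kappa> * x\<^sup>2 / 16" unfolding e_def by (rule min.cobounded2)
    then show "16 * e \<le> \<kappa> * x\<^sup>2" by simp
  qed
  obtain a1 where a1: "a1 \<in> Dirs M (pol M Ds x) \<xi>" "integrable M (\<lambda>\<omega>. \<xi> \<omega> * \<eta> \<omega> * (\<alpha>0 \<omega> - a1 \<omega>)\<^sup>2)"
      "(\<integral>\<omega>. \<xi> \<omega> * \<eta> \<omega> * (\<alpha>0 \<omega> - a1 \<omega>)\<^sup>2 \<partial>M) < e" using app\<alpha>[of \<alpha>0, OF _ e(1)] by auto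
  obtain a2 where a2: "a2 \<in> Dirs M (pol M Ds x) \<xi>" "integrable M (\<lambda>\<omega>. \<xi> \<omega> * \<eta> \<omega> * (\<alpha>d \<omega> - a2 \<omega>)\<^sup>2)"
      "(\<integral>\<omega>. \<xi> \<omega> * \<eta> \<omega> * (\<alpha>d \<omega> - a2 \<omega>)\<^sup>2 \<partial>M) < e" using app\<alpha>[of \<alpha>d, OF _ e(1)] by auto
  obtain b1 where b1: "b1 \<in> Dirs M (pol M Cs y) \<eta>" "integrable M (\<lambda>\<omega>. \<xi> \<omega> * \<eta> \<omega> * (\<beta>0 \<omega> - b1 \<omega>)\<^sup>2)"
      "(\<integral>\<omega>. \<xi> \<omega> * \<eta> \<omega> * (\<beta>0 \<omega> - b1 \<omega>)\<^sup>2 \<partial>M) < e" using app\<beta>[of \<beta>0, OF _ e(1)] by auto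
  obtain b2 where b2: "b2 \<in> Dirs M (pol M Cs y) \<eta>" "integrable M (\<lambda>\<omega>. \<xi> \<omega> * \<eta> \<omega> * (\<beta>d \<omega> - b2 \<omega>)\<^sup>2)"
      "(\<integral>\<omega>. \<xi> \<omega> * \<eta> \<omega> * (\<beta>d \<omega> - b2 \<omega>)\<^sup>2 \<partial>M) < e" using app\<beta>[of \<beta>d, OF _ e(1)] by auto
  interpret Ap: approximants U W p q A c1 c2 M Cs Ds x y \<xi> \<eta> F G \<alpha>0 \<alpha>d \<beta>0 \<beta>d a w c a1 a2 b1 b2
    by unfold_locales (fact a1 a2 b1 b2)+
  define I where "I = (\<integral>\<omega>. \<xi> \<omega> * \<eta> \<omega> * (Ap.N \<omega>)\<^sup>2 \<partial>M)"
  have "I \<le> 16 * e" if "p1 < e" "p2 < e" "p3 < e" "p4 < e" "I \<le> 4 * (p1 + p2 + p3 + p4)" for p1 p2 p3 p4 :: real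
  proof -
    have "p1 + p2 + p3 + p4 \<le> 4 * e" using that(1-4) by simp
    then have "4 * (p1 + p2 + p3 + p4) \<le> 4 * (4 * e)" by (rule mult_left_mono) simp
    with that(5) show ?thesis by simp
  qed
  from this[OF a1(3) a2(3) b1(3) b2(3) Ap.wtN_integrable(2)[folded I_def]] have I: "I \<le> 16 * e" .
  have K1: "Ap.K1 = k1" by (simp add: Ap.K1_def k1_def)
  have gap_const: "4 / c1 * (k1\<^sup>2 * I + \<kappa> * c1 / 8) \<le> \<kappa>"
  proof -
    have "k1\<^sup>2 * I \<le> k1\<^sup>2 * (16 * e)" using I by (intro mult_left_mono) auto
    then have "k1\<^sup>2 * I + \<kappa> * c1 / 8 \<le> \<kappa> * c1 / 4" using e(2) by linarith
    then have "4 / c1 * (k1\<^sup>2 * I + \<kappa> * c1 / 8) \<le> 4 / c1 * (\<kappa> * c1 / 4)" using c1_pos by (intro mult_left_mono) auto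
    then show ?thesis using c1_pos by simp
  qed
  have kc: "0 < \<kappa> * c1 / 8" using \<kappa> c1_pos by simp
  show ?thesis
    using Ap.gap_integral_bound[OF kc] Ap.xt_member Ap.et_member nrm_small_00[OF Ap.e0_pos]
  proof eventually_elim
    case (elim \<pi>)
    have n: "nrm \<pi> \<le> Ap.e0" using elim(4) by simp
    have Le: "Ap.L \<pi> = Ldelta F G (snd \<pi>)" by (simp add: Ap.L_def)
    have nnx: "0 \<le> Ap.xt \<pi> \<omega>" if "\<omega> \<in> space M" for \<omega>
      using pol_nonneg[of "\<lambda>\<omega>. Ap.xt \<pi> \<omega> * Ap.L \<pi> \<omega>", OF _ that] elim(2) Ap.L_pos[of \<pi> \<omega>] by (auto simp: zero_le_mult_iff)
    have nne: "0 \<le> Ap.et \<pi> \<omega>" if "\<omega> \<in> space M" for \<omega>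
      using pol_nonneg[of "\<lambda>\<omega>. Ap.et \<pi> \<omega> / Ap.L \<pi> \<omega>", OF _ that] elim(3) Ap.L_pos[of \<pi> \<omega>] by (auto simp: zero_le_divide_iff)
    have sq_eq: "AE \<omega> in M. \<xi> \<omega> * \<eta> \<omega> * (Ap.xt \<pi> \<omega> * Ap.L \<pi> \<omega> / \<xi> \<omega> - tangent_ratio \<pi> \<omega>)\<^sup>2
       \<le> (nrm \<pi>)\<^sup>2 / x\<^sup>2 * (\<xi> \<omega> * \<eta> \<omega> * (Ap.N \<omega>)\<^sup>2)"
      using pos
    proof eventually_elim
      case (elim \<omega>)
      have "Ap.xt \<pi> \<omega> * Ap.L \<pi> \<omega> / \<xi> \<omega> = 1 + Ap.X \<pi> \<omega>"
        using elim Ap.L_pos[of \<pi> \<omega>] by (simp add: Ap.xt_def)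
      then have eq: "Ap.xt \<pi> \<omega> * Ap.L \<pi> \<omega> / \<xi> \<omega> - tangent_ratio \<pi> \<omega>
          = (fst \<pi> * (a1 \<omega> - \<alpha>0 \<omega>) + snd \<pi> * (a2 \<omega> - \<alpha>d \<omega>)) / x"
        using xy_pos by (simp add: Ap.X_def tangent_ratio_def field_simps)
      have "\<bar>fst \<pi> * (a1 \<omega> - \<alpha>0 \<omega>) + snd \<pi> * (a2 \<omega> - \<alpha>d \<omega>)\<bar> \<le> \<bar>fst \<pi>\<bar> * \<bar>a1 \<omega> - \<alpha>0 \<omega>\<bar> + \<bar>snd \<pi>\<bar> * \<bar>a2 \<omega> - \<alpha>d \<omega>\<bar>"
        by (rule order_trans[OF abs_triangle_ineq]) (simp add: abs_mult)
      also have "\<dots> \<le> nrm \<pi> * \<bar>a1 \<omega> - \<alpha>0 \<omega>\<bar> + nrm \<pi> * \<bar>a2 \<omega> - \<alpha>d \<omega>\<bar>"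
        by (intro add_mono mult_right_mono) auto
      also have "\<dots> = nrm \<pi> * (\<bar>a1 \<omega> - \<alpha>0 \<omega>\<bar> + \<bar>a2 \<omega> - \<alpha>d \<omega>\<bar>)" by (simp only: distrib_left)
      also have "\<dots> \<le> nrm \<pi> * Ap.N \<omega>" by (intro mult_left_mono) (auto simp: Ap.N_def)
      finally have "(fst \<pi> * (a1 \<omega> - \<alpha>0 \<omega>) + snd \<pi> * (a2 \<omega> - \<alpha>d \<omega>))\<^sup>2 \<le> (nrm \<pi> * Ap.N \<omega>)\<^sup>2"
        using power_mono[of "\<bar>fst \<pi> * (a1 \<omega> - \<alpha>0 \<omega>) + snd \<pi> * (a2 \<omega> - \<alpha>d \<omega>)\<bar>" "nrm \<pi> * Ap.N \<omega>" 2] by simp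
      then have "((fst \<pi> * (a1 \<omega> - \<alpha>0 \<omega>) + snd \<pi> * (a2 \<omega> - \<alpha>d \<omega>)) / x)\<^sup>2 \<le> (nrm \<pi>)\<^sup>2 / x\<^sup>2 * (Ap.N \<omega>)\<^sup>2"
        by (simp add: power_divide power_mult_distrib divide_right_mono)
      then have "\<xi> \<omega> * \<eta> \<omega> * ((fst \<pi> * (a1 \<omega> - \<alpha>0 \<omega>) + snd \<pi> * (a2 \<omega> - \<alpha>d \<omega>)) / x)\<^sup>2
          \<le> \<xi> \<omega> * \<eta> \<omega> * ((nrm \<pi>)\<^sup>2 / x\<^sup>2 * (Ap.N \<omega>)\<^sup>2)"
        using elim by (intro mult_left_mono) auto
      then show ?case unfolding eq by (simp add: mult_ac)
    qed
    have i: "integrable M (\<lambda>\<omega>. (nrm \<pi>)\<^sup>2 / x\<^sup>2 * (\<xi> \<omega> * \<eta> \<omega> * (Ap.N \<omega>)\<^sup>2))" using Ap.wtN_integrable(1) by simp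
    have i2: "integrable M (\<lambda>\<omega>. \<xi> \<omega> * \<eta> \<omega> * (Ap.xt \<pi> \<omega> * Ap.L \<pi> \<omega> / \<xi> \<omega> - tangent_ratio \<pi> \<omega>)\<^sup>2)"
    proof (rule Bochner_Integration.integrable_bound[OF i])
      have [measurable]: "tangent_ratio \<pi> \<in> borel_measurable M" unfolding tangent_ratio_def[abs_def] by measurable
      show "(\<lambda>\<omega>. \<xi> \<omega> * \<eta> \<omega> * (Ap.xt \<pi> \<omega> * Ap.L \<pi> \<omega> / \<xi> \<omega> - tangent_ratio \<pi> \<omega>)\<^sup>2) \<in> borel_measurable M"
        by measurable
      show "AE \<omega> in M. norm (\<xi> \<omega> * \<eta> \<omega> * (Ap.xt \<pi> \<omega> * Ap.L \<pi> \<omega> / \<xi> \<omega> - tangent_ratio \<pi> \<omega>)\<^sup>2)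
         \<le> norm ((nrm \<pi>)\<^sup>2 / x\<^sup>2 * (\<xi> \<omega> * \<eta> \<omega> * (Ap.N \<omega>)\<^sup>2))"
        using sq_eq pos
      proof eventually_elim
        case (elim \<omega>)
        have "0 \<le> \<xi> \<omega> * \<eta> \<omega> * (Ap.xt \<pi> \<omega> * Ap.L \<pi> \<omega> / \<xi> \<omega> - tangent_ratio \<pi> \<omega>)\<^sup>2" using elim by simp
        with elim(1) show ?case unfolding real_norm_def by linarith
      qed
    qed
    have "(\<integral>\<omega>. \<xi> \<omega> * \<eta> \<omega> * (Ap.xt \<pi> \<omega> * Ap.L \<pi> \<omega> / \<xi> \<omega> - tangent_ratio \<pi> \<omega>)\<^sup>2 \<partial>M) \<le> (nrm \<pi>)\<^sup>2 / x\<^sup>2 * I"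
      using integral_mono_AE[OF i2 i sq_eq] by (simp add: I_def)
    also have "\<dots> \<le> (nrm \<pi>)\<^sup>2 / x\<^sup>2 * (\<kappa> * x\<^sup>2)" using I e(3) by (intro mult_left_mono) auto
    also have "\<dots> = \<kappa> * (nrm \<pi>)\<^sup>2" using xy_pos by simp
    finally have i3: "(\<integral>\<omega>. \<xi> \<omega> * \<eta> \<omega> * (Ap.xt \<pi> \<omega> * Ap.L \<pi> \<omega> / \<xi> \<omega> - tangent_ratio \<pi> \<omega>)\<^sup>2 \<partial>M) \<le> \<kappa> * (nrm \<pi>)\<^sup>2" .
    have g: "(\<integral>\<omega>. Ap.xt \<pi> \<omega> * Ap.et \<pi> \<omega> - U (Ap.xt \<pi> \<omega>) - W (Ap.et \<pi> \<omega>) \<partial>M) \<le> \<kappa> * (nrm \<pi>)\<^sup>2"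
      using elim(1) mult_right_mono[OF gap_const, of "(nrm \<pi>)\<^sup>2"] unfolding K1 I_def[symmetric] by simp
    have r: "AE \<omega> in M. \<exists>X Y. \<bar>X\<bar> \<le> 1/2 \<and> \<bar>Y\<bar> \<le> 1/2 \<and> Ap.xt \<pi> \<omega> = \<xi> \<omega> * (1 + X) / Ldelta F G (snd \<pi>) \<omega> \<and>
        Ap.et \<pi> \<omega> = \<eta> \<omega> * (1 + Y) * Ldelta F G (snd \<pi>) \<omega>"
      using Ap.ratio_bounds
    proof eventually_elim
      case (elim \<omega>)
      note b = spec[OF elim, of \<pi>, THEN mp, OF n]
      show ?case by (rule exI[of _ "Ap.X \<pi> \<omega>"], rule exI[of _ "Ap.Y \<pi> \<omega>"])
        (use b in \<open>simp add: Ap.xt_def Ap.et_def Le\<close>)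
    qed
    have "almost_optimal_pair \<kappa> \<pi> (Ap.xt \<pi>) (Ap.et \<pi>) (y + Ap.dy \<pi>)"
      unfolding almost_optimal_pair_def
      using elim(2,3) Ap.U_xt_integrable[OF n nnx] Ap.W_et_integrable[OF n nne] Ap.xt_et_integral(2)[of \<pi>] g r i2 i3
      unfolding Le by (simp add: feasible_def)
    then show ?case by blast
  qed
qed


text \<open>Markov's inequality for the Fenchel gap. On \<open>S\<close> the weight h q(h) is at
  least \<open>lo\<close> and q(h) at most \<open>hi\<close>, so a deviation of size e n costs at
  least \<open>c0 * lo * (e * n / hi)\<^sup>2\<close>; the square of n cancels against the bound on
  the expectation. The condition \<open>e * n \<le> hi\<close> keeps the cost below the truncation
  at 1.\<close>

lemma prob_deviation_le:
  fixes t h g :: "'a \<Rightarrow> real"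
  assumes tm [measurable]: "t \<in> borel_measurable M" and hm: "h \<in> borel_measurable M"
    and tn: "\<And>\<omega>. \<omega> \<in> space M \<Longrightarrow> 0 \<le> t \<omega>" and hn: "\<And>\<omega>. \<omega> \<in> space M \<Longrightarrow> 0 \<le> h \<omega>"
    and hp: "AE \<omega> in M. 0 < h \<omega>"
    and g: "AE \<omega> in M. Uext U (t \<omega>) = ereal (g \<omega>)"
    and i: "integrable M (\<lambda>\<omega>. t \<omega> * h \<omega> - g \<omega> - W (h \<omega>))"
    and b: "(\<integral>\<omega>. t \<omega> * h \<omega> - g \<omega> - W (h \<omega>) \<partial>M) \<le> \<kappa> * n\<^sup>2"
    and S [measurable]: "S \<in> sets M"
    and Sb: "AE \<omega> in M. \<omega> \<in> S \<longrightarrow> lo \<le> h \<omega> * q (h \<omega>) \<and> q (h \<omega>) \<le> hi"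
    and lo: "0 < lo" and hi: "0 < hi" and n: "0 < n" and e: "0 < e" "e * n \<le> hi"
  shows "prob {\<omega>\<in>S. e * n < \<bar>t \<omega> - q (h \<omega>)\<bar>} \<le> \<kappa> * (hi\<^sup>2 / (c0 * lo * e\<^sup>2))"
proof -
  interpret Sw: utility_pair W U q p "\<lambda>s. 1 / A (q s)" "1 / c2" "1 / c1" by (rule swap)
  have [measurable]: "(\<lambda>\<omega>. q (h \<omega>)) \<in> borel_measurable M"
    by (rule borel_measurable_comp_nonneg[OF hm hn Sw.p_measurable])
  define D where "D \<omega> = t \<omega> * h \<omega> - g \<omega> - W (h \<omega>)" for \<omega>
  have Di: "integrable M D" "(\<integral>\<omega>. D \<omega> \<partial>M) \<le> \<kappa> * n\<^sup>2" using i b by (auto simp: D_def[abs_def])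
  define E where "E = {\<omega>\<in>S. e * n < \<bar>t \<omega> - q (h \<omega>)\<bar>}"
  have "E = S \<inter> {\<omega>\<in>space M. e * n < \<bar>t \<omega> - q (h \<omega>)\<bar>}" using sets.sets_into_space[OF S] by (auto simp: E_def)
  then have E [measurable]: "E \<in> sets M" by simp
  define \<theta> where "\<theta> = c0 * lo * (e * n / hi)\<^sup>2"
  have \<theta>: "0 < \<theta>" using c0_pos lo hi e n by (simp add: \<theta>_def)
  have DE: "AE \<omega> in M. \<theta> * indicator E \<omega> \<le> D \<omega>"
    using hp g Sb AE_space
  proof eventually_elim
    case (elim \<omega>)
    define \<tau> where "\<tau> = q (h \<omega>)"
    have \<tau>: "0 < \<tau>" using q_pos elim(1) by (simp add: \<tau>_def)
    have lower: "c0 * (h \<omega> * \<tau>) * min 1 (((t \<omega> - \<tau>) / \<tau>)\<^sup>2) \<le> D \<omega>"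
      using gap_lower[OF tn[OF elim(4)] elim(1)] elim(2) by (simp add: D_def \<tau>_def)
    show ?case
    proof (cases "\<omega> \<in> E")
      case True
      then have *: "lo \<le> h \<omega> * \<tau>" "\<tau> \<le> hi" "e * n < \<bar>t \<omega> - \<tau>\<bar>" using elim(3) by (auto simp: E_def \<tau>_def)
      have "e * n / hi \<le> \<bar>t \<omega> - \<tau>\<bar> / \<tau>" using * \<tau> e n by (intro frac_le) auto
      also have "\<dots> = \<bar>(t \<omega> - \<tau>) / \<tau>\<bar>" using \<tau> by simp
      finally have "(e * n / hi)\<^sup>2 \<le> \<bar>(t \<omega> - \<tau>) / \<tau>\<bar>\<^sup>2" using e n hi by (intro power_mono) auto
      then have "(e * n / hi)\<^sup>2 \<le> ((t \<omega> - \<tau>) / \<tau>)\<^sup>2" by (simp only: power2_abs)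
      moreover have "(e * n / hi)\<^sup>2 \<le> 1" using e n hi by (intro power_le_one) auto
      ultimately have "\<theta> \<le> c0 * (h \<omega> * \<tau>) * min 1 (((t \<omega> - \<tau>) / \<tau>)\<^sup>2)"
        unfolding \<theta>_def using * c0_pos lo by (intro mult_mono) auto
      then show ?thesis using lower True by simp
    next
      case False
      have "0 \<le> c0 * (h \<omega> * \<tau>) * min 1 (((t \<omega> - \<tau>) / \<tau>)\<^sup>2)"
        using c0_pos \<tau> elim(1) by (intro mult_nonneg_nonneg) auto
      then show ?thesis using lower False by simp
    qed
  qed
  have Ei: "integrable M (\<lambda>\<omega>. \<theta> * indicator E \<omega>)" using E by (simp add: emeasure_eq_measure)
  have "\<theta> * prob E = (\<integral>\<omega>. \<theta> * indicator E \<omega> \<partial>M)" using E by simp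
  also have "\<dots> \<le> (\<integral>\<omega>. D \<omega> \<partial>M)" by (rule integral_mono_AE[OF Ei Di(1) DE])
  also have "\<dots> \<le> \<kappa> * n\<^sup>2" by (rule Di(2))
  finally have "prob E \<le> \<kappa> * n\<^sup>2 / \<theta>" using \<theta> by (simp add: pos_le_divide_eq mult.commute)
  also have "\<dots> = \<kappa> * (hi\<^sup>2 / (c0 * lo * e\<^sup>2))"
    using n by (simp add: \<theta>_def power_mult_distrib power_divide)
  finally show ?thesis by (simp add: E_def)
qed

end

section \<open>First-order expansion of the optimizers\<close>

context perturbed_pairing
begin

text \<open>Weak duality at a common price \<open>h\<close>: the optimizer has at least the expected
  utility of \<open>f\<close>, and its pairing with \<open>h\<close> is at most that of
  \<open>f\<close>, which exhausts the budget. So its gap against \<open>h\<close> is in expectation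
  no larger than the gap of \<open>f\<close>.\<close>

lemma optimal_gap:
  assumes opt: "optimal \<pi> t" and ap: "almost_optimal_pair \<kappa> \<pi> f h y'"
  shows "\<exists>g. (AE \<omega> in M. Uext U (t \<omega>) = ereal (g \<omega>)) \<and> integrable M (\<lambda>\<omega>. t \<omega> * h \<omega> - g \<omega> - W (h \<omega>)) \<and>
    (\<integral>\<omega>. t \<omega> * h \<omega> - g \<omega> - W (h \<omega>) \<partial>M) \<le> \<kappa> * (nrm \<pi>)\<^sup>2"
proof -
  define L where "L = Ldelta F G (snd \<pi>)"
  have L: "0 < L \<omega>" for \<omega> by (simp add: L_def Ldelta_pos)
  from ap have a: "f \<in> feasible \<pi>" "0 < x + fst \<pi>" "0 < y'" "(\<lambda>\<omega>. h \<omega> / L \<omega>) \<in> pol M Cs y'"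
    "integrable M (\<lambda>\<omega>. U (f \<omega>))" "integrable M (\<lambda>\<omega>. W (h \<omega>))" "(\<integral>\<omega>. f \<omega> * h \<omega> \<partial>M) = (x + fst \<pi>) * y'"
    "(\<integral>\<omega>. f \<omega> * h \<omega> - U (f \<omega>) - W (h \<omega>) \<partial>M) \<le> \<kappa> * (nrm \<pi>)\<^sup>2"
    "AE \<omega> in M. \<exists>X Y. \<bar>X\<bar> \<le> 1/2 \<and> \<bar>Y\<bar> \<le> 1/2 \<and> f \<omega> = \<xi> \<omega> * (1 + X) / L \<omega> \<and> h \<omega> = \<eta> \<omega> * (1 + Y) * L \<omega>"
    by (auto simp: almost_optimal_pair_def L_def)
  have fpos: "AE \<omega> in M. 0 < f \<omega>" using a(9) pos by eventually_elim (use L in auto)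
  have hpos: "AE \<omega> in M. 0 < h \<omega>" using a(9) pos by eventually_elim (use L in auto)
  have t: "t \<in> feasible \<pi>" using opt by (simp add: optimal_def)
  have [measurable]: "t \<in> borel_measurable M" "f \<in> borel_measurable M"
    using L0plus_measurable[OF feasible_L0plus] t a(1) by auto
  have um: "(\<lambda>\<omega>. Uext U (t \<omega>)) \<in> borel_measurable M" "(\<lambda>\<omega>. Uext U (f \<omega>)) \<in> borel_measurable M" by measurable
  note pt = feasible_pairing[OF t a(2) a(4)[unfolded L_def] a(3)] and pf = feasible_pairing[OF a(1,2) a(4)[unfolded L_def] a(3)]
  have k: "integrable M (\<lambda>\<omega>. t \<omega> * h \<omega> - W (h \<omega>))" using pt(1) a(6) by auto
  have kb: "AE \<omega> in M. Uext U (t \<omega>) \<le> ereal (t \<omega> * h \<omega> - W (h \<omega>))"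
    using hpos AE_space by eventually_elim (use Uext_le L0plus_nonneg[OF feasible_L0plus[OF t]] in auto)
  have AEf: "AE \<omega> in M. Uext U (f \<omega>) = ereal (U (f \<omega>))" using fpos by eventually_elim (simp add: Uext_pos)
  have "ereal (\<integral>\<omega>. U (f \<omega>) \<partial>M) \<le> EU M (\<lambda>\<omega>. Uext U (f \<omega>))"
    by (rule EU_sandwich(1)[OF um(2) a(5) _ a(5)]) (use AEf in \<open>eventually_elim, simp\<close>)+
  also have "\<dots> \<le> EU M (\<lambda>\<omega>. Uext U (t \<omega>))" using opt a(1) by (auto simp: optimal_def)
  finally have le: "ereal (\<integral>\<omega>. U (f \<omega>) \<partial>M) \<le> EU M (\<lambda>\<omega>. Uext U (t \<omega>))" .
  then have "EU M (\<lambda>\<omega>. Uext U (t \<omega>)) \<noteq> - \<infinity>" by auto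
  note E = EU_finite[OF um(1) k kb this]
  define g where "g \<omega> = real_of_ereal (Uext U (t \<omega>))" for \<omega>
  have gi: "integrable M g" and gg: "(\<integral>\<omega>. U (f \<omega>) \<partial>M) \<le> (\<integral>\<omega>. g \<omega> \<partial>M)"
    using E(1,3) le by (auto simp: g_def[abs_def])
  have "(\<integral>\<omega>. t \<omega> * h \<omega> - g \<omega> - W (h \<omega>) \<partial>M) = (\<integral>\<omega>. t \<omega> * h \<omega> \<partial>M) - (\<integral>\<omega>. g \<omega> \<partial>M) - (\<integral>\<omega>. W (h \<omega>) \<partial>M)"
    using pt(1) gi a(6) by simp
  also have "\<dots> \<le> (\<integral>\<omega>. f \<omega> * h \<omega> \<partial>M) - (\<integral>\<omega>. U (f \<omega>) \<partial>M) - (\<integral>\<omega>. W (h \<omega>) \<partial>M)"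
    using pt(2) gg a(7) by simp
  also have "\<dots> = (\<integral>\<omega>. f \<omega> * h \<omega> - U (f \<omega>) - W (h \<omega>) \<partial>M)" using pf(1) a(5,6) by simp
  also have "\<dots> \<le> \<kappa> * (nrm \<pi>)\<^sup>2" by (rule a(8))
  finally show ?thesis using E(2) pt(1) gi a(6) by (intro exI[of _ g]) (auto simp: g_def[symmetric])
qed

text \<open>Here \<open>h\<close> differs from \<eta> by a factor in [1/4, 4], hence q(h) from \<xi>
  by at most the factor \<open>exp (ln 4 / c1)\<close>, which is 4 to the power 1 / c1.\<close>

lemma pair_factor_bounds:
  assumes "0 < \<xi> \<omega>" "0 < \<eta> \<omega>" "q (\<eta> \<omega>) = \<xi> \<omega>" and Y: "\<bar>Y\<bar> \<le> 1/2" and L: "1/2 \<le> L" "L \<le> 2"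
    and h: "h = \<eta> \<omega> * (1 + Y) * L" and m: "1 / m \<le> \<xi> \<omega> * \<eta> \<omega>" "\<xi> \<omega> \<le> m" "0 < m"
  shows "1 / (4 * m * exp (ln 4 / c1)) \<le> h * q h" "q h \<le> m * exp (ln 4 / c1)"
proof -
  interpret Sw: utility_pair W U q p "\<lambda>s. 1 / A (q s)" "1 / c2" "1 / c1" by (rule swap)
  define l where "l = (1 + Y) * L"
  have l: "1 / 4 \<le> l" "l \<le> 4"
  proof -
    have "1 / 2 * (1 / 2) \<le> (1 + Y) * L" using Y L by (intro mult_mono) auto
    then show "1 / 4 \<le> l" by (simp add: l_def)
    have "(1 + Y) * L \<le> 2 * 2" using Y L by (intro mult_mono) auto
    then show "l \<le> 4" by (simp add: l_def)
  qed
  have l0: "0 < l" using l by simp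
  have hl: "h = \<eta> \<omega> * l" by (simp add: h l_def)
  then have h0: "0 < h" using l0 assms by simp
  obtain k where k: "1 / c2 \<le> k" "k \<le> 1 / c1" "q h = \<xi> \<omega> * exp (- k * ln l)"
    using Sw.p_exp[OF assms(2) h0] assms hl by auto
  have "ln (1 / 4) \<le> ln l" "ln l \<le> ln 4" using l l0 by (auto simp del: ln_div)
  then have lnl: "\<bar>ln l\<bar> \<le> ln 4" by (simp add: ln_div)
  have k0: "0 \<le> k" using k(1) c2_pos by (intro order_trans[OF _ k(1)]) auto
  have "\<bar>k * ln l\<bar> \<le> 1 / c1 * ln 4" unfolding abs_mult using k k0 lnl c1_pos by (intro mult_mono) auto
  then have kl: "- k * ln l \<le> ln 4 / c1" "- (ln 4 / c1) \<le> - k * ln l" by (simp_all add: abs_le_iff)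
  have "q h \<le> \<xi> \<omega> * exp (ln 4 / c1)" unfolding k(3) using kl assms by (intro mult_left_mono) auto
  also have "\<dots> \<le> m * exp (ln 4 / c1)" using m by (intro mult_right_mono) auto
  finally show "q h \<le> m * exp (ln 4 / c1)" .
  have "1 / (4 * m * exp (ln 4 / c1)) = 1 / m * (1 / 4) * exp (- (ln 4 / c1))" by (simp add: exp_minus field_simps)
  also have "\<dots> \<le> \<xi> \<omega> * \<eta> \<omega> * l * exp (- k * ln l)" using m l kl assms by (intro mult_mono) auto
  also have "\<dots> = (\<eta> \<omega> * l) * (\<xi> \<omega> * exp (- k * ln l))" by simp
  also have "\<dots> = h * q h" by (simp only: k(3) hl[symmetric])
  finally show "1 / (4 * m * exp (ln 4 / c1)) \<le> h * q h" .
qed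

text \<open>The optimizer and the approximation \<open>f\<close> are both compared with q(h), since
  both have a small gap against the price \<open>h\<close>; the distance from \<open>f\<close> to
  the tangent comes from the weighted L2 bound. Each of the three distances gets a third of the
  allowed deviation.\<close>

theorem optimal_expansion:
  assumes ev: "eventually (\<lambda>\<pi>. optimal \<pi> (Xi \<pi>)) (at (0,0))"
  shows "conv_in_prob_00 M (\<lambda>\<pi> \<omega>. \<bar>Xi \<pi> \<omega> - \<xi> \<omega> / x * (x + fst \<pi> * (1 + \<alpha>0 \<omega>) + snd \<pi> * \<alpha>d \<omega>)
                                      / Ldelta F G (snd \<pi>) \<omega>\<bar> / (\<bar>fst \<pi>\<bar> + \<bar>snd \<pi>\<bar>))"
  unfolding conv_in_prob_00_def
proof (intro allI impI tendstoI)
  fix e \<rho>0 :: real assume e0: "0 < e" and \<rho>0: "0 < \<rho>0"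
  define \<rho> where "\<rho> = \<rho>0 / 2"
  have \<rho>: "0 < \<rho>" using \<rho>0 by (simp add: \<rho>_def)
  have "AE \<omega> in M. 0 < \<xi> \<omega> * \<eta> \<omega>" using pos by eventually_elim simp
  from prob_large_set[of "\<lambda>\<omega>. \<xi> \<omega> * \<eta> \<omega>" \<xi> "\<lambda>\<omega>. \<bar>F \<omega>\<bar> + \<bar>G \<omega>\<bar>", OF _ _ _ this \<rho>] obtain m :: real where
    m: "1 \<le> m" "prob {\<omega>\<in>space M. \<not> (1 / m \<le> \<xi> \<omega> * \<eta> \<omega> \<and> \<xi> \<omega> \<le> m \<and> \<bar>F \<omega>\<bar> + \<bar>G \<omega>\<bar> \<le> m)} < \<rho>"
    by auto
  define S where "S = {\<omega>\<in>space M. 1 / m \<le> \<xi> \<omega> * \<eta> \<omega> \<and> \<xi> \<omega> \<le> m \<and> \<bar>F \<omega>\<bar> + \<bar>G \<omega>\<bar> \<le> m}"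
  define B where "B = {\<omega>\<in>space M. \<not> (1 / m \<le> \<xi> \<omega> * \<eta> \<omega> \<and> \<xi> \<omega> \<le> m \<and> \<bar>F \<omega>\<bar> + \<bar>G \<omega>\<bar> \<le> m)}"
  have SB [measurable]: "S \<in> sets M" "B \<in> sets M" unfolding S_def B_def by measurable
  define hi lo e3 where "hi = m * exp (ln 4 / c1)" and "lo = 1 / (4 * m * exp (ln 4 / c1))" and "e3 = e / 3"
  have hl: "0 < hi" "0 < lo" "0 < e3" using m e0 by (auto simp: hi_def lo_def e3_def)
  \<comment> \<open>Markov constants, \<open>C1\<close> for each of the two deviations from q(h) and
    \<open>C2\<close> for the distance to the tangent. They depend on the good set and on
    \<open>e\<close> but not on \<kappa>, which is therefore chosen after them.\<close>
  define C1 where "C1 = hi\<^sup>2 / (c0 * lo * e3\<^sup>2)"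
  define C2 where "C2 = 4 * m ^ 3 / e3\<^sup>2"
  have C: "0 \<le> C1" "0 \<le> C2" using c0_pos hl m by (auto simp: C1_def C2_def)
  define \<kappa> where "\<kappa> = \<rho> / (2 * C1 + C2 + 1)"
  have \<kappa>: "0 < \<kappa>" "\<kappa> * (2 * C1 + C2) \<le> \<rho>" using \<rho> C by (auto simp: \<kappa>_def field_simps)
  \<comment> \<open>The entry \<open>ln 2 / m\<close> keeps L between 1/2 and 2 on \<open>S\<close>;
    the entry \<open>hi / e3\<close> is the truncation condition of
    \<open>prob_deviation_le\<close>.\<close>
  have "eventually (\<lambda>\<pi>. nrm \<pi> < min 1 (min (ln 2 / m) (hi / e3))) (at (0,0))"
    by (rule nrm_small_00) (use m hl in auto)
  with ev almost_optimal_pair_exists[OF \<kappa>(1)] nrm_pos_00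
  show "eventually (\<lambda>\<pi>. dist (prob {\<omega>\<in>space M. e < \<bar>\<bar>Xi \<pi> \<omega> - \<xi> \<omega> / x * (x + fst \<pi> * (1 + \<alpha>0 \<omega>) + snd \<pi> * \<alpha>d \<omega>)
                                      / Ldelta F G (snd \<pi>) \<omega>\<bar> / (\<bar>fst \<pi>\<bar> + \<bar>snd \<pi>\<bar>)\<bar>}) 0 < \<rho>0) (at (0,0))"
  proof eventually_elim
    case (elim \<pi>)
    define n where "n = nrm \<pi>"
    have n: "0 < n" "n \<le> 1" "n \<le> ln 2 / m" "n \<le> hi / e3" using elim by (auto simp: n_def)
    then have nm: "n * m \<le> ln 2" "e3 * n \<le> hi" using m hl by (auto simp: pos_le_divide_eq mult.commute)
    define L where "L = Ldelta F G (snd \<pi>)"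
    have L0: "0 < L \<omega>" for \<omega> by (simp add: L_def Ldelta_pos)
    have [measurable]: "L \<in> borel_measurable M" unfolding L_def by measurable
    have LS: "1/2 \<le> L \<omega>" "L \<omega> \<le> 2" if "\<omega> \<in> S" for \<omega>
    proof -
      have "\<bar>ln (L \<omega>)\<bar> \<le> n * (\<bar>F \<omega>\<bar> + \<bar>G \<omega>\<bar>)" unfolding L_def
        by (rule abs_ln_Ldelta_le) (use n in \<open>auto simp: n_def\<close>)
      also have "\<dots> \<le> n * m" using that n by (intro mult_left_mono) (auto simp: S_def)
      finally have "\<bar>ln (L \<omega>)\<bar> \<le> ln 2" using nm by linarith
      then have "ln (L \<omega>) \<le> ln 2" "ln (1 / 2) \<le> ln (L \<omega>)" by (auto simp: ln_div)
      then show "1/2 \<le> L \<omega>" "L \<omega> \<le> 2" using L0[of \<omega>] by (auto simp del: ln_div)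
    qed
    from elim(2) obtain f h y' where ap: "almost_optimal_pair \<kappa> \<pi> f h y'" by blast
    then have a: "f \<in> feasible \<pi>" "0 < x + fst \<pi>" "0 < y'" "(\<lambda>\<omega>. h \<omega> / L \<omega>) \<in> pol M Cs y'"
      "integrable M (\<lambda>\<omega>. U (f \<omega>))" "integrable M (\<lambda>\<omega>. W (h \<omega>))"
      "(\<integral>\<omega>. f \<omega> * h \<omega> - U (f \<omega>) - W (h \<omega>) \<partial>M) \<le> \<kappa> * n\<^sup>2"
      "AE \<omega> in M. \<exists>X Y. \<bar>X\<bar> \<le> 1/2 \<and> \<bar>Y\<bar> \<le> 1/2 \<and> f \<omega> = \<xi> \<omega> * (1 + X) / L \<omega> \<and> h \<omega> = \<eta> \<omega> * (1 + Y) * L \<omega>"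
      "integrable M (\<lambda>\<omega>. \<xi> \<omega> * \<eta> \<omega> * (f \<omega> * L \<omega> / \<xi> \<omega> - tangent_ratio \<pi> \<omega>)\<^sup>2)"
      "(\<integral>\<omega>. \<xi> \<omega> * \<eta> \<omega> * (f \<omega> * L \<omega> / \<xi> \<omega> - tangent_ratio \<pi> \<omega>)\<^sup>2 \<partial>M) \<le> \<kappa> * n\<^sup>2"
      by (auto simp: almost_optimal_pair_def L_def n_def)
    note t = elim(1)
    have tf: "Xi \<pi> \<in> L0plus M" "f \<in> L0plus M" using t feasible_L0plus[OF a(1)] feasible_L0plus[of "Xi \<pi>" \<pi>] by (auto simp: optimal_def)
    note [measurable] = L0plus_measurable[OF tf(1)] L0plus_measurable[OF tf(2)]
    have "(\<lambda>\<omega>. (h \<omega> / L \<omega>) * L \<omega>) \<in> borel_measurable M" using pol_measurable[OF a(4)] by measurable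
    moreover have "(\<lambda>\<omega>. (h \<omega> / L \<omega>) * L \<omega>) = h" using L0 by (auto simp: fun_eq_iff less_imp_neq[symmetric])
    ultimately have hm [measurable]: "h \<in> borel_measurable M" by simp
    have hn: "0 \<le> h \<omega>" if "\<omega> \<in> space M" for \<omega>
      using pol_nonneg[OF a(4) that] L0[of \<omega>] by (simp add: zero_le_divide_iff)
    have fpos: "AE \<omega> in M. 0 < f \<omega>" using a(8) pos by eventually_elim (use L0 in auto)
    have hpos: "AE \<omega> in M. 0 < h \<omega>" using a(8) pos by eventually_elim (use L0 in auto)
    have Sb: "AE \<omega> in M. \<omega> \<in> S \<longrightarrow> lo \<le> h \<omega> * q (h \<omega>) \<and> q (h \<omega>) \<le> hi"
      using a(8) pos q_eta
    proof eventually_elim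
      fix \<omega> assume XY: "\<exists>X Y. \<bar>X\<bar> \<le> 1/2 \<and> \<bar>Y\<bar> \<le> 1/2 \<and> f \<omega> = \<xi> \<omega> * (1 + X) / L \<omega> \<and> h \<omega> = \<eta> \<omega> * (1 + Y) * L \<omega>"
        and p0: "0 < \<xi> \<omega>" "0 < \<eta> \<omega>" "q (\<eta> \<omega>) = \<xi> \<omega>"
      show "\<omega> \<in> S \<longrightarrow> lo \<le> h \<omega> * q (h \<omega>) \<and> q (h \<omega>) \<le> hi"
      proof
        assume S: "\<omega> \<in> S"
        from XY obtain Y where Y: "\<bar>Y\<bar> \<le> 1/2" "h \<omega> = \<eta> \<omega> * (1 + Y) * L \<omega>" by blast
        show "lo \<le> h \<omega> * q (h \<omega>) \<and> q (h \<omega>) \<le> hi" unfolding lo_def hi_def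
          using pair_factor_bounds[OF p0 Y(1) LS[OF S] Y(2)] S m by (auto simp: S_def)
      qed
    qed
    from optimal_gap[OF t ap] obtain g where g: "AE \<omega> in M. Uext U (Xi \<pi> \<omega>) = ereal (g \<omega>)"
      "integrable M (\<lambda>\<omega>. Xi \<pi> \<omega> * h \<omega> - g \<omega> - W (h \<omega>))"
      "(\<integral>\<omega>. Xi \<pi> \<omega> * h \<omega> - g \<omega> - W (h \<omega>) \<partial>M) \<le> \<kappa> * n\<^sup>2" by (auto simp: n_def)
    define E1 where "E1 = {\<omega>\<in>S. e3 * n < \<bar>Xi \<pi> \<omega> - q (h \<omega>)\<bar>}"
    define E2 where "E2 = {\<omega>\<in>S. e3 * n < \<bar>f \<omega> - q (h \<omega>)\<bar>}"
    have p1: "prob E1 \<le> \<kappa> * C1" unfolding E1_def C1_def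
      by (rule prob_deviation_le[OF _ hm L0plus_nonneg[OF tf(1)] hn hpos g SB(1) Sb hl(2,1) n(1) hl(3) nm(2)]) simp
    have fi: "integrable M (\<lambda>\<omega>. f \<omega> * h \<omega> - U (f \<omega>) - W (h \<omega>))"
      using feasible_pairing(1)[OF a(1,2) a(4)[unfolded L_def] a(3)] a(5,6) by auto
    have fU: "AE \<omega> in M. Uext U (f \<omega>) = ereal (U (f \<omega>))" using fpos by eventually_elim (simp add: Uext_pos)
    have p2: "prob E2 \<le> \<kappa> * C1" unfolding E2_def C1_def
      by (rule prob_deviation_le[OF _ hm L0plus_nonneg[OF tf(2)] hn hpos fU fi a(7) SB(1) Sb hl(2,1) n(1) hl(3) nm(2)]) simp
    define u where "u \<omega> = \<xi> \<omega> * \<eta> \<omega> * (f \<omega> * L \<omega> / \<xi> \<omega> - tangent_ratio \<pi> \<omega>)\<^sup>2" for \<omega>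
    \<comment> \<open>On \<open>S\<close> the weight is at least 1 / m and \<xi> / L at most 2 m, so
      \<open>u < \<theta>\<close> forces a distance of at most \<open>e3 * n\<close> between
      \<open>f\<close> and the tangent.\<close>
    define \<theta> where "\<theta> = 1 / m * (e3 * n / (2 * m))\<^sup>2"
    have \<theta>: "0 < \<theta>" using m hl n by (simp add: \<theta>_def)
    define E3 where "E3 = {\<omega>\<in>space M. \<theta> \<le> u \<omega>}"
    have um [measurable]: "u \<in> borel_measurable M" using a(9) by (auto simp: u_def[abs_def])
    have p3: "prob E3 \<le> \<kappa> * C2"
    proof -
      have "prob E3 \<le> (\<integral>\<omega>. u \<omega> \<partial>M) / \<theta>" unfolding E3_def
        by (rule integral_Markov_inequality_measure[where A="{}"])
           (use a(9) \<theta> pos in \<open>auto simp: u_def[abs_def]\<close>)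
      also have "\<dots> \<le> \<kappa> * n\<^sup>2 / \<theta>" using a(10) \<theta> by (intro divide_right_mono) (auto simp: u_def)
      also have "\<dots> = \<kappa> * C2" using m n hl by (simp add: \<theta>_def C2_def power2_eq_square power3_eq_cube field_simps)
      finally show ?thesis .
    qed
    interpret Sw: utility_pair W U q p "\<lambda>s. 1 / A (q s)" "1 / c2" "1 / c1" by (rule swap)
    have [measurable]: "(\<lambda>\<omega>. q (h \<omega>)) \<in> borel_measurable M"
      by (rule borel_measurable_comp_nonneg[OF hm hn Sw.p_measurable])
    have E12: "E1 = S \<inter> {\<omega>\<in>space M. e3 * n < \<bar>Xi \<pi> \<omega> - q (h \<omega>)\<bar>}" "E2 = S \<inter> {\<omega>\<in>space M. e3 * n < \<bar>f \<omega> - q (h \<omega>)\<bar>}"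
      using sets.sets_into_space[OF SB(1)] by (auto simp: E1_def E2_def)
    have Em [measurable]: "E1 \<in> sets M" "E2 \<in> sets M" "E3 \<in> sets M" unfolding E12 E3_def by measurable
    define Z where "Z \<omega> = \<bar>\<bar>Xi \<pi> \<omega> - \<xi> \<omega> / x * (x + fst \<pi> * (1 + \<alpha>0 \<omega>) + snd \<pi> * \<alpha>d \<omega>) / L \<omega>\<bar> / (\<bar>fst \<pi>\<bar> + \<bar>snd \<pi>\<bar>)\<bar>" for \<omega>
    have sub: "{\<omega>\<in>space M. e < Z \<omega>} \<subseteq> (B \<union> E1) \<union> (E2 \<union> E3)"
    proof
      fix \<omega> assume \<omega>: "\<omega> \<in> {\<omega>\<in>space M. e < Z \<omega>}"
      show "\<omega> \<in> (B \<union> E1) \<union> (E2 \<union> E3)"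
      proof (rule ccontr)
        assume neg: "\<omega> \<notin> (B \<union> E1) \<union> (E2 \<union> E3)"
        then have S: "\<omega> \<in> S" using \<omega> by (auto simp: S_def B_def)
        have b1: "\<bar>Xi \<pi> \<omega> - q (h \<omega>)\<bar> \<le> e3 * n" "\<bar>f \<omega> - q (h \<omega>)\<bar> \<le> e3 * n" "u \<omega> < \<theta>"
          using neg S \<omega> by (auto simp: E1_def E2_def E3_def not_less)
        have wt: "1 / m \<le> \<xi> \<omega> * \<eta> \<omega>" "\<xi> \<omega> \<le> m" using S by (auto simp: S_def)
        have "0 < 1 / m" using m by simp
        with wt(1) have "0 < \<xi> \<omega> * \<eta> \<omega>" by linarith
        then have \<xi>0: "0 < \<xi> \<omega>" using \<xi>_nn[of \<omega>] \<omega> by (auto simp: zero_less_mult_iff)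
        define v where "v = f \<omega> * L \<omega> / \<xi> \<omega> - tangent_ratio \<pi> \<omega>"
        have "1 / m * v\<^sup>2 \<le> u \<omega>" unfolding u_def v_def using wt by (intro mult_right_mono) auto
        then have "1 / m * v\<^sup>2 < 1 / m * (e3 * n / (2 * m))\<^sup>2" using b1(3) by (simp only: \<theta>_def)
        then have "v\<^sup>2 < (e3 * n / (2 * m))\<^sup>2" using \<open>0 < 1 / m\<close> by (simp only: mult_less_cancel_left_pos)
        then have "\<bar>v\<bar> < e3 * n / (2 * m)" using hl n m by (intro power_less_imp_less_base[of "\<bar>v\<bar>" 2]) auto
        then have v: "2 * m * \<bar>v\<bar> \<le> e3 * n" using m by (simp add: field_simps)
        have fe: "f \<omega> - \<xi> \<omega> / x * (x + fst \<pi> * (1 + \<alpha>0 \<omega>) + snd \<pi> * \<alpha>d \<omega>) / L \<omega> = \<xi> \<omega> / L \<omega> * v"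
          using \<xi>0 L0[of \<omega>] by (simp add: v_def tangent_ratio_def right_diff_distrib)
        have "\<xi> \<omega> / L \<omega> \<le> m / (1/2)" using wt LS(1)[OF S] \<xi>0 m by (intro frac_le) auto
        then have "\<bar>\<xi> \<omega> / L \<omega> * v\<bar> \<le> 2 * m * \<bar>v\<bar>" unfolding abs_mult
          using \<xi>0 L0[of \<omega>] by (intro mult_right_mono) auto
        then have b4: "\<bar>f \<omega> - \<xi> \<omega> / x * (x + fst \<pi> * (1 + \<alpha>0 \<omega>) + snd \<pi> * \<alpha>d \<omega>) / L \<omega>\<bar> \<le> e3 * n"
          using v unfolding fe by linarith
        then have "\<bar>Xi \<pi> \<omega> - \<xi> \<omega> / x * (x + fst \<pi> * (1 + \<alpha>0 \<omega>) + snd \<pi> * \<alpha>d \<omega>) / L \<omega>\<bar> \<le> 3 * (e3 * n)"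
        proof -
          have "\<bar>a - d\<bar> \<le> 3 * k" if "\<bar>b - d\<bar> \<le> k" "\<bar>a - c\<bar> \<le> k" "\<bar>b - c\<bar> \<le> k" for a b c d k :: real
            using that by linarith
          then show ?thesis using b1(1,2) b4 by blast
        qed
        then have "Z \<omega> \<le> e" unfolding Z_def using n(1) by (simp add: n_def[unfolded nrm_def] e3_def pos_divide_le_eq)
        then show False using \<omega> by simp
      qed
    qed
    have "prob {\<omega>\<in>space M. e < Z \<omega>} \<le> prob ((B \<union> E1) \<union> (E2 \<union> E3))"
      by (rule finite_measure_mono[OF sub]) measurable
    also have "\<dots> \<le> prob (B \<union> E1) + prob (E2 \<union> E3)" by (rule measure_Un_le) measurable
    also have "\<dots> \<le> (prob B + prob E1) + (prob E2 + prob E3)" by (intro add_mono measure_Un_le) measurable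
    also have "\<dots> < \<rho> + \<kappa> * (2 * C1 + C2)" using p1 p2 p3 m(2) by (simp add: B_def distrib_left)
    also have "\<dots> \<le> \<rho>0" using \<kappa>(2) by (simp add: \<rho>_def)
    finally show ?case by (simp add: Z_def L_def)
  qed
qed

end

section \<open>Duality of the quadratic problems\<close>

text \<open>The test value \<open>- b / (k + 1)\<close> makes the quadratic negative unless b = 0;
  adding 1 to \<open>k\<close> covers the degenerate case k = 0.\<close>

lemma quadratic_min_linear_zero:
  fixes b k :: real
  assumes k: "0 \<le> k" and min: "\<And>t. 0 \<le> 2 * t * b + t\<^sup>2 * k"
  shows "b = 0"
proof (rule ccontr)
  assume b: "b \<noteq> 0"
  have k1: "0 < k + 1" using k by simp
  have "2 * (- b / (k + 1)) * b + (- b / (k + 1))\<^sup>2 * k = - b\<^sup>2 * (k + 2) / (k + 1)\<^sup>2"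
    using k1 by (simp add: power2_eq_square divide_simps) (simp add: algebra_simps)
  also have "\<dots> < 0" using b k k1 by (simp add: divide_neg_pos mult_neg_pos)
  finally show False using min[of "- b / (k + 1)"] by simp
qed

lemma integrable_mult_L2:
  fixes f g :: "'a \<Rightarrow> real"
  assumes [measurable]: "f \<in> borel_measurable R" "g \<in> borel_measurable R"
    and i: "integrable R (\<lambda>\<omega>. (f \<omega>)\<^sup>2)" "integrable R (\<lambda>\<omega>. (g \<omega>)\<^sup>2)"
  shows "integrable R (\<lambda>\<omega>. f \<omega> * g \<omega>)"
proof (rule Bochner_Integration.integrable_bound)
  show "integrable R (\<lambda>\<omega>. (f \<omega>)\<^sup>2 + (g \<omega>)\<^sup>2)" using i by simp
  have half: "r \<le> t" if "2 * r \<le> t" "0 \<le> r" for r t :: real using that by linarith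
  have "\<bar>a\<bar> * \<bar>b\<bar> \<le> a\<^sup>2 + b\<^sup>2" for a b :: real
    by (rule half) (use sum_squares_bound[of "\<bar>a\<bar>" "\<bar>b\<bar>"] in \<open>simp_all add: mult.assoc\<close>)
  then have "\<bar>a * b\<bar> \<le> \<bar>a\<^sup>2 + b\<^sup>2\<bar>" for a b :: real
    unfolding abs_mult by (rule order_trans) simp
  then show "AE \<omega> in R. norm (f \<omega> * g \<omega>) \<le> norm ((f \<omega>)\<^sup>2 + (g \<omega>)\<^sup>2)" by simp
qed measurable

definition sq_int :: "'a measure \<Rightarrow> ('a \<Rightarrow> real) \<Rightarrow> bool" where
  "sq_int R f \<longleftrightarrow> f \<in> borel_measurable R \<and> integrable R (\<lambda>\<omega>. (f \<omega>)\<^sup>2)"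

lemma sq_int_mult: "sq_int R f \<Longrightarrow> sq_int R g \<Longrightarrow> integrable R (\<lambda>\<omega>. f \<omega> * g \<omega>)"
  using integrable_mult_L2[of f R g] by (auto simp: sq_int_def)

lemma sq_int_add: assumes "sq_int R f" "sq_int R g" shows "sq_int R (\<lambda>\<omega>. f \<omega> + g \<omega>)"
proof -
  have "(\<lambda>\<omega>. (f \<omega> + g \<omega>)\<^sup>2) = (\<lambda>\<omega>. (f \<omega>)\<^sup>2 + (g \<omega>)\<^sup>2 + 2 * (f \<omega> * g \<omega>))" by (auto simp: power2_sum)
  then show ?thesis using assms sq_int_mult[OF assms] by (auto simp: sq_int_def)
qed

lemma sq_int_cmult: "sq_int R f \<Longrightarrow> sq_int R (\<lambda>\<omega>. (k::real) * f \<omega>)"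
  by (auto simp: sq_int_def power_mult_distrib)

lemma sq_int_bounded_mult:
  assumes a: "a \<in> borel_measurable R" and f: "sq_int R f" and b: "AE \<omega> in R. \<bar>a \<omega>\<bar> \<le> (K::real)"
  shows "sq_int R (\<lambda>\<omega>. a \<omega> * f \<omega>)"
proof -
  have "AE \<omega> in R. \<bar>(a \<omega>)\<^sup>2\<bar> \<le> K\<^sup>2" using b
  proof eventually_elim
    case (elim \<omega>) then show ?case using power_mono[of "\<bar>a \<omega>\<bar>" K 2] by simp
  qed
  then have "integrable R (\<lambda>\<omega>. (a \<omega>)\<^sup>2 * (f \<omega>)\<^sup>2)"
    using a f by (intro integrable_bounded_mult) (auto simp: sq_int_def)
  then show ?thesis using a f by (auto simp: sq_int_def power_mult_distrib)
qed

lemma (in prob_space) sq_int_const: "sq_int M (\<lambda>_. k::real)" by (simp add: sq_int_def)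

lemma L2_0_sq_int: "f \<in> L2_0 R \<Longrightarrow> sq_int R f" by (auto simp: L2_0_def sq_int_def)

lemma L2_0_lin: "f \<in> L2_0 R \<Longrightarrow> g \<in> L2_0 R \<Longrightarrow> (\<lambda>\<omega>. f \<omega> + (t::real) * g \<omega>) \<in> L2_0 R"
  using sq_int_add[OF L2_0_sq_int[of f R] sq_int_cmult[OF L2_0_sq_int[of g R], of t]]
  by (auto simp: L2_0_def sq_int_def)

text \<open>The common shape of the four problems: (f, g) is (1, 0) for the problems in x and in y,
  (x F, x F) and (- y F, - y F) for the two problems in \<delta>, and \<open>k\<close> collects the
  terms free of the unknown.\<close>

lemma quadratic_minimizer_foc:
  fixes A f g k h \<alpha> :: "'a \<Rightarrow> real"
  assumes A: "A \<in> borel_measurable R" "AE \<omega> in R. 0 \<le> A \<omega> \<and> A \<omega> \<le> K"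
    and f: "sq_int R f" and g: "sq_int R g" and k: "integrable R k" and h: "sq_int R h" and \<alpha>: "sq_int R \<alpha>"
    and min: "\<And>t. (\<integral>\<omega>. A \<omega> * (h \<omega> + f \<omega>)\<^sup>2 - 2 * g \<omega> * h \<omega> - k \<omega> \<partial>R)
      \<le> (\<integral>\<omega>. A \<omega> * ((h \<omega> + t * \<alpha> \<omega>) + f \<omega>)\<^sup>2 - 2 * g \<omega> * (h \<omega> + t * \<alpha> \<omega>) - k \<omega> \<partial>R)"
  shows "(\<integral>\<omega>. (A \<omega> * (h \<omega> + f \<omega>) - g \<omega>) * \<alpha> \<omega> \<partial>R) = 0"
proof -
  have Ab: "AE \<omega> in R. \<bar>A \<omega>\<bar> \<le> K" using A(2) by eventually_elim auto
  have hf: "sq_int R (\<lambda>\<omega>. h \<omega> + f \<omega>)" by (rule sq_int_add[OF h f])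
  have Ahf: "sq_int R (\<lambda>\<omega>. A \<omega> * (h \<omega> + f \<omega>))" by (rule sq_int_bounded_mult[OF A(1) hf Ab])
  have i0: "integrable R (\<lambda>\<omega>. A \<omega> * (h \<omega> + f \<omega>)\<^sup>2 - 2 * g \<omega> * h \<omega> - k \<omega>)"
    using sq_int_mult[OF Ahf hf] sq_int_mult[OF g h] k by (simp add: power2_eq_square mult.assoc)
  have i1: "integrable R (\<lambda>\<omega>. (A \<omega> * (h \<omega> + f \<omega>) - g \<omega>) * \<alpha> \<omega>)"
    using sq_int_mult[OF Ahf \<alpha>] sq_int_mult[OF g \<alpha>] by (simp add: left_diff_distrib)
  have i2: "integrable R (\<lambda>\<omega>. A \<omega> * (\<alpha> \<omega>)\<^sup>2)"
    using integrable_bounded_mult[OF A(1) _ Ab] \<alpha> by (auto simp: sq_int_def)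
  have eq: "(\<integral>\<omega>. A \<omega> * ((h \<omega> + t * \<alpha> \<omega>) + f \<omega>)\<^sup>2 - 2 * g \<omega> * (h \<omega> + t * \<alpha> \<omega>) - k \<omega> \<partial>R)
     = (\<integral>\<omega>. A \<omega> * (h \<omega> + f \<omega>)\<^sup>2 - 2 * g \<omega> * h \<omega> - k \<omega> \<partial>R)
       + (2 * t * (\<integral>\<omega>. (A \<omega> * (h \<omega> + f \<omega>) - g \<omega>) * \<alpha> \<omega> \<partial>R) + t\<^sup>2 * (\<integral>\<omega>. A \<omega> * (\<alpha> \<omega>)\<^sup>2 \<partial>R))" for t
  proof -
    have "(\<lambda>\<omega>. A \<omega> * ((h \<omega> + t * \<alpha> \<omega>) + f \<omega>)\<^sup>2 - 2 * g \<omega> * (h \<omega> + t * \<alpha> \<omega>) - k \<omega>) =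
      (\<lambda>\<omega>. (A \<omega> * (h \<omega> + f \<omega>)\<^sup>2 - 2 * g \<omega> * h \<omega> - k \<omega>) + (2 * t * ((A \<omega> * (h \<omega> + f \<omega>) - g \<omega>) * \<alpha> \<omega>) + t\<^sup>2 * (A \<omega> * (\<alpha> \<omega>)\<^sup>2)))"
      by (auto simp: power2_eq_square algebra_simps)
    then show ?thesis using i0 i1 i2 by simp
  qed
  show ?thesis
  proof (rule quadratic_min_linear_zero)
    show "0 \<le> (\<integral>\<omega>. A \<omega> * (\<alpha> \<omega>)\<^sup>2 \<partial>R)" by (rule integral_nonneg_AE) (use A(2) in \<open>eventually_elim, simp\<close>)
    show "0 \<le> 2 * t * (\<integral>\<omega>. (A \<omega> * (h \<omega> + f \<omega>) - g \<omega>) * \<alpha> \<omega> \<partial>R) + t\<^sup>2 * (\<integral>\<omega>. A \<omega> * (\<alpha> \<omega>)\<^sup>2 \<partial>R)" for t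
      using min[of t] unfolding eq by simp
  qed
qed

locale complementary_spaces = prob_space R for R :: "'a measure" +
  fixes AA BB :: "('a \<Rightarrow> real) set"
  assumes AA_iff: "\<And>\<alpha>. \<alpha> \<in> AA \<longleftrightarrow> \<alpha> \<in> L2_0 R \<and> (\<forall>\<beta>\<in>BB. (\<integral>\<omega>. \<alpha> \<omega> * \<beta> \<omega> \<partial>R) = 0)"
    and BB_iff: "\<And>\<beta>. \<beta> \<in> BB \<longleftrightarrow> \<beta> \<in> L2_0 R \<and> (\<forall>\<alpha>\<in>AA. (\<integral>\<omega>. \<alpha> \<omega> * \<beta> \<omega> \<partial>R) = 0)"
begin

lemma AA_L2: "\<alpha> \<in> AA \<Longrightarrow> \<alpha> \<in> L2_0 R" using AA_iff by blast
lemma BB_L2: "\<beta> \<in> BB \<Longrightarrow> \<beta> \<in> L2_0 R" using BB_iff by blast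
lemmas AA_sq = L2_0_sq_int[OF AA_L2] and BB_sq = L2_0_sq_int[OF BB_L2]

lemma AA_lin: assumes f: "f \<in> AA" and g: "g \<in> AA" shows "(\<lambda>\<omega>. f \<omega> + t * g \<omega>) \<in> AA"
  unfolding AA_iff[of "\<lambda>\<omega>. f \<omega> + t * g \<omega>"]
proof (intro conjI ballI)
  show "(\<lambda>\<omega>. f \<omega> + t * g \<omega>) \<in> L2_0 R" by (rule L2_0_lin[OF AA_L2[OF f] AA_L2[OF g]])
  fix \<beta> assume b: "\<beta> \<in> BB"
  have "(\<integral>\<omega>. (f \<omega> + t * g \<omega>) * \<beta> \<omega> \<partial>R) = (\<integral>\<omega>. f \<omega> * \<beta> \<omega> \<partial>R) + t * (\<integral>\<omega>. g \<omega> * \<beta> \<omega> \<partial>R)"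
    using sq_int_mult[OF AA_sq[OF f] BB_sq[OF b]] sq_int_mult[OF AA_sq[OF g] BB_sq[OF b]]
    by (simp add: distrib_right mult.assoc)
  then show "(\<integral>\<omega>. (f \<omega> + t * g \<omega>) * \<beta> \<omega> \<partial>R) = 0" using AA_iff[of f] AA_iff[of g] f g b by auto
qed

lemma complementary_swap: "complementary_spaces R BB AA"
proof unfold_locales
  show "\<alpha> \<in> BB \<longleftrightarrow> \<alpha> \<in> L2_0 R \<and> (\<forall>\<beta>\<in>AA. (\<integral>\<omega>. \<alpha> \<omega> * \<beta> \<omega> \<partial>R) = 0)" for \<alpha>
    by (subst BB_iff) (simp add: mult.commute)
  show "\<beta> \<in> AA \<longleftrightarrow> \<beta> \<in> L2_0 R \<and> (\<forall>\<alpha>\<in>BB. (\<integral>\<omega>. \<alpha> \<omega> * \<beta> \<omega> \<partial>R) = 0)" for \<beta>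
    by (subst AA_iff) (simp add: mult.commute)
qed

text \<open>Directions have mean zero, so subtracting the mean preserves orthogonality and puts the
  function into \<open>L2_0\<close>, where complementarity applies. The subtracted means become the
  slopes \<open>a\<close> and \<open>w\<close>.\<close>

lemma orthogonal_complement:
  assumes f: "sq_int R f" and o: "\<And>\<alpha>. \<alpha> \<in> AA \<Longrightarrow> (\<integral>\<omega>. f \<omega> * \<alpha> \<omega> \<partial>R) = 0"
  shows "(\<lambda>\<omega>. f \<omega> - (\<integral>\<omega>. f \<omega> \<partial>R)) \<in> BB"
  unfolding BB_iff[of "\<lambda>\<omega>. f \<omega> - (\<integral>\<omega>. f \<omega> \<partial>R)"]
proof (intro conjI ballI)
  let ?m = "\<integral>\<omega>. f \<omega> \<partial>R"
  have fi: "integrable R f" using sq_int_mult[OF f sq_int_const[of 1]] by simp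
  have s: "sq_int R (\<lambda>\<omega>. f \<omega> - ?m)" using sq_int_add[OF f sq_int_const[of "- ?m"]] by simp
  show "(\<lambda>\<omega>. f \<omega> - ?m) \<in> L2_0 R" using s fi by (auto simp: L2_0_def sq_int_def prob_space)
  fix \<alpha> assume a: "\<alpha> \<in> AA"
  have ai: "integrable R \<alpha>" "(\<integral>\<omega>. \<alpha> \<omega> \<partial>R) = 0" using AA_L2[OF a] by (auto simp: L2_0_def)
  have "(\<integral>\<omega>. \<alpha> \<omega> * (f \<omega> - ?m) \<partial>R) = (\<integral>\<omega>. f \<omega> * \<alpha> \<omega> \<partial>R) - ?m * (\<integral>\<omega>. \<alpha> \<omega> \<partial>R)"
    using sq_int_mult[OF f AA_sq[OF a]] ai by (simp add: right_diff_distrib mult.commute)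
  then show "(\<integral>\<omega>. \<alpha> \<omega> * (f \<omega> - ?m) \<partial>R) = 0" using o[OF a] ai by simp
qed

text \<open>Testing the difference of the two conditions with h1 - h2 itself makes the B-weighted
  integral of its square vanish, and B is positive.\<close>

lemma foc_unique:
  fixes B f g :: "'a \<Rightarrow> real"
  assumes B: "B \<in> borel_measurable R" "AE \<omega> in R. 0 < B \<omega> \<and> B \<omega> \<le> K"
    and f: "sq_int R f" and g: "sq_int R g" and h: "h1 \<in> AA" "h2 \<in> AA"
    and foc: "\<And>\<alpha>. \<alpha> \<in> AA \<Longrightarrow> (\<integral>\<omega>. (B \<omega> * (h1 \<omega> + f \<omega>) - g \<omega>) * \<alpha> \<omega> \<partial>R) = 0"
      "\<And>\<alpha>. \<alpha> \<in> AA \<Longrightarrow> (\<integral>\<omega>. (B \<omega> * (h2 \<omega> + f \<omega>) - g \<omega>) * \<alpha> \<omega> \<partial>R) = 0"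
  shows "AE \<omega> in R. h1 \<omega> = h2 \<omega>"
proof -
  have Bb: "AE \<omega> in R. \<bar>B \<omega>\<bar> \<le> K" using B(2) by eventually_elim auto
  define d where "d \<omega> = h1 \<omega> - h2 \<omega>" for \<omega>
  have d: "d \<in> AA" using AA_lin[OF h, of "-1"] by (simp add: d_def[abs_def])
  have i: "integrable R (\<lambda>\<omega>. (B \<omega> * (h \<omega> + f \<omega>) - g \<omega>) * d \<omega>)" if "h \<in> AA" for h
    using sq_int_mult[OF sq_int_bounded_mult[OF B(1) sq_int_add[OF AA_sq[OF that] f] Bb] AA_sq[OF d]] sq_int_mult[OF g AA_sq[OF d]]
    by (simp add: left_diff_distrib)
  have eq: "(\<lambda>\<omega>. B \<omega> * (d \<omega>)\<^sup>2) = (\<lambda>\<omega>. (B \<omega> * (h1 \<omega> + f \<omega>) - g \<omega>) * d \<omega> - (B \<omega> * (h2 \<omega> + f \<omega>) - g \<omega>) * d \<omega>)"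
    by (auto simp: d_def power2_eq_square algebra_simps)
  have z: "integrable R (\<lambda>\<omega>. B \<omega> * (d \<omega>)\<^sup>2)" "(\<integral>\<omega>. B \<omega> * (d \<omega>)\<^sup>2 \<partial>R) = 0"
    unfolding eq using i[OF h(1)] i[OF h(2)] foc[OF d] by simp_all
  have nn: "AE \<omega> in R. 0 \<le> B \<omega> * (d \<omega>)\<^sup>2" using B(2) by eventually_elim simp
  have "AE \<omega> in R. B \<omega> * (d \<omega>)\<^sup>2 = 0" using integral_nonneg_eq_0_iff_AE[OF z(1) nn] z(2) by simp
  then show ?thesis using B(2) by eventually_elim (auto simp: d_def)
qed

text \<open>From the primal minimizers, elements of \<open>BB\<close> are built that satisfy the
  dual first-order conditions; uniqueness identifies them with the given dual minimizers. As B = 1 /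
  A, the dual integrand becomes a combination of primal directions and a constant, and this is
  orthogonal to \<open>BB\<close>.\<close>

theorem minimizer_duality:
  fixes A B F kA kB :: "'a \<Rightarrow> real"
  assumes c: "0 < c1" and A: "A \<in> borel_measurable R" "AE \<omega> in R. c1 \<le> A \<omega> \<and> A \<omega> \<le> c2"
    and B: "B \<in> borel_measurable R" "AE \<omega> in R. B \<omega> = 1 / A \<omega>"
    and F: "sq_int R F" and k: "integrable R kA" "integrable R kB" and xy: "0 < x" "0 < y"
    and \<alpha>0: "\<alpha>0 \<in> AA" "\<And>\<alpha>. \<alpha> \<in> AA \<Longrightarrow> (\<integral>\<omega>. A \<omega> * (1 + \<alpha>0 \<omega>)\<^sup>2 \<partial>R) \<le> (\<integral>\<omega>. A \<omega> * (1 + \<alpha> \<omega>)\<^sup>2 \<partial>R)"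
    and \<beta>0: "\<beta>0 \<in> BB" "\<And>\<beta>. \<beta> \<in> BB \<Longrightarrow> (\<integral>\<omega>. B \<omega> * (1 + \<beta>0 \<omega>)\<^sup>2 \<partial>R) \<le> (\<integral>\<omega>. B \<omega> * (1 + \<beta> \<omega>)\<^sup>2 \<partial>R)"
    and \<alpha>d: "\<alpha>d \<in> AA" "\<And>\<alpha>. \<alpha> \<in> AA \<Longrightarrow> (\<integral>\<omega>. A \<omega> * (\<alpha>d \<omega> + x * F \<omega>)\<^sup>2 - 2 * x * F \<omega> * \<alpha>d \<omega> - kA \<omega> \<partial>R)
        \<le> (\<integral>\<omega>. A \<omega> * (\<alpha> \<omega> + x * F \<omega>)\<^sup>2 - 2 * x * F \<omega> * \<alpha> \<omega> - kA \<omega> \<partial>R)"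
    and \<beta>d: "\<beta>d \<in> BB" "\<And>\<beta>. \<beta> \<in> BB \<Longrightarrow> (\<integral>\<omega>. B \<omega> * (\<beta>d \<omega> - y * F \<omega>)\<^sup>2 + 2 * y * F \<omega> * \<beta>d \<omega> - kB \<omega> \<partial>R)
        \<le> (\<integral>\<omega>. B \<omega> * (\<beta> \<omega> - y * F \<omega>)\<^sup>2 + 2 * y * F \<omega> * \<beta> \<omega> - kB \<omega> \<partial>R)"
  shows "\<exists>a w. a \<noteq> 0 \<and> (AE \<omega> in R. A \<omega> * (1 + \<alpha>0 \<omega>) = a * (1 + \<beta>0 \<omega>)) \<and>
     (AE \<omega> in R. y * F \<omega> - A \<omega> * (\<alpha>d \<omega> + x * F \<omega>) * (y / x) = w * (1 + \<beta>0 \<omega>) + \<beta>d \<omega>)"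
proof -
  interpret Sw: complementary_spaces R BB AA by (rule complementary_swap)
  have A': "AE \<omega> in R. 0 \<le> A \<omega> \<and> A \<omega> \<le> c2" "AE \<omega> in R. \<bar>A \<omega>\<bar> \<le> c2" using A(2) by (eventually_elim, use c in auto)+
  have B': "AE \<omega> in R. 0 \<le> B \<omega> \<and> B \<omega> \<le> 1 / c1" "AE \<omega> in R. 0 < B \<omega> \<and> B \<omega> \<le> 1 / c1"
    using A(2) B(2) by (eventually_elim, use c in \<open>auto simp: frac_le\<close>)+
  have xF: "sq_int R (\<lambda>\<omega>. x * F \<omega>)" "sq_int R (\<lambda>\<omega>. - y * F \<omega>)"
    using sq_int_cmult[OF F, of x] sq_int_cmult[OF F, of "- y"] by auto
  have one: "sq_int R (\<lambda>_. 1)" and zero: "sq_int R (\<lambda>_. 0)" by (rule sq_int_const)+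
  have foc1: "(\<integral>\<omega>. (A \<omega> * (\<alpha>0 \<omega> + 1) - 0) * \<alpha> \<omega> \<partial>R) = 0" if a: "\<alpha> \<in> AA" for \<alpha>
  proof (rule quadratic_minimizer_foc[OF A(1) A'(1) one zero _ AA_sq[OF \<alpha>0(1)] AA_sq[OF a], where k="\<lambda>_. 0"])
    fix t
    show "(\<integral>\<omega>. A \<omega> * (\<alpha>0 \<omega> + 1)\<^sup>2 - 2 * 0 * \<alpha>0 \<omega> - 0 \<partial>R) \<le> (\<integral>\<omega>. A \<omega> * ((\<alpha>0 \<omega> + t * \<alpha> \<omega>) + 1)\<^sup>2 - 2 * 0 * (\<alpha>0 \<omega> + t * \<alpha> \<omega>) - 0 \<partial>R)"
      using \<alpha>0(2)[OF AA_lin[OF \<alpha>0(1) a, of t]] by (simp add: add.commute add.left_commute)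
  qed simp
  have foc2: "(\<integral>\<omega>. (B \<omega> * (\<beta>0 \<omega> + 1) - 0) * \<beta> \<omega> \<partial>R) = 0" if a: "\<beta> \<in> BB" for \<beta>
  proof (rule quadratic_minimizer_foc[OF B(1) B'(1) one zero _ BB_sq[OF \<beta>0(1)] BB_sq[OF a], where k="\<lambda>_. 0"])
    fix t
    show "(\<integral>\<omega>. B \<omega> * (\<beta>0 \<omega> + 1)\<^sup>2 - 2 * 0 * \<beta>0 \<omega> - 0 \<partial>R) \<le> (\<integral>\<omega>. B \<omega> * ((\<beta>0 \<omega> + t * \<beta> \<omega>) + 1)\<^sup>2 - 2 * 0 * (\<beta>0 \<omega> + t * \<beta> \<omega>) - 0 \<partial>R)"
      using \<beta>0(2)[OF Sw.AA_lin[OF \<beta>0(1) a, of t]] by (simp add: add.commute add.left_commute)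
  qed simp
  have foc3: "(\<integral>\<omega>. (A \<omega> * (\<alpha>d \<omega> + x * F \<omega>) - x * F \<omega>) * \<alpha> \<omega> \<partial>R) = 0" if a: "\<alpha> \<in> AA" for \<alpha>
  proof (rule quadratic_minimizer_foc[OF A(1) A'(1) xF(1) xF(1) k(1) AA_sq[OF \<alpha>d(1)] AA_sq[OF a]])
    fix t
    show "(\<integral>\<omega>. A \<omega> * (\<alpha>d \<omega> + x * F \<omega>)\<^sup>2 - 2 * (x * F \<omega>) * \<alpha>d \<omega> - kA \<omega> \<partial>R)
      \<le> (\<integral>\<omega>. A \<omega> * ((\<alpha>d \<omega> + t * \<alpha> \<omega>) + x * F \<omega>)\<^sup>2 - 2 * (x * F \<omega>) * (\<alpha>d \<omega> + t * \<alpha> \<omega>) - kA \<omega> \<partial>R)"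
      using \<alpha>d(2)[OF AA_lin[OF \<alpha>d(1) a, of t]] by (simp only: mult.assoc)
  qed
  have foc4: "(\<integral>\<omega>. (B \<omega> * (\<beta>d \<omega> + - y * F \<omega>) - - y * F \<omega>) * \<beta> \<omega> \<partial>R) = 0" if a: "\<beta> \<in> BB" for \<beta>
  proof (rule quadratic_minimizer_foc[OF B(1) B'(1) xF(2) xF(2) k(2) BB_sq[OF \<beta>d(1)] BB_sq[OF a]])
    fix t
    show "(\<integral>\<omega>. B \<omega> * (\<beta>d \<omega> + - y * F \<omega>)\<^sup>2 - 2 * (- y * F \<omega>) * \<beta>d \<omega> - kB \<omega> \<partial>R)
      \<le> (\<integral>\<omega>. B \<omega> * ((\<beta>d \<omega> + t * \<beta> \<omega>) + - y * F \<omega>)\<^sup>2 - 2 * (- y * F \<omega>) * (\<beta>d \<omega> + t * \<beta> \<omega>) - kB \<omega> \<partial>R)"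
      using \<beta>d(2)[OF Sw.AA_lin[OF \<beta>d(1) a, of t]] by (simp add: mult.assoc)
  qed
  have a01: "sq_int R (\<lambda>\<omega>. \<alpha>0 \<omega> + 1)" by (rule sq_int_add[OF AA_sq[OF \<alpha>0(1)] one])
  define f where "f \<omega> = A \<omega> * (\<alpha>0 \<omega> + 1)" for \<omega>
  have f: "sq_int R f" unfolding f_def[abs_def] by (rule sq_int_bounded_mult[OF A(1) a01 A'(2)])
  have fi: "integrable R f" using sq_int_mult[OF f one] by simp
  \<comment> \<open>By the first-order condition for \<alpha>0 this mean equals the expectation of A
    times the square of 1 + \<alpha>0, that is a(x,x). It is at least c1 because \<alpha>0 has mean
    zero.\<close>
  define a where "a = (\<integral>\<omega>. f \<omega> \<partial>R)"
  have a: "0 < a"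
  proof -
    have e1: "integrable R (\<lambda>\<omega>. (\<alpha>0 \<omega> + 1)\<^sup>2)" using a01 by (simp add: sq_int_def)
    have e2: "integrable R (\<lambda>\<omega>. f \<omega> * (\<alpha>0 \<omega> + 1))" by (rule sq_int_mult[OF f a01])
    have al: "integrable R \<alpha>0" "(\<integral>\<omega>. \<alpha>0 \<omega> \<partial>R) = 0" "integrable R (\<lambda>\<omega>. (\<alpha>0 \<omega>)\<^sup>2)" using AA_L2[OF \<alpha>0(1)] by (auto simp: L2_0_def)
    have "(\<lambda>\<omega>. (\<alpha>0 \<omega> + 1)\<^sup>2) = (\<lambda>\<omega>. (\<alpha>0 \<omega>)\<^sup>2 + 2 * \<alpha>0 \<omega> + 1)" by (auto simp: power2_sum)
    then have "(\<integral>\<omega>. (\<alpha>0 \<omega> + 1)\<^sup>2 \<partial>R) = (\<integral>\<omega>. (\<alpha>0 \<omega>)\<^sup>2 \<partial>R) + 1" using al by (simp add: prob_space)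
    then have "1 \<le> (\<integral>\<omega>. (\<alpha>0 \<omega> + 1)\<^sup>2 \<partial>R)" by simp
    then have "c1 \<le> c1 * (\<integral>\<omega>. (\<alpha>0 \<omega> + 1)\<^sup>2 \<partial>R)" using c by simp
    also have "\<dots> = (\<integral>\<omega>. c1 * (\<alpha>0 \<omega> + 1)\<^sup>2 \<partial>R)" by simp
    also have "\<dots> \<le> (\<integral>\<omega>. f \<omega> * (\<alpha>0 \<omega> + 1) \<partial>R)"
    proof (rule integral_mono_AE)
      show "AE \<omega> in R. c1 * (\<alpha>0 \<omega> + 1)\<^sup>2 \<le> f \<omega> * (\<alpha>0 \<omega> + 1)" using A(2)
        by eventually_elim (auto simp: f_def power2_eq_square mult.assoc intro!: mult_right_mono)
    qed (use e1 e2 in auto)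
    also have "(\<integral>\<omega>. f \<omega> * (\<alpha>0 \<omega> + 1) \<partial>R) = (\<integral>\<omega>. f \<omega> * \<alpha>0 \<omega> \<partial>R) + a"
      using sq_int_mult[OF f AA_sq[OF \<alpha>0(1)]] fi by (simp add: distrib_left a_def)
    also have "(\<integral>\<omega>. f \<omega> * \<alpha>0 \<omega> \<partial>R) = 0" using foc1[OF \<alpha>0(1)] by (simp add: f_def)
    finally show ?thesis using c by simp
  qed
  have "(\<lambda>\<omega>. f \<omega> - a) \<in> BB" unfolding a_def by (rule orthogonal_complement[OF f]) (use foc1 in \<open>simp add: f_def\<close>)
  \<comment> \<open>The element \<open>f - a\<close> of \<open>BB\<close> divided by
    \<open>a\<close>. Then B (1 + b) = (1 + \<alpha>0) / a, which is orthogonal to every dual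
    direction.\<close>
  define b where "b \<omega> = f \<omega> / a - 1" for \<omega>
  have b: "b \<in> BB"
  proof -
    have "(\<lambda>\<omega>. (f \<omega> - a) + (1 / a - 1) * (f \<omega> - a)) = b" using a by (auto simp: b_def field_simps)
    then show ?thesis using Sw.AA_lin[OF \<open>(\<lambda>\<omega>. f \<omega> - a) \<in> BB\<close> \<open>(\<lambda>\<omega>. f \<omega> - a) \<in> BB\<close>, of "1 / a - 1"] by simp
  qed
  have BA: "AE \<omega> in R. B \<omega> * A \<omega> = 1" using A(2) B(2) by eventually_elim (use c in auto)
  have meas [measurable]: "A \<in> borel_measurable R" "B \<in> borel_measurable R" "F \<in> borel_measurable R"
      "\<alpha>0 \<in> borel_measurable R" "\<alpha>d \<in> borel_measurable R" "\<beta>0 \<in> borel_measurable R" "\<beta>d \<in> borel_measurable R" "f \<in> borel_measurable R"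
    using A B F AA_sq[OF \<alpha>0(1)] AA_sq[OF \<alpha>d(1)] BB_sq[OF \<beta>0(1)] BB_sq[OF \<beta>d(1)] f by (auto simp: sq_int_def)
  have bb: "AE \<omega> in R. b \<omega> = \<beta>0 \<omega>"
  proof (rule Sw.foc_unique[OF B(1) B'(2) one zero b \<beta>0(1)])
    fix \<beta> assume be: "\<beta> \<in> BB"
    have [measurable]: "\<beta> \<in> borel_measurable R" "b \<in> borel_measurable R" using BB_sq[OF be] BB_sq[OF b] by (auto simp: sq_int_def)
    have bz: "integrable R \<beta>" "(\<integral>\<omega>. \<beta> \<omega> \<partial>R) = 0" using BB_L2[OF be] by (auto simp: L2_0_def)
    have "(\<integral>\<omega>. (B \<omega> * (b \<omega> + 1) - 0) * \<beta> \<omega> \<partial>R) = (\<integral>\<omega>. 1 / a * (\<alpha>0 \<omega> * \<beta> \<omega> + \<beta> \<omega>) \<partial>R)"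
    proof (rule integral_cong_AE)
      show "AE \<omega> in R. (B \<omega> * (b \<omega> + 1) - 0) * \<beta> \<omega> = 1 / a * (\<alpha>0 \<omega> * \<beta> \<omega> + \<beta> \<omega>)" using BA
      proof eventually_elim
        case (elim \<omega>)
        have "(B \<omega> * (b \<omega> + 1) - 0) * \<beta> \<omega> = (B \<omega> * A \<omega>) * (1 / a * (\<alpha>0 \<omega> * \<beta> \<omega> + \<beta> \<omega>))"
          by (simp add: b_def f_def algebra_simps add_divide_distrib)
        then show ?case using elim by simp
      qed
    qed measurable
    also have "\<dots> = 1 / a * ((\<integral>\<omega>. \<alpha>0 \<omega> * \<beta> \<omega> \<partial>R) + (\<integral>\<omega>. \<beta> \<omega> \<partial>R))"
      using sq_int_mult[OF AA_sq[OF \<alpha>0(1)] BB_sq[OF be]] bz by simp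
    also have "\<dots> = 0" using AA_iff[of \<alpha>0] \<alpha>0(1) be bz by auto
    finally show "(\<integral>\<omega>. (B \<omega> * (b \<omega> + 1) - 0) * \<beta> \<omega> \<partial>R) = 0" .
  qed (rule foc2)
  then have r1: "AE \<omega> in R. A \<omega> * (1 + \<alpha>0 \<omega>) = a * (1 + \<beta>0 \<omega>)"
    by eventually_elim (use a in \<open>auto simp: b_def f_def field_simps\<close>)
  \<comment> \<open>The integrand of the first-order condition for \<alpha>d, scaled by - y / x. Its
    mean \<open>w\<close> is - (y / x) a(x,d), since the condition tested with \<alpha>0 lets the
    factor 1 + \<alpha>0 be inserted.\<close>
  define g where "g \<omega> = - (y / x) * (A \<omega> * (\<alpha>d \<omega> + x * F \<omega>) - x * F \<omega>)" for \<omega>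
  have g: "sq_int R g"
    using sq_int_cmult[OF sq_int_add[OF sq_int_bounded_mult[OF A(1) sq_int_add[OF AA_sq[OF \<alpha>d(1)] xF(1)] A'(2)] sq_int_cmult[OF F, of "- x"]], of "- (y / x)"]
    by (simp add: g_def[abs_def])
  define w where "w = (\<integral>\<omega>. g \<omega> \<partial>R)"
  have gw: "(\<lambda>\<omega>. g \<omega> - w) \<in> BB" unfolding w_def
  proof (rule orthogonal_complement[OF g])
    fix \<alpha> assume al: "\<alpha> \<in> AA"
    have "(\<integral>\<omega>. g \<omega> * \<alpha> \<omega> \<partial>R) = (\<integral>\<omega>. - (y / x) * ((A \<omega> * (\<alpha>d \<omega> + x * F \<omega>) - x * F \<omega>) * \<alpha> \<omega>) \<partial>R)"
      by (simp only: g_def mult.assoc)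
    then show "(\<integral>\<omega>. g \<omega> * \<alpha> \<omega> \<partial>R) = 0" using foc3[OF al] by simp
  qed
  \<comment> \<open>The constant \<open>w\<close> is removed as w (1 + \<beta>0): multiplied by B
    the latter becomes (w / a) (1 + \<alpha>0), a primal direction plus a constant, whereas B w
    alone has no such form.\<close>
  define d where "d \<omega> = (g \<omega> - w) + - w * \<beta>0 \<omega>" for \<omega>
  have d: "d \<in> BB" unfolding d_def[abs_def] by (rule Sw.AA_lin[OF gw \<beta>0(1)])
  have dd: "AE \<omega> in R. d \<omega> = \<beta>d \<omega>"
  proof (rule Sw.foc_unique[OF B(1) B'(2) xF(2) xF(2) d \<beta>d(1)])
    fix \<beta> assume be: "\<beta> \<in> BB"
    have [measurable]: "\<beta> \<in> borel_measurable R" "d \<in> borel_measurable R" using BB_sq[OF be] BB_sq[OF d] by (auto simp: sq_int_def)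
    have bz: "integrable R \<beta>" "(\<integral>\<omega>. \<beta> \<omega> \<partial>R) = 0" using BB_L2[OF be] by (auto simp: L2_0_def)
    have "(\<integral>\<omega>. (B \<omega> * (d \<omega> + - y * F \<omega>) - - y * F \<omega>) * \<beta> \<omega> \<partial>R)
        = (\<integral>\<omega>. - (y / x) * (\<alpha>d \<omega> * \<beta> \<omega>) - w / a * (\<alpha>0 \<omega> * \<beta> \<omega> + \<beta> \<omega>) \<partial>R)"
    proof (rule integral_cong_AE)
      show "AE \<omega> in R. (B \<omega> * (d \<omega> + - y * F \<omega>) - - y * F \<omega>) * \<beta> \<omega> = - (y / x) * (\<alpha>d \<omega> * \<beta> \<omega>) - w / a * (\<alpha>0 \<omega> * \<beta> \<omega> + \<beta> \<omega>)"
        using BA r1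
      proof eventually_elim
        case (elim \<omega>)
        have b0: "1 + \<beta>0 \<omega> = A \<omega> * (1 + \<alpha>0 \<omega>) / a" using elim(2) a by (simp add: field_simps)
        have "d \<omega> + - y * F \<omega> = - (y / x) * A \<omega> * (\<alpha>d \<omega> + x * F \<omega>) - w * (1 + \<beta>0 \<omega>)"
          using xy by (simp add: d_def g_def field_simps)
        also have "\<dots> = A \<omega> * (- (y / x) * (\<alpha>d \<omega> + x * F \<omega>) - w / a * (1 + \<alpha>0 \<omega>))"
        proof -
          have "- m * r * s - w * (r * v / a) = r * (- m * s - w / a * v)" for m r s v :: real by (simp add: algebra_simps)
          then show ?thesis unfolding b0 by this
        qed
        finally have e: "d \<omega> + - y * F \<omega> = A \<omega> * (- (y / x) * (\<alpha>d \<omega> + x * F \<omega>) - w / a * (1 + \<alpha>0 \<omega>))" .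
        have ba: "B \<omega> * (A \<omega> * s) = s" for s using elim(1) by (simp add: mult.assoc[symmetric])
        have "B \<omega> * (d \<omega> + - y * F \<omega>) - - y * F \<omega> = - (y / x) * (\<alpha>d \<omega> + x * F \<omega>) - w / a * (1 + \<alpha>0 \<omega>) - - y * F \<omega>"
          by (simp only: e ba)
        also have "\<dots> = - (y / x) * \<alpha>d \<omega> - w / a * (1 + \<alpha>0 \<omega>)"
        proof -
          have "- (y / x) * (s + x * u) - v - - y * u = - (y / x) * s - v" for s u v using xy by (simp add: distrib_left)
          then show ?thesis by this
        qed
        finally have "B \<omega> * (d \<omega> + - y * F \<omega>) - - y * F \<omega> = - (y / x) * \<alpha>d \<omega> - w / a * (1 + \<alpha>0 \<omega>)" .
        moreover have "(- m * s - v * (1 + u)) * b = - m * (s * b) - v * (u * b + b)" for m s v u b :: real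
          by (simp add: algebra_simps)
        ultimately show ?case by (simp only:)
      qed
    qed measurable
    also have "\<dots> = - (y / x) * (\<integral>\<omega>. \<alpha>d \<omega> * \<beta> \<omega> \<partial>R) - w / a * ((\<integral>\<omega>. \<alpha>0 \<omega> * \<beta> \<omega> \<partial>R) + (\<integral>\<omega>. \<beta> \<omega> \<partial>R))"
      using sq_int_mult[OF AA_sq[OF \<alpha>0(1)] BB_sq[OF be]] sq_int_mult[OF AA_sq[OF \<alpha>d(1)] BB_sq[OF be]] bz by simp
    also have "\<dots> = 0" using AA_iff[of \<alpha>0] AA_iff[of \<alpha>d] \<alpha>0(1) \<alpha>d(1) be bz by auto
    finally show "(\<integral>\<omega>. (B \<omega> * (d \<omega> + - y * F \<omega>) - - y * F \<omega>) * \<beta> \<omega> \<partial>R) = 0" .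
  qed (rule foc4)
  have "AE \<omega> in R. y * F \<omega> - A \<omega> * (\<alpha>d \<omega> + x * F \<omega>) * (y / x) = w * (1 + \<beta>0 \<omega>) + \<beta>d \<omega>"
    using dd
  proof eventually_elim
    case (elim \<omega>)
    then have "\<beta>d \<omega> = (g \<omega> - w) + - w * \<beta>0 \<omega>" by (simp add: d_def)
    then show ?case using xy by (simp add: g_def field_simps)
  qed
  then show ?thesis using a r1 by (intro exI[of _ a] exI[of _ w]) auto
qed

end

section \<open>The conjugate utility\<close>

lemma utility_ok_deriv:
  assumes "utility_ok U c1 c2" and t: "0 < t"
  shows "(U has_real_derivative deriv U t) (at t)" "0 < deriv U t"
    "(deriv U has_real_derivative - (RRA U t * deriv U t / t)) (at t)" "c1 \<le> RRA U t" "RRA U t \<le> c2"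
proof -
  from assms have mono: "strict_mono_on {0<..} U" and c1: "0 < c1"
    and b: "c1 \<le> - deriv (deriv U) t * t / deriv U t" "- deriv (deriv U) t * t / deriv U t \<le> c2"
    and d: "U differentiable (at t)" "deriv U differentiable (at t)" by (auto simp: utility_ok_def)
  show 1: "(U has_real_derivative deriv U t) (at t)" using d(1) by (simp add: DERIV_deriv_iff_real_differentiable)
  \<comment> \<open>Division by 0 yields 0, so a vanishing derivative would contradict the positive
    lower bound on the quotient.\<close>
  have nz: "deriv U t \<noteq> 0" using b(1) c1 by auto
  have "\<not> deriv U t < 0"
  proof
    assume "deriv U t < 0"
    from DERIV_neg_dec_right[OF 1 this] obtain e where e: "0 < e" "\<And>h. 0 < h \<Longrightarrow> h < e \<Longrightarrow> U (t + h) < U t" by auto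
    have "U t < U (t + e / 2)" using e(1) t by (intro strict_mono_onD[OF mono]) auto
    with e(2)[of "e / 2"] e(1) show False by auto
  qed
  with nz show "0 < deriv U t" by simp
  have "deriv (deriv U) t = - (RRA U t * deriv U t / t)" using nz t by (simp add: RRA_def)
  then show "(deriv U has_real_derivative - (RRA U t * deriv U t / t)) (at t)"
    using d(2) by (metis DERIV_deriv_iff_real_differentiable)
  show "c1 \<le> RRA U t" "RRA U t \<le> c2" using b by (auto simp: RRA_def)
qed

lemma utility_ok_deriv_decreasing:
  assumes U: "utility_ok U c1 c2" and ab: "0 < a" "a < b"
  shows "deriv U b < deriv U a"
proof (rule DERIV_neg_imp_decreasing[OF ab(2)])
  fix t assume "a \<le> t" "t \<le> b"
  then have t: "0 < t" using ab by simp
  have "0 < c1" using U by (simp add: utility_ok_def)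
  then have "0 < RRA U t" using utility_ok_deriv(4)[OF U t] by linarith
  then have "- (RRA U t * deriv U t / t) < 0" using utility_ok_deriv(2)[OF U t] t by simp
  then show "\<exists>y. (deriv U has_real_derivative y) (at t) \<and> y < 0" using utility_ok_deriv(3)[OF U t] by blast
qed

text \<open>In logarithmic coordinates ln U' has slope at most - c1, so it runs through all reals:
  the Inada conditions are a consequence of the lower bound on the risk aversion.\<close>

lemma utility_ok_deriv_surj:
  assumes U: "utility_ok U c1 c2" and s: "0 < s"
  shows "\<exists>t>0. deriv U t = s"
proof -
  have c1: "0 < c1" using U by (simp add: utility_ok_def)
  define h where "h v = ln (deriv U (exp v))" for v
  have d: "(h has_real_derivative - RRA U (exp v)) (at v)" for v
  proof -
    note u = utility_ok_deriv[OF U exp_gt_zero[of v]]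
    have "((\<lambda>v. deriv U (exp v)) has_real_derivative - (RRA U (exp v) * deriv U (exp v) / exp v) * exp v) (at v)"
      by (rule DERIV_chain2[where f="deriv U" and g=exp, OF u(3)]) auto
    then have "((\<lambda>v. ln (deriv U (exp v))) has_real_derivative
        1 / deriv U (exp v) * (- (RRA U (exp v) * deriv U (exp v) / exp v) * exp v)) (at v)"
      by (intro DERIV_chain2[where f=ln and g="\<lambda>v. deriv U (exp v)"]) (use u in \<open>auto intro!: derivative_eq_intros\<close>)
    then show ?thesis using u(2) by (simp add: h_def[abs_def])
  qed
  have steep: "h b \<le> h a - c1 * (b - a)" if "a < b" for a b
  proof -
    from MVT2[OF that, of h "\<lambda>v. - RRA U (exp v)"] d obtain z where "h b - h a = (b - a) * - RRA U (exp z)" by blast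
    moreover have "(b - a) * c1 \<le> (b - a) * RRA U (exp z)"
      using that utility_ok_deriv(4)[OF U exp_gt_zero[of z]] by (intro mult_left_mono) auto
    ultimately show ?thesis by (simp add: algebra_simps)
  qed
  \<comment> \<open>Over a distance \<open>K\<close> to either side of 0 the slope bound moves
    \<open>h\<close> by at least |ln s - h 0| + 1, so the level ln s is enclosed.\<close>
  define K where "K = (\<bar>ln s - h 0\<bar> + 1) / c1"
  have K: "0 < K" "c1 * K = \<bar>ln s - h 0\<bar> + 1" using c1 by (auto simp: K_def add_nonneg_pos)
  have "h K \<le> ln s" "ln s \<le> h (- K)" using steep[of 0 K] steep[of "- K" 0] K by auto
  moreover have "isCont h v" for v using DERIV_isCont[OF d] .
  ultimately obtain v where v: "h v = ln s" using IVT2[of h K "ln s" "- K"] K by auto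
  have "deriv U (exp v) = s" using v s utility_ok_deriv(2)[OF U exp_gt_zero[of v]] by (simp add: h_def)
  then show ?thesis by (intro exI[of _ "exp v"]) simp
qed

text \<open>On positive arguments this is - V'; at the remaining arguments the value is
  arbitrary.\<close>

definition inv_deriv :: "(real \<Rightarrow> real) \<Rightarrow> real \<Rightarrow> real" where
  "inv_deriv U s = (SOME t. 0 < t \<and> deriv U t = s)"

lemma inv_deriv:
  assumes U: "utility_ok U c1 c2"
  shows "0 < s \<Longrightarrow> 0 < inv_deriv U s" "0 < s \<Longrightarrow> deriv U (inv_deriv U s) = s" "0 < t \<Longrightarrow> inv_deriv U (deriv U t) = t"
proof -
  have *: "0 < inv_deriv U s \<and> deriv U (inv_deriv U s) = s" if "0 < s" for s
    unfolding inv_deriv_def by (rule someI_ex) (use utility_ok_deriv_surj[OF U that] in auto)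
  then show "0 < s \<Longrightarrow> 0 < inv_deriv U s" "0 < s \<Longrightarrow> deriv U (inv_deriv U s) = s" by auto
  show "inv_deriv U (deriv U t) = t" if "0 < t"
    using *[OF utility_ok_deriv(2)[OF U that]] that utility_ok_deriv_decreasing[OF U]
    by (metis less_irrefl linorder_neqE_linordered_idom)
qed

lemma inv_deriv_derivative:
  assumes U: "utility_ok U c1 c2" and s: "0 < s"
  shows "(inv_deriv U has_real_derivative - (1 / RRA U (inv_deriv U s) * inv_deriv U s / s)) (at s)"
proof -
  define t where "t = inv_deriv U s"
  have t: "0 < t" "deriv U t = s" using inv_deriv[OF U] s by (auto simp: t_def)
  have R: "0 < RRA U t" using utility_ok_deriv(4)[OF U t(1)] U by (auto simp: utility_ok_def)
  have "isCont (inv_deriv U) (deriv U t)"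
  proof (rule isCont_inverse_function[where d="t / 2" and f="deriv U"])
    show "0 < t / 2" using t by simp
    fix z assume "\<bar>z - t\<bar> \<le> t / 2"
    then have z: "0 < z" using t(1) by linarith
    show "inv_deriv U (deriv U z) = z" using inv_deriv(3)[OF U z] .
    show "isCont (deriv U) z" using DERIV_isCont[OF utility_ok_deriv(3)[OF U z]] .
  qed
  then have cont: "isCont (inv_deriv U) s" using t by simp
  have "(inv_deriv U has_real_derivative inverse (- (RRA U t * deriv U t / t))) (at s)"
  proof (rule DERIV_inverse_function[where f="deriv U" and a="s / 2" and b="2 * s"])
    show "(deriv U has_real_derivative - (RRA U t * deriv U t / t)) (at (inv_deriv U s))"
      using utility_ok_deriv(3)[OF U t(1)] by (simp add: t_def)
    show "- (RRA U t * deriv U t / t) \<noteq> 0" using R t s by simp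
    show "deriv U (inv_deriv U z) = z" if "s / 2 < z" "z < 2 * s" for z using inv_deriv(2)[OF U] that s by simp
  qed (use s cont in auto)
  then show ?thesis using t R s by (simp add: t_def[symmetric] inverse_eq_divide)
qed

text \<open>The conjugate is written down through the Fenchel equality. In its derivative the terms
  containing the derivative of \<open>inv_deriv U\<close> cancel, because U' at
  \<open>inv_deriv U s\<close> is \<open>s\<close>.\<close>

lemma utility_pair_inv_deriv:
  assumes U: "utility_ok U c1 c2"
  shows "utility_pair U (\<lambda>s. s * inv_deriv U s - U (inv_deriv U s)) (deriv U) (inv_deriv U) (RRA U) c1 c2"
proof
  show "0 < c1" "c1 \<le> c2" using U by (auto simp: utility_ok_def)
next
  fix t :: real assume t: "0 < t"
  note u = utility_ok_deriv[OF U t]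
  show "(U has_real_derivative deriv U t) (at t)" "0 < deriv U t"
    "(deriv U has_real_derivative - (RRA U t * deriv U t / t)) (at t)" "c1 \<le> RRA U t" "RRA U t \<le> c2" by (fact u)+
  show "inv_deriv U (deriv U t) = t" "0 < inv_deriv U t" "deriv U (inv_deriv U t) = t" using inv_deriv[OF U] t by auto
  show "(inv_deriv U has_real_derivative - (1 / RRA U (inv_deriv U t) * inv_deriv U t / t)) (at t)"
    by (rule inv_deriv_derivative[OF U t])
  show "U t + (deriv U t * inv_deriv U (deriv U t) - U (inv_deriv U (deriv U t))) = t * deriv U t"
    using inv_deriv(3)[OF U t] by (simp add: mult.commute)
  let ?D = "- (1 / RRA U (inv_deriv U t) * inv_deriv U t / t)"
  have I: "(inv_deriv U has_real_derivative ?D) (at t)" by (rule inv_deriv_derivative[OF U t])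
  have i0: "0 < inv_deriv U t" and i1: "deriv U (inv_deriv U t) = t" using inv_deriv[OF U] t by auto
  have "(U has_real_derivative t) (at (inv_deriv U t))" using utility_ok_deriv(1)[OF U i0] i1 by simp
  then have c: "((\<lambda>s. U (inv_deriv U s)) has_real_derivative t * ?D) (at t)" by (rule DERIV_chain2[OF _ I])
  have "((\<lambda>s. s * inv_deriv U s) has_real_derivative 1 * inv_deriv U t + ?D * t) (at t)"
    by (rule DERIV_mult[OF DERIV_ident I])
  from DERIV_diff[OF this c] show "((\<lambda>s. s * inv_deriv U s - U (inv_deriv U s)) has_real_derivative inv_deriv U t) (at t)"
    by (simp add: mult.commute)
qed

section \<open>Identification of the conjugate with V and of its risk aversion with B\<close>

context utility_pair
begin

lemma Vext_eq: "0 < s \<Longrightarrow> Vext U s = ereal (- W s)"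
  unfolding Vext_def
proof (rule antisym)
  assume s: "0 < s"
  show "(SUP t\<in>{0<..}. ereal (U t - t * s)) \<le> ereal (- W s)"
  proof (rule SUP_least)
    fix t :: real assume "t \<in> {0<..}"
    then show "ereal (U t - t * s) \<le> ereal (- W s)" using gap_nonneg[of t s] s by simp
  qed
  have "- W s = U (q s) - q s * s" using fenchel_eq[OF q_pos[OF s]] pq[OF s] by simp
  then show "ereal (- W s) \<le> (SUP t\<in>{0<..}. ereal (U t - t * s))" using q_pos[OF s]
    by (intro SUP_upper2[of "q s"]) auto
qed

lemma Vfun_eq: "0 < s \<Longrightarrow> Vfun U s = - W s" by (simp add: Vfun_def Vext_eq)

text \<open>The axioms speak of W at positive arguments, so W may be exchanged for a function that
  differs elsewhere, such as - \<open>Vfun U\<close>, whose values there depend on the conversion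
  from extended reals.\<close>

lemma change_conjugate:
  assumes "\<And>s. 0 < s \<Longrightarrow> W' s = W s"
  shows "utility_pair U W' p q A c1 c2"
proof
  fix s :: real assume s: "0 < s"
  show "(W' has_real_derivative q s) (at s)"
    by (rule has_field_derivative_transform_within_open[OF dW[OF s], of "{0<..}"]) (use s assms in auto)
  show "U s + W' (p s) = s * p s" using fenchel_eq[OF s] assms[OF p_pos[OF s]] by simp
qed (use c1_pos c1_le dU p_pos q_pos qp pq dp dq A_ge A_le in auto)

text \<open>At 0 the claim is that sup U equals - inf W. Fenchel's inequality at the price e / t
  gives one direction up to e; the other follows from U(q(s)) + W(s) = s q(s) > 0.\<close>

lemma Vext_Uext: assumes "0 \<le> t" shows "Vext U t = - Uext W t"
proof (cases "0 < t")
  case True then show ?thesis by (simp add: Vext_eq Uext_def)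
next
  case False
  then have t: "t = 0" using assms by simp
  have "(SUP t\<in>{0<..}. ereal (U t)) = (SUP s\<in>{0<..}. - ereal (W s))"
  proof (rule antisym; rule SUP_least)
    fix t :: real assume t: "t \<in> {0<..}"
    have "ereal (U t) \<le> (SUP s\<in>{0<..}. - ereal (W s)) + ereal e" if e: "0 < e" for e
    proof -
      have s: "0 < e / t" using e t by simp
      have "U t \<le> - W (e / t) + e" using gap_nonneg[of t "e / t"] s t by simp
      then have "ereal (U t) \<le> - ereal (W (e / t)) + ereal e" by simp
      also have "\<dots> \<le> (SUP s\<in>{0<..}. - ereal (W s)) + ereal e" using s by (intro add_right_mono SUP_upper) auto
      finally show ?thesis .
    qed
    then show "ereal (U t) \<le> (SUP s\<in>{0<..}. - ereal (W s))" by (rule ereal_le_epsilon2)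
  next
    fix s :: real assume s: "s \<in> {0<..}"
    have "0 < q s * s" using q_pos[of s] s by simp
    moreover have "U (q s) + W s = q s * s" using fenchel_eq[of "q s"] q_pos[of s] pq[of s] s by simp
    ultimately have "- W s \<le> U (q s)" by linarith
    then show "- ereal (W s) \<le> (SUP t\<in>{0<..}. ereal (U t))" using q_pos[of s] s by (intro SUP_upper2[of "q s"]) auto
  qed
  then show ?thesis using t by (simp add: Vext_def Uext_def ereal_SUP_uminus_eq del: uminus_ereal.simps)
qed

text \<open>On the positive axis V' = - q, so B is the relative risk aversion of the exchanged
  utility W.\<close>

lemma Bcoef_eq: assumes s: "0 < s" shows "Bcoef U s = 1 / A (q s)"
proof -
  have v: "(Vfun U has_real_derivative - q t) (at t)" if t: "0 < t" for t
    by (rule has_field_derivative_transform_within_open[OF DERIV_minus[OF dW[OF t]], of "{0<..}"])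
       (use t Vfun_eq in auto)
  then have dv: "deriv (Vfun U) t = - q t" if "0 < t" for t using DERIV_imp_deriv that by blast
  have "(deriv (Vfun U) has_real_derivative - (- (1 / A (q s) * q s / s))) (at s)"
    by (rule has_field_derivative_transform_within_open[OF DERIV_minus[OF dq[OF s]], of "{0<..}"]) (use s dv in auto)
  then have "deriv (deriv (Vfun U)) s = 1 / A (q s) * q s / s" using DERIV_imp_deriv by fastforce
  then show ?thesis using s q_pos[OF s] by (simp add: Bcoef_def dv)
qed

end

lemma utility_pair_of_utility_ok:
  assumes U: "utility_ok U c1 c2"
  shows "utility_pair U (\<lambda>s. - Vfun U s) (deriv U) (inv_deriv U) (RRA U) c1 c2"
proof -
  interpret utility_pair U "\<lambda>s. s * inv_deriv U s - U (inv_deriv U s)" "deriv U" "inv_deriv U" "RRA U" c1 c2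
    by (rule utility_pair_inv_deriv[OF U])
  show ?thesis by (rule change_conjugate) (simp add: Vfun_eq)
qed

section \<open>Optimality conditions for the unperturbed problem\<close>

lemma EU_real_parts:
  assumes "\<bar>EU M f\<bar> \<noteq> \<infinity>" shows "Epos M f < \<infinity>" "Eneg M f < \<infinity>"
proof -
  show N: "Eneg M f < \<infinity>" using assms by (auto simp: EU_def less_top split: if_splits)
  show "Epos M f < \<infinity>"
  proof (rule ccontr)
    assume "\<not> Epos M f < \<infinity>"
    then have "Epos M f = \<infinity>" by (simp add: less_top[symmetric])
    then have "EU M f = \<infinity>" using N by (cases "Eneg M f") (auto simp: EU_def)
    then show False using assms by simp
  qed
qed

lemma Epos_less_top_of_EU:
  assumes "EU M f \<noteq> \<infinity>" "Eneg M f < \<infinity>" shows "Epos M f < \<infinity>"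
proof (rule ccontr)
  assume "\<not> Epos M f < \<infinity>"
  then have "Epos M f = \<infinity>" by (simp add: less_top[symmetric])
  then have "EU M f = \<infinity>" using assms(2) by (cases "Eneg M f") (auto simp: EU_def)
  then show False using assms by simp
qed

context utility_pair
begin

lemma p_lower: assumes "0 < t" "1 \<le> s" shows "p t * exp (- c2 * ln s) \<le> p (s * t)"
proof -
  obtain k where k: "k \<le> c2" "p (s * t) = p t * exp (- k * ln s)" using p_exp[of t "s * t"] assms by auto
  have "k * ln s \<le> c2 * ln s" using k assms by (intro mult_right_mono) auto
  then show ?thesis unfolding k(2) using p_pos[OF assms(1)] by simp
qed

lemma p_upper: assumes "0 < t" "0 < s" "s \<le> 1" shows "p (s * t) \<le> p t * exp (- c2 * ln s)"
proof -
  obtain k where k: "k \<le> c2" "p (s * t) = p t * exp (- k * ln s)" using p_exp[of t "s * t"] assms by auto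
  have "c2 * ln s \<le> k * ln s" using k assms by (intro mult_right_mono_neg) auto
  then show ?thesis unfolding k(2) using p_pos[OF assms(1)] by simp
qed

text \<open>Scaling \<xi> gives a minorant of v(s x) that touches at s = 1, so its derivative there,
  E[\<xi> p(\<xi>)], must be x y. Convex combinations with an arbitrary admissible element and
  Fatou's lemma put p(\<xi>) into the polar set. Positivity of \<xi> is itself part of the
  conclusion; hence the cut-off versions of \<xi> p(\<xi>) and p(\<xi>).\<close>

theorem primal_first_order:
  fixes M :: "'a measure" and \<xi> :: "'a \<Rightarrow> real"
  assumes prob: "prob_space M" and C: "Cs = pol M Ds 1" and D: "Ds \<subseteq> L0plus M"
    and z0: "z0 \<in> Cs" "\<forall>\<omega>\<in>space M. 0 < z0 \<omega>" and x: "0 < x" and \<xi>: "\<xi> \<in> pol M Ds x"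
    and v: "\<And>t. v t = (SUP f\<in>pol M Ds t. EU M (\<lambda>\<omega>. Uext U (f \<omega>)))"
    and fin: "eventually (\<lambda>t. \<bar>v t\<bar> \<noteq> \<infinity>) (nhds x)"
    and der: "((\<lambda>t. real_of_ereal (v t)) has_real_derivative y) (at x)"
    and opt: "EU M (\<lambda>\<omega>. Uext U (\<xi> \<omega>)) = v x"
  shows "AE \<omega> in M. 0 < \<xi> \<omega>" "integrable M (\<lambda>\<omega>. U (\<xi> \<omega>))" "integrable M (\<lambda>\<omega>. \<xi> \<omega> * p (\<xi> \<omega>))"
    "(\<integral>\<omega>. \<xi> \<omega> * p (\<xi> \<omega>) \<partial>M) = x * y" "0 < y" "(\<lambda>\<omega>. if 0 < \<xi> \<omega> then p (\<xi> \<omega>) else 0) \<in> pol M Cs y"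
proof -
  interpret prob_space M by fact
  have \<xi>m [measurable]: "\<xi> \<in> borel_measurable M" using pol_measurable[OF \<xi>] .
  have \<xi>n: "0 \<le> \<xi> \<omega>" if "\<omega> \<in> space M" for \<omega> using pol_nonneg[OF \<xi> that] .
  have um: "(\<lambda>\<omega>. Uext U (f \<omega>)) \<in> borel_measurable M" if [measurable]: "f \<in> borel_measurable M" for f by measurable
  have pm: "(\<lambda>\<omega>. p (f \<omega>)) \<in> borel_measurable M" if "f \<in> borel_measurable M" "\<And>\<omega>. \<omega> \<in> space M \<Longrightarrow> 0 \<le> f \<omega>" for f
    by (rule borel_measurable_comp_nonneg[OF that p_measurable])
  note [measurable] = pm[OF \<xi>m \<xi>n]
  define vr where "vr t = real_of_ereal (v t)" for t
  have vx: "\<bar>v x\<bar> \<noteq> \<infinity>" using eventually_nhds_x_imp_x[OF fin] .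
  define g where "g \<omega> = real_of_ereal (Uext U (\<xi> \<omega>))" for \<omega>
  note G = EU_eq_integral[OF um[OF \<xi>m] EU_real_parts[of M "\<lambda>\<omega>. Uext U (\<xi> \<omega>)"]]
  have gi: "integrable M g" and gae: "AE \<omega> in M. Uext U (\<xi> \<omega>) = ereal (g \<omega>)" and gv: "(\<integral>\<omega>. g \<omega> \<partial>M) = vr x"
    using G vx by (auto simp: g_def[abs_def] opt vr_def)
  define \<phi> where "\<phi> \<omega> = (if 0 < \<xi> \<omega> then \<xi> \<omega> * p (\<xi> \<omega>) else 0)" for \<omega>
  have \<phi>m [measurable]: "\<phi> \<in> borel_measurable M" unfolding \<phi>_def[abs_def] by measurable
  have \<phi>n: "0 \<le> \<phi> \<omega>" for \<omega> using p_pos[of "\<xi> \<omega>"] by (auto simp: \<phi>_def intro!: mult_nonneg_nonneg less_imp_le)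
  have upper: "EU M (\<lambda>\<omega>. Uext U (f \<omega>)) \<le> v t" if "f \<in> pol M Ds t" for f t unfolding v by (rule SUP_upper[OF that])
  have scal: "(\<lambda>\<omega>. s * \<xi> \<omega>) \<in> pol M Ds (s * x)" if "0 < s" for s using pol_scale[OF D \<xi>, of s] that by simp
  \<comment> \<open>The tangent at \<open>s * \<xi>\<close>, evaluated at \<open>\<xi>\<close>.
    Replacing p(s \<xi>) by p(\<xi>) times s to the power - c2 goes in the required direction on
    both sides of s = 1, since the sign of s - 1 changes together with the direction of the
    bound.\<close>
  have tang: "AE \<omega> in M. ereal (g \<omega> + (s - 1) * exp (- c2 * ln s) * \<phi> \<omega>) \<le> Uext U (s * \<xi> \<omega>)" if s: "0 < s" for s
    using gae AE_space
  proof eventually_elim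
    case (elim \<omega>)
    show ?case
    proof (cases "0 < \<xi> \<omega>")
      case True
      have sp: "(s - 1) * (p (\<xi> \<omega>) * exp (- c2 * ln s)) \<le> (s - 1) * p (s * \<xi> \<omega>)"
      proof (cases "1 \<le> s")
        case 1: True then show ?thesis using p_lower[OF True 1] by (intro mult_left_mono) auto
      next
        case False then show ?thesis using p_upper[OF True s] by (intro mult_left_mono_neg) auto
      qed
      have "\<xi> \<omega> * ((s - 1) * (p (\<xi> \<omega>) * exp (- c2 * ln s))) \<le> \<xi> \<omega> * ((s - 1) * p (s * \<xi> \<omega>))"
        by (rule mult_left_mono[OF sp less_imp_le[OF True]])
      moreover have "U (\<xi> \<omega>) \<le> U (s * \<xi> \<omega>) + p (s * \<xi> \<omega>) * (\<xi> \<omega> - s * \<xi> \<omega>)" using tangent[of "s * \<xi> \<omega>" "\<xi> \<omega>"] True s by simp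
      moreover have "g \<omega> = U (\<xi> \<omega>)" using elim True by (simp add: Uext_pos)
      ultimately show ?thesis using True s by (simp add: Uext_pos \<phi>_def algebra_simps)
    next
      case False
      then have "\<xi> \<omega> = 0" using \<xi>n[OF elim(2)] by simp
      then show ?thesis using elim by (simp add: \<phi>_def)
    qed
  qed
  have cont: "((\<lambda>s. s * x) \<longlongrightarrow> x) (nhds 1)"
  proof -
    have "((\<lambda>s. s * x) \<longlongrightarrow> 1 * x) (nhds 1)" by (intro tendsto_mult tendsto_const filterlim_ident)
    then show ?thesis by simp
  qed
  have ev1: "eventually (\<lambda>s. 0 < s \<and> \<bar>v (s * x)\<bar> \<noteq> \<infinity>) (nhds 1)"
  proof -
    have "eventually (\<lambda>s. \<bar>v (s * x)\<bar> \<noteq> \<infinity>) (nhds 1)"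
      using fin cont unfolding filterlim_iff by blast
    moreover have "eventually (\<lambda>s. s \<in> {0<..}) (nhds (1::real))" by (intro eventually_nhds_in_open) auto
    ultimately show ?thesis by eventually_elim auto
  qed
  then obtain e where e: "0 < e" "\<And>s. dist s 1 < e \<Longrightarrow> 0 < s \<and> \<bar>v (s * x)\<bar> \<noteq> \<infinity>"
    unfolding eventually_nhds_metric by blast
  have \<phi>i: "integrable M \<phi>"
  proof -
    \<comment> \<open>A single s > 1 with finite value is enough: there the minorant bounds
      \<open>\<phi>\<close> by an integrable difference quotient.\<close>
    define s where "s = 1 + e / 2"
    have s: "1 < s" "\<bar>v (s * x)\<bar> \<noteq> \<infinity>" using e(1) e(2)[of s] by (auto simp: s_def dist_real_def)
    have sm: "(\<lambda>\<omega>. s * \<xi> \<omega>) \<in> borel_measurable M" by measurable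
    have mono: "AE \<omega> in M. ereal (g \<omega>) \<le> Uext U (s * \<xi> \<omega>)" using tang[OF less_trans[OF zero_less_one s(1)]]
    proof eventually_elim
      case (elim \<omega>)
      have "0 \<le> (s - 1) * exp (- c2 * ln s) * \<phi> \<omega>" using s \<phi>n by simp
      then have "ereal (g \<omega>) \<le> ereal (g \<omega> + (s - 1) * exp (- c2 * ln s) * \<phi> \<omega>)" by simp
      also note elim
      finally show ?case .
    qed
    have N: "Eneg M (\<lambda>\<omega>. Uext U (s * \<xi> \<omega>)) < \<infinity>" by (rule Eneg_less_top[OF gi mono])
    have "EU M (\<lambda>\<omega>. Uext U (s * \<xi> \<omega>)) \<noteq> \<infinity>" using upper[OF scal[of s]] s by auto
    note H = EU_eq_integral[OF um[OF sm] Epos_less_top_of_EU[OF this N] N]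
    have k: "0 < (s - 1) * exp (- c2 * ln s)" using s by simp
    show ?thesis
    proof (rule Bochner_Integration.integrable_bound)
      show "integrable M (\<lambda>\<omega>. (real_of_ereal (Uext U (s * \<xi> \<omega>)) - g \<omega>) / ((s - 1) * exp (- c2 * ln s)))" using H(1) gi by simp
      have "0 < s" using s(1) by simp
      show "AE \<omega> in M. norm (\<phi> \<omega>) \<le> norm ((real_of_ereal (Uext U (s * \<xi> \<omega>)) - g \<omega>) / ((s - 1) * exp (- c2 * ln s)))"
        using H(2) tang[OF \<open>0 < s\<close>]
      proof eventually_elim
        case (elim \<omega>)
        have "g \<omega> + (s - 1) * exp (- c2 * ln s) * \<phi> \<omega> \<le> real_of_ereal (Uext U (s * \<xi> \<omega>))"
          using elim by (metis ereal_less_eq(3))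
        then have "\<phi> \<omega> \<le> (real_of_ereal (Uext U (s * \<xi> \<omega>)) - g \<omega>) / ((s - 1) * exp (- c2 * ln s))"
          using k by (subst pos_le_divide_eq) (auto simp: mult.commute)
        then show ?case using \<phi>n[of \<omega>] unfolding real_norm_def by linarith
      qed
    qed measurable
  qed
  define I where "I = (\<integral>\<omega>. \<phi> \<omega> \<partial>M)"
  have key: "vr x + (s - 1) * exp (- c2 * ln s) * I \<le> vr (s * x)" if s: "dist s 1 < e" for s
  proof -
    have s0: "0 < s" "\<bar>v (s * x)\<bar> \<noteq> \<infinity>" using e(2)[OF s] by auto
    have sm: "(\<lambda>\<omega>. s * \<xi> \<omega>) \<in> borel_measurable M" by measurable
    let ?l = "\<lambda>\<omega>. g \<omega> + (s - 1) * exp (- c2 * ln s) * \<phi> \<omega>"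
    have li: "integrable M ?l" using gi \<phi>i by simp
    have N: "Eneg M (\<lambda>\<omega>. Uext U (s * \<xi> \<omega>)) < \<infinity>" by (rule Eneg_less_top[OF li tang[OF s0(1)]])
    have "EU M (\<lambda>\<omega>. Uext U (s * \<xi> \<omega>)) \<noteq> \<infinity>" using upper[OF scal[OF s0(1)]] s0 by auto
    note H = EU_eq_integral[OF um[OF sm] Epos_less_top_of_EU[OF this N] N]
    have "(\<integral>\<omega>. ?l \<omega> \<partial>M) \<le> (\<integral>\<omega>. real_of_ereal (Uext U (s * \<xi> \<omega>)) \<partial>M)"
    proof (rule integral_mono_AE[OF li H(1)])
      show "AE \<omega> in M. ?l \<omega> \<le> real_of_ereal (Uext U (s * \<xi> \<omega>))"
        using H(2) tang[OF s0(1)] by eventually_elim (metis ereal_less_eq(3))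
    qed
    moreover have "(\<integral>\<omega>. ?l \<omega> \<partial>M) = vr x + (s - 1) * exp (- c2 * ln s) * I" using gi \<phi>i gv by (simp add: I_def)
    moreover have "ereal (\<integral>\<omega>. real_of_ereal (Uext U (s * \<xi> \<omega>)) \<partial>M) \<le> v (s * x)" using H(3) upper[OF scal[OF s0(1)]] by simp
    then have "(\<integral>\<omega>. real_of_ereal (Uext U (s * \<xi> \<omega>)) \<partial>M) \<le> vr (s * x)" using s0(2) by (cases "v (s * x)") (auto simp: vr_def)
    ultimately show ?thesis by simp
  qed
  have Ixy: "I = x * y"
  proof -
    \<comment> \<open>Nonnegative near 1 and zero at 1, hence with vanishing derivative y x - I
      there.\<close>
    define d where "d s = vr (s * x) - (vr x + (s - 1) * exp (- c2 * ln s) * I)" for s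
    have "((\<lambda>s. vr (s * x)) has_real_derivative y * x) (at 1)"
      by (rule DERIV_chain2[where f=vr]) (use der in \<open>auto simp: vr_def[abs_def] intro!: derivative_eq_intros\<close>)
    then have "(d has_real_derivative y * x - I) (at 1)" unfolding d_def[abs_def] by (auto intro!: derivative_eq_intros)
    moreover have "\<forall>s. \<bar>1 - s\<bar> < e \<longrightarrow> d 1 \<le> d s" using key by (auto simp: d_def dist_real_def abs_minus_commute)
    ultimately have "y * x - I = 0" using DERIV_local_min e(1) by blast
    then show ?thesis by (simp add: mult.commute)
  qed
  \<comment> \<open>Optimality of \<xi> against the convex combination f makes p(f) \<zeta> in mean
    no larger than p(f) \<xi>, and the latter is at most \<open>\<phi>\<close> times a factor that
    tends to 1 with \<epsilon> \<rightarrow> 0.\<close>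
  have bound: "(\<integral>\<^sup>+ \<omega>. ennreal (p ((1 - \<epsilon>) * \<xi> \<omega> + \<epsilon> * \<zeta> \<omega>) * \<zeta> \<omega>) \<partial>M) \<le> ennreal (exp (- c2 * ln (1 - \<epsilon>)) * I)"
    if \<epsilon>: "0 < \<epsilon>" "\<epsilon> < 1" and \<zeta>: "\<zeta> \<in> pol M Ds x" and pos: "AE \<omega> in M. 0 < \<xi> \<omega> \<or> 0 < \<zeta> \<omega>" for \<epsilon> \<zeta>
  proof -
    define k where "k = exp (- c2 * ln (1 - \<epsilon>))"
    have [measurable]: "\<zeta> \<in> borel_measurable M" using pol_measurable[OF \<zeta>] .
    have \<zeta>n: "0 \<le> \<zeta> \<omega>" if "\<omega> \<in> space M" for \<omega> using pol_nonneg[OF \<zeta> that] .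
    define f where "f \<omega> = (1 - \<epsilon>) * \<xi> \<omega> + \<epsilon> * \<zeta> \<omega>" for \<omega>
    have fm [measurable]: "f \<in> borel_measurable M" unfolding f_def[abs_def] by measurable
    have fn: "0 \<le> f \<omega>" if "\<omega> \<in> space M" for \<omega> using \<xi>n[OF that] \<zeta>n[OF that] \<epsilon> by (simp add: f_def)
    note [measurable] = pm[OF fm fn]
    have fpol: "f \<in> pol M Ds x"
      using pol_add[OF D pol_scale[OF D \<xi>, of "1 - \<epsilon>"] pol_scale[OF D \<zeta>, of \<epsilon>]] \<epsilon> x
      by (simp add: f_def[abs_def] flip: distrib_right)
    have fac: "AE \<omega> in M. 0 < f \<omega> \<and> ereal (g \<omega> - \<epsilon> * p (f \<omega>) * (\<xi> \<omega> - \<zeta> \<omega>)) \<le> Uext U (f \<omega>) \<and> p (f \<omega>) * \<xi> \<omega> \<le> k * \<phi> \<omega> \<and> 0 < p (f \<omega>)"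
      using gae pos AE_space
    proof eventually_elim
      case (elim \<omega>)
      note nn = \<xi>n[OF elim(3)] \<zeta>n[OF elim(3)]
      have f0: "0 < f \<omega>"
      proof (cases "0 < \<xi> \<omega>")
        case True then show ?thesis using nn \<epsilon> by (simp add: f_def add_pos_nonneg)
      next
        case False then show ?thesis using nn \<epsilon> elim(2) by (simp add: f_def add_nonneg_pos)
      qed
      have "ereal (g \<omega>) \<le> ereal (U (f \<omega>) + p (f \<omega>) * (\<xi> \<omega> - f \<omega>))" using Uext_tangent[OF f0 nn(1)] elim(1) by simp
      moreover have "\<xi> \<omega> - f \<omega> = \<epsilon> * (\<xi> \<omega> - \<zeta> \<omega>)" by (simp add: f_def algebra_simps)
      ultimately have "ereal (g \<omega> - \<epsilon> * p (f \<omega>) * (\<xi> \<omega> - \<zeta> \<omega>)) \<le> Uext U (f \<omega>)" using f0 by (simp add: Uext_pos mult_ac)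
      moreover have "p (f \<omega>) * \<xi> \<omega> \<le> k * \<phi> \<omega>"
      proof (cases "0 < \<xi> \<omega>")
        case True
        have "p (f \<omega>) \<le> p ((1 - \<epsilon>) * \<xi> \<omega>)" using True \<epsilon> nn by (intro p_antimono) (auto simp: f_def)
        also have "\<dots> \<le> p (\<xi> \<omega>) * k" unfolding k_def using True \<epsilon> by (intro p_upper) auto
        finally have "p (f \<omega>) * \<xi> \<omega> \<le> p (\<xi> \<omega>) * k * \<xi> \<omega>" using True by (intro mult_right_mono) auto
        then show ?thesis using True by (simp add: \<phi>_def mult_ac)
      next
        case False then have "\<xi> \<omega> = 0" using nn by simp
        then show ?thesis by (simp add: \<phi>_def)
      qed
      ultimately show ?case using f0 p_pos[OF f0] by blast
    qed
    have li: "integrable M (\<lambda>\<omega>. g \<omega> - \<epsilon> * (k * \<phi> \<omega>))" using gi \<phi>i by simp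
    have lb: "AE \<omega> in M. ereal (g \<omega> - \<epsilon> * (k * \<phi> \<omega>)) \<le> Uext U (f \<omega>)"
      using fac AE_space
    proof eventually_elim
      case (elim \<omega>)
      have "p (f \<omega>) * (\<xi> \<omega> - \<zeta> \<omega>) \<le> p (f \<omega>) * \<xi> \<omega>" using elim \<zeta>n[OF elim(2)] by (intro mult_left_mono) auto
      also have "\<dots> \<le> k * \<phi> \<omega>" using elim by blast
      finally have "\<epsilon> * (p (f \<omega>) * (\<xi> \<omega> - \<zeta> \<omega>)) \<le> \<epsilon> * (k * \<phi> \<omega>)" using \<epsilon>(1) by (rule mult_left_mono[OF _ less_imp_le])
      then have "ereal (g \<omega> - \<epsilon> * (k * \<phi> \<omega>)) \<le> ereal (g \<omega> - \<epsilon> * p (f \<omega>) * (\<xi> \<omega> - \<zeta> \<omega>))" by (simp add: mult.assoc)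
      also have "\<dots> \<le> Uext U (f \<omega>)" using elim by blast
      finally show ?case .
    qed
    have N: "Eneg M (\<lambda>\<omega>. Uext U (f \<omega>)) < \<infinity>" by (rule Eneg_less_top[OF li lb])
    have "EU M (\<lambda>\<omega>. Uext U (f \<omega>)) \<noteq> \<infinity>" using upper[OF fpol] vx by auto
    note H = EU_eq_integral[OF um[OF fm] Epos_less_top_of_EU[OF this N] N]
    define h where "h \<omega> = real_of_ereal (Uext U (f \<omega>))" for \<omega>
    have hi: "integrable M h" "(\<integral>\<omega>. h \<omega> \<partial>M) \<le> (\<integral>\<omega>. g \<omega> \<partial>M)"
    proof -
      show "integrable M h" using H(1) by (simp add: h_def[abs_def])
      have "ereal (\<integral>\<omega>. h \<omega> \<partial>M) \<le> v x" using H(3) upper[OF fpol] by (simp add: h_def)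
      then show "(\<integral>\<omega>. h \<omega> \<partial>M) \<le> (\<integral>\<omega>. g \<omega> \<partial>M)" using vx gv by (cases "v x") (auto simp: vr_def)
    qed
    define m where "m \<omega> = 1 / \<epsilon> * (h \<omega> - g \<omega>) + k * \<phi> \<omega>" for \<omega>
    have mi: "integrable M m" unfolding m_def[abs_def] using hi gi \<phi>i by simp
    have mle: "(\<integral>\<omega>. m \<omega> \<partial>M) \<le> k * I"
    proof -
      have "(\<integral>\<omega>. m \<omega> \<partial>M) = 1 / \<epsilon> * ((\<integral>\<omega>. h \<omega> \<partial>M) - (\<integral>\<omega>. g \<omega> \<partial>M)) + k * I"
        unfolding m_def using hi gi \<phi>i by (simp add: I_def)
      moreover have "1 / \<epsilon> * ((\<integral>\<omega>. h \<omega> \<partial>M) - (\<integral>\<omega>. g \<omega> \<partial>M)) \<le> 0" using hi(2) \<epsilon> by (intro mult_nonneg_nonpos) auto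
      ultimately show ?thesis by simp
    qed
    have le: "AE \<omega> in M. p (f \<omega>) * \<zeta> \<omega> \<le> m \<omega> \<and> 0 \<le> p (f \<omega>) * \<zeta> \<omega>"
      using fac H(2) AE_space
    proof eventually_elim
      case (elim \<omega>)
      have "ereal (g \<omega> - \<epsilon> * p (f \<omega>) * (\<xi> \<omega> - \<zeta> \<omega>)) \<le> ereal (h \<omega>)" using elim by (simp add: h_def)
      then have "\<epsilon> * (p (f \<omega>) * \<zeta> \<omega> - p (f \<omega>) * \<xi> \<omega>) \<le> h \<omega> - g \<omega>" by (simp add: algebra_simps)
      then have "p (f \<omega>) * \<zeta> \<omega> - p (f \<omega>) * \<xi> \<omega> \<le> 1 / \<epsilon> * (h \<omega> - g \<omega>)" using \<epsilon> by (simp add: pos_le_divide_eq mult.commute)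
      moreover have "p (f \<omega>) * \<xi> \<omega> \<le> k * \<phi> \<omega>" using elim by blast
      moreover have "0 \<le> p (f \<omega>) * \<zeta> \<omega>" using elim(1) \<zeta>n[OF elim(3)] by simp
      moreover have "r \<le> t + u" if "r - v \<le> t" "v \<le> u" for r t u v :: real using that by linarith
      ultimately show ?case unfolding m_def by blast
    qed
    have mn: "AE \<omega> in M. 0 \<le> m \<omega>" using le by eventually_elim linarith
    have "(\<integral>\<^sup>+ \<omega>. ennreal (p (f \<omega>) * \<zeta> \<omega>) \<partial>M) \<le> (\<integral>\<^sup>+ \<omega>. ennreal (m \<omega>) \<partial>M)"
      by (rule nn_integral_mono_AE) (use le in \<open>eventually_elim, auto intro: ennreal_leI\<close>)
    also have "\<dots> = ennreal (\<integral>\<omega>. m \<omega> \<partial>M)" by (rule nn_integral_eq_integral[OF mi mn])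
    also have "\<dots> \<le> ennreal (k * I)" using mle by (rule ennreal_leI)
    finally show ?thesis by (simp add: f_def k_def)
  qed
  define \<epsilon> where "\<epsilon> n = 1 / real (n + 2)" for n
  have \<epsilon>: "0 < \<epsilon> n" "\<epsilon> n < 1" for n by (auto simp: \<epsilon>_def)
  have \<epsilon>0: "\<epsilon> \<longlonglongrightarrow> 0"
    using LIMSEQ_ignore_initial_segment[OF lim_inverse_n', of 2] by (simp add: \<epsilon>_def[abs_def] inverse_eq_divide)
  have fatou: "(\<integral>\<^sup>+ \<omega>. liminf (\<lambda>n. ennreal (p ((1 - \<epsilon> n) * \<xi> \<omega> + \<epsilon> n * \<zeta> \<omega>) * \<zeta> \<omega>)) \<partial>M) \<le> ennreal (x * y)"
    if \<zeta>: "\<zeta> \<in> pol M Ds x" and pos: "AE \<omega> in M. 0 < \<xi> \<omega> \<or> 0 < \<zeta> \<omega>" for \<zeta>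
  proof -
    have [measurable]: "\<zeta> \<in> borel_measurable M" using pol_measurable[OF \<zeta>] .
    have [measurable]: "(\<lambda>\<omega>. p ((1 - \<epsilon> n) * \<xi> \<omega> + \<epsilon> n * \<zeta> \<omega>)) \<in> borel_measurable M" for n
      by (rule pm) (use \<xi>n pol_nonneg[OF \<zeta>] \<epsilon>[of n] in auto)
    have "(\<integral>\<^sup>+ \<omega>. liminf (\<lambda>n. ennreal (p ((1 - \<epsilon> n) * \<xi> \<omega> + \<epsilon> n * \<zeta> \<omega>) * \<zeta> \<omega>)) \<partial>M)
      \<le> liminf (\<lambda>n. \<integral>\<^sup>+ \<omega>. ennreal (p ((1 - \<epsilon> n) * \<xi> \<omega> + \<epsilon> n * \<zeta> \<omega>) * \<zeta> \<omega>) \<partial>M)"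
      by (rule nn_integral_liminf) measurable
    also have "\<dots> \<le> liminf (\<lambda>n. ennreal (exp (- c2 * ln (1 - \<epsilon> n)) * I))"
      by (intro Liminf_mono always_eventually allI bound[OF \<epsilon> \<zeta> pos])
    also have "\<dots> = ennreal (x * y)"
    proof -
      have "(\<lambda>n. exp (- c2 * ln (1 - \<epsilon> n)) * I) \<longlonglongrightarrow> exp (- c2 * ln (1 - 0)) * I"
        by (intro tendsto_intros \<epsilon>0) auto
      from lim_imp_Liminf[OF _ tendsto_ennrealI[OF this]] show ?thesis by (simp add: Ixy)
    qed
    finally show ?thesis .
  qed
  show pos: "AE \<omega> in M. 0 < \<xi> \<omega>"
  proof -
    \<comment> \<open>With a strictly positive direction, p is evaluated ever closer to 0 wherever
      \<xi> vanishes. There p tends to \<infinity>, which the Fatou bound rules out up to a null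
      set.\<close>
    define \<zeta> where "\<zeta> \<omega> = x * z0 \<omega>" for \<omega>
    have \<zeta>: "\<zeta> \<in> pol M Ds x" using pol_scale[OF D, of z0 1 x] z0(1) x C by (simp add: \<zeta>_def[abs_def])
    have [measurable]: "\<zeta> \<in> borel_measurable M" using pol_measurable[OF \<zeta>] .
    have [measurable]: "(\<lambda>\<omega>. p ((1 - \<epsilon> n) * \<xi> \<omega> + \<epsilon> n * \<zeta> \<omega>)) \<in> borel_measurable M" for n
      by (rule pm) (use \<xi>n pol_nonneg[OF \<zeta>] \<epsilon>[of n] in auto)
    have \<zeta>p: "0 < \<zeta> \<omega>" if "\<omega> \<in> space M" for \<omega> using bspec[OF z0(2) that] x by (simp add: \<zeta>_def)
    have F: "(\<integral>\<^sup>+ \<omega>. liminf (\<lambda>n. ennreal (p ((1 - \<epsilon> n) * \<xi> \<omega> + \<epsilon> n * \<zeta> \<omega>) * \<zeta> \<omega>)) \<partial>M) \<le> ennreal (x * y)"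
      by (rule fatou[OF \<zeta>]) (use \<zeta>p in auto)
    have "AE \<omega> in M. liminf (\<lambda>n. ennreal (p ((1 - \<epsilon> n) * \<xi> \<omega> + \<epsilon> n * \<zeta> \<omega>) * \<zeta> \<omega>)) \<noteq> \<infinity>"
      by (rule nn_integral_PInf_AE) (use F in \<open>auto simp: top_unique\<close>)
    then show ?thesis using AE_space
    proof eventually_elim
      case (elim \<omega>)
      show ?case
      proof (rule ccontr)
        assume "\<not> 0 < \<xi> \<omega>"
        then have z: "\<xi> \<omega> = 0" using \<xi>n[OF elim(2)] by simp
        have "ennreal B \<le> liminf (\<lambda>n. ennreal (p ((1 - \<epsilon> n) * \<xi> \<omega> + \<epsilon> n * \<zeta> \<omega>) * \<zeta> \<omega>))" if B: "0 < B" for B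
        proof (rule Liminf_bounded)
          \<comment> \<open>Below this threshold \<open>p\<close> exceeds
            \<open>B / \<zeta> \<omega>\<close>, by monotonicity and because \<open>q\<close>
            inverts \<open>p\<close>.\<close>
          define b where "b = q (B / \<zeta> \<omega>)"
          have b: "0 < b" "p b = B / \<zeta> \<omega>" using q_pos pq B \<zeta>p[OF elim(2)] by (auto simp: b_def)
          have "(\<lambda>n. \<epsilon> n * \<zeta> \<omega>) \<longlonglongrightarrow> 0 * \<zeta> \<omega>" by (intro tendsto_intros \<epsilon>0)
          then have "eventually (\<lambda>n. \<epsilon> n * \<zeta> \<omega> < b) sequentially" using b by (intro order_tendstoD(2)) auto
          then show "eventually (\<lambda>n. ennreal B \<le> ennreal (p ((1 - \<epsilon> n) * \<xi> \<omega> + \<epsilon> n * \<zeta> \<omega>) * \<zeta> \<omega>)) sequentially"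
          proof eventually_elim
            case (elim n)
            have "B / \<zeta> \<omega> \<le> p (\<epsilon> n * \<zeta> \<omega>)" using p_antimono[of "\<epsilon> n * \<zeta> \<omega>" b] elim b(2) \<epsilon>(1)[of n] \<zeta>p[OF \<open>\<omega> \<in> space M\<close>] by simp
            then have "B \<le> p (\<epsilon> n * \<zeta> \<omega>) * \<zeta> \<omega>" using \<zeta>p[OF \<open>\<omega> \<in> space M\<close>] by (simp add: pos_divide_le_eq)
            then show ?case using z by (simp add: ennreal_leI)
          qed
        qed
        note lb = this
        obtain B where "liminf (\<lambda>n. ennreal (p ((1 - \<epsilon> n) * \<xi> \<omega> + \<epsilon> n * \<zeta> \<omega>) * \<zeta> \<omega>)) = ennreal B" "0 \<le> B"
          using elim(1) by (cases "liminf (\<lambda>n. ennreal (p ((1 - \<epsilon> n) * \<xi> \<omega> + \<epsilon> n * \<zeta> \<omega>) * \<zeta> \<omega>))") auto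
        then show False using lb[of "B + 1"] by simp
      qed
    qed
  qed
  have AE\<phi>: "AE \<omega> in M. \<phi> \<omega> = \<xi> \<omega> * p (\<xi> \<omega>)" using pos by eventually_elim (simp add: \<phi>_def)
  show i: "integrable M (\<lambda>\<omega>. \<xi> \<omega> * p (\<xi> \<omega>))" using integrable_cong_AE_imp[OF \<phi>i _ AE\<phi>] by simp
  show int: "(\<integral>\<omega>. \<xi> \<omega> * p (\<xi> \<omega>) \<partial>M) = x * y"
    unfolding Ixy[symmetric] I_def by (rule integral_cong_AE) (use AE\<phi> in \<open>auto elim: AE_mp\<close>)
  show "integrable M (\<lambda>\<omega>. U (\<xi> \<omega>))"
  proof (rule integrable_cong_AE_imp[OF gi])
    show "(\<lambda>\<omega>. U (\<xi> \<omega>)) \<in> borel_measurable M" by (rule borel_measurable_comp_nonneg[OF \<xi>m \<xi>n U_measurable])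
    show "AE \<omega> in M. g \<omega> = U (\<xi> \<omega>)" using pos gae by eventually_elim (simp add: Uext_pos)
  qed
  have nn: "AE \<omega> in M. 0 \<le> \<xi> \<omega> * p (\<xi> \<omega>)" using pos by eventually_elim (simp add: p_pos less_imp_le)
  have "x * y \<noteq> 0"
  proof
    assume "x * y = 0"
    then have "AE \<omega> in M. \<xi> \<omega> * p (\<xi> \<omega>) = 0" using integral_nonneg_eq_0_iff_AE[OF i nn] int by simp
    then have "AE \<omega> in M. False" using pos by eventually_elim (use p_pos in fastforce)
    then show False by simp
  qed
  moreover have "0 \<le> x * y" using integral_nonneg_AE[OF nn] int by simp
  ultimately show y: "0 < y" using x by (simp add: zero_le_mult_iff)
  show "(\<lambda>\<omega>. if 0 < \<xi> \<omega> then p (\<xi> \<omega>) else 0) \<in> pol M Cs y"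
  proof (rule polI)
    show "(\<lambda>\<omega>. if 0 < \<xi> \<omega> then p (\<xi> \<omega>) else 0) \<in> L0plus M" using p_pos by (auto simp: L0plus_def less_imp_le)
    fix f assume f: "f \<in> Cs"
    have \<zeta>: "(\<lambda>\<omega>. x * f \<omega>) \<in> pol M Ds x" using pol_scale[OF D, of f 1 x] f x C by simp
    have [measurable]: "f \<in> borel_measurable M" using pol_measurable[of f M Ds 1] f C by simp
    have fn: "0 \<le> f \<omega>" if "\<omega> \<in> space M" for \<omega> using pol_nonneg[of f M Ds 1 \<omega>] f C that by simp
    have "ennreal x * (\<integral>\<^sup>+ \<omega>. ennreal ((if 0 < \<xi> \<omega> then p (\<xi> \<omega>) else 0) * f \<omega>) \<partial>M)
       = (\<integral>\<^sup>+ \<omega>. ennreal (p (\<xi> \<omega>) * (x * f \<omega>)) \<partial>M)"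
    proof (subst nn_integral_cmult[symmetric])
      show "(\<integral>\<^sup>+ \<omega>. ennreal x * ennreal ((if 0 < \<xi> \<omega> then p (\<xi> \<omega>) else 0) * f \<omega>) \<partial>M) = (\<integral>\<^sup>+ \<omega>. ennreal (p (\<xi> \<omega>) * (x * f \<omega>)) \<partial>M)"
        by (rule nn_integral_cong_AE) (use pos in \<open>eventually_elim, use x in \<open>simp add: ennreal_mult'[symmetric] mult_ac\<close>\<close>)
    qed measurable
    also have "\<dots> = (\<integral>\<^sup>+ \<omega>. liminf (\<lambda>n. ennreal (p ((1 - \<epsilon> n) * \<xi> \<omega> + \<epsilon> n * (x * f \<omega>)) * (x * f \<omega>))) \<partial>M)"
    proof (rule nn_integral_cong_AE)
      show "AE \<omega> in M. ennreal (p (\<xi> \<omega>) * (x * f \<omega>)) = liminf (\<lambda>n. ennreal (p ((1 - \<epsilon> n) * \<xi> \<omega> + \<epsilon> n * (x * f \<omega>)) * (x * f \<omega>)))"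
        using pos
      proof eventually_elim
        case (elim \<omega>)
        have "(\<lambda>n. (1 - \<epsilon> n) * \<xi> \<omega> + \<epsilon> n * (x * f \<omega>)) \<longlonglongrightarrow> (1 - 0) * \<xi> \<omega> + 0 * (x * f \<omega>)" by (intro tendsto_intros \<epsilon>0)
        then have "(\<lambda>n. (1 - \<epsilon> n) * \<xi> \<omega> + \<epsilon> n * (x * f \<omega>)) \<longlonglongrightarrow> \<xi> \<omega>" by simp
        from isCont_tendsto_compose[OF p_continuous[OF elim] this]
        have "(\<lambda>n. ennreal (p ((1 - \<epsilon> n) * \<xi> \<omega> + \<epsilon> n * (x * f \<omega>)) * (x * f \<omega>))) \<longlonglongrightarrow> ennreal (p (\<xi> \<omega>) * (x * f \<omega>))"
          by (intro tendsto_ennrealI tendsto_intros)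
        from lim_imp_Liminf[OF _ this] show ?case by simp
      qed
    qed
    also have "\<dots> \<le> ennreal (x * y)" by (rule fatou[OF \<zeta>]) (use pos in \<open>eventually_elim, simp\<close>)
    also have "\<dots> = ennreal x * ennreal y" using x by (simp add: ennreal_mult')
    finally show "(\<integral>\<^sup>+ \<omega>. ennreal ((if 0 < \<xi> \<omega> then p (\<xi> \<omega>) else 0) * f \<omega>) \<partial>M) \<le> ennreal y"
      using x by (simp add: ennreal_mult_le_mult_iff)
  qed
qed

end

section \<open>The dual optimizer and the passage to the conjugate problem\<close>

context utility_pair
begin

text \<open>The candidate p(\<xi>) attains the weak duality bound x y - E[U(\<xi>)]. A dual
  optimizer does no worse, so its nonnegative gap against \<xi> has expectation 0, and the quadratic
  lower bound of the gap forces it to equal p(\<xi>).\<close>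

lemma dual_optimizer_eq:
  fixes M :: "'a measure"
  assumes prob: "prob_space M" and D: "Ds = pol M Cs 1" and C: "Cs \<subseteq> L0plus M" and xy: "0 < x" "0 < y"
    and \<xi>: "\<xi> \<in> pol M Ds x" "AE \<omega> in M. 0 < \<xi> \<omega>" and Ui: "integrable M (\<lambda>\<omega>. U (\<xi> \<omega>))"
    and i: "integrable M (\<lambda>\<omega>. \<xi> \<omega> * p (\<xi> \<omega>))" "(\<integral>\<omega>. \<xi> \<omega> * p (\<xi> \<omega>) \<partial>M) = x * y"
    and cand: "(\<lambda>\<omega>. if 0 < \<xi> \<omega> then p (\<xi> \<omega>) else 0) \<in> pol M Cs y"
    and \<eta>: "\<eta> \<in> pol M Cs y"
    and opt: "\<forall>h\<in>pol M Cs y. EU M (\<lambda>\<omega>. Uext W (h \<omega>)) \<le> EU M (\<lambda>\<omega>. Uext W (\<eta> \<omega>))"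
  shows "AE \<omega> in M. \<eta> \<omega> = p (\<xi> \<omega>)" "integrable M (\<lambda>\<omega>. W (\<eta> \<omega>))" "(\<integral>\<omega>. \<xi> \<omega> * \<eta> \<omega> \<partial>M) = x * y"
proof -
  interpret prob_space M by fact
  interpret Sw: utility_pair W U q p "\<lambda>s. 1 / A (q s)" "1 / c2" "1 / c1" by (rule swap)
  have [measurable]: "\<xi> \<in> borel_measurable M" "\<eta> \<in> borel_measurable M" using pol_measurable \<xi>(1) \<eta> by auto
  have \<eta>n: "0 \<le> \<eta> \<omega>" if "\<omega> \<in> space M" for \<omega> using pol_nonneg[OF \<eta> that] .
  define h where "h \<omega> = (if 0 < \<xi> \<omega> then p (\<xi> \<omega>) else 0)" for \<omega>
  have hp: "h \<in> pol M Cs y" using cand by (simp add: h_def[abs_def])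
  have [measurable]: "h \<in> borel_measurable M" using pol_measurable[OF hp] .
  have um: "(\<lambda>\<omega>. Uext W (h \<omega>)) \<in> borel_measurable M" "(\<lambda>\<omega>. Uext W (\<eta> \<omega>)) \<in> borel_measurable M" by measurable
  let ?l = "\<lambda>\<omega>. \<xi> \<omega> * p (\<xi> \<omega>) - U (\<xi> \<omega>)"
  have li: "integrable M ?l" using i(1) Ui by simp
  have AEh: "AE \<omega> in M. Uext W (h \<omega>) = ereal (?l \<omega>)" using \<xi>(2)
  proof eventually_elim
    case (elim \<omega>)
    have "W (p (\<xi> \<omega>)) = ?l \<omega>" using fenchel_eq[OF elim] by simp
    then show ?case using elim p_pos[OF elim] by (simp add: h_def Sw.Uext_pos)
  qed
  have "ereal (\<integral>\<omega>. ?l \<omega> \<partial>M) \<le> EU M (\<lambda>\<omega>. Uext W (h \<omega>))"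
    by (rule EU_sandwich(1)[OF um(1) li _ li]) (use AEh in \<open>eventually_elim, simp\<close>)+
  also have "\<dots> \<le> EU M (\<lambda>\<omega>. Uext W (\<eta> \<omega>))" by (rule bspec[OF opt hp])
  finally have le: "ereal (x * y - (\<integral>\<omega>. U (\<xi> \<omega>) \<partial>M)) \<le> EU M (\<lambda>\<omega>. Uext W (\<eta> \<omega>))" using i Ui by simp
  note pr = pol_pairing_integral[OF D C \<xi>(1) \<eta> xy(2,1)]
  let ?k = "\<lambda>\<omega>. \<xi> \<omega> * \<eta> \<omega> - U (\<xi> \<omega>)"
  have ki: "integrable M ?k" using pr(1) Ui by simp
  have kb: "AE \<omega> in M. Uext W (\<eta> \<omega>) \<le> ereal (?k \<omega>)" using \<xi>(2) AE_space
    by eventually_elim (use Sw.Uext_le \<eta>n in \<open>simp add: mult.commute\<close>)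
  have "EU M (\<lambda>\<omega>. Uext W (\<eta> \<omega>)) \<noteq> - \<infinity>" using le by auto
  note H = EU_finite[OF um(2) ki kb this]
  define g where "g \<omega> = real_of_ereal (Uext W (\<eta> \<omega>))" for \<omega>
  have gi: "integrable M g" and gae: "AE \<omega> in M. Uext W (\<eta> \<omega>) = ereal (g \<omega>)" using H by (auto simp: g_def[abs_def])
  have gl: "x * y - (\<integral>\<omega>. U (\<xi> \<omega>) \<partial>M) \<le> (\<integral>\<omega>. g \<omega> \<partial>M)" using le H(3) by (simp add: g_def)
  have d: "integrable M (\<lambda>\<omega>. ?k \<omega> - g \<omega>)" using ki gi by simp
  have dn: "AE \<omega> in M. 0 \<le> ?k \<omega> - g \<omega>" using kb gae by eventually_elim (metis diff_ge_0_iff_ge ereal_less_eq(3))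
  have "(\<integral>\<omega>. ?k \<omega> - g \<omega> \<partial>M) = (\<integral>\<omega>. \<xi> \<omega> * \<eta> \<omega> \<partial>M) - (\<integral>\<omega>. U (\<xi> \<omega>) \<partial>M) - (\<integral>\<omega>. g \<omega> \<partial>M)" using pr(1) Ui gi by simp
  then have "(\<integral>\<omega>. ?k \<omega> - g \<omega> \<partial>M) = 0" using integral_nonneg_AE[OF dn] pr(2) gl by linarith
  then have z: "AE \<omega> in M. ?k \<omega> - g \<omega> = 0" using integral_nonneg_eq_0_iff_AE[OF d dn] by simp
  show eq: "AE \<omega> in M. \<eta> \<omega> = p (\<xi> \<omega>)" using z gae \<xi>(2) AE_space
  proof eventually_elim
    case (elim \<omega>)
    let ?m = "Sw.c0 * (\<xi> \<omega> * p (\<xi> \<omega>)) * min 1 (((\<eta> \<omega> - p (\<xi> \<omega>)) / p (\<xi> \<omega>))\<^sup>2)"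
    have "g \<omega> \<le> \<eta> \<omega> * \<xi> \<omega> - U (\<xi> \<omega>) - ?m" using Sw.gap_lower[OF \<eta>n[OF elim(4)] elim(3)] elim(2) by simp
    then have "?m \<le> 0" using elim(1) by (simp add: mult.commute)
    moreover have "0 < Sw.c0 * (\<xi> \<omega> * p (\<xi> \<omega>))" using Sw.c0_pos elim(3) p_pos[OF elim(3)] by simp
    moreover have "s \<le> 0" if "k * s \<le> 0" "0 < k" for k s :: real using that by (simp add: mult_le_0_iff)
    ultimately have "min 1 (((\<eta> \<omega> - p (\<xi> \<omega>)) / p (\<xi> \<omega>))\<^sup>2) \<le> 0" by blast
    then have "((\<eta> \<omega> - p (\<xi> \<omega>)) / p (\<xi> \<omega>))\<^sup>2 \<le> 0" by (simp only: min_le_iff_disj) simp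
    then show ?case using p_pos[OF elim(3)] by simp
  qed
  show "integrable M (\<lambda>\<omega>. W (\<eta> \<omega>))"
  proof (rule integrable_cong_AE_imp[OF li])
    show "(\<lambda>\<omega>. W (\<eta> \<omega>)) \<in> borel_measurable M" by (rule borel_measurable_comp_nonneg[OF _ \<eta>n Sw.U_measurable]) simp
    show "AE \<omega> in M. ?l \<omega> = W (\<eta> \<omega>)" using eq \<xi>(2)
      by eventually_elim (use fenchel_eq in \<open>simp add: algebra_simps\<close>)
  qed
  show "(\<integral>\<omega>. \<xi> \<omega> * \<eta> \<omega> \<partial>M) = x * y" unfolding i(2)[symmetric]
  proof (rule integral_cong_AE)
    have "AE \<omega> in M. \<xi> \<omega> * \<eta> \<omega> = \<xi> \<omega> * p (\<xi> \<omega>)" using eq by eventually_elim simp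
    then show "AE \<omega> in M. \<xi> \<omega> * \<eta> \<omega> = \<xi> \<omega> * p (\<xi> \<omega>)" .
  qed (use i(1) in auto)
qed

text \<open>Since V = - W, positive and negative parts are exchanged, and the conventions match: the
  part whose divergence makes \<open>EV\<close> infinite is the one whose divergence makes
  \<open>EU\<close> equal to - \<infinity>.\<close>

lemma EV_Vext:
  assumes "\<And>\<omega>. \<omega> \<in> space M \<Longrightarrow> 0 \<le> f \<omega>"
  shows "EV M (\<lambda>\<omega>. Vext U (f \<omega>)) = - EU M (\<lambda>\<omega>. Uext W (f \<omega>))"
proof -
  have P: "Epos M (\<lambda>\<omega>. Vext U (f \<omega>)) = Eneg M (\<lambda>\<omega>. Uext W (f \<omega>))"
    unfolding Epos_def Eneg_def by (rule nn_integral_cong) (simp add: Vext_Uext assms)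
  have N: "Eneg M (\<lambda>\<omega>. Vext U (f \<omega>)) = Epos M (\<lambda>\<omega>. Uext W (f \<omega>))"
    unfolding Epos_def Eneg_def by (rule nn_integral_cong) (simp add: Vext_Uext assms)
  show ?thesis unfolding EV_def EU_def P N
    by (cases "Epos M (\<lambda>\<omega>. Uext W (f \<omega>))"; cases "Eneg M (\<lambda>\<omega>. Uext W (f \<omega>))") auto
qed

lemma Dset_eq: "Dset Ds F G y d = Cset Ds (\<lambda>\<omega>. - F \<omega>) (\<lambda>\<omega>. - G \<omega>) y d"
  by (simp add: Dset_def Cset_def Ldelta_uminus)

text \<open>Negation turns the infimum into a supremum and the lower finiteness of the dual value
  into the upper finiteness demanded by \<open>primal_opt\<close>.\<close>

lemma dual_opt_iff:
  assumes D: "Ds \<subseteq> L0plus M" and y: "0 \<le> y"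
  shows "dual_opt M U Ds F G y d \<eta> \<longleftrightarrow> primal_opt M W Ds (\<lambda>\<omega>. - F \<omega>) (\<lambda>\<omega>. - G \<omega>) y d \<eta>"
proof -
  let ?S = "Cset Ds (\<lambda>\<omega>. - F \<omega>) (\<lambda>\<omega>. - G \<omega>) y d"
  have nn: "EV M (\<lambda>\<omega>. Vext U (f \<omega>)) = - EU M (\<lambda>\<omega>. Uext W (f \<omega>))" if "f \<in> ?S" for f
  proof (rule EV_Vext)
    fix \<omega> assume "\<omega> \<in> space M"
    then show "0 \<le> f \<omega>" using that D y Ldelta_pos[of "\<lambda>\<omega>. - F \<omega>" "\<lambda>\<omega>. - G \<omega>" d \<omega>]
      by (auto simp: Cset_def L0plus_def intro!: divide_nonneg_pos mult_nonneg_nonneg)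
  qed
  have "vval M U Ds F G y d = (INF f\<in>?S. - EU M (\<lambda>\<omega>. Uext W (f \<omega>)))"
    unfolding vval_def Dset_eq by (rule INF_cong) (use nn in auto)
  also have "\<dots> = - uval M W Ds (\<lambda>\<omega>. - F \<omega>) (\<lambda>\<omega>. - G \<omega>) y d"
    unfolding uval_def by (rule ereal_INF_uminus_eq)
  finally have v: "vval M U Ds F G y d = - uval M W Ds (\<lambda>\<omega>. - F \<omega>) (\<lambda>\<omega>. - G \<omega>) y d" .
  show ?thesis unfolding dual_opt_def primal_opt_def v Dset_eq
    using nn[of \<eta>] by (auto simp: ereal_uminus_less_reorder)
qed

end

section \<open>Transfer to the value functions of the statement\<close>

context perturbed_pairing
begin

text \<open>The two notions differ by the finiteness of the value, for which weak duality at the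
  price \<eta> L yields the common bound \<open>C\<close>.\<close>

lemma primal_opt_iff_optimal:
  "eventually (\<lambda>\<pi>. \<forall>f. primal_opt M U Cs F G (x + fst \<pi>) (snd \<pi>) f \<longleftrightarrow> optimal \<pi> f) (at (0,0))"
  using small_perturbation
proof eventually_elim
  case (elim \<pi>)
  have S: "Cset Cs F G (x + fst \<pi>) (snd \<pi>) = feasible \<pi>"
    using Cset_iff[OF C_pol Ds_L0] elim by (auto simp: feasible_def)
  define C where "C = (x + fst \<pi>) * y - (\<integral>\<omega>. W (\<eta> \<omega> * Ldelta F G (snd \<pi>) \<omega>) \<partial>M)"
  have Wint: "integrable M (\<lambda>\<omega>. W (\<eta> \<omega> * Ldelta F G (snd \<pi>) \<omega>))"
    using W_scaled_integrable[of "snd \<pi>" 1] elim by simp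
  have eta: "(\<lambda>\<omega>. (\<eta> \<omega> * Ldelta F G (snd \<pi>) \<omega>) / Ldelta F G (snd \<pi>) \<omega>) \<in> pol M Cs y"
    using \<eta> Ldelta_pos[of F G "snd \<pi>"] by (simp add: less_imp_neq[symmetric])
  have b: "EU M (\<lambda>\<omega>. Uext U (f \<omega>)) \<le> ereal C" if f: "f \<in> feasible \<pi>" for f
  proof -
    have "0 < x + fst \<pi>" using elim by simp
    note p = feasible_pairing[OF f this eta xy_pos(2)]
    have [measurable]: "f \<in> borel_measurable M" using L0plus_measurable[OF feasible_L0plus[OF f]] .
    let ?k = "\<lambda>\<omega>. f \<omega> * (\<eta> \<omega> * Ldelta F G (snd \<pi>) \<omega>) - W (\<eta> \<omega> * Ldelta F G (snd \<pi>) \<omega>)"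
    have "EU M (\<lambda>\<omega>. Uext U (f \<omega>)) \<le> ereal (\<integral>\<omega>. ?k \<omega> \<partial>M)"
    proof (rule EU_upper)
      show "integrable M ?k" using p(1) Wint by simp
      show "AE \<omega> in M. Uext U (f \<omega>) \<le> ereal (?k \<omega>)" using pos(2) AE_space
        by eventually_elim (use Uext_le L0plus_nonneg[OF feasible_L0plus[OF f]] Ldelta_pos[of F G "snd \<pi>"] in simp)
    qed measurable
    also have "\<dots> \<le> ereal C" using p Wint by (simp add: C_def)
    finally show ?thesis .
  qed
  show ?case
  proof
    fix f
    have "uval M U Cs F G (x + fst \<pi>) (snd \<pi>) \<le> ereal C" unfolding uval_def S by (intro SUP_least b)
    then have fin: "uval M U Cs F G (x + fst \<pi>) (snd \<pi>) < \<infinity>" by (rule le_less_trans) simp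
    show "primal_opt M U Cs F G (x + fst \<pi>) (snd \<pi>) f \<longleftrightarrow> optimal \<pi> f"
    proof
      assume p: "primal_opt M U Cs F G (x + fst \<pi>) (snd \<pi>) f"
      then show "optimal \<pi> f"
        unfolding primal_opt_def optimal_def uval_def S by (metis (no_types, lifting) SUP_upper)
    next
      assume p: "optimal \<pi> f"
      then have "EU M (\<lambda>\<omega>. Uext U (f \<omega>)) = uval M U Cs F G (x + fst \<pi>) (snd \<pi>)"
        unfolding optimal_def uval_def S by (intro antisym SUP_upper SUP_least) auto
      then show "primal_opt M U Cs F G (x + fst \<pi>) (snd \<pi>) f"
        using p fin by (simp add: primal_opt_def S optimal_def)
    qed
  qed
qed

theorem primal_expansion:
  "eventually (\<lambda>\<pi>. \<exists>f. primal_opt M U Cs F G (x + fst \<pi>) (snd \<pi>) f) (at (0,0))"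
  "eventually (\<lambda>\<pi>. primal_opt M U Cs F G (x + fst \<pi>) (snd \<pi>) (Xi \<pi>)) (at (0,0)) \<Longrightarrow>
    conv_in_prob_00 M (\<lambda>\<pi> \<omega>. \<bar>Xi \<pi> \<omega> - \<xi> \<omega> / x * (x + fst \<pi> * (1 + \<alpha>0 \<omega>) + snd \<pi> * \<alpha>d \<omega>)
                                      / Ldelta F G (snd \<pi>) \<omega>\<bar> / (\<bar>fst \<pi>\<bar> + \<bar>snd \<pi>\<bar>))"
proof -
  show "eventually (\<lambda>\<pi>. \<exists>f. primal_opt M U Cs F G (x + fst \<pi>) (snd \<pi>) f) (at (0,0))"
    using optimal_exists primal_opt_iff_optimal by eventually_elim blast
  assume ev: "eventually (\<lambda>\<pi>. primal_opt M U Cs F G (x + fst \<pi>) (snd \<pi>) (Xi \<pi>)) (at (0,0))"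
  show "conv_in_prob_00 M (\<lambda>\<pi> \<omega>. \<bar>Xi \<pi> \<omega> - \<xi> \<omega> / x * (x + fst \<pi> * (1 + \<alpha>0 \<omega>) + snd \<pi> * \<alpha>d \<omega>)
                                      / Ldelta F G (snd \<pi>) \<omega>\<bar> / (\<bar>fst \<pi>\<bar> + \<bar>snd \<pi>\<bar>))"
    by (rule optimal_expansion) (use ev primal_opt_iff_optimal in \<open>eventually_elim, blast\<close>)
qed

end

section \<open>The main theorem\<close>

text \<open>The expansions are asserted for every family that consists of optimizers near (0,0),
  whichever versions it picks; the existence claims ensure that there are such families.\<close>

theorem mainTheorem13:
  fixes M :: "'a measure" and U :: "real \<Rightarrow> real" and c1 c2 :: real
    and Cs Ds :: "('a \<Rightarrow> real) set" and F G :: "'a \<Rightarrow> real"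
    and x y z :: real and \<xi>0 \<eta>0 \<alpha>0 \<alpha>d \<beta>0 \<beta>d :: "'a \<Rightarrow> real"
  assumes P: "prob_space M"
    and Uok: "utility_ok U c1 c2"
    and CD: "polar_pair M Cs Ds"
    and Fm: "F \<in> borel_measurable M"
    and Gm: "G \<in> borel_measurable M" and Gnn: "\<forall>\<omega>\<in>space M. 0 \<le> G \<omega>"
    and x0: "0 < x"
    and zfin: "0 < z" "uval M U Cs F G z 0 < \<infinity>"
    and ydef: "u_deriv M U Cs F G x 0 y"
    and xiopt: "primal_opt M U Cs F G x 0 \<xi>0"
    and etaopt: "dual_opt M U Ds F G y 0 \<eta>0"
    and integr: "integrability_assm M F G \<xi>0 \<eta>0 x y"
    and compl: "complementarity_assm M U Cs Ds F G"
    and alpha_min: "\<alpha>0 \<in> A2 M Cs F G x 0 \<xi>0 \<eta>0 y"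
       "\<forall>\<alpha>\<in>A2 M Cs F G x 0 \<xi>0 \<eta>0 y.
          (\<integral>\<omega>. RRA U (\<xi>0 \<omega>) * (1 + \<alpha>0 \<omega>)\<^sup>2 \<partial>Rmeas M \<xi>0 \<eta>0 x y)
        \<le> (\<integral>\<omega>. RRA U (\<xi>0 \<omega>) * (1 + \<alpha> \<omega>)\<^sup>2 \<partial>Rmeas M \<xi>0 \<eta>0 x y)"
    and beta_min: "\<beta>0 \<in> B2 M Ds F G y 0 \<xi>0 \<eta>0 x"
       "\<forall>\<beta>\<in>B2 M Ds F G y 0 \<xi>0 \<eta>0 x.
          (\<integral>\<omega>. Bcoef U (\<eta>0 \<omega>) * (1 + \<beta>0 \<omega>)\<^sup>2 \<partial>Rmeas M \<xi>0 \<eta>0 x y)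
        \<le> (\<integral>\<omega>. Bcoef U (\<eta>0 \<omega>) * (1 + \<beta> \<omega>)\<^sup>2 \<partial>Rmeas M \<xi>0 \<eta>0 x y)"
    and alphad_min: "\<alpha>d \<in> A2 M Cs F G x 0 \<xi>0 \<eta>0 y"
       "\<forall>\<alpha>\<in>A2 M Cs F G x 0 \<xi>0 \<eta>0 y.
          (\<integral>\<omega>. RRA U (\<xi>0 \<omega>) * (\<alpha>d \<omega> + x * F \<omega>)\<^sup>2 - 2 * x * F \<omega> * \<alpha>d \<omega>
                 - x\<^sup>2 * ((F \<omega>)\<^sup>2 + G \<omega>) \<partial>Rmeas M \<xi>0 \<eta>0 x y)
        \<le> (\<integral>\<omega>. RRA U (\<xi>0 \<omega>) * (\<alpha> \<omega> + x * F \<omega>)\<^sup>2 - 2 * x * F \<omega> * \<alpha> \<omega>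
                 - x\<^sup>2 * ((F \<omega>)\<^sup>2 + G \<omega>) \<partial>Rmeas M \<xi>0 \<eta>0 x y)"
    and betad_min: "\<beta>d \<in> B2 M Ds F G y 0 \<xi>0 \<eta>0 x"
       "\<forall>\<beta>\<in>B2 M Ds F G y 0 \<xi>0 \<eta>0 x.
          (\<integral>\<omega>. Bcoef U (\<eta>0 \<omega>) * (\<beta>d \<omega> - y * F \<omega>)\<^sup>2 + 2 * y * F \<omega> * \<beta>d \<omega>
                 - y\<^sup>2 * ((F \<omega>)\<^sup>2 - G \<omega>) \<partial>Rmeas M \<xi>0 \<eta>0 x y)
        \<le> (\<integral>\<omega>. Bcoef U (\<eta>0 \<omega>) * (\<beta> \<omega> - y * F \<omega>)\<^sup>2 + 2 * y * F \<omega> * \<beta> \<omega>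
                 - y\<^sup>2 * ((F \<omega>)\<^sup>2 - G \<omega>) \<partial>Rmeas M \<xi>0 \<eta>0 x y)"
  shows
    "(eventually (\<lambda>p. \<exists>\<xi>. primal_opt M U Cs F G (x + fst p) (snd p) \<xi>) (at (0, 0))) \<and>
     (\<forall>Xi :: real \<times> real \<Rightarrow> 'a \<Rightarrow> real.
        eventually (\<lambda>p. primal_opt M U Cs F G (x + fst p) (snd p) (Xi p)) (at (0, 0)) \<longrightarrow>
        conv_in_prob_00 M (\<lambda>p \<omega>. \<bar>Xi p \<omega> - \<xi>0 \<omega> / x * (x + fst p * (1 + \<alpha>0 \<omega>) + snd p * \<alpha>d \<omega>)
                                      / Ldelta F G (snd p) \<omega>\<bar> / (\<bar>fst p\<bar> + \<bar>snd p\<bar>))) \<and>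
     (eventually (\<lambda>p. \<exists>\<eta>. dual_opt M U Ds F G (y + fst p) (snd p) \<eta>) (at (0, 0))) \<and>
     (\<forall>Eta :: real \<times> real \<Rightarrow> 'a \<Rightarrow> real.
        eventually (\<lambda>p. dual_opt M U Ds F G (y + fst p) (snd p) (Eta p)) (at (0, 0)) \<longrightarrow>
        conv_in_prob_00 M (\<lambda>p \<omega>. \<bar>Eta p \<omega> - \<eta>0 \<omega> / y * (y + fst p * (1 + \<beta>0 \<omega>) + snd p * \<beta>d \<omega>)
                                      * Ldelta F G (snd p) \<omega>\<bar> / (\<bar>fst p\<bar> + \<bar>snd p\<bar>)))"
proof -
  interpret prob_space M by (rule P)
  define W where "W = (\<lambda>s. - Vfun U s)"
  interpret UP: utility_pair U W "deriv U" "inv_deriv U" "RRA U" c1 c2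
    unfolding W_def by (rule utility_pair_of_utility_ok[OF Uok])
  have L0: "Cs \<subseteq> L0plus M" "Ds \<subseteq> L0plus M" using CD by (auto simp: polar_pair_def)
  have Cpol: "Cs = pol M Ds 1"
  proof -
    have "\<And>f. f \<in> L0plus M \<Longrightarrow> f \<in> Cs \<longleftrightarrow> (\<forall>h\<in>Ds. (\<integral>\<^sup>+ \<omega>. ennreal (f \<omega> * h \<omega>) \<partial>M) \<le> 1)" using CD by (auto simp: polar_pair_def)
    then show ?thesis using L0(1) unfolding pol_def by auto
  qed
  have Dpol: "Ds = pol M Cs 1"
  proof -
    have "\<And>h. h \<in> L0plus M \<Longrightarrow> h \<in> Ds \<longleftrightarrow> (\<forall>f\<in>Cs. (\<integral>\<^sup>+ \<omega>. ennreal (f \<omega> * h \<omega>) \<partial>M) \<le> 1)" using CD by (auto simp: polar_pair_def)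
    then show ?thesis using L0(2) unfolding pol_def by (auto simp: mult.commute)
  qed
  obtain z0 where z0: "z0 \<in> Cs" "\<forall>\<omega>\<in>space M. 0 < z0 \<omega>" using CD by (auto simp: polar_pair_def)
  have L1: "Ldelta F' G' 0 = (\<lambda>_. 1)" for F' G' :: "'a \<Rightarrow> real" by (simp add: Ldelta_def fun_eq_iff)
  have C0: "Cset Cs F G t 0 = pol M Ds t" if "0 < t" for t
    using Cset_iff[OF Cpol L0(2) that, of _ F G 0] by (auto simp: L1)
  have D0: "Dset Ds F G t 0 = pol M Cs t" if "0 < t" for t
    unfolding UP.Dset_eq using Cset_iff[OF Dpol L0(1) that, of _ "\<lambda>\<omega>. - F \<omega>" "\<lambda>\<omega>. - G \<omega>" 0] by (auto simp: L1)
  have \<xi>: "\<xi>0 \<in> pol M Ds x" and \<xi>v: "EU M (\<lambda>\<omega>. Uext U (\<xi>0 \<omega>)) = uval M U Cs F G x 0"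
    using xiopt C0[OF x0] by (auto simp: primal_opt_def)
  \<comment> \<open>Agrees with the value function for positive capital, which is why finiteness and
    differentiability at x are transferred on the open half-line.\<close>
  define v where "v t = (SUP f\<in>pol M Ds t. EU M (\<lambda>\<omega>. Uext U (f \<omega>)))" for t
  have vu: "uval M U Cs F G t 0 = v t" if "0 < t" for t unfolding uval_def v_def C0[OF that] ..
  have evp: "eventually (\<lambda>t. t \<in> {0<..}) (nhds x)" by (intro eventually_nhds_in_open) (use x0 in auto)
  have vfin: "eventually (\<lambda>t. \<bar>v t\<bar> \<noteq> \<infinity>) (nhds x)"
    using evp ydef[unfolded u_deriv_def, THEN conjunct1] by eventually_elim (simp add: vu)
  have vder: "((\<lambda>t. real_of_ereal (v t)) has_real_derivative y) (at x)"
    by (rule has_field_derivative_transform_within_open[OF ydef[unfolded u_deriv_def, THEN conjunct2], of "{0<..}"])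
       (use x0 vu in auto)
  note foc = UP.primal_first_order[OF P Cpol L0(2) z0 x0 \<xi> v_def vfin vder \<xi>v[unfolded vu[OF x0]]]
  note ypos = foc(5)
  interpret Sw: utility_pair W U "inv_deriv U" "deriv U" "\<lambda>s. 1 / RRA U (inv_deriv U s)" "1 / c2" "1 / c1" by (rule UP.swap)
  \<comment> \<open>At this point y > 0 is known, so the dual problem can be read as the primal
    problem of W.\<close>
  have dopt: "primal_opt M W Ds (\<lambda>\<omega>. - F \<omega>) (\<lambda>\<omega>. - G \<omega>) y 0 \<eta>0"
    using etaopt UP.dual_opt_iff[OF L0(2) less_imp_le[OF ypos]] by blast
  have \<eta>: "\<eta>0 \<in> pol M Cs y" using etaopt D0[OF ypos] by (auto simp: dual_opt_def)
  have \<eta>opt: "\<forall>h\<in>pol M Cs y. EU M (\<lambda>\<omega>. Uext W (h \<omega>)) \<le> EU M (\<lambda>\<omega>. Uext W (\<eta>0 \<omega>))"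
    using dopt unfolding primal_opt_def uval_def UP.Dset_eq[symmetric] D0[OF ypos]
    by (metis (no_types, lifting) SUP_upper)
  note du = UP.dual_optimizer_eq[OF P Dpol L0(1) x0 ypos \<xi> foc(1,2,3,4,6) \<eta> \<eta>opt]
  have \<eta>pos: "AE \<omega> in M. 0 < \<eta>0 \<omega>" using du(1) foc(1) by eventually_elim (simp add: UP.p_pos)
  interpret PP: polar_pairing M Cs Ds x y \<xi>0 \<eta>0
    by unfold_locales (use Cpol Dpol x0 ypos \<xi> \<eta> foc(1) \<eta>pos du(3) in auto)

  define R where "R = Rmeas M \<xi>0 \<eta>0 x y"
  \<comment> \<open>The density of R is positive almost everywhere, so R and M have the same null
    sets, and integrals under R are the weighted integrals of the locale divided by x y.\<close>
  define \<rho> where "\<rho> \<omega> = \<xi>0 \<omega> * \<eta>0 \<omega> / (x * y)" for \<omega>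
  have R: "R = density M (\<lambda>\<omega>. ennreal (\<rho> \<omega>))" by (simp add: R_def Rmeas_def \<rho>_def)
  have \<rho>m [measurable]: "\<rho> \<in> borel_measurable M" unfolding \<rho>_def[abs_def] by measurable
  have \<rho>n: "AE \<omega> in M. 0 \<le> \<rho> \<omega>" and \<rho>p: "AE \<omega> in M. 0 < \<rho> \<omega>"
    using foc(1) \<eta>pos by (eventually_elim, use x0 ypos in \<open>simp add: \<rho>_def\<close>)+
  have meas_R: "borel_measurable R = borel_measurable M" by (rule measurable_cong_sets) (simp_all add: R)
  have AE_R: "(AE \<omega> in R. Q \<omega>) \<longleftrightarrow> (AE \<omega> in M. Q \<omega>)" for Q
  proof -
    have "(AE \<omega> in R. Q \<omega>) \<longleftrightarrow> (AE \<omega> in M. 0 < ennreal (\<rho> \<omega>) \<longrightarrow> Q \<omega>)" unfolding R by (rule AE_density) measurable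
    also have "\<dots> \<longleftrightarrow> (AE \<omega> in M. Q \<omega>)"
    proof
      assume "AE \<omega> in M. 0 < ennreal (\<rho> \<omega>) \<longrightarrow> Q \<omega>"
      then show "AE \<omega> in M. Q \<omega>" using \<rho>p by eventually_elim simp
    qed auto
    finally show ?thesis .
  qed
  have int_R: "integrable R f \<longleftrightarrow> integrable M (\<lambda>\<omega>. \<xi>0 \<omega> * \<eta>0 \<omega> * f \<omega>)"
    and lint_R: "(\<integral>\<omega>. f \<omega> \<partial>R) = (\<integral>\<omega>. \<xi>0 \<omega> * \<eta>0 \<omega> * f \<omega> \<partial>M) / (x * y)"
    if f: "f \<in> borel_measurable M" for f :: "'a \<Rightarrow> real"
  proof -
    have e: "(\<lambda>\<omega>. \<rho> \<omega> * f \<omega>) = (\<lambda>\<omega>. \<xi>0 \<omega> * \<eta>0 \<omega> * f \<omega> / (x * y))" by (simp add: \<rho>_def fun_eq_iff)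
    have "integrable R f \<longleftrightarrow> integrable M (\<lambda>\<omega>. \<rho> \<omega> * f \<omega>)" unfolding R using integrable_density[OF f \<rho>m \<rho>n] by simp
    also have "\<dots> \<longleftrightarrow> integrable M (\<lambda>\<omega>. \<xi>0 \<omega> * \<eta>0 \<omega> * f \<omega>)" 
    proof -
      have "(\<lambda>\<omega>. \<rho> \<omega> * f \<omega>) = (\<lambda>\<omega>. 1 / (x * y) * (\<xi>0 \<omega> * \<eta>0 \<omega> * f \<omega>))" by (simp add: e)
      then show ?thesis using x0 ypos by (simp only: integrable_mult_left_iff) simp
    qed
    finally show "integrable R f \<longleftrightarrow> integrable M (\<lambda>\<omega>. \<xi>0 \<omega> * \<eta>0 \<omega> * f \<omega>)" .
    have "(\<integral>\<omega>. f \<omega> \<partial>R) = (\<integral>\<omega>. \<rho> \<omega> * f \<omega> \<partial>M)" unfolding R using integral_density[OF f \<rho>m \<rho>n] by simp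
    then show "(\<integral>\<omega>. f \<omega> \<partial>R) = (\<integral>\<omega>. \<xi>0 \<omega> * \<eta>0 \<omega> * f \<omega> \<partial>M) / (x * y)" unfolding e by simp
  qed
  have Rprob: "prob_space R"
  proof
    have "emeasure R (space R) = (\<integral>\<^sup>+ \<omega>. ennreal (\<rho> \<omega>) \<partial>M)"
      unfolding R by (simp add: emeasure_density)
    also have "\<dots> = ennreal (\<integral>\<omega>. \<rho> \<omega> \<partial>M)"
      using PP.wt_integrable \<rho>n by (intro nn_integral_eq_integral) (auto simp: \<rho>_def[abs_def])
    also have "(\<integral>\<omega>. \<rho> \<omega> \<partial>M) = 1" using du(3) x0 ypos by (simp add: \<rho>_def)
    finally show "emeasure R (space R) = 1" by simp
  qed
  interpret RP: prob_space R by (rule Rprob)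

  obtain c where c: "0 < c" "integrable R (\<lambda>\<omega>. exp (c * (\<bar>F \<omega>\<bar> + G \<omega>)))"
    using integr by (auto simp: integrability_assm_def R_def)
  note [measurable] = Fm Gm
  have expi: "integrable M (\<lambda>\<omega>. \<xi>0 \<omega> * \<eta>0 \<omega> * exp (c * (\<bar>F \<omega>\<bar> + \<bar>G \<omega>\<bar>)))"
  proof -
    have m: "(\<lambda>\<omega>. exp (c * (\<bar>F \<omega>\<bar> + G \<omega>))) \<in> borel_measurable M" by measurable
    have "integrable M (\<lambda>\<omega>. \<xi>0 \<omega> * \<eta>0 \<omega> * exp (c * (\<bar>F \<omega>\<bar> + G \<omega>)))" using c(2) int_R[OF m] by simp
    then show ?thesis by (rule Bochner_Integration.integrable_cong[THEN iffD1, rotated 2]) (use Gnn in auto)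
  qed
  have Rm: "f \<in> borel_measurable R" if "f \<in> borel_measurable M" for f :: "'a \<Rightarrow> real" using that by (simp only: meas_R)
  have F2: "sq_int R F"
    unfolding sq_int_def
  proof
    show "F \<in> borel_measurable R" by (rule Rm[OF Fm])
    show "integrable R (\<lambda>\<omega>. (F \<omega>)\<^sup>2)"
    proof (rule Bochner_Integration.integrable_bound)
      show "integrable R (\<lambda>\<omega>. 2 / c\<^sup>2 * exp (c * (\<bar>F \<omega>\<bar> + G \<omega>)))" using c(2) by simp
      show "(\<lambda>\<omega>. (F \<omega>)\<^sup>2) \<in> borel_measurable R" by (rule Rm) measurable
      show "AE \<omega> in R. norm ((F \<omega>)\<^sup>2) \<le> norm (2 / c\<^sup>2 * exp (c * (\<bar>F \<omega>\<bar> + G \<omega>)))"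
        unfolding AE_R
      proof (rule AE_I2)
        fix \<omega> assume "\<omega> \<in> space M"
        then have G: "0 \<le> G \<omega>" using Gnn by simp
        have "(F \<omega>)\<^sup>2 = \<bar>F \<omega>\<bar>\<^sup>2" by simp
        also have "\<dots> \<le> 2 / c\<^sup>2 * exp (c * \<bar>F \<omega>\<bar>)" by (rule square_le_exp[OF c(1)]) simp
        also have "\<dots> \<le> 2 / c\<^sup>2 * exp (c * (\<bar>F \<omega>\<bar> + G \<omega>))" using c(1) G by (intro mult_left_mono) auto
        finally show "norm ((F \<omega>)\<^sup>2) \<le> norm (2 / c\<^sup>2 * exp (c * (\<bar>F \<omega>\<bar> + G \<omega>)))" by simp
      qed
    qed
  qed
  have Gi: "integrable R G"
  proof (rule Bochner_Integration.integrable_bound)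
    show "integrable R (\<lambda>\<omega>. 1 / c * exp (c * (\<bar>F \<omega>\<bar> + G \<omega>)))" using c(2) by simp
    show "G \<in> borel_measurable R" by (rule Rm[OF Gm])
    show "AE \<omega> in R. norm (G \<omega>) \<le> norm (1 / c * exp (c * (\<bar>F \<omega>\<bar> + G \<omega>)))"
      unfolding AE_R
    proof (rule AE_I2)
      fix \<omega> assume "\<omega> \<in> space M"
      then have G: "0 \<le> G \<omega>" using Gnn by simp
      have "c * G \<omega> \<le> c * (\<bar>F \<omega>\<bar> + G \<omega>)" using c(1) by (intro mult_left_mono) auto
      also have "\<dots> \<le> exp (c * (\<bar>F \<omega>\<bar> + G \<omega>))" using exp_ge_add_one_self[of "c * (\<bar>F \<omega>\<bar> + G \<omega>)"] by linarith
      finally have "G \<omega> \<le> 1 / c * exp (c * (\<bar>F \<omega>\<bar> + G \<omega>))" using c(1) by (simp add: pos_le_divide_eq mult.commute)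
      then show "norm (G \<omega>) \<le> norm (1 / c * exp (c * (\<bar>F \<omega>\<bar> + G \<omega>)))" using G c(1) by simp
    qed
  qed
  define AA where "AA = A2 M Cs F G x 0 \<xi>0 \<eta>0 y"
  define BB where "BB = B2 M Ds F G y 0 \<xi>0 \<eta>0 x"
  have comp: "(\<forall>\<alpha>. \<alpha> \<in> AA \<longleftrightarrow> \<alpha> \<in> L2_0 R \<and> (\<forall>\<beta>\<in>BB. integral\<^sup>L R (\<lambda>\<omega>. \<alpha> \<omega> * \<beta> \<omega>) = 0)) \<and>
     (\<forall>\<beta>. \<beta> \<in> BB \<longleftrightarrow> \<beta> \<in> L2_0 R \<and> (\<forall>\<alpha>\<in>AA. integral\<^sup>L R (\<lambda>\<omega>. \<alpha> \<omega> * \<beta> \<omega>) = 0))"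
    using compl x0 ydef xiopt etaopt unfolding complementarity_assm_def Let_def AA_def BB_def R_def by blast
  interpret CS: complementary_spaces R AA BB
    using comp by unfold_locales blast+
  have Am: "(\<lambda>\<omega>. RRA U (\<xi>0 \<omega>)) \<in> borel_measurable R"
    by (intro Rm borel_measurable_comp_nonneg[OF PP.\<xi>m PP.\<xi>_nn UP.A_measurable])
  have Bm: "(\<lambda>\<omega>. Bcoef U (\<eta>0 \<omega>)) \<in> borel_measurable R"
  proof (intro Rm borel_measurable_comp_nonneg[OF PP.\<eta>m PP.\<eta>_nn])
    have "(\<lambda>s. if 0 < s then Bcoef U s else 0) = (\<lambda>s. if 0 < s then 1 / RRA U (inv_deriv U s) else 0)"
      by (auto simp: UP.Bcoef_eq fun_eq_iff)
    then show "(\<lambda>s. if 0 < s then Bcoef U s else 0) \<in> borel_measurable borel" using Sw.A_measurable by simp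
  qed
  have Ab: "AE \<omega> in R. c1 \<le> RRA U (\<xi>0 \<omega>) \<and> RRA U (\<xi>0 \<omega>) \<le> c2"
    unfolding AE_R using foc(1) by eventually_elim (simp add: UP.A_ge UP.A_le)
  have BA: "AE \<omega> in R. Bcoef U (\<eta>0 \<omega>) = 1 / RRA U (\<xi>0 \<omega>)"
    unfolding AE_R using foc(1) du(1) by eventually_elim (simp add: UP.Bcoef_eq UP.p_pos UP.qp)
  have kA: "integrable R (\<lambda>\<omega>. x\<^sup>2 * ((F \<omega>)\<^sup>2 + G \<omega>))" and kB: "integrable R (\<lambda>\<omega>. y\<^sup>2 * ((F \<omega>)\<^sup>2 - G \<omega>))"
    using F2 Gi by (auto simp: sq_int_def)
  from CS.minimizer_duality[OF UP.c1_pos Am Ab Bm BA F2 kA kB x0 ypos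
      alpha_min(1)[folded AA_def] alpha_min(2)[folded AA_def R_def, rule_format]
      beta_min(1)[folded BB_def] beta_min(2)[folded BB_def R_def, rule_format]
      alphad_min(1)[folded AA_def] alphad_min(2)[folded AA_def R_def, rule_format]
      betad_min(1)[folded BB_def] betad_min(2)[folded BB_def R_def, rule_format]]
  obtain a w where aw: "a \<noteq> 0" "AE \<omega> in R. RRA U (\<xi>0 \<omega>) * (1 + \<alpha>0 \<omega>) = a * (1 + \<beta>0 \<omega>)"
    "AE \<omega> in R. y * F \<omega> - RRA U (\<xi>0 \<omega>) * (\<alpha>d \<omega> + x * F \<omega>) * (y / x) = w * (1 + \<beta>0 \<omega>) + \<beta>d \<omega>" by blast
  have mem: "\<alpha>0 \<in> AA" "\<alpha>d \<in> AA" "\<beta>0 \<in> BB" "\<beta>d \<in> BB"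
    using alpha_min(1) alphad_min(1) beta_min(1) betad_min(1) by (auto simp: AA_def BB_def)
  have dirm: "f \<in> borel_measurable M" if "f \<in> AA \<or> f \<in> BB" for f
    using that CS.AA_L2[of f] CS.BB_L2[of f] meas_R by (auto simp: L2_0_def)
  \<comment> \<open>The accuracy is divided by x y to pass from R to M. The closure only bounds a
    Bochner integral, which is 0 for non-integrable functions; integrability is derived separately
    from the boundedness of the direction and the square integrability of
    \<open>\<alpha>\<close>.\<close>
  have approx: "\<exists>f\<in>Dirs M S \<zeta>. integrable M (\<lambda>\<omega>. \<xi>0 \<omega> * \<eta>0 \<omega> * (\<alpha> \<omega> - f \<omega>)\<^sup>2) \<and>
      (\<integral>\<omega>. \<xi>0 \<omega> * \<eta>0 \<omega> * (\<alpha> \<omega> - f \<omega>)\<^sup>2 \<partial>M) < e"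
    if al: "\<alpha> \<in> L2closure R (Dirinf M S \<zeta>)" and e: "0 < e" and S: "S \<subseteq> L0plus M" and z: "AE \<omega> in M. 0 < \<zeta> \<omega>" for \<alpha> e S \<zeta>
  proof -
    have "0 < e / (x * y)" using e x0 ypos by simp
    with al obtain f where f: "f \<in> Dirinf M S \<zeta>" "(\<integral>\<omega>. (\<alpha> \<omega> - f \<omega>)\<^sup>2 \<partial>R) < e / (x * y)"
      unfolding L2closure_def by blast
    have fD: "f \<in> Dirs M S \<zeta>" using f(1) by (auto simp: Dirinf_def Dirs_def Linf_def)
    then obtain K where K: "AE \<omega> in M. \<bar>f \<omega>\<bar> \<le> K" using Dirs_AE_bounded[OF fD S z] by blast
    have fm: "f \<in> borel_measurable M" using fD by (simp add: Dirs_def)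
    have \<alpha>2: "\<alpha> \<in> L2_0 R" using al by (simp add: L2closure_def)
    have "sq_int R (\<lambda>\<omega>. f \<omega> * 1)"
      by (rule sq_int_bounded_mult[OF Rm[OF fm] RP.sq_int_const]) (use K in \<open>simp add: AE_R\<close>)
    then have d: "sq_int R (\<lambda>\<omega>. \<alpha> \<omega> - f \<omega>)" using sq_int_add[OF L2_0_sq_int[OF \<alpha>2] sq_int_cmult[of R f "-1"]] by simp
    have m: "(\<lambda>\<omega>. (\<alpha> \<omega> - f \<omega>)\<^sup>2) \<in> borel_measurable M" using d meas_R by (auto simp: sq_int_def)
    have "integrable M (\<lambda>\<omega>. \<xi>0 \<omega> * \<eta>0 \<omega> * (\<alpha> \<omega> - f \<omega>)\<^sup>2)" using d int_R[OF m] by (simp add: sq_int_def)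
    moreover have "(\<integral>\<omega>. \<xi>0 \<omega> * \<eta>0 \<omega> * (\<alpha> \<omega> - f \<omega>)\<^sup>2 \<partial>M) < e"
      using f(2) lint_R[OF m] x0 ypos by (simp add: divide_less_cancel mult_pos_pos)
    ultimately show ?thesis using fD by blast
  qed
  interpret PT: perturbed_pairing U W "deriv U" "inv_deriv U" "RRA U" c1 c2 M Cs Ds x y \<xi>0 \<eta>0 F G \<alpha>0 \<alpha>d \<beta>0 \<beta>d a w c
  proof (intro perturbed_pairing.intro perturbed_pairing_axioms.intro)
    show "utility_pair U W (deriv U) (inv_deriv U) (RRA U) c1 c2" by (rule UP.utility_pair_axioms)
    show "prob_space M" by (rule P)
    show "polar_pairing M Cs Ds x y \<xi>0 \<eta>0" by (rule PP.polar_pairing_axioms)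
    show "\<exists>f\<in>Dirs M (pol M Ds x) \<xi>0. integrable M (\<lambda>\<omega>. \<xi>0 \<omega> * \<eta>0 \<omega> * (\<alpha> \<omega> - f \<omega>)\<^sup>2) \<and>
       (\<integral>\<omega>. \<xi>0 \<omega> * \<eta>0 \<omega> * (\<alpha> \<omega> - f \<omega>)\<^sup>2 \<partial>M) < e" if "\<alpha> \<in> {\<alpha>0, \<alpha>d}" "0 < e" for \<alpha> e
      by (rule approx[OF _ that(2) PP.pol_L0 foc(1)])
         (use that(1) mem in \<open>auto simp: AA_def A2_def C0[OF x0] R_def\<close>)
    show "\<exists>f\<in>Dirs M (pol M Cs y) \<eta>0. integrable M (\<lambda>\<omega>. \<xi>0 \<omega> * \<eta>0 \<omega> * (\<beta> \<omega> - f \<omega>)\<^sup>2) \<and>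
       (\<integral>\<omega>. \<xi>0 \<omega> * \<eta>0 \<omega> * (\<beta> \<omega> - f \<omega>)\<^sup>2 \<partial>M) < e" if "\<beta> \<in> {\<beta>0, \<beta>d}" "0 < e" for \<beta> e
      by (rule approx[OF _ that(2) PP.pol_L0 \<eta>pos])
         (use that(1) mem in \<open>auto simp: BB_def B2_def D0[OF ypos] R_def\<close>)
  qed (use Fm Gm du foc(2) c(1) expi aw mem dirm AE_R in auto)
  interpret PD: perturbed_pairing W U "inv_deriv U" "deriv U" "\<lambda>s. 1 / RRA U (inv_deriv U s)" "1 / c2" "1 / c1" M Ds Cs y x \<eta>0 \<xi>0
    "\<lambda>\<omega>. - F \<omega>" "\<lambda>\<omega>. - G \<omega>" \<beta>0 \<beta>d \<alpha>0 \<alpha>d "1 / a" "x * w / (y * a)" c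
    by (rule PT.swap_pairing)
  \<comment> \<open>Restricted to small perturbations because y + \<Delta>y has to be
    nonnegative.\<close>
  have dual_iff: "eventually (\<lambda>p. \<forall>h. dual_opt M U Ds F G (y + fst p) (snd p) h \<longleftrightarrow>
      primal_opt M W Ds (\<lambda>\<omega>. - F \<omega>) (\<lambda>\<omega>. - G \<omega>) (y + fst p) (snd p) h) (at (0,0))"
    using PD.small_perturbation by eventually_elim (use UP.dual_opt_iff[OF L0(2)] in auto)
  show ?thesis
  proof (intro conjI allI impI)
    show "eventually (\<lambda>p. \<exists>\<xi>. primal_opt M U Cs F G (x + fst p) (snd p) \<xi>) (at (0, 0))"
      by (rule PT.primal_expansion(1))
  next
    fix Xi :: "real \<times> real \<Rightarrow> 'a \<Rightarrow> real"
    assume "eventually (\<lambda>p. primal_opt M U Cs F G (x + fst p) (snd p) (Xi p)) (at (0, 0))"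
    then show "conv_in_prob_00 M (\<lambda>p \<omega>. \<bar>Xi p \<omega> - \<xi>0 \<omega> / x * (x + fst p * (1 + \<alpha>0 \<omega>) + snd p * \<alpha>d \<omega>)
                                      / Ldelta F G (snd p) \<omega>\<bar> / (\<bar>fst p\<bar> + \<bar>snd p\<bar>))"
      by (rule PT.primal_expansion(2))
  next
    show "eventually (\<lambda>p. \<exists>\<eta>. dual_opt M U Ds F G (y + fst p) (snd p) \<eta>) (at (0, 0))"
      using PD.primal_expansion(1) dual_iff by eventually_elim blast
  next
    fix Eta :: "real \<times> real \<Rightarrow> 'a \<Rightarrow> real"
    assume "eventually (\<lambda>p. dual_opt M U Ds F G (y + fst p) (snd p) (Eta p)) (at (0, 0))"
    then have "eventually (\<lambda>p. primal_opt M W Ds (\<lambda>\<omega>. - F \<omega>) (\<lambda>\<omega>. - G \<omega>) (y + fst p) (snd p) (Eta p)) (at (0, 0))"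
      using dual_iff by eventually_elim blast
    from PD.primal_expansion(2)[OF this]
    show "conv_in_prob_00 M (\<lambda>p \<omega>. \<bar>Eta p \<omega> - \<eta>0 \<omega> / y * (y + fst p * (1 + \<beta>0 \<omega>) + snd p * \<beta>d \<omega>)
                                      * Ldelta F G (snd p) \<omega>\<bar> / (\<bar>fst p\<bar> + \<bar>snd p\<bar>))"
      by (simp add: Ldelta_uminus)
  qed
qed

end
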